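(* Let $G$ be of type $A_\ell$, $\ell\geq 4$, over an algebraically closed field $k$ of characteristic $p>0$. If $p>2$ then the following hold. (a) If $\ell\equiv 0\pmod p$ then $H^0(\omega_2+\omega_{\ell-1})/L(\omega_2+\omega_{\ell-1})\cong k$. (b) If $\ell\equiv 1\pmod p$ then $H^0(\omega_2+\omega_{\ell-1})/L(\omega_2+\omega_{\ell-1})\cong H^0(\omega_1+\omega_\ell)$, and this module is simple. (c) In all other cases (with $p>2$) $H^0(\omega_2+\omega_{\ell-1})$ is simple. If $p=2$ then the following hold. (d) If $\ell\equiv 0\pmod 4$ then $H^0(\omega_2+\omega_{\ell-1})/L(\omega_2+\omega_{\ell-1})\cong k$. (e) If $\ell\equiv 1\pmod 4$ then $H^0(\omega_2+\omega_{\ell-1})/L(\omega_2+\omega_{\ell-1})\cong V(\omega_1+\omega_\ell)$. (f) If $\ell\equiv 2\pmod 4$ then $H^0(\omega_2+\omega_{\ell-1})$ is simple. (g) If $\ell\equiv 3\pmod 4$ then $H^0(\omega_2+\omega_{\ell-1})/L(\omega_2+\omega_{\ell-1})\cong L(\omega_1+\omega_\ell)$. We have (h) $$\dim L(\omega_2+\omega_{\ell-1})=\begin{cases} \frac14\ell^4+\frac12\ell^3-\frac34\ell^2-2\ell-2, & \text{in cases (a) and (d)},\\ \frac14(\ell+2)(\ell^3-7\ell-2), & \text{in cases (b) and (e)},\\ \frac14(\ell-2)(\ell+2)(\ell+1)^2, & \text{in cases (c) and (f)},\\ \frac14\ell(\ell^3+2\ell^2-7\ell-16), & \text{in case (g).}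 \end{cases}$$
   Context: $G$ is a simply connected semisimple algebraic group over the algebraically closed field $k$ of characteristic $p>0$, with maximal torus $T$, a positive system of roots, and Borel subgroup $B\supset T$ corresponding to the negative roots. The fundamental weights of type $A_\ell$ are numbered so that $\omega_i$ is the highest weight of the $i$-th exterior power of the $(\ell+1)$-dimensional standard module. All modules are rational $G$-modules; $k$ also denotes the one-dimensional trivial module. For a dominant weight $\lambda$, $H^0(\lambda)=\mathrm{ind}_B^G(\lambda)$ is the induced module (dual Weyl module); it has a unique simple submodule, which is the simple module $L(\lambda)$ of highest weight $\lambda$. The quotient $H^0(\lambda)/L(\lambda)$ is taken with respect to this submodule. $V(\lambda)$ denotes the Weyl module with highest weight $\lambda$, i.e. the dual of $H^0(-w_0\lambda)$, where $w_0$ is the longest element of the Weyl group. *)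

theory Defs
  imports
    "HOL-Algebra.AbelCoset"
    "Jordan_Normal_Form.VS_Connect"
    "Jordan_Normal_Form.Determinant"
    "HOL-Library.Function_Algebras"
    "HOL-Number_Theory.Cong"
begin

hide_const (open) Multiset.mult

section \<open>Modules over a group\<close>

text \<open>
  A \<open>G\<close>-module over the field \<open>'k\<close> is a \<open>'k\<close>-vector space record together with a linear action
  of the group \<open>G\<close>.  The ring fields \<open>mult\<close> and \<open>one\<close> inherited from \<open>module\<close> carry no meaning.
  Rationality is not imposed separately: it is inherited by submodules, quotients and duals of the
  finite-dimensional rational modules \<open>H0\<close> below.
\<close>

record ('k, 'v, 'g) gmodule = "('k, 'v) module" +
  act :: "'g \<Rightarrow> 'v \<Rightarrow> 'v"

locale G_module = group G + vectorspace "class_ring :: 'k ring" V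
  for G :: "'g monoid" and V :: "('k :: field, 'v, 'g) gmodule" +
  assumes act_linear: "g \<in> carrier G \<Longrightarrow> act V g \<in> LinearCombinations.module_hom class_ring V V"
    and act_one: "v \<in> carrier V \<Longrightarrow> act V \<one>\<^bsub>G\<^esub> v = v"
    and act_mult: "\<lbrakk>g \<in> carrier G; h \<in> carrier G; v \<in> carrier V\<rbrakk>
      \<Longrightarrow> act V (g \<otimes>\<^bsub>G\<^esub> h) v = act V g (act V h v)"

definition gsubmodule :: "'g monoid \<Rightarrow> 'v set \<Rightarrow> ('k :: field, 'v, 'g) gmodule \<Rightarrow> bool" where
  "gsubmodule G W V \<longleftrightarrow>
     LinearCombinations.submodule class_ring W V \<and> (\<forall>g \<in> carrier G. \<forall>w \<in> W. act V g w \<in> W)"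

definition simple_gmodule :: "'g monoid \<Rightarrow> ('k :: field, 'v, 'g) gmodule \<Rightarrow> bool" where
  "simple_gmodule G V \<longleftrightarrow> G_module G V \<and> carrier V \<noteq> {\<zero>\<^bsub>V\<^esub>} \<and>
     (\<forall>W. gsubmodule G W V \<longrightarrow> W = {\<zero>\<^bsub>V\<^esub>} \<or> W = carrier V)"

definition gmodule_iso ::
    "'g monoid \<Rightarrow> ('k :: field, 'v, 'g) gmodule \<Rightarrow> ('k, 'w, 'g) gmodule \<Rightarrow> bool" where
  "gmodule_iso G V W \<longleftrightarrow> (\<exists>f \<in> LinearCombinations.module_hom class_ring V W.
     bij_betw f (carrier V) (carrier W) \<and>
     (\<forall>g \<in> carrier G. \<forall>v \<in> carrier V. f (act V g v) = act W g (f v)))"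

text \<open>
  The quotient is carried by the cosets \<open>U + v\<close>.  In the scalar multiplication the summand \<open>U\<close> is
  needed for \<open>c = 0\<close>: elementwise multiplication of a coset by \<open>0\<close> gives \<open>{0}\<close> and not \<open>U\<close>.
\<close>

definition quotient_gmodule ::
    "('k :: field, 'v, 'g) gmodule \<Rightarrow> 'v set \<Rightarrow> ('k, 'v set, 'g) gmodule" where
  "quotient_gmodule V U =
     \<lparr>carrier = a_rcosets\<^bsub>V\<^esub> U, mult = undefined, one = undefined,
      zero = U, add = (\<lambda>X Y. X <+>\<^bsub>V\<^esub> Y),
      smult = (\<lambda>c X. U <+>\<^bsub>V\<^esub> (smult V c ` X)),
      act = (\<lambda>g X. act V g ` X)\<rparr>"

definition trivial_gmodule :: "('k :: field, 'k, 'g) gmodule" where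
  "trivial_gmodule =
     \<lparr>carrier = UNIV, mult = undefined, one = undefined, zero = 0, add = (+), smult = (*),
      act = (\<lambda>g c. c)\<rparr>"

definition dual_gmodule ::
    "'g monoid \<Rightarrow> ('k :: field, 'v, 'g) gmodule \<Rightarrow> ('k, 'v \<Rightarrow> 'k, 'g) gmodule" where
  "dual_gmodule G V =
     \<lparr>carrier = LinearCombinations.module_hom class_ring V (trivial_gmodule :: ('k, 'k, 'g) gmodule)
        \<inter> extensional (carrier V),
      mult = undefined, one = undefined,
      zero = (\<lambda>v \<in> carrier V. 0),
      add = (\<lambda>\<phi> \<psi>. \<lambda>v \<in> carrier V. \<phi> v + \<psi> v),
      smult = (\<lambda>c \<phi>. \<lambda>v \<in> carrier V. c * \<phi> v),
      act = (\<lambda>g \<phi>. \<lambda>v \<in> carrier V. \<phi> (act V (inv\<^bsub>G\<^esub> g) v))\<rparr>"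

section \<open>The special linear group\<close>

text \<open>
  \<open>SL n\<close> is the simply connected group of type \<open>A\<close> and rank \<open>n - 1\<close>, with the diagonal matrices as
  maximal torus.  The roots of the upper triangular matrices are the positive ones, so the Borel
  subgroup of the negative roots consists of the lower triangular matrices.
\<close>

definition SL :: "nat \<Rightarrow> 'k :: field mat monoid" where
  "SL n = \<lparr>carrier = {A \<in> carrier_mat n n. det A = 1}, mult = (*), one = 1\<^sub>m n\<rparr>"

definition borel_neg :: "nat \<Rightarrow> 'k :: field mat set" where
  "borel_neg n = {b \<in> carrier (SL n). \<forall>i < n. \<forall>j < n. i < j \<longrightarrow> b $$ (i, j) = 0}"

text \<open>
  The coordinate ring: the algebra of functions on \<open>SL n\<close> generated by the matrix entries.  (The
  inverse of the determinant is not needed, and over an infinite field polynomial functions are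
  the same as regular functions.)
\<close>

inductive_set regular_functions :: "nat \<Rightarrow> ('k :: field mat \<Rightarrow> 'k) set" for n where
  const: "(\<lambda>x \<in> carrier (SL n). c) \<in> regular_functions n"
| entry: "\<lbrakk>i < n; j < n\<rbrakk> \<Longrightarrow> (\<lambda>x \<in> carrier (SL n). x $$ (i, j)) \<in> regular_functions n"
| add: "\<lbrakk>f \<in> regular_functions n; h \<in> regular_functions n\<rbrakk>
    \<Longrightarrow> (\<lambda>x \<in> carrier (SL n). f x + h x) \<in> regular_functions n"
| mult: "\<lbrakk>f \<in> regular_functions n; h \<in> regular_functions n\<rbrakk>
    \<Longrightarrow> (\<lambda>x \<in> carrier (SL n). f x * h x) \<in> regular_functions n"

text \<open>
  A weight \<open>\<mu>\<close> is given by integers \<open>\<mu> 0, \<dots>, \<mu> (n - 1)\<close> and stands for the character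
  \<open>t \<mapsto> \<Prod>i<n. t\<^sub>i ^ \<mu> i\<close> of the diagonal torus; it depends on \<open>\<mu>\<close> only up to adding a constant,
  since \<open>\<Prod>i<n. t\<^sub>i = 1\<close>.  \<open>weight_char\<close> is this character, extended to \<open>borel_neg n\<close> so as to be
  trivial on the unipotent radical.  The \<open>i\<close>-th fundamental weight is \<open>t \<mapsto> t\<^sub>0 \<cdots> t\<^bsub>i-1\<^esub>\<close>, the highest
  weight of the \<open>i\<close>-th exterior power of the standard module.
\<close>

type_synonym weight = "nat \<Rightarrow> int"

definition weight_char :: "nat \<Rightarrow> weight \<Rightarrow> 'k :: field mat \<Rightarrow> 'k" where
  "weight_char n \<mu> b = (\<Prod>i<n. b $$ (i, i) powi \<mu> i)"

definition fund_weight :: "nat \<Rightarrow> weight" ("\<omega>") where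
  "\<omega> i = (\<lambda>j. if j < i then 1 else 0)"

text \<open>
  The Weyl group is the symmetric group permuting the coordinates, and its longest element is the
  order-reversing permutation.
\<close>

definition w0 :: "nat \<Rightarrow> weight \<Rightarrow> weight" where
  "w0 n \<mu> = (\<lambda>j. \<mu> (n - 1 - j))"

section \<open>Induced, simple and Weyl modules\<close>

text \<open>
  \<open>ind\<^sub>B\<^sup>G \<mu> = {f \<in> k[G]. f(xb) = \<mu>(b)\<^sup>-\<^sup>1 f(x)}\<close> with \<open>G\<close> acting by left translation.
\<close>

definition H0 :: "'k :: field itself \<Rightarrow> nat \<Rightarrow> weight \<Rightarrow> ('k, 'k mat \<Rightarrow> 'k, 'k mat) gmodule" where
  "H0 TYPE('k) n \<mu> =
     \<lparr>carrier = {f \<in> regular_functions n. \<forall>x \<in> carrier (SL n). \<forall>b \<in> borel_neg n.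
        f (x \<otimes>\<^bsub>SL n\<^esub> b) = inverse (weight_char n \<mu> b) * f x},
      mult = undefined, one = undefined,
      zero = (\<lambda>x \<in> carrier (SL n). 0),
      add = (\<lambda>f h. \<lambda>x \<in> carrier (SL n). f x + h x),
      smult = (\<lambda>c f. \<lambda>x \<in> carrier (SL n). c * f x),
      act = (\<lambda>g f. \<lambda>x \<in> carrier (SL n). f (inv\<^bsub>SL n\<^esub> g \<otimes>\<^bsub>SL n\<^esub> x))\<rparr>"

text \<open>
  For dominant \<open>\<mu>\<close>, the simple module of highest weight \<open>\<mu>\<close>, as the unique simple submodule of \<open>H0\<close>.
\<close>

definition L :: "'k :: field itself \<Rightarrow> nat \<Rightarrow> weight \<Rightarrow> ('k, 'k mat \<Rightarrow> 'k, 'k mat) gmodule" where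
  "L TYPE('k) n \<mu> = (let H = H0 TYPE('k) n \<mu> in
     H\<lparr>carrier := (THE W. gsubmodule (SL n) W H \<and> simple_gmodule (SL n) (H\<lparr>carrier := W\<rparr>))\<rparr>)"

definition Weyl ::
    "'k :: field itself \<Rightarrow> nat \<Rightarrow> weight \<Rightarrow> ('k, ('k mat \<Rightarrow> 'k) \<Rightarrow> 'k, 'k mat) gmodule" where
  "Weyl TYPE('k) n \<mu> = dual_gmodule (SL n) (H0 TYPE('k) n (- w0 n \<mu>))"

end

theory Submission
  imports Defs
begin

text \<open>
  Write \<open>n = \<ell> + 1\<close>.  The module \<open>H\<^sup>0(\<omega>\<^sub>2 + \<omega>\<^bsub>n-2\<^esub>)\<close> consists of the functions
  \<open>psi c x = \<Sum> c\<^bsub>ijkl\<^esub> P\<^bsub>ij\<^esub>(x) Q\<^bsub>kl\<^esub>(x)\<close>, where \<open>P\<^bsub>ij\<^esub>\<close> is a minor of the first two rows of \<open>x\<inverse>\<close> and \<open>Q\<^bsub>kl\<^esub>\<close>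
  one of the last two columns of \<open>x\<close>.  To see that there are no others one decomposes a function
  into weight vectors for the torus of \<open>GL\<^sub>n\<close>; its weights are permutations of \<open>(0,0,1,\<dots>,1,2,2)\<close>,
  \<open>(0,1,\<dots>,1,2)\<close> and \<open>(1,\<dots>,1)\<close>, and by density of the big cell a weight vector is determined by the
  action of the root subgroups on it, which ends in multiples of the highest weight vector.

  Every nonzero submodule contains the highest weight vector.  Modulo the submodule this vector
  generates, \<open>psi c\<close> depends only on the contraction \<open>kap c\<close> and the trace \<open>pr c\<close> of the
  antisymmetrised array, and the identities \<open>\<Sum>\<^sub>l P\<^bsub>il\<^esub> Q\<^bsub>jl\<^esub> = 0\<close> and \<open>\<Sum>\<^bsub>i<j\<^esub> P\<^bsub>ij\<^esub> Q\<^bsub>ij\<^esub> = 0\<close> relate what is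
  left by the coefficients \<open>n - 2\<close>, \<open>n - 1\<close> and \<open>n choose 2\<close> in \<open>k\<close>.  The cases of the theorem are
  the possible degenerations of these relations; the quotient by the simple socle is realised by
  \<open>pr c\<close>, by \<open>kap c\<close> modulo scalars, or, for the Weyl module, by the pairing with the matrix
  \<open>kap c + pr c\<close> of trace zero.  The kernel of \<open>psi\<close> on antisymmetric arrays has dimension \<open>n\<^sup>2\<close>,
  which gives all dimensions.
\<close>

section \<open>The special linear group\<close>

text \<open>No character formula enters: \<open>V mw\<close> is determined from its weights,
  uniformly in \<open>p\<close>. The coefficients \<open>n - 2\<close>, \<open>n - 1\<close> and
  \<open>n choose 2\<close> arise twice, which is what makes the answer exact. From one side, an
  invariant built from \<open>kap\<close> and \<open>pr\<close> descends from arrays to functions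
  when it vanishes on the kernel of \<open>psi\<close>, and contracting a kernel element produces
  these coefficients. From the other side, the same two identities of minors bound what can survive
  modulo a nonzero submodule. In every case the two bounds meet.

  Characteristic 2 is the obstacle that shapes the set-up. The trace of \<open>kap c\<close> is
  \<open>2 * pr c\<close>: when 2 is invertible this expresses \<open>pr\<close> through
  \<open>kap\<close>, when \<open>2 = 0\<close> it makes \<open>kap\<close> traceless and leaves
  \<open>pr\<close> independent. Hence \<open>pr\<close> is carried separately, nothing is ever
  halved in the general constructions, and the residue of \<open>l\<close> modulo 4 enters through
  the parity of \<open>n choose 2\<close>. The bound \<open>l \<ge> 4\<close> supplies a fifth
  index: four occur in a product of two minors, and a further one absorbs the sign of a
  permutation.\<close>

lemma alg_closed_infinite: "infinite (UNIV :: 'k :: alg_closed_field set)"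
proof
  assume fin: "finite (UNIV :: 'k set)"
  define p :: "'k poly" where "p = (\<Prod>a\<in>UNIV. [:-a, 1:]) + 1"
  have "degree (\<Prod>a\<in>(UNIV::'k set). [:-a, 1:]) = (\<Sum>a\<in>(UNIV::'k set). degree [:-a, 1:])"
    by (rule degree_prod_eq_sum_degree) auto
  hence "degree (\<Prod>a\<in>(UNIV::'k set). [:-a, 1:]) = card (UNIV::'k set)" by simp
  hence "degree p > 0" unfolding p_def using fin by (simp add: degree_add_eq_left finite_UNIV_card_ge_0)
  then obtain x where "poly p x = 0" using alg_closed_imp_poly_has_root by blast
  moreover have "poly p x = 1"
    unfolding p_def using fin by (auto simp: poly_prod)
  ultimately show False by simp
qed

lemma infinite_nonzero: "infinite (UNIV - {0 :: 'k :: alg_closed_field})"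
  using alg_closed_infinite by simp

text \<open>Laurent families are defined for \<open>s \<noteq> 0\<close> only, so polynomial
  identities have to be recognised on the punctured line.\<close>

lemma poly_eqI_nonzero:
  fixes p q :: "'k :: alg_closed_field poly"
  assumes "\<And>s. s \<noteq> 0 \<Longrightarrow> poly p s = poly q s"
  shows "p = q"
proof (rule ccontr)
  assume "p \<noteq> q"
  hence "finite {s. poly (p - q) s = 0}" by (intro poly_roots_finite) simp
  moreover have "UNIV - {0} \<subseteq> {s. poly (p - q) s = 0}" using assms by auto
  ultimately show False using infinite_nonzero finite_subset by blast
qed

lemma mult_entry:
  "A \<in> carrier_mat n n \<Longrightarrow> B \<in> carrier_mat n n \<Longrightarrow> i < n \<Longrightarrow> j < n
   \<Longrightarrow> (A * B) $$ (i, j) = (\<Sum>k<n. A $$ (i, k) * B $$ (k, j))"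
  by (auto simp: scalar_prod_def atLeast0LessThan intro!: sum.cong)

locale sln =
  fixes n :: nat and ty :: "'k :: alg_closed_field itself"
  assumes n2: "n \<ge> 2"
begin

abbreviation S :: "'k mat set" where "S \<equiv> carrier (SL n)"
abbreviation iv :: "'k mat \<Rightarrow> 'k mat" where "iv \<equiv> m_inv (SL n)"
text \<open>The root element \<open>1 + t e\<^bsub>ij\<^esub>\<close>.\<close>

abbreviation E :: "nat \<Rightarrow> nat \<Rightarrow> 'k \<Rightarrow> 'k mat" where "E i j t \<equiv> addrow_mat n t i j"

section \<open>The group \<open>SL n\<close>, its root elements, diagonal scalings and permutation
  matrices\<close>

lemma S_iff: "x \<in> S \<longleftrightarrow> x \<in> carrier_mat n n \<and> det x = 1"
  by (simp add: SL_def)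

lemma S_carrier: "x \<in> S \<Longrightarrow> x \<in> carrier_mat n n"
  by (simp add: SL_def)

lemma SL_simps [simp]: "mult (SL n) = (*)" "one (SL n) = 1\<^sub>m n"
  by (simp_all add: SL_def)

lemma adj_in_S: "x \<in> S \<Longrightarrow> adj_mat x \<in> S" "x \<in> S \<Longrightarrow> x * adj_mat x = 1\<^sub>m n"
  "x \<in> S \<Longrightarrow> adj_mat x * x = 1\<^sub>m n"
proof -
  assume x: "x \<in> S"
  hence c: "x \<in> carrier_mat n n" and d: "det x = 1" by (auto simp: S_iff)
  note a = adj_mat[OF c]
  show 1: "x * adj_mat x = 1\<^sub>m n" "adj_mat x * x = 1\<^sub>m n"
    using a d by auto
  have "det x * det (adj_mat x) = 1" using det_mult[OF c a(1)] 1 by simp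
  thus "adj_mat x \<in> S" using a d by (auto simp: S_iff)
qed

lemma S_mult: "x \<in> S \<Longrightarrow> y \<in> S \<Longrightarrow> x * y \<in> S"
  using det_mult[of x n y] by (auto simp: S_iff)

lemma S_one: "1\<^sub>m n \<in> S"
  by (auto simp: S_iff)

sublocale SLG: group "SL n :: 'k mat monoid"
  rewrites "mult (SL n) = (*)" and "one (SL n) = 1\<^sub>m n"
proof -
  show "group (SL n :: 'k mat monoid)"
  proof (rule groupI)
    show "\<And>x y z :: 'k mat. x \<in> S \<Longrightarrow> y \<in> S \<Longrightarrow> z \<in> S \<Longrightarrow>
       x \<otimes>\<^bsub>SL n\<^esub> y \<otimes>\<^bsub>SL n\<^esub> z = x \<otimes>\<^bsub>SL n\<^esub> (y \<otimes>\<^bsub>SL n\<^esub> z)"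
      by (auto simp: S_iff intro: assoc_mult_mat)
    show "\<And>x :: 'k mat. x \<in> S \<Longrightarrow> \<one>\<^bsub>SL n\<^esub> \<otimes>\<^bsub>SL n\<^esub> x = x" by (auto simp: S_iff)
    show "\<And>x :: 'k mat. x \<in> S \<Longrightarrow> \<exists>y\<in>S. y \<otimes>\<^bsub>SL n\<^esub> x = \<one>\<^bsub>SL n\<^esub>"
      using adj_in_S by auto
  qed (auto simp: S_mult S_one)
qed simp_all

lemma iv_eqI: "x \<in> S \<Longrightarrow> y \<in> carrier_mat n n \<Longrightarrow> x * y = 1\<^sub>m n \<Longrightarrow> iv x = y"
proof -
  assume x: "x \<in> S" and y: "y \<in> carrier_mat n n" and xy: "x * y = 1\<^sub>m n"
  have "det x * det y = 1" using det_mult[of x n y] x y xy by (auto simp: S_iff)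
  hence "y \<in> S" using x y by (auto simp: S_iff)
  moreover have "y * x = 1\<^sub>m n" using mat_mult_left_right_inverse[OF S_carrier[OF x] y xy] .
  ultimately show "iv x = y" using x SLG.inv_equality by auto
qed

lemma iv_adj: "x \<in> S \<Longrightarrow> iv x = adj_mat x"
  by (rule iv_eqI) (auto simp: adj_in_S intro: S_carrier)

lemma iv_S: "x \<in> S \<Longrightarrow> iv x \<in> S" by simp

lemma iv_mult: "x \<in> S \<Longrightarrow> y \<in> S \<Longrightarrow> iv (x * y) = iv y * iv x"
  using SLG.inv_mult_group by simp

lemma S_entry_mult: "x \<in> S \<Longrightarrow> y \<in> S \<Longrightarrow> i < n \<Longrightarrow> j < n
   \<Longrightarrow> (x * y) $$ (i, j) = (\<Sum>k<n. x $$ (i, k) * y $$ (k, j))"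
  by (rule mult_entry) (auto intro: S_carrier)

lemma S_eqI: "x \<in> carrier_mat n n \<Longrightarrow> y \<in> carrier_mat n n
   \<Longrightarrow> (\<And>i j. i < n \<Longrightarrow> j < n \<Longrightarrow> x $$ (i, j) = y $$ (i, j)) \<Longrightarrow> x = y"
  by (rule eq_matI) auto

lemma iv_right_sum: "x \<in> S \<Longrightarrow> i < n \<Longrightarrow> j < n \<Longrightarrow>
   (\<Sum>k<n. x $$ (i, k) * iv x $$ (k, j)) = (if i = j then 1 else 0)"
  using S_entry_mult[of x "iv x" i j] by auto

lemma iv_left_sum: "x \<in> S \<Longrightarrow> i < n \<Longrightarrow> j < n \<Longrightarrow>
   (\<Sum>k<n. iv x $$ (i, k) * x $$ (k, j)) = (if i = j then 1 else 0)"
  using S_entry_mult[of "iv x" x i j] by auto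

lemma E_S [simp]: "i \<noteq> j \<Longrightarrow> E i j t \<in> S"
  using det_addrow_mat[of i j n t] carrier_matI[of "addrow_mat n t i j" n n] by (simp add: S_iff)

lemma E_entry: "r < n \<Longrightarrow> c < n \<Longrightarrow> E i j t $$ (r, c) = (if r = c then 1 else 0) + (if r = i \<and> c = j then t else 0)"
  by auto

lemma E_mult_entry:
  assumes "x \<in> carrier_mat n n" "i < n" "j < n" "r < n" "c < n"
  shows "(E i j t * x) $$ (r, c) = x $$ (r, c) + (if r = i then t * x $$ (j, c) else 0)"
proof -
  have "(E i j t * x) $$ (r, c) = (\<Sum>k<n. E i j t $$ (r, k) * x $$ (k, c))"
    by (rule mult_entry) (use assms in \<open>auto simp: addrow_mat_def\<close>)
  also have "\<dots> = (\<Sum>k<n. (if k = r then x $$ (k, c) else 0) + (if k = j then (if r = i then t * x $$ (k, c) else 0) else 0))"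
    using assms by (intro sum.cong) (auto simp: E_entry algebra_simps simp del: index_mat_addrow_mat)
  also have "\<dots> = x $$ (r, c) + (if r = i then t * x $$ (j, c) else 0)"
    using assms by (simp add: sum.distrib)
  finally show ?thesis .
qed

lemma mult_E_entry:
  assumes "x \<in> carrier_mat n n" "i < n" "j < n" "r < n" "c < n"
  shows "(x * E i j t) $$ (r, c) = x $$ (r, c) + (if c = j then t * x $$ (r, i) else 0)"
proof -
  have "(x * E i j t) $$ (r, c) = (\<Sum>k<n. x $$ (r, k) * E i j t $$ (k, c))"
    by (rule mult_entry) (use assms in \<open>auto simp: addrow_mat_def\<close>)
  also have "\<dots> = (\<Sum>k<n. (if k = c then x $$ (r, k) else 0) + (if k = i then (if c = j then t * x $$ (r, k) else 0) else 0))"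
    using assms by (intro sum.cong) (auto simp: E_entry algebra_simps simp del: index_mat_addrow_mat)
  also have "\<dots> = x $$ (r, c) + (if c = j then t * x $$ (r, i) else 0)"
    using assms by (simp add: sum.distrib)
  finally show ?thesis .
qed

lemma E_carrier [simp]: "E i j t \<in> carrier_mat n n" by (auto simp: addrow_mat_def)

lemma E_add: "i < n \<Longrightarrow> j < n \<Longrightarrow> i \<noteq> j \<Longrightarrow> E i j s * E i j t = E i j (s + t)"
  by (rule S_eqI) (auto simp: E_mult_entry simp del: index_mult_mat(1))

lemma E_zero: "E i j 0 = 1\<^sub>m n"
  by (rule S_eqI) auto

lemma iv_E: "i < n \<Longrightarrow> j < n \<Longrightarrow> i \<noteq> j \<Longrightarrow> iv (E i j t) = E i j (- t)"
  by (rule iv_eqI) (auto simp: E_add E_zero)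

lemma iv_E_mult:
  assumes "x \<in> S" "i < n" "j < n" "i \<noteq> j" "r < n" "c < n"
  shows "iv (E i j t * x) $$ (r, c) = iv x $$ (r, c) - (if c = j then t * iv x $$ (r, i) else 0)"
  using assms by (simp add: iv_mult iv_E mult_E_entry S_carrier[OF iv_S])

lemma E_comm: "i < n \<Longrightarrow> j < n \<Longrightarrow> k < n \<Longrightarrow> l < n \<Longrightarrow> i \<noteq> l \<Longrightarrow> j \<noteq> k \<Longrightarrow>
   E i j s * E k l t = E k l t * E i j s"
  by (rule S_eqI) (auto simp: E_mult_entry simp del: index_mult_mat(1))

text \<open>The Chevalley commutator relation. Evaluating a weight vector at both sides yields the
  additive relations between its first-order coefficients along \<open>E i j\<close>,
  \<open>E j k\<close> and \<open>E i k\<close>.\<close>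

lemma E_commutator: "i < n \<Longrightarrow> j < n \<Longrightarrow> k < n \<Longrightarrow> i \<noteq> j \<Longrightarrow> j \<noteq> k \<Longrightarrow> i \<noteq> k \<Longrightarrow>
   E i j s * E j k t = E i k (s * t) * (E j k t * E i j s)"
  by (rule S_eqI) (auto simp: E_mult_entry mult_carrier_mat[of _ n n _ n] simp del: index_mult_mat(1))

text \<open>The product of \<open>x\<close> with the diagonal matrices of \<open>d\<close> on the
  left and \<open>c\<close> on the right; separately these may have any determinant.\<close>

definition sc :: "(nat \<Rightarrow> 'k) \<Rightarrow> (nat \<Rightarrow> 'k) \<Rightarrow> 'k mat \<Rightarrow> 'k mat" where
  "sc d c x = mat n n (\<lambda>(i, j). d i * c j * x $$ (i, j))"

lemma sc_entry [simp]: "i < n \<Longrightarrow> j < n \<Longrightarrow> sc d c x $$ (i, j) = d i * c j * x $$ (i, j)"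
  by (simp add: sc_def)

lemma sc_carrier [simp]: "sc d c x \<in> carrier_mat n n" by (simp add: sc_def)

text \<open>Each term of the Leibniz formula takes one entry from every row and every column, so it
  picks up every \<open>d i\<close> and every \<open>c i\<close> exactly once.\<close>

lemma det_sc:
  assumes "x \<in> carrier_mat n n"
  shows "det (sc d c x) = (\<Prod>i<n. d i) * (\<Prod>i<n. c i) * det x"
proof -
  have "det (sc d c x) = (\<Sum>p\<in>{p. p permutes {0..<n}}. signof p * (\<Prod>i = 0..<n. d i * c (p i) * x $$ (i, p i)))"
    unfolding det_def'[OF sc_carrier]
  proof (intro sum.cong refl arg_cong2[of _ _ _ _ "(*)"] prod.cong)
    fix p i assume p: "p \<in> {p. p permutes {0..<n}}" and i: "i \<in> {0..<n}"
    thus "sc d c x $$ (i, p i) = d i * c (p i) * x $$ (i, p i)"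
      using permutes_in_image[of p "{0..<n}" i] by auto
  qed
  also have "\<dots> = (\<Sum>p\<in>{p. p permutes {0..<n}}. (\<Prod>i<n. d i) * (\<Prod>i<n. c i) * (signof p * (\<Prod>i = 0..<n. x $$ (i, p i))))"
  proof (intro sum.cong refl)
    fix p assume "p \<in> {p. p permutes {0..<n}}"
    hence "(\<Prod>i = 0..<n. c i) = (\<Prod>i = 0..<n. c (p i))"
      using prod.permute[of p "{0..<n}" c] by (simp add: o_def)
    thus "signof p * (\<Prod>i = 0..<n. d i * c (p i) * x $$ (i, p i)) = (\<Prod>i<n. d i) * (\<Prod>i<n. c i) * (signof p * (\<Prod>i = 0..<n. x $$ (i, p i)))"
      by (simp add: prod.distrib atLeast0LessThan mult.assoc mult.left_commute)
  qed
  also have "\<dots> = (\<Prod>i<n. d i) * (\<Prod>i<n. c i) * det x"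
    unfolding det_def'[OF assms] by (simp add: sum_distrib_left)
  finally show ?thesis .
qed

lemma sc_S: "x \<in> S \<Longrightarrow> (\<Prod>i<n. d i) * (\<Prod>i<n. c i) = 1 \<Longrightarrow> sc d c x \<in> S"
  by (auto simp: S_iff det_sc)

lemma iv_sc:
  assumes x: "x \<in> S" and p: "(\<Prod>i<n. d i) * (\<Prod>i<n. c i) = 1"
  shows "iv (sc d c x) = sc (\<lambda>i. inverse (c i)) (\<lambda>i. inverse (d i)) (iv x)"
proof (rule iv_eqI)
  have nz: "d i \<noteq> 0" "c i \<noteq> 0" if "i < n" for i
    using p that prod_zero[of "{..<n}" d] prod_zero[of "{..<n}" c] by fastforce+
  show "sc d c x * sc (\<lambda>i. inverse (c i)) (\<lambda>i. inverse (d i)) (iv x) = 1\<^sub>m n"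
  proof (rule S_eqI)
    fix i j assume ij: "i < n" "j < n"
    have "(sc d c x * sc (\<lambda>i. inverse (c i)) (\<lambda>i. inverse (d i)) (iv x)) $$ (i, j)
      = (\<Sum>k<n. (d i * c k * x $$ (i, k)) * (inverse (c k) * inverse (d j) * iv x $$ (k, j)))"
      by (subst mult_entry[where n = n]) (use ij in auto)
    also have "\<dots> = (\<Sum>k<n. (d i * inverse (d j)) * (x $$ (i, k) * iv x $$ (k, j)))"
      using nz by (intro sum.cong) auto
    also have "\<dots> = (d i * inverse (d j)) * (if i = j then 1 else 0)"
      unfolding sum_distrib_left[symmetric] using iv_right_sum[OF x ij] by simp
    also have "\<dots> = 1\<^sub>m n $$ (i, j)" using ij nz by auto
    finally show "(sc d c x * sc (\<lambda>i. inverse (c i)) (\<lambda>i. inverse (d i)) (iv x)) $$ (i, j) = 1\<^sub>m n $$ (i, j)" .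
  qed (auto intro: mult_carrier_mat[of _ n n])
qed (auto simp: sc_S x p)

text \<open>The left action of the torus of \<open>GL\<^sub>n\<close>, brought back to determinant \<open>1\<close> by rescaling the first
  column.  The latter is a right translation by the lower Borel subgroup up to a scalar matrix, so
  this torus acts on \<open>H\<^sup>0\<close>, and its weights can be compared coordinate by coordinate.\<close>

definition dil :: "nat \<Rightarrow> 'k \<Rightarrow> 'k mat \<Rightarrow> 'k mat" where
  "dil r s = sc (\<lambda>i. if i = r then s else 1) (\<lambda>j. if j = 0 then inverse s else 1)"

lemma dil_prod: "r < n \<Longrightarrow> s \<noteq> 0 \<Longrightarrow>
   (\<Prod>i<n. if i = r then s else 1) * (\<Prod>i<n. if i = 0 then inverse s else 1) = (1 :: 'k)"
  using n2 by (simp add: prod.delta)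

lemma dil_S: "x \<in> S \<Longrightarrow> r < n \<Longrightarrow> s \<noteq> 0 \<Longrightarrow> dil r s x \<in> S"
  unfolding dil_def by (rule sc_S) (use dil_prod in auto)

lemma dil_entry: "i < n \<Longrightarrow> j < n \<Longrightarrow>
   dil r s x $$ (i, j) = (if i = r then s else 1) * (if j = 0 then inverse s else 1) * x $$ (i, j)"
  by (simp add: dil_def)

lemma iv_dil_entry: "x \<in> S \<Longrightarrow> r < n \<Longrightarrow> s \<noteq> 0 \<Longrightarrow> i < n \<Longrightarrow> j < n \<Longrightarrow>
   iv (dil r s x) $$ (i, j) = (if i = 0 then s else 1) * (if j = r then inverse s else 1) * iv x $$ (i, j)"
  unfolding dil_def by (subst iv_sc) (use dil_prod in auto)

lemma dil_carrier [simp]: "dil r s x \<in> carrier_mat n n" by (simp add: dil_def)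

lemma dil_comm: "dil r s (dil q t x) = dil q t (dil r s x)"
  by (rule S_eqI) (auto simp: dil_entry)

lemma dil_dil: "dil r s (dil r t x) = dil r (s * t) x"
  by (rule S_eqI) (auto simp: dil_entry)

text \<open>The torus normalises each root subgroup: conjugation multiplies the parameter by the
  value of a root, here \<open>s\<close> for \<open>r = j\<close> and its inverse for
  \<open>r = i\<close>. This is the source of the weight shifts in
  \<open>E_expand_wt\<close>.\<close>

lemma dil_E: "x \<in> S \<Longrightarrow> i < n \<Longrightarrow> j < n \<Longrightarrow> i \<noteq> j \<Longrightarrow> r < n \<Longrightarrow> s \<noteq> 0 \<Longrightarrow>
   E i j t * dil r s x = dil r s (E i j (t * (if r = j then s else 1) * (if r = i then inverse s else 1)) * x)"
  by (rule S_eqI) (auto simp: E_mult_entry dil_entry S_carrier field_simps simp del: index_mult_mat(1) intro: mult_carrier_mat[of _ n n] )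

text \<open>A permutation matrix; the row \<open>q\<close> absorbs the sign so that the determinant is \<open>1\<close>.\<close>

definition mon :: "(nat \<Rightarrow> nat) \<Rightarrow> nat \<Rightarrow> 'k mat" where
  "mon \<pi> q = mat n n (\<lambda>(r, c). if c = \<pi> r then (if r = q then signof \<pi> else 1) else 0)"

lemma signof_sq: "(signof \<pi> :: 'k) * signof \<pi> = 1" by (simp add: sign_def)

lemma mon_eq: "\<pi> permutes {0..<n} \<Longrightarrow> mon \<pi> q = sc (\<lambda>r. if r = q then signof \<pi> else 1) (\<lambda>_. 1) (mat n n (\<lambda>(i, j). 1\<^sub>m n $$ (\<pi> i, j)))"
proof (rule S_eqI)
  fix i j assume "\<pi> permutes {0..<n}" "i < n" "j < n"
  moreover from this have "\<pi> i < n" using permutes_in_image[of \<pi> "{0..<n}" i] by auto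
  ultimately show "mon \<pi> q $$ (i, j) = sc (\<lambda>r. if r = q then signof \<pi> else 1) (\<lambda>_. 1) (mat n n (\<lambda>(i, j). 1\<^sub>m n $$ (\<pi> i, j))) $$ (i, j)"
    by (auto simp: mon_def)
qed (auto simp: mon_def)

lemma mon_S:
  assumes p: "\<pi> permutes {0..<n}" and q: "q < n"
  shows "mon \<pi> q \<in> S"
proof -
  have "det (mat n n (\<lambda>(i, j). 1\<^sub>m n $$ (\<pi> i, j))) = (signof \<pi> * 1 :: 'k)"
    using det_permute_rows[OF one_carrier_mat p] by simp
  moreover have "(\<Prod>r<n. if r = q then signof \<pi> else 1) = (signof \<pi> :: 'k)" using q by simp
  ultimately have "det (mon \<pi> q) = (1 :: 'k)" unfolding mon_eq[OF p]
    by (subst det_sc) (use signof_sq[of \<pi>] in auto)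
  thus ?thesis unfolding S_iff by (simp add: mon_def)
qed

lemma mon_mult_entry:
  assumes p: "\<pi> permutes {0..<n}" and q: "q < n" and x: "x \<in> carrier_mat n n" and rc: "r < n" "c < n"
  shows "(mon \<pi> q * x) $$ (r, c) = (if r = q then signof \<pi> else 1) * x $$ (\<pi> r, c)"
proof -
  have pr: "\<pi> r < n" using permutes_in_image[OF p, of r] rc by auto
  have "(mon \<pi> q * x) $$ (r, c) = (\<Sum>k<n. mon \<pi> q $$ (r, k) * x $$ (k, c))"
    by (rule mult_entry) (use rc x in \<open>auto simp: mon_def\<close>)
  also have "\<dots> = (\<Sum>k<n. if k = \<pi> r then (if r = q then signof \<pi> else 1) * x $$ (k, c) else 0)"
    using rc by (intro sum.cong) (auto simp: mon_def)
  finally show ?thesis using pr by simp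
qed

lemma iv_mon:
  assumes p: "\<pi> permutes {0..<n}" and q: "q < n"
  shows "iv (mon \<pi> q) = transpose_mat (mon \<pi> q)"
proof (rule iv_eqI)
  show "mon \<pi> q * transpose_mat (mon \<pi> q) = 1\<^sub>m n"
  proof (rule S_eqI)
    fix i j assume ij: "i < n" "j < n"
    have pr: "\<pi> i < n" using permutes_in_image[OF p, of i] ij by auto
    show "(mon \<pi> q * transpose_mat (mon \<pi> q)) $$ (i, j) = 1\<^sub>m n $$ (i, j)"
      using ij pr permutes_inj[OF p, THEN injD, of i j] signof_sq[of \<pi>]
      by (subst mon_mult_entry[OF p q]) (auto simp: mon_def)
  qed (auto simp: mon_def intro: mult_carrier_mat[of _ n n])
next
  show "mon \<pi> q \<in> S" by (rule mon_S[OF p q])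
qed (auto simp: mon_def)

lemma iv_mon_mult_entry:
  assumes p: "\<pi> permutes {0..<n}" and q: "q < n" and x: "x \<in> S" and rc: "r < n" "c < n"
  shows "iv (mon \<pi> q * x) $$ (r, c) = (if c = q then signof \<pi> else 1) * iv x $$ (r, \<pi> c)"
proof -
  have pr: "\<pi> c < n" using permutes_in_image[OF p, of c] rc by auto
  have "iv (mon \<pi> q * x) $$ (r, c) = (iv x * transpose_mat (mon \<pi> q)) $$ (r, c)"
    using iv_mult[OF mon_S[OF p q] x] iv_mon[OF p q] by simp
  also have "\<dots> = (\<Sum>k<n. iv x $$ (r, k) * transpose_mat (mon \<pi> q) $$ (k, c))"
    by (rule mult_entry) (use rc S_carrier[OF iv_S[OF x]] in \<open>auto simp: mon_def\<close>)
  also have "\<dots> = (\<Sum>k<n. if k = \<pi> c then (if c = q then signof \<pi> else 1) * iv x $$ (r, k) else 0)"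
    using rc by (intro sum.cong) (auto simp: mon_def)
  finally show ?thesis using pr by simp
qed

section \<open>The coordinate ring\<close>

lemma reg_ext: "f \<in> regular_functions n \<Longrightarrow> f \<in> extensional S"
  by (induction rule: regular_functions.induct) (auto simp: extensional_def)

lemma reg_cong: "(\<lambda>x\<in>S. f x) \<in> regular_functions n \<Longrightarrow> (\<And>x. x \<in> S \<Longrightarrow> f x = g x) \<Longrightarrow> (\<lambda>x\<in>S. g x) \<in> regular_functions n"
  by (metis (no_types, lifting) restrict_ext)

lemma reg_add: "(\<lambda>x\<in>S. f x) \<in> regular_functions n \<Longrightarrow> (\<lambda>x\<in>S. g x) \<in> regular_functions n
   \<Longrightarrow> (\<lambda>x\<in>S. f x + g x) \<in> regular_functions n"
  by (drule (1) regular_functions.add) (erule reg_cong, simp)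

lemma reg_mult: "(\<lambda>x\<in>S. f x) \<in> regular_functions n \<Longrightarrow> (\<lambda>x\<in>S. g x) \<in> regular_functions n
   \<Longrightarrow> (\<lambda>x\<in>S. f x * g x) \<in> regular_functions n"
  by (drule (1) regular_functions.mult) (erule reg_cong, simp)

lemma reg_sum: "(\<And>i. i \<in> I \<Longrightarrow> (\<lambda>x\<in>S. f i x) \<in> regular_functions n)
   \<Longrightarrow> (\<lambda>x\<in>S. \<Sum>i\<in>I. f i x) \<in> regular_functions n"
proof (induction I rule: infinite_finite_induct)
  case (insert i I)
  thus ?case using reg_add[of "f i" "\<lambda>x. \<Sum>i\<in>I. f i x"] by (simp only: sum.insert if_False insert_iff simp_thms)
qed (auto intro: regular_functions.const)

lemma reg_prod: "(\<And>i. i \<in> I \<Longrightarrow> (\<lambda>x\<in>S. f i x) \<in> regular_functions n)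
   \<Longrightarrow> (\<lambda>x\<in>S. \<Prod>i\<in>I. f i x) \<in> regular_functions n"
proof (induction I rule: infinite_finite_induct)
  case (insert i I)
  thus ?case using reg_mult[of "f i" "\<lambda>x. \<Prod>i\<in>I. f i x"] by (simp only: prod.insert if_False insert_iff simp_thms)
qed (auto intro: regular_functions.const)

text \<open>On \<open>SL n\<close> the inverse is the adjugate, and its entries are signed minors,
  hence polynomials in the entries of \<open>x\<close>.\<close>

lemma reg_iv:
  assumes ij: "i < n" "j < n"
  shows "(\<lambda>x\<in>S. iv x $$ (i, j)) \<in> regular_functions n"
proof -
  have "(\<lambda>x\<in>S. (- 1) ^ (j + i) * (\<Sum>p\<in>{p. p permutes {0..<n - 1}}. signof p *
     (\<Prod>k = 0..<n - 1. x $$ (insert_index j k, insert_index i (p k))))) \<in> regular_functions n"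
  proof (intro reg_mult reg_sum reg_prod regular_functions.const)
    fix p k assume p: "p \<in> {p. p permutes {0..<n - 1}}" and k: "k \<in> {0..<n - 1}"
    have "p k < n - 1" using permutes_in_image[of p "{0..<n - 1}" k] p k by auto
    thus "(\<lambda>x\<in>S. x $$ (insert_index j k, insert_index i (p k))) \<in> regular_functions n"
      using k by (intro regular_functions.entry) (auto simp: insert_index_def)
  qed
  thus ?thesis
  proof (rule reg_cong)
    fix x assume x: "x \<in> S"
    hence xc: "x \<in> carrier_mat n n" by (rule S_carrier)
    have "iv x $$ (i, j) = cofactor x j i"
      using iv_adj[OF x] xc ij by (auto simp: adj_mat_def)
    also have "\<dots> = (- 1) ^ (j + i) * det (mat_delete x j i)" by (simp add: cofactor_def)
    also have "det (mat_delete x j i) = (\<Sum>p\<in>{p. p permutes {0..<n - 1}}. signof p * (\<Prod>k = 0..<n - 1. mat_delete x j i $$ (k, p k)))"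
      by (rule det_def') (use xc in \<open>auto intro: mat_delete_carrier\<close>)
    also have "\<dots> = (\<Sum>p\<in>{p. p permutes {0..<n - 1}}. signof p *
     (\<Prod>k = 0..<n - 1. x $$ (insert_index j k, insert_index i (p k))))"
    proof (intro sum.cong refl arg_cong2[of _ _ _ _ "(*)"] prod.cong)
      fix p k assume p: "p \<in> {p. p permutes {0..<n - 1}}" and k: "k \<in> {0..<n - 1}"
      have "p k < n - 1" using permutes_in_image[of p "{0..<n - 1}" k] p k by auto
      thus "mat_delete x j i $$ (k, p k) = x $$ (insert_index j k, insert_index i (p k))"
        using k xc by (auto simp: mat_delete_def insert_index_def)
    qed
    finally show "(- 1) ^ (j + i) * (\<Sum>p\<in>{p. p permutes {0..<n - 1}}. signof p *
     (\<Prod>k = 0..<n - 1. x $$ (insert_index j k, insert_index i (p k)))) = iv x $$ (i, j)" by simp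
  qed
qed

end

section \<open>Regular functions and weights\<close>

lemma coeffs_eqI:
  fixes A B :: "nat \<Rightarrow> 'k :: alg_closed_field"
  assumes "\<And>s. s \<noteq> 0 \<Longrightarrow> (\<Sum>m\<le>d. s ^ m * A m) = (\<Sum>m\<le>d. s ^ m * B m)" and "m \<le> d"
  shows "A m = B m"
proof -
  have "(\<Sum>m\<le>d. monom (A m) m) = (\<Sum>m\<le>d. monom (B m) m)"
    by (rule poly_eqI_nonzero) (use assms in \<open>simp add: poly_sum poly_monom mult.commute\<close>)
  hence "coeff (\<Sum>m\<le>d. monom (A m) m) m = coeff (\<Sum>m\<le>d. monom (B m) m) m" by simp
  thus ?thesis using assms(2) by (simp add: coeff_sum)
qed

context sln
begin

abbreviation V :: "weight \<Rightarrow> ('k mat \<Rightarrow> 'k) set" where "V \<mu> \<equiv> carrier (H0 TYPE('k) n \<mu>)"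

text \<open>Functions are \<open>undefined\<close> off \<open>S\<close>, so that agreement on
  \<open>S\<close> is equality of functions and a subspace can serve directly as the carrier of a
  module.\<close>

definition func_sub :: "('k mat \<Rightarrow> 'k) set \<Rightarrow> bool" where
  "func_sub W \<longleftrightarrow> W \<subseteq> extensional S \<and> (\<lambda>x\<in>S. 0) \<in> W \<and>
     (\<forall>f\<in>W. \<forall>h\<in>W. (\<lambda>x\<in>S. f x + h x) \<in> W) \<and> (\<forall>c. \<forall>f\<in>W. (\<lambda>x\<in>S. c * f x) \<in> W)"

lemma fsub_sum:
  assumes "func_sub W" "\<And>i. i \<in> I \<Longrightarrow> (\<lambda>x\<in>S. f i x) \<in> W"
  shows "(\<lambda>x\<in>S. \<Sum>i\<in>I. f i x) \<in> W"
  using assms(2)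
proof (induction I rule: infinite_finite_induct)
  case (insert i I)
  have "(\<lambda>x\<in>S. (\<lambda>x\<in>S. f i x) x + (\<lambda>x\<in>S. \<Sum>i\<in>I. f i x) x) \<in> W"
    using insert assms(1) unfolding func_sub_def by blast
  also have "(\<lambda>x\<in>S. (\<lambda>x\<in>S. f i x) x + (\<lambda>x\<in>S. \<Sum>i\<in>I. f i x) x) = (\<lambda>x\<in>S. \<Sum>i\<in>insert i I. f i x)"
    using insert by auto
  finally show ?case .
qed (use assms(1) in \<open>auto simp: func_sub_def\<close>)

lemma fsub_add: "func_sub W \<Longrightarrow> (\<lambda>x\<in>S. f x) \<in> W \<Longrightarrow> (\<lambda>x\<in>S. g x) \<in> W \<Longrightarrow> (\<lambda>x\<in>S. f x + g x) \<in> W"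
  using fsub_sum[of W "{0, 1 :: nat}" "\<lambda>i. if i = 0 then f else g"] by auto

lemma fsub_smult: "func_sub W \<Longrightarrow> (\<lambda>x\<in>S. f x) \<in> W \<Longrightarrow> (\<lambda>x\<in>S. c * f x) \<in> W"
proof -
  assume "func_sub W" "(\<lambda>x\<in>S. f x) \<in> W"
  hence "(\<lambda>x\<in>S. c * (\<lambda>x\<in>S. f x) x) \<in> W" unfolding func_sub_def by blast
  also have "(\<lambda>x\<in>S. c * (\<lambda>x\<in>S. f x) x) = (\<lambda>x\<in>S. c * f x)" by auto
  finally show ?thesis .
qed

lemma fsub_diff: "func_sub W \<Longrightarrow> (\<lambda>x\<in>S. f x) \<in> W \<Longrightarrow> (\<lambda>x\<in>S. g x) \<in> W \<Longrightarrow> (\<lambda>x\<in>S. f x - g x) \<in> W"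
  using fsub_add[of W f "\<lambda>x. - 1 * g x"] fsub_smult[of W g "- 1"] by simp

lemma fsub_restrict: "func_sub W \<Longrightarrow> f \<in> W \<Longrightarrow> (\<lambda>x\<in>S. f x) \<in> W"
  unfolding func_sub_def using extensional_restrict[of f S] by auto

lemma fsub_cong: "(\<lambda>x\<in>S. f x) \<in> W \<Longrightarrow> (\<And>x. x \<in> S \<Longrightarrow> f x = g x) \<Longrightarrow> (\<lambda>x\<in>S. g x) \<in> W"
  using restrict_ext[of S f g] by simp

lemma fsub_zero: "func_sub W \<Longrightarrow> (\<lambda>x\<in>S. 0) \<in> W" by (simp add: func_sub_def)

text \<open>The induction passes to the divided difference of the family at a point of \<open>T\<close>.\<close>

lemma coeff_mem:
  assumes W: "func_sub W" and T: "infinite T"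
    and F: "\<And>s. s \<in> T \<Longrightarrow> (\<lambda>x\<in>S. \<Sum>m\<le>d. s ^ m * F m x) \<in> W" and m: "m \<le> d"
  shows "(\<lambda>x\<in>S. F m x) \<in> W"
  using T F m
proof (induction d arbitrary: T F m)
  case 0
  from 0(1) obtain s where "s \<in> T" by (metis all_not_in_conv finite.emptyI)
  from 0(2)[OF this] 0 show ?case by simp
next
  case (Suc d)
  from Suc(2) obtain s0 where s0: "s0 \<in> T" by (metis all_not_in_conv finite.emptyI)
  \<comment> \<open>The coefficients of the family divided by \<open>s - s0\<close> after
    subtraction of its value at \<open>s0\<close>; \<open>key\<close> is this identity.\<close>
  define H where "H m x = (\<Sum>r\<in>{m<..Suc d}. s0 ^ (r - Suc m) * F r x)" for m x
  have key: "(\<Sum>m\<le>Suc d. s ^ m * F m x) - (\<Sum>m\<le>Suc d. s0 ^ m * F m x) = (s - s0) * (\<Sum>m\<le>d. s ^ m * H m x)" for s x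
  proof -
    have "(\<Sum>m\<le>Suc d. s ^ m * F m x) - (\<Sum>m\<le>Suc d. s0 ^ m * F m x) = (\<Sum>r\<le>Suc d. (s ^ r - s0 ^ r) * F r x)"
      by (simp add: sum_subtractf algebra_simps)
    also have "\<dots> = (\<Sum>r\<le>Suc d. (s - s0) * (\<Sum>m<r. s ^ m * s0 ^ (r - Suc m)) * F r x)"
      by (simp add: power_diff_sumr2 mult.commute)
    also have "\<dots> = (s - s0) * (\<Sum>r\<le>Suc d. \<Sum>m<r. s ^ m * s0 ^ (r - Suc m) * F r x)"
      by (simp only: sum_distrib_left sum_distrib_right mult.assoc)
    also have "(\<Sum>r\<le>Suc d. \<Sum>m<r. s ^ m * s0 ^ (r - Suc m) * F r x) = (\<Sum>m\<le>d. \<Sum>r\<in>{m<..Suc d}. s ^ m * s0 ^ (r - Suc m) * F r x)"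
      by (subst sum.Sigma, simp, simp, subst sum.Sigma, simp, simp,
          rule sum.reindex_bij_witness[of _ "\<lambda>(a, b). (b, a)" "\<lambda>(a, b). (b, a)"]) auto
    also have "\<dots> = (\<Sum>m\<le>d. s ^ m * H m x)"
      by (simp add: H_def sum_distrib_left mult.assoc)
    finally show ?thesis .
  qed
  have H: "(\<lambda>x\<in>S. H m x) \<in> W" if "m \<le> d" for m
  proof (rule Suc(1)[of "T - {s0}" H m])
    show "infinite (T - {s0})" using Suc(2) by simp
    fix s assume s: "s \<in> T - {s0}"
    hence "(\<lambda>x\<in>S. inverse (s - s0) * ((\<Sum>m\<le>Suc d. s ^ m * F m x) - (\<Sum>m\<le>Suc d. s0 ^ m * F m x))) \<in> W"
      using s0 by (intro fsub_smult fsub_diff W Suc(3)) auto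
    thus "(\<lambda>x\<in>S. \<Sum>m\<le>d. s ^ m * H m x) \<in> W"
      by (rule fsub_cong) (use s in \<open>simp only: key, simp\<close>)
  qed fact
  \<comment> \<open>Horner's recursion, which recovers the original coefficients from those of the
    divided difference. \<open>H (Suc d)\<close> is an empty sum, so the recursion also closes at
    the top.\<close>
  have step: "H m x = F (Suc m) x + s0 * H (Suc m) x" if "m \<le> d" for m x
  proof -
    have "{m<..Suc d} = insert (Suc m) {Suc m<..Suc d}" using that by auto
    hence "H m x = F (Suc m) x + (\<Sum>r\<in>{Suc m<..Suc d}. s0 ^ (r - Suc m) * F r x)"
      by (simp add: H_def)
    also have "(\<Sum>r\<in>{Suc m<..Suc d}. s0 ^ (r - Suc m) * F r x) = s0 * H (Suc m) x"
      unfolding H_def sum_distrib_left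
      by (intro sum.cong) (auto simp: power_Suc[symmetric] mult.assoc[symmetric] Suc_diff_Suc simp del: power_Suc)
    finally show ?thesis .
  qed
  have H': "(\<lambda>x\<in>S. H m x) \<in> W" if "m \<le> Suc d" for m
  proof (cases "m = Suc d")
    case True
    thus ?thesis using W by (simp add: H_def func_sub_def)
  qed (use H that in auto)
  show ?case
  proof (cases m)
    case 0
    have "(\<lambda>x\<in>S. (\<Sum>m\<le>Suc d. s0 ^ m * F m x) - s0 * H 0 x) \<in> W"
      using H'[of 0] by (intro fsub_diff fsub_smult W Suc(3)[OF s0]) auto
    moreover have "(\<Sum>m\<le>Suc d. s0 ^ m * F m x) - s0 * H 0 x = F 0 x" for x
    proof -
      have "{..Suc d} = insert 0 {0<..Suc d}" by auto
      hence "(\<Sum>m\<le>Suc d. s0 ^ m * F m x) = F 0 x + (\<Sum>m\<in>{0<..Suc d}. s0 ^ m * F m x)" by simp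
      also have "(\<Sum>m\<in>{0<..Suc d}. s0 ^ m * F m x) = s0 * H 0 x"
        unfolding H_def sum_distrib_left
        by (intro sum.cong) (auto simp: power_Suc[symmetric] mult.assoc[symmetric] simp del: power_Suc)
      finally show ?thesis by simp
    qed
    ultimately show ?thesis unfolding 0 by (simp only:)
  next
    case (Suc m')
    have "(\<lambda>x\<in>S. H m' x - s0 * H m x) \<in> W"
      using H'[of m'] H'[of m] Suc Suc.prems(3) by (intro fsub_diff fsub_smult W) auto
    thus ?thesis
      by (rule fsub_cong) (use step[of m'] Suc Suc.prems(3) in auto)
  qed
qed

text \<open>A family of functions depending on \<open>s\<close> as a polynomial (\<open>b = True\<close>) or, for \<open>s \<noteq> 0\<close> only, as a
  Laurent polynomial (\<open>b = False\<close>).\<close>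

definition lpoly :: "bool \<Rightarrow> ('k \<Rightarrow> 'k mat \<Rightarrow> 'k) \<Rightarrow> bool" where
  "lpoly b h \<longleftrightarrow> (\<exists>M d q. (b \<longrightarrow> M = 0) \<and> (\<forall>x. degree (q x) \<le> d) \<and>
     (\<forall>s. \<forall>x\<in>S. b \<or> s \<noteq> 0 \<longrightarrow> s ^ M * h s x = poly (q x) s))"

lemma lpoly_cong:
  "lpoly b h \<Longrightarrow> (\<And>s x. x \<in> S \<Longrightarrow> b \<or> s \<noteq> 0 \<Longrightarrow> h s x = h' s x) \<Longrightarrow> lpoly b h'"
  unfolding lpoly_def by simp

lemma lpoly_const: "lpoly b (\<lambda>s x. c x)"
  unfolding lpoly_def by (rule exI[of _ 0], rule exI[of _ 0], rule exI[of _ "\<lambda>x. [:c x:]"]) auto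

lemma lpoly_id: "lpoly b (\<lambda>s x. s)"
  unfolding lpoly_def by (rule exI[of _ 0], rule exI[of _ 1], rule exI[of _ "\<lambda>x. [:0, 1:]"]) auto

lemma lpoly_inverse: "lpoly False (\<lambda>s x. inverse s)"
  unfolding lpoly_def by (rule exI[of _ 1], rule exI[of _ 0], rule exI[of _ "\<lambda>x. 1"]) auto

lemma lpoly_add: "lpoly b h \<Longrightarrow> lpoly b h' \<Longrightarrow> lpoly b (\<lambda>s x. h s x + h' s x)"
proof -
  assume h: "lpoly b h" and h': "lpoly b h'"
  from h obtain M d q where
    1: "b \<longrightarrow> M = 0" "\<And>x. degree (q x) \<le> d" "\<And>s x. x \<in> S \<Longrightarrow> b \<or> s \<noteq> 0 \<Longrightarrow> s ^ M * h s x = poly (q x) s"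
    unfolding lpoly_def by blast
  from h' obtain M' d' q' where
    2: "b \<longrightarrow> M' = 0" "\<And>x. degree (q' x) \<le> d'" "\<And>s x. x \<in> S \<Longrightarrow> b \<or> s \<noteq> 0 \<Longrightarrow> s ^ M' * h' s x = poly (q' x) s"
    unfolding lpoly_def by blast
  show ?thesis unfolding lpoly_def
  proof (intro exI conjI allI ballI impI)
    show "b \<Longrightarrow> M + M' = 0" using 1 2 by simp
    show "degree (monom 1 M' * q x + monom 1 M * q' x) \<le> (M' + d) + (M + d')" for x
    proof (rule degree_add_le)
      show "degree (monom 1 M' * q x) \<le> (M' + d) + (M + d')"
        using degree_mult_le[of "monom 1 M'" "q x"] 1(2)[of x] degree_monom_le[of "1::'k" M'] by linarith
      show "degree (monom 1 M * q' x) \<le> (M' + d) + (M + d')"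
        using degree_mult_le[of "monom 1 M" "q' x"] 2(2)[of x] degree_monom_le[of "1::'k" M] by linarith
    qed
    fix s :: 'k and x assume sx: "x \<in> S" "b \<or> s \<noteq> 0"
    have "s ^ (M + M') * (h s x + h' s x) = s ^ M' * (s ^ M * h s x) + s ^ M * (s ^ M' * h' s x)"
      by (simp add: power_add algebra_simps)
    thus "s ^ (M + M') * (h s x + h' s x) = poly (monom 1 M' * q x + monom 1 M * q' x) s"
      unfolding 1(3)[OF sx] 2(3)[OF sx] by (simp add: poly_monom)
  qed
qed

lemma lpoly_mult: "lpoly b h \<Longrightarrow> lpoly b h' \<Longrightarrow> lpoly b (\<lambda>s x. h s x * h' s x)"
proof -
  assume h: "lpoly b h" and h': "lpoly b h'"
  from h obtain M d q where
    1: "b \<longrightarrow> M = 0" "\<And>x. degree (q x) \<le> d" "\<And>s x. x \<in> S \<Longrightarrow> b \<or> s \<noteq> 0 \<Longrightarrow> s ^ M * h s x = poly (q x) s"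
    unfolding lpoly_def by blast
  from h' obtain M' d' q' where
    2: "b \<longrightarrow> M' = 0" "\<And>x. degree (q' x) \<le> d'" "\<And>s x. x \<in> S \<Longrightarrow> b \<or> s \<noteq> 0 \<Longrightarrow> s ^ M' * h' s x = poly (q' x) s"
    unfolding lpoly_def by blast
  show ?thesis unfolding lpoly_def
  proof (intro exI conjI allI ballI impI)
    show "b \<Longrightarrow> M + M' = 0" using 1 2 by simp
    show "degree (q x * q' x) \<le> d + d'" for x
      using degree_mult_le[of "q x" "q' x"] 1(2)[of x] 2(2)[of x] by linarith
    fix s :: 'k and x assume sx: "x \<in> S" "b \<or> s \<noteq> 0"
    have "s ^ (M + M') * (h s x * h' s x) = (s ^ M * h s x) * (s ^ M' * h' s x)"
      by (simp add: power_add algebra_simps)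
    thus "s ^ (M + M') * (h s x * h' s x) = poly (q x * q' x) s"
      unfolding 1(3)[OF sx] 2(3)[OF sx] by simp
  qed
qed

text \<open>Sums and products of families are families again, and the induction over the generation
  of the coordinate ring keeps the degree bounded uniformly in \<open>x\<close>. This uniformity is
  what makes the coefficients finitely many functions of \<open>x\<close>.\<close>

lemma lpoly_reg:
  assumes f: "f \<in> regular_functions n"
    and \<phi>: "\<And>s x. x \<in> S \<Longrightarrow> b \<or> s \<noteq> 0 \<Longrightarrow> \<phi> s x \<in> S"
    and e: "\<And>i j. i < n \<Longrightarrow> j < n \<Longrightarrow> lpoly b (\<lambda>s x. \<phi> s x $$ (i, j))"
  shows "lpoly b (\<lambda>s x. f (\<phi> s x))"
  using f
proof (induction rule: regular_functions.induct)
  case (const c)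
  show ?case by (rule lpoly_cong[OF lpoly_const[of b "\<lambda>x. c"]]) (use \<phi> in auto)
next
  case (entry i j)
  show ?case by (rule lpoly_cong[OF e[OF entry]]) (use \<phi> in auto)
next
  case (add f h)
  show ?case by (rule lpoly_cong[OF lpoly_add[OF add(3,4)]]) (use \<phi> in auto)
next
  case (mult f h)
  show ?case by (rule lpoly_cong[OF lpoly_mult[OF mult(3,4)]]) (use \<phi> in auto)
qed

lemma lpoly_expand:
  assumes "lpoly b h"
  obtains M F d where "b \<longrightarrow> M = 0" "\<And>s x. x \<in> S \<Longrightarrow> b \<or> s \<noteq> 0 \<Longrightarrow> s ^ M * h s x = (\<Sum>m\<le>d. s ^ m * F m x)"
proof -
  from assms obtain M d q where
    1: "b \<longrightarrow> M = 0" "\<And>x. degree (q x) \<le> d" "\<And>s x. x \<in> S \<Longrightarrow> b \<or> s \<noteq> 0 \<Longrightarrow> s ^ M * h s x = poly (q x) s"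
    unfolding lpoly_def by blast
  show ?thesis
  proof (rule that[of M "\<lambda>m x. coeff (q x) m" d])
    fix s :: 'k and x assume "x \<in> S" "b \<or> s \<noteq> 0"
    hence "s ^ M * h s x = poly (q x) s" by (rule 1)
    also have "\<dots> = (\<Sum>m\<le>d. coeff (q x) m * s ^ m)"
      unfolding poly_altdef using 1(2)[of x]
      by (intro sum.mono_neutral_left) (auto simp: coeff_eq_0)
    finally show "s ^ M * h s x = (\<Sum>m\<le>d. s ^ m * coeff (q x) m)" by (simp add: mult.commute)
  qed (use 1 in simp)
qed

lemma reg_comp:
  assumes f: "f \<in> regular_functions n"
    and \<phi>: "\<And>x. x \<in> S \<Longrightarrow> \<phi> x \<in> S"
    and e: "\<And>i j. i < n \<Longrightarrow> j < n \<Longrightarrow> (\<lambda>x\<in>S. \<phi> x $$ (i, j)) \<in> regular_functions n"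
  shows "(\<lambda>x\<in>S. f (\<phi> x)) \<in> regular_functions n"
  using f
proof (induction rule: regular_functions.induct)
  case (const c)
  show ?case by (rule reg_cong[OF regular_functions.const[of c]]) (use \<phi> in auto)
next
  case (entry i j)
  show ?case by (rule reg_cong[OF e[OF entry]]) (use \<phi> in auto)
next
  case (add f h)
  show ?case by (rule reg_cong[OF reg_add[OF add(3,4)]]) (use \<phi> in auto)
next
  case (mult f h)
  show ?case by (rule reg_cong[OF reg_mult[OF mult(3,4)]]) (use \<phi> in auto)
qed

section \<open>The induced modules under left translation and the torus\<close>

lemma V_iff: "f \<in> V \<mu> \<longleftrightarrow> f \<in> regular_functions n \<and>
   (\<forall>x\<in>S. \<forall>b\<in>borel_neg n. f (x * b) = inverse (weight_char n \<mu> b) * f x)"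
  by (simp add: H0_def)

lemma V_ext: "f \<in> V \<mu> \<Longrightarrow> f \<in> extensional S" by (auto simp: V_iff reg_ext)

lemma borel_S: "b \<in> borel_neg n \<Longrightarrow> b \<in> S" by (simp add: borel_neg_def)

lemma V_fsub: "func_sub (V \<mu>)"
  unfolding func_sub_def
proof (intro conjI ballI allI)
  show "V \<mu> \<subseteq> extensional S" using V_ext by auto
  show "(\<lambda>x\<in>S. 0) \<in> V \<mu>" by (auto simp: V_iff S_mult borel_S regular_functions.const)
  show "(\<lambda>x\<in>S. f x + h x) \<in> V \<mu>" if "f \<in> V \<mu>" "h \<in> V \<mu>" for f h
    using that by (auto simp: V_iff S_mult borel_S algebra_simps intro: regular_functions.add)
  show "(\<lambda>x\<in>S. c * f x) \<in> V \<mu>" if "f \<in> V \<mu>" for c f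
    using that regular_functions.mult[OF regular_functions.const[of c] , of f]
    by (auto simp: V_iff S_mult borel_S algebra_simps restrict_def cong: if_cong)
qed

lemma V_left:
  assumes f: "f \<in> V \<mu>" and g: "g \<in> S"
  shows "(\<lambda>x\<in>S. f (g * x)) \<in> V \<mu>"
  unfolding V_iff
proof (intro conjI ballI)
  show "(\<lambda>x\<in>S. f (g * x)) \<in> regular_functions n"
  proof (rule reg_comp)
    fix i j assume ij: "i < n" "j < n"
    have "(\<lambda>x\<in>S. \<Sum>k<n. g $$ (i, k) * x $$ (k, j)) \<in> regular_functions n"
      by (intro reg_sum reg_mult regular_functions.const regular_functions.entry) (use ij in auto)
    thus "(\<lambda>x\<in>S. (g * x) $$ (i, j)) \<in> regular_functions n"
      by (rule reg_cong) (use ij g in \<open>simp add: S_entry_mult del: index_mult_mat(1)\<close>)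
  qed (use f g S_mult in \<open>auto simp: V_iff\<close>)
  fix x b :: "'k mat" assume x: "x \<in> S" and b: "b \<in> borel_neg n"
  have "g * (x * b) = (g * x) * b"
    using assoc_mult_mat[OF S_carrier[OF g] S_carrier[OF x] S_carrier[OF borel_S[OF b]]] by simp
  thus "(\<lambda>x\<in>S. f (g * x)) (x * b) = inverse (weight_char n \<mu> b) * (\<lambda>x\<in>S. f (g * x)) x"
    using f g x b borel_S[OF b] by (auto simp: S_mult V_iff)
qed

text \<open>Rescaling the first column does not commute with \<open>b\<close>, but it replaces
  \<open>b\<close> by a diagonal conjugate \<open>b'\<close>. That conjugate is again lower
  triangular with the same diagonal, so the character takes the same value.\<close>

lemma V_dil:
  assumes f: "f \<in> V \<mu>" and r: "r < n" and s: "s \<noteq> 0"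
  shows "(\<lambda>x\<in>S. f (dil r s x)) \<in> V \<mu>"
  unfolding V_iff
proof (intro conjI ballI)
  show "(\<lambda>x\<in>S. f (dil r s x)) \<in> regular_functions n"
  proof (rule reg_comp)
    fix i j assume ij: "i < n" "j < n"
    show "(\<lambda>x\<in>S. dil r s x $$ (i, j)) \<in> regular_functions n"
      by (rule reg_cong[OF reg_mult[OF regular_functions.const[of
         "(if i = r then s else 1) * (if j = 0 then inverse s else 1)"] regular_functions.entry[OF ij]]])
       (use ij in \<open>simp add: dil_entry\<close>)
  qed (use f r s dil_S in \<open>auto simp: V_iff\<close>)
  fix x b :: "'k mat" assume x: "x \<in> S" and b: "b \<in> borel_neg n"
  define c :: "nat \<Rightarrow> 'k" where "c j = (if j = 0 then inverse s else 1)" for j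
  define b' where "b' = sc (\<lambda>k. inverse (c k)) c b"
  have c0: "c j \<noteq> 0" for j using s by (auto simp: c_def)
  have "(\<Prod>i<n. inverse (c i)) * (\<Prod>i<n. c i) = 1"
    using c0 by (simp flip: prod.distrib)
  hence b'S: "b' \<in> S" unfolding b'_def by (intro sc_S borel_S b)
  have b': "b' \<in> borel_neg n" using b b'S by (auto simp: borel_neg_def b'_def)
  have w: "weight_char n \<mu> b' = weight_char n \<mu> b"
    unfolding weight_char_def using c0 by (intro prod.cong) (auto simp: b'_def)
  have "dil r s (x * b) = dil r s x * b'"
  proof (rule S_eqI)
    fix i j assume ij: "i < n" "j < n"
    have "dil r s (x * b) $$ (i, j) = (if i = r then s else 1) * c j * (\<Sum>k<n. x $$ (i, k) * b $$ (k, j))"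
      using ij x borel_S[OF b] by (simp add: dil_entry c_def S_entry_mult del: index_mult_mat(1))
    also have "\<dots> = (\<Sum>k<n. dil r s x $$ (i, k) * b' $$ (k, j))"
      unfolding sum_distrib_left using ij c0
      by (intro sum.cong) (auto simp: dil_entry b'_def c_def[symmetric])
    also have "\<dots> = (dil r s x * b') $$ (i, j)"
      using mult_entry[OF S_carrier[OF dil_S[OF x r s]] S_carrier[OF b'S] ij] by simp
    finally show "dil r s (x * b) $$ (i, j) = (dil r s x * b') $$ (i, j)" .
  qed (use S_carrier[OF S_mult[OF dil_S[OF x r s] b'S]] in auto)
  thus "(\<lambda>x\<in>S. f (dil r s x)) (x * b) = inverse (weight_char n \<mu> b) * (\<lambda>x\<in>S. f (dil r s x)) x"
    using f x b b' borel_S[OF b] dil_S[OF x r s] w by (auto simp: S_mult V_iff)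
qed

lemma lpoly_E_left: "i < n \<Longrightarrow> j < n \<Longrightarrow> i \<noteq> j \<Longrightarrow> f \<in> regular_functions n \<Longrightarrow> lpoly True (\<lambda>t x. f (E i j t * x))"
proof (rule lpoly_reg)
  fix r c assume *: "i < n" "j < n" "i \<noteq> j" "r < n" "c < n"
  have "lpoly True (\<lambda>t x. x $$ (r, c) + t * (if r = i then x $$ (j, c) else 0))"
    by (intro lpoly_add lpoly_mult lpoly_const lpoly_id)
  thus "lpoly True (\<lambda>t x. (E i j t * x) $$ (r, c))"
    by (rule lpoly_cong) (use * in \<open>auto simp: E_mult_entry S_carrier simp del: index_mult_mat(1)\<close>)
qed (auto simp: S_mult)

lemma lpoly_E_right: "i < n \<Longrightarrow> j < n \<Longrightarrow> i \<noteq> j \<Longrightarrow> f \<in> regular_functions n \<Longrightarrow> lpoly True (\<lambda>t x. f (x * E i j t))"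
proof (rule lpoly_reg)
  fix r c assume *: "i < n" "j < n" "i \<noteq> j" "r < n" "c < n"
  have "lpoly True (\<lambda>t x. x $$ (r, c) + t * (if c = j then x $$ (r, i) else 0))"
    by (intro lpoly_add lpoly_mult lpoly_const lpoly_id)
  thus "lpoly True (\<lambda>t x. (x * E i j t) $$ (r, c))"
    by (rule lpoly_cong) (use * in \<open>auto simp: mult_E_entry S_carrier simp del: index_mult_mat(1)\<close>)
qed (auto simp: S_mult)

lemma lpoly_dil: "r < n \<Longrightarrow> f \<in> regular_functions n \<Longrightarrow> lpoly False (\<lambda>t x. f (dil r t x))"
proof (rule lpoly_reg)
  fix i j assume *: "i < n" "j < n"
  have "lpoly False (\<lambda>t x. (if i = r then t else 1) * (if j = 0 then inverse t else 1) * x $$ (i, j))"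
    using lpoly_id[of False] lpoly_inverse lpoly_const[of False "\<lambda>x. 1"]
    by (cases "i = r"; cases "j = 0") (auto intro!: lpoly_mult lpoly_const)
  thus "lpoly False (\<lambda>t x. dil r t x $$ (i, j))"
    by (rule lpoly_cong) (use * in \<open>auto simp: dil_entry\<close>)
qed (auto simp: dil_S)

text \<open>The coefficients \<open>F m\<close> are the divided powers of a root vector applied to
  \<open>f\<close>. They belong to \<open>V \<mu>\<close> because all translates do and the field is
  infinite.\<close>

lemma E_expand:
  assumes f: "f \<in> V \<mu>" and ij: "i < n" "j < n" "i \<noteq> j"
  obtains F d where "\<And>m. F m \<in> V \<mu>" "\<And>t x. x \<in> S \<Longrightarrow> f (E i j t * x) = (\<Sum>m\<le>d. t ^ m * F m x)" "F 0 = f"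
proof -
  have fr: "f \<in> regular_functions n" using f by (simp add: V_iff)
  obtain M d G where MG: "True \<longrightarrow> M = 0"
    and G: "\<And>t x. x \<in> S \<Longrightarrow> True \<or> t \<noteq> 0 \<Longrightarrow> t ^ M * f (E i j t * x) = (\<Sum>m\<le>d. t ^ m * G m x)"
    using lpoly_expand[OF lpoly_E_left[OF ij fr]] by metis
  have G': "f (E i j t * x) = (\<Sum>m\<le>d. t ^ m * G m x)" if "x \<in> S" for t x
    using MG G[OF that, of t] by simp
  define F where "F m = (\<lambda>x\<in>S. if m \<le> d then G m x else 0)" for m
  have FG: "(\<Sum>m\<le>d. t ^ m * F m x) = (\<Sum>m\<le>d. t ^ m * G m x)" if "x \<in> S" for t x
    using that by (intro sum.cong) (auto simp: F_def)
  show ?thesis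
  proof (rule that[of F d])
    show "F m \<in> V \<mu>" for m
    proof (cases "m \<le> d")
      case True
      have "(\<lambda>x\<in>S. G m x) \<in> V \<mu>"
      proof (rule coeff_mem[OF V_fsub alg_closed_infinite _ True])
        fix t
        have "(\<lambda>x\<in>S. f (E i j t * x)) \<in> V \<mu>" by (rule V_left[OF f]) (use ij in simp)
        thus "(\<lambda>x\<in>S. \<Sum>m\<le>d. t ^ m * G m x) \<in> V \<mu>" by (rule fsub_cong) (rule G')
      qed
      thus ?thesis using True by (simp add: F_def)
    qed (use fsub_zero[OF V_fsub] in \<open>simp add: F_def\<close>)
    show "f (E i j t * x) = (\<Sum>m\<le>d. t ^ m * F m x)" if "x \<in> S" for t x
      using FG[OF that] G'[OF that] by simp
    show "F 0 = f"
    proof (rule extensionalityI)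
      fix x assume x: "x \<in> S"
      have "f x = (\<Sum>m\<le>d. 0 ^ m * G m x)" using G'[OF x, of 0] x by (simp add: E_zero)
      also have "\<dots> = G 0 x"
        by (subst sum.remove[of _ 0]) (auto simp: power_0_left)
      finally show "F 0 x = f x" using x by (simp add: F_def)
    qed (use V_ext[OF f] in \<open>auto simp: F_def\<close>)
  qed
qed

text \<open>Only the first \<open>r\<close> torus coordinates are required to act by scalars, the
  intermediate stage of \<open>weight_decomposition\<close>.\<close>

definition wtk :: "nat \<Rightarrow> ('k mat \<Rightarrow> 'k) \<Rightarrow> weight \<Rightarrow> bool" where
  "wtk r f \<kappa> \<longleftrightarrow> (\<forall>q<r. \<forall>s. s \<noteq> 0 \<longrightarrow> (\<forall>x\<in>S. f (dil q s x) = s powi \<kappa> q * f x))"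

abbreviation wt :: "('k mat \<Rightarrow> 'k) \<Rightarrow> weight \<Rightarrow> bool" where "wt \<equiv> wtk n"

lemma wtD: "wtk r f \<kappa> \<Longrightarrow> q < r \<Longrightarrow> s \<noteq> 0 \<Longrightarrow> x \<in> S \<Longrightarrow> f (dil q s x) = s powi \<kappa> q * f x"
  by (simp add: wtk_def)

lemma wtk_fsub: "func_sub W \<Longrightarrow> r \<le> n \<Longrightarrow> func_sub {f \<in> W. wtk r f \<kappa>}"
  unfolding func_sub_def wtk_def by (auto simp: dil_S algebra_simps)

text \<open>The torus coordinates are diagonalised one at a time. The Laurent coefficients in
  \<open>t\<close> of \<open>f (dil r t x)\<close> are eigenfunctions of the new coordinate, they
  keep the weights already fixed because the coordinates commute, and they add up to
  \<open>f\<close>.\<close>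

lemma weight_decomposition:
  assumes N: "func_sub N" and wt: "\<And>f \<kappa>. f \<in> V \<mu> \<Longrightarrow> wt f \<kappa> \<Longrightarrow> f \<in> N"
  shows "V \<mu> \<subseteq> N"
proof -
  have "r \<le> n \<Longrightarrow> f \<in> V \<mu> \<Longrightarrow> wtk r f \<kappa> \<Longrightarrow> f \<in> N" for r f \<kappa>
  proof (induction "n - r" arbitrary: r f \<kappa>)
    case 0
    thus ?case using wt by simp
  next
    case (Suc k)
    hence r: "r < n" by simp
    let ?W = "{f \<in> V \<mu>. wtk r f \<kappa>}"
    have W: "func_sub ?W" using r by (intro wtk_fsub V_fsub) auto
    have fr: "f \<in> regular_functions n" using Suc by (simp add: V_iff)
    obtain M d G where G0: "\<And>t x. x \<in> S \<Longrightarrow> False \<or> t \<noteq> 0 \<Longrightarrow> t ^ M * f (dil r t x) = (\<Sum>m\<le>d. t ^ m * G m x)"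
      using lpoly_expand[OF lpoly_dil[OF r fr]] by metis
    have G: "t ^ M * f (dil r t x) = (\<Sum>m\<le>d. t ^ m * G m x)" if "x \<in> S" "t \<noteq> 0" for t x
      using G0 that by simp
    have mem: "(\<lambda>x\<in>S. G m x) \<in> ?W" if "m \<le> d" for m
    proof (rule coeff_mem[OF W infinite_nonzero _ that])
      fix t :: 'k assume t: "t \<in> UNIV - {0}"
      have "wtk r (\<lambda>x\<in>S. f (dil r t x)) \<kappa>"
        unfolding wtk_def
      proof (intro allI impI ballI)
        fix q and s :: 'k and x assume q: "q < r" and s: "s \<noteq> 0" and x: "x \<in> S"
        have "f (dil r t (dil q s x)) = f (dil q s (dil r t x))" by (simp add: dil_comm)
        also have "\<dots> = s powi \<kappa> q * f (dil r t x)"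
          using wtD[OF Suc(5) q s] dil_S[OF x r] t by auto
        finally show "(\<lambda>x\<in>S. f (dil r t x)) (dil q s x) = s powi \<kappa> q * (\<lambda>x\<in>S. f (dil r t x)) x"
          using x s q r by (simp add: dil_S)
      qed
      hence "(\<lambda>x\<in>S. f (dil r t x)) \<in> ?W" using V_dil[OF Suc(4) r, of t] t by auto
      hence "(\<lambda>x\<in>S. t ^ M * f (dil r t x)) \<in> ?W" by (rule fsub_smult[OF W])
      thus "(\<lambda>x\<in>S. \<Sum>m\<le>d. t ^ m * G m x) \<in> ?W" by (rule fsub_cong) (use G t in auto)
    qed
    \<comment> \<open>Expanding \<open>f\<close> at \<open>dil r (t * s) x\<close> in two ways and
      comparing the coefficients of powers of \<open>t\<close> shows that \<open>G m\<close> is an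
      eigenfunction of exponent \<open>m - M\<close>.\<close>
    have wG: "G m (dil r s x) = s powi (int m - int M) * G m x" if m: "m \<le> d" and x: "x \<in> S" and s: "s \<noteq> 0" for m s x
    proof -
      have "s ^ M * G m (dil r s x) = s ^ m * G m x"
      proof (rule coeffs_eqI[OF _ m])
        fix t :: 'k assume t: "t \<noteq> 0"
        have "(\<Sum>m\<le>d. t ^ m * (s ^ M * G m (dil r s x))) = s ^ M * (\<Sum>m\<le>d. t ^ m * G m (dil r s x))"
          by (simp add: sum_distrib_left mult.left_commute)
        also have "\<dots> = s ^ M * (t ^ M * f (dil r t (dil r s x)))"
          using G[OF dil_S[OF x r s] t] by simp
        also have "\<dots> = (t * s) ^ M * f (dil r (t * s) x)"
          by (simp add: dil_dil power_mult_distrib)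
        also have "\<dots> = (\<Sum>m\<le>d. (t * s) ^ m * G m x)" using G[OF x, of "t * s"] t s by simp
        finally show "(\<Sum>m\<le>d. t ^ m * (s ^ M * G m (dil r s x))) = (\<Sum>m\<le>d. t ^ m * (s ^ m * G m x))"
          by (simp add: power_mult_distrib mult.assoc)
      qed
      thus ?thesis using s by (simp add: power_int_diff field_simps)
    qed
    have "(\<lambda>x\<in>S. G m x) \<in> N" if m: "m \<le> d" for m
    proof (rule Suc(1)[of "Suc r" _ "\<kappa>(r := int m - int M)"])
      show "wtk (Suc r) (\<lambda>x\<in>S. G m x) (\<kappa>(r := int m - int M))"
        unfolding wtk_def
      proof (intro allI impI ballI)
        fix q and s :: 'k and x assume q: "q < Suc r" and s: "s \<noteq> 0" and x: "x \<in> S"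
        show "(\<lambda>x\<in>S. G m x) (dil q s x) = s powi (\<kappa>(r := int m - int M)) q * (\<lambda>x\<in>S. G m x) x"
        proof (cases "q = r")
          case True
          thus ?thesis using wG[OF m x s] x dil_S[OF x r s] by simp
        next
          case False
          hence "q < r" using q by simp
          thus ?thesis using mem[OF m] s x False wtD[of r "\<lambda>x\<in>S. G m x" \<kappa> q s x] by simp
        qed
      qed
    qed (use mem[OF m] Suc r in auto)
    hence "(\<lambda>x\<in>S. \<Sum>m\<le>d. G m x) \<in> N" by (intro fsub_sum N) auto
    moreover have "f x = (\<Sum>m\<le>d. G m x)" if "x \<in> S" for x
    proof -
      \<comment> \<open>At \<open>t = 1\<close> the expansion writes \<open>f\<close> as the sum of
        its eigencomponents.\<close>
      have "dil r 1 x = x" using S_carrier[OF that] by (intro S_eqI) (auto simp: dil_entry)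
      thus ?thesis using G[OF that, of 1] by simp
    qed
    ultimately have "(\<lambda>x\<in>S. f x) \<in> N" by (subst restrict_ext[of S f "\<lambda>x. \<Sum>m\<le>d. G m x"]) auto
    thus ?case using extensional_restrict[OF V_ext[OF Suc(4)]] by simp
  qed
  from this[of 0] show ?thesis by (auto simp: wtk_def)
qed

text \<open>Moving a torus element past \<open>E i j\<close> by \<open>dil_E\<close> rescales the
  parameter \<open>t\<close>; comparing coefficients in \<open>t\<close> gives the eigenvalue of
  each \<open>F m\<close>.\<close>

lemma E_expand_wt:
  assumes ij: "i < n" "j < n" "i \<noteq> j" and w: "wt f \<kappa>"
    and F: "\<And>t x. x \<in> S \<Longrightarrow> f (E i j t * x) = (\<Sum>m\<le>d. t ^ m * F m x)" and m: "m \<le> d"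
  shows "wt (F m) (\<lambda>r. \<kappa> r + int m * ((if r = j then 1 else 0) - (if r = i then 1 else 0)))"
  unfolding wtk_def
proof (intro allI impI ballI)
  fix r and s :: 'k and x assume r: "r < n" and s: "s \<noteq> (0 :: 'k)" and x: "x \<in> S"
  define u where "u = (if r = j then s else 1) * (if r = i then inverse s else 1)"
  have u: "u = s powi ((if r = j then 1 else 0) - (if r = i then 1 else 0))"
    using ij s by (auto simp: u_def power_int_minus)
  have "F m (dil r s x) = s powi \<kappa> r * u ^ m * F m x"
  proof (rule coeffs_eqI[OF _ m])
    fix t :: 'k
    have "(\<Sum>m\<le>d. t ^ m * F m (dil r s x)) = f (E i j t * dil r s x)"
      using F[OF dil_S[OF x r s]] by simp
    also have "\<dots> = f (dil r s (E i j (t * u) * x))"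
      using dil_E[OF x ij r s] by (simp add: u_def mult.assoc)
    also have "\<dots> = s powi \<kappa> r * f (E i j (t * u) * x)"
      using wtD[OF w r s] ij x by (simp add: S_mult)
    also have "\<dots> = s powi \<kappa> r * (\<Sum>m\<le>d. (t * u) ^ m * F m x)" using F[OF x] by simp
    also have "\<dots> = (\<Sum>m\<le>d. t ^ m * (s powi \<kappa> r * u ^ m * F m x))"
      by (simp add: sum_distrib_left power_mult_distrib algebra_simps)
    finally show "(\<Sum>m\<le>d. t ^ m * F m (dil r s x)) = (\<Sum>m\<le>d. t ^ m * (s powi \<kappa> r * u ^ m * F m x))" .
  qed
  also have "s powi \<kappa> r * u ^ m = s powi (\<kappa> r + int m * ((if r = j then 1 else 0) - (if r = i then 1 else 0)))"
    using s unfolding u by (simp add: power_int_add power_int_mult mult.commute[of "int m"])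
  finally show "F m (dil r s x) = s powi (\<kappa> r + int m * ((if r = j then 1 else 0) - (if r = i then 1 else 0))) * F m x" .
qed

lemma mon_dil:
  assumes p: "\<pi> permutes {0..<n}" and q: "q < n" and x: "x \<in> S" and r: "r < n"
  shows "mon \<pi> q * dil (\<pi> r) s x = dil r s (mon \<pi> q * x)"
proof (rule S_eqI)
  fix i j assume ij: "i < n" "j < n"
  have "\<pi> i < n" using permutes_in_image[OF p, of i] ij by auto
  thus "(mon \<pi> q * dil (\<pi> r) s x) $$ (i, j) = dil r s (mon \<pi> q * x) $$ (i, j)"
    using ij x permutes_inj[OF p, THEN injD, of i r]
    by (auto simp: mon_mult_entry[OF p q] dil_entry S_carrier simp del: index_mult_mat(1))
qed (auto simp: mon_def intro: mult_carrier_mat[of _ n n])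

lemma wt_mon:
  assumes p: "\<pi> permutes {0..<n}" and q: "q < n" and w: "wt f \<kappa>"
  shows "wt (\<lambda>x\<in>S. f (mon \<pi> q * x)) (\<lambda>r. \<kappa> (inv_into UNIV \<pi> r))"
  unfolding wtk_def
proof (intro allI impI ballI)
  fix r and s :: 'k and x assume r: "r < n" and s: "s \<noteq> (0 :: 'k)" and x: "x \<in> S"
  let ?r = "inv_into UNIV \<pi> r"
  have r': "?r < n" using permutes_in_image[OF permutes_inv[OF p], of r] r by auto
  have \<pi>r: "\<pi> ?r = r" using permutes_inverses(1)[OF p] by simp
  have "f (mon \<pi> q * dil r s x) = f (dil ?r s (mon \<pi> q * x))"
    using mon_dil[OF p q x r', of s] \<pi>r by simp
  also have "\<dots> = s powi \<kappa> ?r * f (mon \<pi> q * x)"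
    using wtD[OF w r' s] mon_S[OF p q] x by (simp add: S_mult)
  finally show "(\<lambda>x\<in>S. f (mon \<pi> q * x)) (dil r s x) = s powi \<kappa> ?r * (\<lambda>x\<in>S. f (mon \<pi> q * x)) x"
    using x dil_S[OF x r s] by simp
qed

end

section \<open>The big cell\<close>

lemma powi_sum: "(s :: 'k :: field) \<noteq> 0 \<Longrightarrow> s powi (\<Sum>i\<in>I. e i) = (\<Prod>i\<in>I. s powi e i)"
  by (induction I rule: infinite_finite_induct) (auto simp: power_int_add)

context sln
begin

text \<open>The big cell is dense: the matrices with last rows and columns diagonal are reduced one row
  and column at a time; a vanishing pivot is the limit of nonvanishing ones along a line.\<close>

lemma big_cell_dense:
  assumes one: "1\<^sub>m n \<in> Z"
    and left: "\<And>i j t x. i < j \<Longrightarrow> j < n \<Longrightarrow> x \<in> S \<Longrightarrow> x \<in> Z \<Longrightarrow> E i j t * x \<in> Z"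
    and right: "\<And>b x. b \<in> borel_neg n \<Longrightarrow> x \<in> S \<Longrightarrow> x \<in> Z \<Longrightarrow> x * b \<in> Z"
    and lim: "\<And>i j x. i < n \<Longrightarrow> j < n \<Longrightarrow> i \<noteq> j \<Longrightarrow> x \<in> S \<Longrightarrow> (\<And>s. s \<noteq> 0 \<Longrightarrow> x * E i j s \<in> Z) \<Longrightarrow> x \<in> Z"
  shows "S \<subseteq> Z"
proof -
  \<comment> \<open>\<open>D n\<close> is no condition, while \<open>D 0\<close> says that
    \<open>x\<close> is diagonal and hence in the Borel subgroup.\<close>
  define D where "D m x \<longleftrightarrow> (\<forall>i<n. \<forall>j<n. i \<noteq> j \<and> (m \<le> i \<or> m \<le> j) \<longrightarrow> x $$ (i, j) = (0 :: 'k))" for m x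
  have "m \<le> n \<Longrightarrow> x \<in> S \<Longrightarrow> D m x \<Longrightarrow> x \<in> Z" for m x
  proof (induction m arbitrary: x)
    case 0
    hence "x \<in> borel_neg n" by (auto simp: borel_neg_def D_def)
    from right[OF this S_one one] show ?case using S_carrier[OF 0(2)] by simp
  next
    case (Suc m)
    hence m: "m < n" by simp
    \<comment> \<open>With a nonzero pivot, entries above it are cleared by upper root elements from
      the left and entries beside it by lower ones from the right. The number of nonzero entries in
      that row and column drops each time.\<close>
    have piv: "x \<in> Z" if "x \<in> S" "D (Suc m) x" "x $$ (m, m) \<noteq> 0" for x
      using that
    proof (induction "card {i. i < m \<and> x $$ (i, m) \<noteq> 0} + card {j. j < m \<and> x $$ (m, j) \<noteq> 0}" arbitrary: x rule: less_induct)
      case (less x)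
      note xc = S_carrier[OF less(2)]
      consider i where "i < m" "x $$ (i, m) \<noteq> 0" | j where "j < m" "x $$ (m, j) \<noteq> 0"
        | "\<forall>i<m. x $$ (i, m) = 0" "\<forall>j<m. x $$ (m, j) = 0" by blast
      thus ?case
      proof cases
        case (1 i)
        define c where "c = - x $$ (i, m) / x $$ (m, m)"
        have c0: "x $$ (i, m) + c * x $$ (m, m) = 0" using less(4) by (simp add: c_def)
        let ?y = "E i m c * x"
        have e: "?y $$ (r, q) = x $$ (r, q) + (if r = i then c * x $$ (m, q) else 0)" if "r < n" "q < n" for r q
          using E_mult_entry[OF xc _ m that] 1 m by simp
        have 2: "{k. k < m \<and> ?y $$ (m, k) \<noteq> 0} = {k. k < m \<and> x $$ (m, k) \<noteq> 0}"
          using 1 m by (auto simp: e)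
        have 3: "{k. k < m \<and> ?y $$ (k, m) \<noteq> 0} = {k. k < m \<and> x $$ (k, m) \<noteq> 0} - {i}"
          using 1 m less(4) c0 by (auto simp: e split: if_splits)
        have y: "?y \<in> S" using 1 less(2) by (intro S_mult) auto
        have "card ({k. k < m \<and> x $$ (k, m) \<noteq> 0} - {i}) < card {k. k < m \<and> x $$ (k, m) \<noteq> 0}"
          using 1 by (intro card_Diff1_less) auto
        moreover have "D (Suc m) ?y" using less(3) 1 m by (auto simp: D_def e)
        moreover have "?y $$ (m, m) \<noteq> 0" using less(4) 1 m by (auto simp: e)
        ultimately have "?y \<in> Z" using less(1)[of ?y] y 2 3 by simp
        hence "E i m (- c) * ?y \<in> Z" using left[of i m ?y] 1 m y by simp
        moreover have "E i m (- c) * ?y = (E i m (- c) * E i m c) * x"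
          by (rule assoc_mult_mat[symmetric]) (use xc in auto)
        ultimately show ?thesis using 1 m xc by (simp add: E_add E_zero)
      next
        case (2 j)
        define c where "c = - x $$ (m, j) / x $$ (m, m)"
        have c0: "x $$ (m, j) + c * x $$ (m, m) = 0" using less(4) by (simp add: c_def)
        let ?y = "x * E m j c"
        have e: "?y $$ (r, q) = x $$ (r, q) + (if q = j then c * x $$ (r, m) else 0)" if "r < n" "q < n" for r q
          using mult_E_entry[OF xc m _ that] 2 m by simp
        have 3: "{k. k < m \<and> ?y $$ (k, m) \<noteq> 0} = {k. k < m \<and> x $$ (k, m) \<noteq> 0}"
          using 2 m by (auto simp: e)
        have 4: "{k. k < m \<and> ?y $$ (m, k) \<noteq> 0} = {k. k < m \<and> x $$ (m, k) \<noteq> 0} - {j}"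
          using 2 m less(4) c0 by (auto simp: e split: if_splits)
        have y: "?y \<in> S" using 2 less(2) by (intro S_mult) auto
        have "card ({k. k < m \<and> x $$ (m, k) \<noteq> 0} - {j}) < card {k. k < m \<and> x $$ (m, k) \<noteq> 0}"
          using 2 by (intro card_Diff1_less) auto
        moreover have "D (Suc m) ?y" using less(3) 2 m by (auto simp: D_def e)
        moreover have "?y $$ (m, m) \<noteq> 0" using less(4) 2 m by (auto simp: e)
        ultimately have "?y \<in> Z" using less(1)[of ?y] y 3 4 by simp
        moreover have "E m j (- c) \<in> borel_neg n" using 2 m by (auto simp: borel_neg_def)
        ultimately have "?y * E m j (- c) \<in> Z" using right y by blast
        moreover have "?y * E m j (- c) = x * (E m j c * E m j (- c))"
          by (rule assoc_mult_mat) (use xc in auto)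
        ultimately show ?thesis using 2 m xc by (simp add: E_add E_zero)
      next
        case 3
        have "D m x" unfolding D_def
        proof (intro allI impI)
          fix i j assume ij: "i < n" "j < n" "i \<noteq> j \<and> (m \<le> i \<or> m \<le> j)"
          show "x $$ (i, j) = 0"
          proof (cases "Suc m \<le> i \<or> Suc m \<le> j")
            case True
            thus ?thesis using less(3) ij by (auto simp: D_def)
          next
            case False
            hence "i = m \<and> j < m \<or> j = m \<and> i < m" using ij by auto
            thus ?thesis using 3 by auto
          qed
        qed
        thus ?thesis using Suc.IH[of x] less(2) m by simp
      qed
    qed
    show ?case
    proof (cases "x $$ (m, m) = 0")
      case False
      thus ?thesis using piv Suc by simp
    next
      case True
      \<comment> \<open>An invertible matrix has some nonzero entry in row \<open>m\<close>, and
        \<open>D (Suc m)\<close> places it at a column \<open>i < m\<close>. Adding \<open>s\<close>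
        times that column to column \<open>m\<close> makes the pivot nonzero.\<close>
      have "(\<Sum>k<n. x $$ (m, k) * iv x $$ (k, m)) \<noteq> 0" using iv_right_sum[OF Suc(3) m m] by simp
      then obtain i where i: "i < n" "x $$ (m, i) \<noteq> 0"
        by (metis (no_types, lifting) lessThan_iff mult_zero_left sum.neutral)
      have im: "i < m"
      proof (rule ccontr)
        assume "\<not> i < m"
        hence "i = m \<or> Suc m \<le> i" by auto
        thus False using i True Suc(4) m by (auto simp: D_def)
      qed
      note xc = S_carrier[OF Suc(3)]
      show ?thesis
      proof (rule lim[of i m x])
        fix s :: 'k assume s: "s \<noteq> 0"
        have e: "(x * E i m s) $$ (r, q) = x $$ (r, q) + (if q = m then s * x $$ (r, i) else 0)" if "r < n" "q < n" for r q
          using mult_E_entry[OF xc i(1) m that] by simp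
        show "x * E i m s \<in> Z"
        proof (rule piv)
          show "x * E i m s \<in> S" using Suc(3) im by (intro S_mult) auto
          show "D (Suc m) (x * E i m s)" using Suc(4) im m by (auto simp: D_def e)
          show "(x * E i m s) $$ (m, m) \<noteq> 0" using m s i True by (auto simp: e)
        qed
      qed (use im m Suc(3) i in auto)
    qed
  qed
  from this[of n] show ?thesis by (auto simp: D_def)
qed

lemma zero_at_limit:
  assumes f: "f \<in> regular_functions n" and ij: "i < n" "j < n" "i \<noteq> j" and x: "x \<in> S"
    and z: "\<And>s. s \<noteq> 0 \<Longrightarrow> f (x * E i j s) = 0"
  shows "f x = 0"
proof -
  obtain M q d where MG: "True \<longrightarrow> M = 0" "\<And>x. degree (q x) \<le> d"
    and G: "\<And>t x. x \<in> S \<Longrightarrow> True \<or> t \<noteq> 0 \<Longrightarrow> t ^ M * f (x * E i j t) = poly (q x) t"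
    using lpoly_E_right[OF ij f] unfolding lpoly_def by blast
  have G': "f (x * E i j t) = poly (q x) t" for t using MG(1) G[OF x, of t] by simp
  have "q x = 0" by (rule poly_eqI_nonzero) (use z in \<open>simp flip: G'\<close>)
  thus ?thesis using G'[of 0] x by (simp add: E_zero S_carrier)
qed

definition U :: "'k mat set" where
  "U = {u \<in> carrier_mat n n. (\<forall>i<n. u $$ (i, i) = 1) \<and> (\<forall>i<n. \<forall>j<i. u $$ (i, j) = 0)}"

lemma U_S: "u \<in> U \<Longrightarrow> u \<in> S"
proof -
  assume u: "u \<in> U"
  hence "det u = prod_list (diag_mat u)"
    by (intro det_upper_triangular[of _ n]) (auto simp: U_def)
  also have "\<dots> = 1" unfolding prod_list_diag_prod using u by (auto simp: U_def)
  finally show ?thesis using u by (simp add: S_iff U_def)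
qed

lemma U_mult_E: "u \<in> U \<Longrightarrow> i < j \<Longrightarrow> j < n \<Longrightarrow> u * E i j t \<in> U"
  unfolding U_def by (auto simp: mult_E_entry intro: mult_carrier_mat[of _ n n] simp del: index_mult_mat(1))

text \<open>The set given to \<open>big_cell_dense\<close> demands \<open>f (u * x) = 0\<close> for
  all \<open>u\<close> in \<open>U\<close>, because the vanishing of \<open>f\<close> alone is not
  preserved by left multiplication with upper root elements.\<close>

lemma V_zero_if_U:
  assumes f: "f \<in> V \<mu>" and z: "\<And>u. u \<in> U \<Longrightarrow> f u = 0" and x: "x \<in> S"
  shows "f x = 0"
proof -
  have assoc: "u * (x * b) = (u * x) * b" if "u \<in> U" "x \<in> S" "b \<in> S" for u x b
    using assoc_mult_mat[OF S_carrier[OF U_S[OF that(1)]] S_carrier[OF that(2)] S_carrier[OF that(3)]] by simp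
  have "S \<subseteq> {x \<in> S. \<forall>u\<in>U. f (u * x) = 0}"
  proof (rule big_cell_dense)
    show "1\<^sub>m n \<in> {x \<in> S. \<forall>u\<in>U. f (u * x) = 0}"
      using S_one z by (auto simp: U_def)
  next
    fix i j t x assume ij: "i < j" "j < n" and x: "x \<in> S" "x \<in> {x \<in> S. \<forall>u\<in>U. f (u * x) = 0}"
    have "f (u * (E i j t * x)) = 0" if u: "u \<in> U" for u
    proof -
      have "u * (E i j t * x) = (u * E i j t) * x"
        using assoc_mult_mat[OF S_carrier[OF U_S[OF u]] E_carrier S_carrier[OF x(1)]] by simp
      thus ?thesis using U_mult_E[OF u ij, of t] x(2) by auto
    qed
    thus "E i j t * x \<in> {x \<in> S. \<forall>u\<in>U. f (u * x) = 0}" using x ij by (auto intro: S_mult)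
  next
    fix b :: "'k mat" and x assume b: "b \<in> borel_neg n" and x: "x \<in> S" "x \<in> {x \<in> S. \<forall>u\<in>U. f (u * x) = 0}"
    have "f (u * (x * b)) = 0" if u: "u \<in> U" for u
      using assoc[OF u x(1) borel_S[OF b]] f b x u U_S[OF u] by (auto simp: V_iff S_mult)
    thus "x * b \<in> {x \<in> S. \<forall>u\<in>U. f (u * x) = 0}" using x b borel_S by (auto intro: S_mult)
  next
    fix i j x assume ij: "i < n" "j < n" "i \<noteq> j" and x: "x \<in> S"
      and s: "\<And>s. s \<noteq> 0 \<Longrightarrow> x * E i j s \<in> {x \<in> S. \<forall>u\<in>U. f (u * x) = 0}"
    have "f (u * x) = 0" if u: "u \<in> U" for u
    proof (rule zero_at_limit[OF _ ij])
      show "f \<in> regular_functions n" using f by (simp add: V_iff)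
      show "u * x \<in> S" using U_S[OF u] x by (rule S_mult)
      show "f (u * x * E i j r) = 0" if "r \<noteq> 0" for r
        using s[OF that] assoc[OF u x E_S[OF ij(3)], of r] u by auto
    qed
    thus "x \<in> {x \<in> S. \<forall>u\<in>U. f (u * x) = 0}" using x by simp
  qed
  moreover have "1\<^sub>m n \<in> U" by (auto simp: U_def)
  ultimately have "f (1\<^sub>m n * x) = 0" using x by blast
  thus ?thesis using S_carrier[OF x] by simp
qed

text \<open>Uniqueness of the vector fixed by the upper unipotent group. The weight vectors below
  are all determined by subtracting a candidate and showing that the rest is invariant and vanishes
  at the identity.\<close>

lemma V_zero_if_invariant:
  assumes f: "f \<in> V \<mu>" and one: "f (1\<^sub>m n) = 0"
    and inv: "\<And>i j t x. i < j \<Longrightarrow> j < n \<Longrightarrow> x \<in> S \<Longrightarrow> f (E i j t * x) = f x" and x: "x \<in> S"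
  shows "f x = 0"
proof -
  have fr: "f \<in> regular_functions n" using f by (simp add: V_iff)
  have "S \<subseteq> {x \<in> S. f x = 0}"
  proof (rule big_cell_dense)
    fix i j x assume ij: "i < n" "j < n" "i \<noteq> j" and x: "x \<in> S"
      and s: "\<And>s. s \<noteq> 0 \<Longrightarrow> x * E i j s \<in> {x \<in> S. f x = 0}"
    show "x \<in> {x \<in> S. f x = 0}" using zero_at_limit[OF fr ij x] s x by auto
  next
    fix b :: "'k mat" and x assume b: "b \<in> borel_neg n" and x: "x \<in> S" "x \<in> {x \<in> S. f x = 0}"
    thus "x * b \<in> {x \<in> S. f x = 0}" using f borel_S[OF b] by (auto simp: S_mult V_iff)
  qed (use one S_one inv in \<open>auto intro: S_mult\<close>)
  thus ?thesis using x by auto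
qed

text \<open>The dominance order: conjugating an upper unitriangular matrix by a one-parameter subgroup has a
  limit, so the corresponding exponent in the value of \<open>f\<close> cannot be negative.\<close>

lemma wt_prefix:
  assumes f: "f \<in> V \<mu>" and w: "wt f \<kappa>" and x0: "x0 \<in> S" "f x0 \<noteq> 0" and k: "k \<le> n"
  shows "(\<Sum>i<k. \<kappa> i + \<mu> i - \<mu> 0) \<ge> 0" and "k = n \<Longrightarrow> (\<Sum>i<k. \<kappa> i + \<mu> i - \<mu> 0) = 0"
proof -
  define d :: "'k \<Rightarrow> nat \<Rightarrow> 'k" where "d s i = (if i < k then s else 1)" for s i
  define c :: "'k \<Rightarrow> nat \<Rightarrow> 'k" where "c s j = (if j = 0 then inverse (s ^ k) else 1)" for s j
  obtain u where u: "u \<in> U" "f u \<noteq> 0" using V_zero_if_U[OF f] x0 by blast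
  note uS = U_S[OF u(1)]
  have it: "m \<le> n \<Longrightarrow> sc (\<lambda>i. if i < m then s else 1) (\<lambda>j. if j = 0 then inverse (s ^ m) else 1) u \<in> S \<and>
      f (sc (\<lambda>i. if i < m then s else 1) (\<lambda>j. if j = 0 then inverse (s ^ m) else 1) u) = s powi (\<Sum>i<m. \<kappa> i) * f u"
    if s: "s \<noteq> 0" for s m
  proof (induction m)
    case 0
    have "sc (\<lambda>i. if i < 0 then s else 1) (\<lambda>j. if j = 0 then inverse (s ^ 0) else 1) u = u"
      using S_carrier[OF uS] by (intro S_eqI) auto
    thus ?case using uS by (simp only:) simp
  next
    case (Suc m)
    let ?y = "sc (\<lambda>i. if i < m then s else 1) (\<lambda>j. if j = 0 then inverse (s ^ m) else 1) u"
    have y: "?y \<in> S" "f ?y = s powi (\<Sum>i<m. \<kappa> i) * f u" using Suc by auto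
    have "sc (\<lambda>i. if i < Suc m then s else 1) (\<lambda>j. if j = 0 then inverse (s ^ Suc m) else 1) u = dil m s ?y"
      by (rule S_eqI) (auto simp: dil_entry)
    moreover have "dil m s ?y \<in> S" using y Suc s by (intro dil_S) auto
    moreover have "f (dil m s ?y) = s powi (\<Sum>i<Suc m. \<kappa> i) * f u"
      using wtD[OF w _ s y(1), of m] y Suc s by (simp add: power_int_add)
    ultimately show ?case by simp
  qed
  \<comment> \<open>The conjugate of \<open>u\<close> by the diagonal matrix with \<open>s\<close>
    in its first \<open>k\<close> places. As \<open>u\<close> is upper triangular no negative power
    of \<open>s\<close> occurs, so the family extends to \<open>s = 0\<close>.\<close>
  define us where "us s = mat n n (\<lambda>(i, j). (if i < k \<and> k \<le> j then s else 1) * u $$ (i, j))" for s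
  have usU: "us s \<in> U" for s using u(1) by (auto simp: U_def us_def)
  define e where "e = (\<Sum>i<k. \<kappa> i + \<mu> i - \<mu> 0)"
  have main: "f (us s) = s powi e * f u" if s: "s \<noteq> 0" for s
  proof -
    define b where "b = sc (d s) (c s) (1\<^sub>m n)"
    have dc0: "d s i \<noteq> 0" "c s i \<noteq> 0" for i using s by (auto simp: d_def c_def)
    have pd: "(\<Prod>i<n. d s i) = s ^ k"
    proof -
      have "(\<Prod>i<n. d s i) = (\<Prod>i\<in>{..<k}. s)"
        unfolding d_def using k by (intro prod.mono_neutral_cong_right) auto
      thus ?thesis by simp
    qed
    have pc: "(\<Prod>i<n. c s i) = inverse (s ^ k)" using n2 by (simp add: c_def)
    have bS: "b \<in> S" unfolding b_def using s by (intro sc_S S_one) (simp add: pd pc)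
    have bB: "b \<in> borel_neg n" using bS by (auto simp: borel_neg_def b_def)
    have "sc (d s) (c s) u = us s * b"
    proof (rule S_eqI)
      fix i j assume ij: "i < n" "j < n"
      have "(us s * b) $$ (i, j) = (\<Sum>l<n. us s $$ (i, l) * b $$ (l, j))"
        by (rule mult_entry) (use ij in \<open>auto simp: us_def b_def\<close>)
      also have "\<dots> = (\<Sum>l<n. if l = j then us s $$ (i, j) * (d s j * c s j) else 0)"
        using ij by (intro sum.cong) (auto simp: b_def)
      also have "\<dots> = us s $$ (i, j) * (d s j * c s j)" using ij by simp
      also have "\<dots> = d s i * c s j * u $$ (i, j)"
        using ij u(1) by (auto simp: us_def d_def U_def)
      finally show "sc (d s) (c s) u $$ (i, j) = (us s * b) $$ (i, j)" using ij by simp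
    qed (auto simp: us_def b_def intro: mult_carrier_mat[of _ n n])
    moreover have "f (sc (d s) (c s) u) = s powi (\<Sum>i<k. \<kappa> i) * f u"
      using it[OF s k] unfolding d_def c_def by simp
    moreover have "f (us s * b) = inverse (weight_char n \<mu> b) * f (us s)"
      using f U_S[OF usU] bB by (auto simp: V_iff)
    moreover have "weight_char n \<mu> b = s powi (\<Sum>i<k. \<mu> i - \<mu> 0)"
    proof -
      have "weight_char n \<mu> b = (\<Prod>i<n. d s i powi \<mu> i) * (\<Prod>i<n. c s i powi \<mu> i)"
        unfolding weight_char_def b_def by (simp add: power_int_mult_distrib prod.distrib)
      also have "(\<Prod>i<n. d s i powi \<mu> i) = (\<Prod>i<k. s powi \<mu> i)"
        unfolding d_def using k by (intro prod.mono_neutral_cong_right) auto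
      also have "(\<Prod>i<n. c s i powi \<mu> i) = inverse (s ^ k) powi \<mu> 0"
      proof -
        have "(\<Prod>i<n. c s i powi \<mu> i) = (\<Prod>i<n. if i = 0 then inverse (s ^ k) powi \<mu> 0 else 1)"
          by (intro prod.cong) (auto simp: c_def)
        thus ?thesis using n2 by simp
      qed
      also have "inverse (s ^ k) powi \<mu> 0 = (\<Prod>i<k. s powi (- \<mu> 0))"
      proof -
        have "inverse (s ^ k) powi \<mu> 0 = inverse ((s powi \<mu> 0) ^ k)"
          by (simp add: power_int_inverse power_int_power power_int_power' mult.commute)
        also have "\<dots> = inverse (s powi \<mu> 0) ^ k" by (rule power_inverse[symmetric])
        also have "\<dots> = (\<Prod>i<k. s powi (- \<mu> 0))" by (simp add: power_int_minus)
        finally show ?thesis .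
      qed
      also have "(\<Prod>i<k. s powi \<mu> i) * (\<Prod>i<k. s powi (- \<mu> 0)) = (\<Prod>i<k. s powi (\<mu> i - \<mu> 0))"
        using s by (simp only: prod.distrib[symmetric] power_int_add[symmetric] simp_thms) simp
      finally show ?thesis using s by (simp add: powi_sum)
    qed
    ultimately have "f (us s) = s powi (\<Sum>i<k. \<mu> i - \<mu> 0) * (s powi (\<Sum>i<k. \<kappa> i) * f u)"
      using s by (simp add: field_simps)
    also have "\<dots> = s powi e * f u"
      using s by (simp add: e_def power_int_add[symmetric] sum.distrib[symmetric] sum_subtractf add_diff_eq[symmetric] add.commute)
    finally show ?thesis .
  qed
  have "lpoly True (\<lambda>s x. f (us s))"
  proof (rule lpoly_reg)
    show "f \<in> regular_functions n" using f by (simp add: V_iff)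
    fix i j assume ij: "i < n" "j < n"
    have "lpoly True (\<lambda>s x. (if i < k \<and> k \<le> j then s else 1) * u $$ (i, j))"
      by (cases "i < k \<and> k \<le> j") (auto intro!: lpoly_mult lpoly_id lpoly_const)
    thus "lpoly True (\<lambda>s x. us s $$ (i, j))" using ij by (simp add: us_def)
  qed (use usU U_S in auto)
  then obtain M q dd where MG: "True \<longrightarrow> M = 0" "\<And>x. degree (q x) \<le> dd"
    and G: "\<And>t x. x \<in> S \<Longrightarrow> True \<or> t \<noteq> 0 \<Longrightarrow> t ^ M * f (us t) = poly (q x) t"
    unfolding lpoly_def by blast
  define p where "p = q u"
  have P: "poly p t = f (us t)" for t using MG(1) G[OF uS, of t] by (simp add: p_def)
  show e0: "(\<Sum>i<k. \<kappa> i + \<mu> i - \<mu> 0) \<ge> 0"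
  proof (rule ccontr)
    assume "\<not> ?thesis"
    hence neg: "e < 0" by (simp add: e_def)
    \<comment> \<open>For negative \<open>e\<close> a positive power of \<open>s\<close> times the
      polynomial \<open>p\<close> would be the nonzero constant \<open>f u\<close>, contrary to its
      value at 0.\<close>
    have "p * monom 1 (nat (- e)) = [:f u:]"
    proof (rule poly_eqI_nonzero)
      fix s :: 'k assume s: "s \<noteq> 0"
      have "s ^ nat (- e) = s powi (- e)" using neg by (simp add: power_int_def)
      thus "poly (p * monom 1 (nat (- e))) s = poly [:f u:] s"
        using main[OF s] s by (simp add: P poly_monom power_int_minus)
    qed
    hence "poly (p * monom 1 (nat (- e))) 0 = f u" by simp
    thus False using u(2) neg by (simp add: poly_monom power_0_left)
  qed
  show "(\<Sum>i<k. \<kappa> i + \<mu> i - \<mu> 0) = 0" if "k = n"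
  proof -
    \<comment> \<open>For \<open>k = n\<close> the conjugation is by a scalar matrix, so
      \<open>s powi e = 1\<close> for all \<open>s \<noteq> 0\<close> and the exponent
      vanishes.\<close>
    have uu: "us s = u" for s using that S_carrier[OF uS] by (intro S_eqI) (auto simp: us_def)
    have "monom 1 (nat e) = (1 :: 'k poly)"
    proof (rule poly_eqI_nonzero)
      fix s :: 'k assume s: "s \<noteq> 0"
      have "s ^ nat e = s powi e" using e0 by (simp add: power_int_def e_def)
      thus "poly (monom 1 (nat e)) s = poly 1 s"
        using main[OF s] u(2) uu by (simp add: poly_monom)
    qed
    hence "degree (monom 1 (nat e) :: 'k poly) = 0" by simp
    hence "nat e = 0" by (simp add: degree_monom_eq)
    thus ?thesis using e0 by (simp add: e_def)
  qed
qed

section \<open>Weights that occur, and their symmetry\<close>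

definition occurs :: "weight \<Rightarrow> weight \<Rightarrow> bool" where
  "occurs \<mu> \<kappa> \<longleftrightarrow> (\<exists>f\<in>V \<mu>. wt f \<kappa> \<and> (\<exists>x\<in>S. f x \<noteq> 0))"

text \<open>Translation by a permutation matrix permutes the torus coordinates. The matrix of the
  inverse permutation is used because \<open>wt_mon\<close> inverts once more.\<close>

lemma occurs_perm:
  assumes o: "occurs \<mu> \<kappa>" and p: "\<pi> permutes {0..<n}"
  shows "occurs \<mu> (\<lambda>r. \<kappa> (\<pi> r))"
proof -
  from o obtain f x where f: "f \<in> V \<mu>" "wt f \<kappa>" "x \<in> S" "f x \<noteq> 0" unfolding occurs_def by blast
  let ?\<sigma> = "inv_into UNIV \<pi>"
  have s: "?\<sigma> permutes {0..<n}" by (rule permutes_inv[OF p])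
  have iv': "inv_into UNIV ?\<sigma> = \<pi>" by (rule permutes_inv_inv[OF p])
  have 0: "0 < n" using n2 by simp
  let ?w = "mon ?\<sigma> 0"
  have w: "?w \<in> S" by (rule mon_S[OF s 0])
  have "?w * (iv ?w * x) = (?w * iv ?w) * x"
    using assoc_mult_mat[OF S_carrier[OF w] S_carrier[OF iv_S[OF w]] S_carrier[OF f(3)]] by simp
  hence "?w * (iv ?w * x) = x" using w S_carrier[OF f(3)] by simp
  moreover have "iv ?w * x \<in> S" using w f by (intro S_mult) auto
  ultimately have "\<exists>x\<in>S. (\<lambda>x\<in>S. f (?w * x)) x \<noteq> 0" using f by (intro bexI[of _ "iv ?w * x"]) auto
  thus ?thesis using V_left[OF f(1) w] wt_mon[OF s 0 f(2)] unfolding occurs_def iv' by blast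
qed

text \<open>The weight of the \<open>m\<close>-th divided power along \<open>E i j\<close>. Since
  the group acts on arguments, the root of \<open>E i j\<close> enters with the opposite
  sign.\<close>

definition shift :: "weight \<Rightarrow> nat \<Rightarrow> nat \<Rightarrow> nat \<Rightarrow> weight" where
  "shift \<kappa> i j m = (\<lambda>r. \<kappa> r + int m * ((if r = j then 1 else 0) - (if r = i then 1 else 0)))"

text \<open>Coefficients of degree at least 2 are weight vectors of weights that do not occur, so
  they vanish. If the expansion has degree 0, the linear coefficient is the zero function.\<close>

lemma E_linear:
  assumes f: "f \<in> V \<mu>" "wt f \<kappa>" and ij: "i < n" "j < n" "i \<noteq> j"
    and no: "\<And>m. m \<ge> 2 \<Longrightarrow> \<not> occurs \<mu> (shift \<kappa> i j m)"
  obtains F where "F \<in> V \<mu>" "wt F (shift \<kappa> i j 1)" "\<And>t x. x \<in> S \<Longrightarrow> f (E i j t * x) = f x + t * F x"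
proof -
  obtain F d where F: "\<And>m. F m \<in> V \<mu>" "\<And>t x. x \<in> S \<Longrightarrow> f (E i j t * x) = (\<Sum>m\<le>d. t ^ m * F m x)" "F 0 = f"
    using E_expand[OF f(1) ij] by blast
  note w = E_expand_wt[OF ij f(2) F(2), folded shift_def]
  have z: "F m x = 0" if "m \<le> d" "m \<ge> 2" "x \<in> S" for m x
    using no[OF that(2)] F(1)[of m] w[OF _ that(1)] that(3) unfolding occurs_def by blast
  show ?thesis
  proof (cases "d \<ge> 1")
    case True
    show ?thesis
    proof (rule that[of "F 1"])
      fix t x assume x: "x \<in> S"
      have "{..d} = insert 0 (insert 1 {2..d})" using True by auto
      hence "(\<Sum>m\<le>d. t ^ m * F m x) = F 0 x + (t * F 1 x + (\<Sum>m\<in>{2..d}. t ^ m * F m x))" by simp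
      also have "(\<Sum>m\<in>{2..d}. t ^ m * F m x) = 0" using z x by (intro sum.neutral) auto
      finally show "f (E i j t * x) = f x + t * F 1 x" using F(2)[OF x] F(3) by simp
    qed (use F(1) w True in auto)
  next
    case False
    hence d: "d = 0" by simp
    show ?thesis
      by (rule that[of "\<lambda>x\<in>S. 0"]) (use fsub_zero[OF V_fsub] F(2,3) d in \<open>auto simp: wtk_def dil_S\<close>)
  qed
qed

lemma E_fixed:
  assumes f: "f \<in> V \<mu>" "wt f \<kappa>" and ij: "i < n" "j < n" "i \<noteq> j"
    and no: "\<And>m. m \<ge> 1 \<Longrightarrow> \<not> occurs \<mu> (shift \<kappa> i j m)" and x: "x \<in> S"
  shows "f (E i j t * x) = f x"
proof -
  obtain F where F: "F \<in> V \<mu>" "wt F (shift \<kappa> i j 1)" "\<And>t x. x \<in> S \<Longrightarrow> f (E i j t * x) = f x + t * F x"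
    by (rule E_linear[OF f ij]) (use no in auto)
  have "F x = 0" using no[of 1] F x unfolding occurs_def by auto
  thus ?thesis using F(3)[OF x] by simp
qed

end

section \<open>Exponents, permutations, and potentials of additive relations\<close>

lemma powi_eq_one:
  assumes "\<And>s :: 'k :: alg_closed_field. s \<noteq> 0 \<Longrightarrow> s powi e = 1"
  shows "e = 0"
proof -
  have m: "monom 1 (nat \<bar>e\<bar>) = (1 :: 'k poly)"
  proof (rule poly_eqI_nonzero)
    fix s :: 'k assume s: "s \<noteq> 0"
    have "s ^ nat \<bar>e\<bar> = 1"
      using assms[OF s] s by (cases "e \<ge> 0") (auto simp: power_int_def field_simps)
    thus "poly (monom 1 (nat \<bar>e\<bar>)) s = poly 1 s" by (simp add: poly_monom)
  qed
  have "degree (monom 1 (nat \<bar>e\<bar>) :: 'k poly) = 0" using m by simp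
  thus ?thesis by (simp add: degree_monom_eq)
qed

lemma powi_eq:
  assumes "\<And>s :: 'k :: alg_closed_field. s \<noteq> 0 \<Longrightarrow> s powi e = s powi e'"
  shows "e = e'"
proof -
  have "e - e' = 0"
  proof (rule powi_eq_one)
    fix s :: 'k assume s: "s \<noteq> 0"
    show "s powi (e - e') = 1" using assms[OF s] s by (simp add: power_int_diff)
  qed
  thus ?thesis by simp
qed

lemma extend_to_permutation:
  assumes inj: "inj_on f A" and A: "A \<subseteq> {0..<n :: nat}" "f ` A \<subseteq> {0..<n}"
  obtains \<pi> where "\<pi> permutes {0..<n}" "\<And>a. a \<in> A \<Longrightarrow> \<pi> a = f a"
proof -
  have fin: "finite A" using A finite_subset by blast
  have "card ({0..<n} - A) = card ({0..<n} - f ` A)"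
    using A fin by (simp add: card_Diff_subset card_image[OF inj])
  then obtain g where g: "bij_betw g ({0..<n} - A) ({0..<n} - f ` A)"
    using finite_same_card_bij[of "{0..<n} - A" "{0..<n} - f ` A"] by auto
  define \<pi> where "\<pi> x = (if x \<in> A then f x else if x < n then g x else x)" for x
  have "bij_betw \<pi> A (f ` A)" using inj by (auto simp: bij_betw_def \<pi>_def inj_on_def)
  moreover have "bij_betw \<pi> ({0..<n} - A) ({0..<n} - f ` A)"
    using g by (rule bij_betw_cong[THEN iffD1, rotated]) (auto simp: \<pi>_def)
  ultimately have "bij_betw \<pi> (A \<union> ({0..<n} - A)) (f ` A \<union> ({0..<n} - f ` A))"
    by (rule bij_betw_combine) auto
  moreover have "A \<union> ({0..<n} - A) = {0..<n}" "f ` A \<union> ({0..<n} - f ` A) = {0..<n}" using A by auto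
  ultimately have "\<pi> permutes {0..<n}"
    using A by (intro bij_imp_permutes) (auto simp: \<pi>_def)
  thus ?thesis using that[of \<pi>] by (auto simp: \<pi>_def)
qed

lemma permutation4:
  assumes "distinct [i, j, k, l]" "{i, j, k, l} \<subseteq> {0..<n :: nat}"
    and "distinct [i', j', k', l']" "{i', j', k', l'} \<subseteq> {0..<n}"
  obtains \<pi> where "\<pi> permutes {0..<n}" "\<pi> i = i'" "\<pi> j = j'" "\<pi> k = k'" "\<pi> l = l'"
proof -
  define f where "f x = (if x = i then i' else if x = j then j' else if x = k then k' else l')" for x
  obtain \<pi> where "\<pi> permutes {0..<n}" "\<And>a. a \<in> {i, j, k, l} \<Longrightarrow> \<pi> a = f a"
    by (rule extend_to_permutation[of f "{i, j, k, l}" n]) (use assms in \<open>auto simp: f_def inj_on_def\<close>)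
  thus ?thesis using that[of \<pi>] assms by (auto simp: f_def)
qed

lemma sorting_permutation:
  fixes \<kappa> :: "nat \<Rightarrow> int"
  obtains \<pi> where "\<pi> permutes {0..<n}" "\<And>i j. i \<le> j \<Longrightarrow> j < n \<Longrightarrow> \<kappa> (\<pi> i) \<le> \<kappa> (\<pi> j)"
proof -
  let ?ys = "map \<kappa> [0..<n]"
  have "mset (sort ?ys) = mset ?ys" by simp
  then obtain p where p: "p permutes {..<length ?ys}" "permute_list p ?ys = sort ?ys"
    by (rule mset_eq_permutation)
  have p': "p permutes {0..<n}" using p(1) by (simp add: atLeast0LessThan)
  have e: "\<kappa> (p i) = sort ?ys ! i" if "i < n" for i
  proof -
    have "p i < n" using permutes_in_image[OF p', of i] that by auto
    thus ?thesis using that p by (simp add: permute_list_nth flip: p(2))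
  qed
  have "\<kappa> (p i) \<le> \<kappa> (p j)" if "i \<le> j" "j < n" for i j
    using sorted_nth_mono[OF sorted_sort, of i j ?ys] that by (simp add: e)
  thus ?thesis using that p' by blast
qed

text \<open>Two triangles through a third point show that \<open>c\<close> is antisymmetric with
  respect to the base point \<open>u\<close>; the potential is then read off along the edges at
  \<open>u\<close>.\<close>

lemma cocycle_solution:
  fixes c :: "'i \<Rightarrow> 'i \<Rightarrow> 'a :: ab_group_add"
  assumes three: "u \<in> I" "v \<in> I" "w \<in> I" "u \<noteq> v" "v \<noteq> w" "u \<noteq> w"
    and c: "\<And>i j l. i \<in> I \<Longrightarrow> j \<in> I \<Longrightarrow> l \<in> I \<Longrightarrow> i \<noteq> j \<Longrightarrow> j \<noteq> l \<Longrightarrow> i \<noteq> l \<Longrightarrow> c i l = c i j + c j l"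
  obtains d where "\<And>i j. i \<in> I \<Longrightarrow> j \<in> I \<Longrightarrow> i \<noteq> j \<Longrightarrow> c i j = d i - d j"
proof -
  define d where "d i = (if i = u then 0 else - c u i)" for i
  have anti: "c i u = - c u i" if "i \<in> I" "i \<noteq> u" for i
  proof -
    obtain l where l: "l \<in> I" "l \<noteq> u" "l \<noteq> i" using three by metis
    have "c i l = c i u + c u l" "c u l = c u i + c i l" using c[of i u l] c[of u i l] that l three by auto
    hence "c i l = c i u + (c u i + c i l)" by simp
    hence "c i u + c u i = 0" by (simp add: algebra_simps)
    thus ?thesis by (simp add: eq_neg_iff_add_eq_0)
  qed
  have "c i j = d i - d j" if ij: "i \<in> I" "j \<in> I" "i \<noteq> j" for i j
  proof (cases "i = u \<or> j = u")
    case True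
    thus ?thesis using anti[of i] ij by (auto simp: d_def)
  next
    case False
    thus ?thesis using c[of u i j] ij three by (auto simp: d_def)
  qed
  thus ?thesis by (rule that)
qed

text \<open>The solution is normalised by \<open>d\<^bsub>0j\<^esub> = 0\<close> and \<open>d\<^bsub>12\<^esub> = 0\<close>.\<close>

lemma cross_difference_solution:
  fixes X :: "nat \<Rightarrow> nat \<Rightarrow> nat \<Rightarrow> nat \<Rightarrow> 'a :: ab_group_add"
  assumes n: "n \<ge> 5"
    and sym: "\<And>i j l m. distinct [i, j, l, m] \<Longrightarrow> {i, j, l, m} \<subseteq> {..<n} \<Longrightarrow> X i j l m = X l m i j"
    and anti: "\<And>i j l m. X i j l m = - X i j m l"
    and add: "\<And>i j l m q. X i j l m + X i j m q = X i j l q"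
    and cyc: "\<And>i j l q. distinct [i, j, l, q] \<Longrightarrow> {i, j, l, q} \<subseteq> {..<n} \<Longrightarrow> X i l q j = X i j q l + X j l q i"
  obtains d where "\<And>i j. d i j = d j i"
    "\<And>i j l m. distinct [i, j, l, m] \<Longrightarrow> {i, j, l, m} \<subseteq> {..<n} \<Longrightarrow> X i j l m = d i l - d j l - d i m + d j m"
proof -
  have X0: "X i j l l = 0" for i j l using add[of i j l l l] by simp
  have anti1: "X i j l m = - X j i l m" if "distinct [i, j, l, m]" "{i, j, l, m} \<subseteq> {..<n}" for i j l m
    using sym[of i j l m] sym[of j i l m] anti[of l m i j] that by auto
  \<comment> \<open>With row 0 of the solution normalised to zero, \<open>X 0 1 l m\<close> must be
    \<open>d 1 m - d 1 l\<close> and \<open>X 0 j l 1\<close> must be \<open>d j 1 - d j l\<close>.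
    Together with \<open>d 1 2 = 0\<close> this forces \<open>e l = d 1 l\<close> and the formula
    for \<open>D\<close>.\<close>
  define e where "e l = X 0 1 2 l" for l
  define D where "D j l = (if j = 1 then e l else if l = 1 then e j else e j - X 0 j l 1)" for j l
  define d where "d j l = (if j = l \<or> j = 0 \<or> l = 0 \<or> j \<ge> n \<or> l \<ge> n then 0 else D j l)" for j l
  have X01: "X 0 1 l m = e m - e l" for l m
    using add[of 0 1 l 2 m] anti[of 0 1 l 2] by (simp add: e_def)
  \<comment> \<open>The array is recovered row by row; the cyclic relation is what makes it
    symmetric.\<close>
  have D_sym: "D j l = D l j" if "distinct [0, j, l]" "{j, l} \<subseteq> {..<n}" for j l
  proof (cases "j = 1 \<or> l = 1")
    case False
    have "X 0 l j 1 = X 0 1 j l + X 1 l j 0" using cyc[of 0 1 l j] that False n by auto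
    also have "X 1 l j 0 = X j 0 1 l" using sym[of 1 l j 0] that False n by auto
    also have "\<dots> = - X 0 j 1 l" using anti1[of j 0 1 l] that False n by auto
    also have "\<dots> = X 0 j l 1" using anti[of 0 j 1 l] by simp
    finally show ?thesis using False X01[of j l] by (simp add: D_def)
  qed (auto simp: D_def)
  have d_sym: "d i j = d j i" for i j using D_sym[of i j] by (auto simp: d_def)
  have c0: "X 0 j l m = d j m - d j l" if "distinct [0, j, l, m]" "{j, l, m} \<subseteq> {..<n}" for j l m
  proof -
    have dD: "d j m = D j m" "d j l = D j l" using that by (auto simp: d_def)
    show ?thesis
    proof (cases "j = 1")
      case True
      thus ?thesis using dD X01 by (simp add: D_def)
    next
      case False
      consider "l = 1" | "m = 1" | "l \<noteq> 1" "m \<noteq> 1" by blast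
      thus ?thesis
      proof cases
        case 1
        thus ?thesis using False dD that anti[of 0 j 1 m] by (auto simp: D_def)
      next
        case 2
        thus ?thesis using False dD that by (auto simp: D_def)
      next
        case 3
        thus ?thesis using False dD add[of 0 j l 1 m] anti[of 0 j 1 m] by (auto simp: D_def)
      qed
    qed
  qed
  have d0: "d 0 j = 0" "d j 0 = 0" for j by (auto simp: d_def)
  show ?thesis
  proof (rule that[of d])
    fix i j l m assume A: "distinct [i, j, l, m]" "{i, j, l, m} \<subseteq> {..<n}"
    consider "i = 0" | "j = 0" | "l = 0" | "m = 0" | "i \<noteq> 0" "j \<noteq> 0" "l \<noteq> 0" "m \<noteq> 0" by blast
    thus "X i j l m = d i l - d j l - d i m + d j m"
    proof cases
      case 1 thus ?thesis using c0[of j l m] A d0 by auto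
    next
      case 2 thus ?thesis using c0[of i l m] anti1[of i j l m] A d0 by auto
    next
      case 3 thus ?thesis using c0[of m i j] sym[of i j l m] A d0 d_sym[of m] by auto
    next
      case 4 thus ?thesis using c0[of l i j] sym[of i j l m] anti1[of l m i j] A d0 d_sym[of l] by auto
    next
      case 5
      have "X i j l m = X l m i j" using sym A by simp
      also have "\<dots> = X l m i 0 + X l m 0 j" using add by simp
      also have "X l m i 0 = X i 0 l m" using sym[of l m i 0] A 5 n by auto
      also have "\<dots> = - X 0 i l m" using anti1[of i 0 l m] A 5 n by auto
      also have "X l m 0 j = X 0 j l m" using sym[of l m 0 j] A 5 n by auto
      finally show ?thesis using c0[of i l m] c0[of j l m] A 5 by auto
    qed
  qed (rule d_sym)
qed

context sln
begin

section \<open>Triangular matrices, and functions built from minors\<close>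

lemma wt_cong: "(\<And>r. r < n \<Longrightarrow> \<kappa> r = \<kappa>' r) \<Longrightarrow> wt f \<kappa> \<longleftrightarrow> wt f \<kappa>'"
  by (auto simp: wtk_def)

lemma borel_diag:
  assumes b: "b \<in> borel_neg n"
  shows "(\<Prod>i<n. b $$ (i, i)) = (1 :: 'k)" "i < n \<Longrightarrow> b $$ (i, i) \<noteq> 0"
proof -
  have bc: "b \<in> carrier_mat n n" "det b = 1" using borel_S[OF b] by (auto simp: S_iff)
  have "det b = prod_list (diag_mat b)"
    by (rule det_lower_triangular[of n]) (use b bc in \<open>auto simp: borel_neg_def\<close>)
  thus 1: "(\<Prod>i<n. b $$ (i, i)) = 1" using bc by (simp add: prod_list_diag_prod atLeast0LessThan)
  show "b $$ (i, i) \<noteq> 0" if "i < n"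
    using 1 that prod_zero[of "{..<n}" "\<lambda>i. b $$ (i, i)"] by fastforce
qed

lemma iv_borel:
  assumes b: "b \<in> borel_neg n"
  shows "i < j \<Longrightarrow> j < n \<Longrightarrow> iv b $$ (i, j) = (0 :: 'k)" "i < n \<Longrightarrow> iv b $$ (i, i) = inverse (b $$ (i, i))"
proof -
  note bS = borel_S[OF b]
  have lower: "iv b $$ (i, j) = 0" if "i < j" "j < n" for i j
    using that
  proof (induction i rule: less_induct)
    case (less i)
    have "0 = (\<Sum>k<n. b $$ (i, k) * iv b $$ (k, j))" using iv_right_sum[OF bS, of i j] less by simp
    also have "\<dots> = (\<Sum>k\<in>{i}. b $$ (i, k) * iv b $$ (k, j))"
    proof (rule sum.mono_neutral_right)
      show "\<forall>k\<in>{..<n} - {i}. b $$ (i, k) * iv b $$ (k, j) = 0"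
      proof
        fix k assume k: "k \<in> {..<n} - {i}"
        show "b $$ (i, k) * iv b $$ (k, j) = 0"
        proof (cases "k < i")
          case True thus ?thesis using less by simp
        next
          case False thus ?thesis using k b less by (auto simp: borel_neg_def)
        qed
      qed
    qed (use less in auto)
    finally show ?case using borel_diag(2)[OF b, of i] less by simp
  qed
  thus "i < j \<Longrightarrow> j < n \<Longrightarrow> iv b $$ (i, j) = 0" .
  assume i: "i < n"
  have "1 = (\<Sum>k<n. b $$ (i, k) * iv b $$ (k, i))" using iv_right_sum[OF bS, of i i] i by simp
  also have "\<dots> = (\<Sum>k\<in>{i}. b $$ (i, k) * iv b $$ (k, i))"
  proof (rule sum.mono_neutral_right)
    show "\<forall>k\<in>{..<n} - {i}. b $$ (i, k) * iv b $$ (k, i) = 0"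
    proof
      fix k assume k: "k \<in> {..<n} - {i}"
      show "b $$ (i, k) * iv b $$ (k, i) = 0"
        using lower[of k i] k b i by (cases "k < i") (auto simp: borel_neg_def)
    qed
  qed (use i in auto)
  finally show "iv b $$ (i, i) = inverse (b $$ (i, i))" by (simp add: inverse_unique)
qed

text \<open>At the identity, \<open>dil r s\<close> is a right translation by a diagonal matrix of
  the Borel subgroup, so \<open>\<mu>\<close> dictates the weight. A weight vector of any other
  weight therefore vanishes at the identity, as \<open>V_zero_if_invariant\<close> requires.\<close>

lemma wt_one:
  assumes f: "f \<in> V \<mu>" "wt f \<kappa>" and nz: "f (1\<^sub>m n) \<noteq> 0" and r: "r < n"
  shows "\<kappa> r = \<mu> 0 - \<mu> r"
proof (rule powi_eq)
  fix s :: 'k assume s: "s \<noteq> 0"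
  let ?b = "dil r s (1\<^sub>m n)"
  have bS: "?b \<in> S" by (rule dil_S[OF S_one r s])
  have b: "?b \<in> borel_neg n" using bS by (auto simp: borel_neg_def dil_entry)
  have "f (1\<^sub>m n * ?b) = inverse (weight_char n \<mu> ?b) * f (1\<^sub>m n)"
    using f(1) S_one b unfolding V_iff by blast
  hence "f ?b = inverse (weight_char n \<mu> ?b) * f (1\<^sub>m n)" using S_carrier[OF bS] by simp
  moreover have "f ?b = s powi \<kappa> r * f (1\<^sub>m n)" by (rule wtD[OF f(2) r s S_one])
  moreover have "weight_char n \<mu> ?b = s powi (\<mu> r - \<mu> 0)"
  proof -
    have "weight_char n \<mu> ?b = (\<Prod>i<n. (if i = r then s powi \<mu> r else 1) * (if i = 0 then s powi (- \<mu> 0) else 1))"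
      unfolding weight_char_def using s
      by (intro prod.cong) (auto simp: dil_entry power_int_mult_distrib power_int_minus power_int_inverse)
    also have "\<dots> = s powi \<mu> r * s powi (- \<mu> 0)" using r n2 by (simp add: prod.distrib)
    finally show ?thesis using s by (simp add: power_int_add[symmetric])
  qed
  ultimately show "s powi \<kappa> r = s powi (\<mu> 0 - \<mu> r)"
    using nz s power_int_minus[of s "\<mu> r - \<mu> 0"] by simp
qed

lemma weight_char_two:
  assumes "a \<le> n" "c \<le> n" and nz: "\<And>i. i < n \<Longrightarrow> b $$ (i, i) \<noteq> 0"
  shows "weight_char n (\<omega> a + \<omega> c) b = (\<Prod>i<a. b $$ (i, i)) * (\<Prod>i<c. b $$ (i, i) :: 'k)"
proof -
  have 1: "(\<Prod>i<n. if i < a then b $$ (i, i) else 1) = (\<Prod>i<a. b $$ (i, i))" if "a \<le> n" for a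
    using that by (intro prod.mono_neutral_cong_right) auto
  have "weight_char n (\<omega> a + \<omega> c) b = (\<Prod>i<n. (if i < a then b $$ (i, i) else 1) * (if i < c then b $$ (i, i) else 1))"
    unfolding weight_char_def by (intro prod.cong) (use nz in \<open>auto simp: fund_weight_def power_int_add\<close>)
  thus ?thesis using 1 assms by (simp add: prod.distrib)
qed

definition Pm :: "nat \<Rightarrow> nat \<Rightarrow> 'k mat \<Rightarrow> 'k" where
  "Pm i j x = iv x $$ (0, i) * iv x $$ (1, j) - iv x $$ (0, j) * iv x $$ (1, i)"

definition Qm :: "nat \<Rightarrow> nat \<Rightarrow> 'k mat \<Rightarrow> 'k" where
  "Qm k l x = x $$ (k, n - 2) * x $$ (l, n - 1) - x $$ (l, n - 2) * x $$ (k, n - 1)"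

definition PQ :: "nat \<Rightarrow> nat \<Rightarrow> nat \<Rightarrow> nat \<Rightarrow> 'k mat \<Rightarrow> 'k" where
  "PQ i j k l x = Pm i j x * Qm k l x"

text \<open>The entry in row 0 and column \<open>n - 1\<close> of \<open>iv x * e * x\<close>, where
  \<open>e\<close> is the matrix unit at \<open>(i, k)\<close>: a matrix coefficient of the adjoint
  action.\<close>

definition AZ :: "nat \<Rightarrow> nat \<Rightarrow> 'k mat \<Rightarrow> 'k" where
  "AZ i k x = iv x $$ (0, i) * x $$ (k, n - 1)"

lemma Pm_anti: "Pm j i x = - Pm i j x" "Pm i i x = 0" by (auto simp: Pm_def)
lemma Qm_anti: "Qm j i x = - Qm i j x" "Qm i i x = 0" by (auto simp: Qm_def)

lemma Pm_E:
  assumes "x \<in> S" "i < n" "j < n" "i \<noteq> j" "p < n" "q < n"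
  shows "Pm p q (E i j t * x) = Pm p q x - t * ((if p = j then Pm i q x else 0) + (if q = j then Pm p i x else 0))"
  using assms n2 by (auto simp: Pm_def iv_E_mult algebra_simps)

lemma Qm_E:
  assumes "x \<in> S" "i < n" "j < n" "i \<noteq> j" "p < n" "q < n"
  shows "Qm p q (E i j t * x) = Qm p q x + t * ((if p = i then Qm j q x else 0) + (if q = i then Qm p j x else 0))"
  using assms n2 by (auto simp: Qm_def E_mult_entry S_carrier algebra_simps simp del: index_mult_mat(1))

lemma AZ_E:
  assumes "x \<in> S" "i < n" "j < n" "i \<noteq> j" "p < n" "q < n"
  shows "AZ p q (E i j t * x) = (iv x $$ (0, p) - (if p = j then t * iv x $$ (0, i) else 0)) *
    (x $$ (q, n - 1) + (if q = i then t * x $$ (j, n - 1) else 0))"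
  using assms n2 by (simp add: AZ_def iv_E_mult E_mult_entry S_carrier del: index_mult_mat(1))

lemma PQ_mon:
  assumes p: "\<pi> permutes {0..<n}" and q: "q < n" and x: "x \<in> S" and ijkl: "i < n" "j < n" "k < n" "l < n"
  shows "PQ i j k l (mon \<pi> q * x) = (if i = q then signof \<pi> else 1) * (if j = q then signof \<pi> else 1) *
    (if k = q then signof \<pi> else 1) * (if l = q then signof \<pi> else 1) * PQ (\<pi> i) (\<pi> j) (\<pi> k) (\<pi> l) x"
  using n2 ijkl unfolding PQ_def Pm_def Qm_def
  by (simp add: iv_mon_mult_entry[OF p q x] mon_mult_entry[OF p q S_carrier[OF x]] algebra_simps
      del: index_mult_mat(1))

lemma AZ_mon:
  assumes p: "\<pi> permutes {0..<n}" and q: "q < n" and x: "x \<in> S" and ijkl: "i < n" "k < n"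
  shows "AZ i k (mon \<pi> q * x) = (if i = q then signof \<pi> else 1) * (if k = q then signof \<pi> else 1) * AZ (\<pi> i) (\<pi> k) x"
  using n2 ijkl unfolding AZ_def
  by (simp add: iv_mon_mult_entry[OF p q x] mon_mult_entry[OF p q S_carrier[OF x]] algebra_simps
      del: index_mult_mat(1))

text \<open>Under inversion the row that carries the sign moves from \<open>q\<close> to
  \<open>\<pi> q\<close>.\<close>

lemma iv_mon_inverse:
  assumes p: "\<pi> permutes {0..<n}" and q: "q < n" and x: "x \<in> S"
  shows "mon \<pi> q * (mon (inv_into UNIV \<pi>) (\<pi> q) * x) = x"
proof -
  let ?\<sigma> = "inv_into UNIV \<pi>"
  have s: "?\<sigma> permutes {0..<n}" by (rule permutes_inv[OF p])
  have pq: "\<pi> q < n" using permutes_in_image[OF p, of q] q by auto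
  have sg: "signof ?\<sigma> = (signof \<pi> :: 'k)"
  proof -
    have "permutation \<pi>" using p permutation_permutes finite_atLeastLessThan by blast
    thus ?thesis by (simp add: sign_inverse)
  qed
  have mc: "mon ?\<sigma> (\<pi> q) * x \<in> carrier_mat n n"
    using S_carrier[OF S_mult[OF mon_S[OF s pq] x]] .
  show ?thesis
  proof (rule S_eqI)
    fix i j assume ij: "i < n" "j < n"
    have pi: "\<pi> i < n" using permutes_in_image[OF p, of i] ij by auto
    show "(mon \<pi> q * (mon ?\<sigma> (\<pi> q) * x)) $$ (i, j) = x $$ (i, j)"
      using ij pi permutes_inverses(2)[OF p] permutes_inj[OF p, THEN injD, of i q] signof_sq[of \<pi>]
      by (auto simp: mon_mult_entry[OF p q mc] mon_mult_entry[OF s pq S_carrier[OF x]] sg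
          mult.assoc[symmetric] simp del: index_mult_mat(1))
  qed (use mc S_carrier[OF x] in \<open>auto simp: mon_def intro: mult_carrier_mat[of _ n n]\<close>)
qed

end

section \<open>The two induced modules\<close>

text \<open>The weight of \<open>AZ i k\<close> under \<open>dil\<close>. The summand 1 is due to
  the rescaled first column in \<open>dil\<close>, which multiplies row 0 of the inverse by
  \<open>s\<close>.\<close>

definition K1 :: "nat \<Rightarrow> nat \<Rightarrow> weight" where
  "K1 i k = (\<lambda>r. 1 + (if r = k then 1 else 0) - (if r = i then 1 else 0))"

definition K2 :: "nat \<Rightarrow> nat \<Rightarrow> nat \<Rightarrow> nat \<Rightarrow> weight" where
  "K2 i j k l = (\<lambda>r. 1 + (if r = k then 1 else 0) + (if r = l then 1 else 0)
     - (if r = i then 1 else 0) - (if r = j then 1 else 0))"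

lemma powi_K2: "(s :: 'k :: field) \<noteq> 0 \<Longrightarrow> s powi K2 i j k l r = s * (if r = k then s else 1) * (if r = l then s else 1)
    * (if r = i then inverse s else 1) * (if r = j then inverse s else 1)"
  by (auto simp: K2_def power_int_add power_int_diff field_simps)

lemma powi_K1: "(s :: 'k :: field) \<noteq> 0 \<Longrightarrow> s powi K1 i k r = s * (if r = k then s else 1) * (if r = i then inverse s else 1)"
  by (auto simp: K1_def power_int_add power_int_diff field_simps)

lemma K2_diag: "K2 i l k l = K1 i k" by (auto simp: K2_def K1_def)

lemma K1_diag: "K1 k k = (\<lambda>_. 1)" by (auto simp: K1_def)

lemma sum_last:
  fixes h :: "nat \<Rightarrow> 'a :: comm_monoid_add"
  shows "1 \<le> n \<Longrightarrow> sum h {..<n} = sum h {..<n - 1} + h (n - 1)"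
    and "2 \<le> n \<Longrightarrow> sum h {..<n} = sum h {..<n - 2} + h (n - 2) + h (n - 1)"
    and "3 \<le> n \<Longrightarrow> sum h {..<n} = sum h {..<n - 3} + h (n - 3) + h (n - 2) + h (n - 1)"
proof -
  show "1 \<le> n \<Longrightarrow> sum h {..<n} = sum h {..<n - 1} + h (n - 1)" by (cases n) auto
  assume "2 \<le> n"
  then obtain m where "n = Suc (Suc m)" by (intro that[of "n - 2"]) auto
  thus "sum h {..<n} = sum h {..<n - 2} + h (n - 2) + h (n - 1)" by simp
next
  assume "3 \<le> n"
  then obtain m where "n = Suc (Suc (Suc m))" by (intro that[of "n - 3"]) auto
  thus "sum h {..<n} = sum h {..<n - 3} + h (n - 3) + h (n - 2) + h (n - 1)" by simp
qed

locale sl5 = sln n ty for n and ty :: "'k :: alg_closed_field itself" +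
  assumes n5: "n \<ge> 5"
begin

definition mw :: weight where "mw = \<omega> 2 + \<omega> (n - 2)"
text \<open>The highest root. Through \<open>sg\<close>, the space \<open>V aw\<close> turns out to
  be the matrices modulo scalars.\<close>

definition aw :: weight where "aw = \<omega> 1 + \<omega> (n - 1)"

lemma PQ_dil:
  assumes "x \<in> S" "r < n" "s \<noteq> 0" "i < n" "j < n" "k < n" "l < n"
  shows "PQ i j k l (dil r s x) = s powi K2 i j k l r * PQ i j k l x"
  using assms n5 unfolding PQ_def Pm_def Qm_def powi_K2[OF assms(3)]
  by (auto simp: dil_entry iv_dil_entry algebra_simps)

lemma AZ_dil:
  assumes "x \<in> S" "r < n" "s \<noteq> 0" "i < n" "k < n"
  shows "AZ i k (dil r s x) = s powi K1 i k r * AZ i k x"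
  using assms n5 unfolding AZ_def powi_K1[OF assms(3)]
  by (auto simp: dil_entry iv_dil_entry algebra_simps)

lemma col_borel:
  assumes x: "x \<in> S" and b: "b \<in> borel_neg n" and k: "k < n"
  shows "(x * b) $$ (k, n - 1) = x $$ (k, n - 1) * b $$ (n - 1, n - 1)"
    and "(x * b) $$ (k, n - 2) = x $$ (k, n - 2) * b $$ (n - 2, n - 2) + x $$ (k, n - 1) * b $$ (n - 1, n - 2)"
proof -
  have bz: "i < j \<Longrightarrow> j < n \<Longrightarrow> b $$ (i, j) = 0" for i j using b by (auto simp: borel_neg_def)
  have "(\<Sum>i<n. x $$ (k, i) * b $$ (i, n - 1)) = (\<Sum>i\<in>{n - 1}. x $$ (k, i) * b $$ (i, n - 1))"
    by (rule sum.mono_neutral_right) (use n5 in \<open>auto simp: bz\<close>)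
  thus "(x * b) $$ (k, n - 1) = x $$ (k, n - 1) * b $$ (n - 1, n - 1)"
    using S_entry_mult[OF x borel_S[OF b] k, of "n - 1"] n5 by simp
  have "(\<Sum>i<n. x $$ (k, i) * b $$ (i, n - 2)) = (\<Sum>i\<in>{n - 2, n - 1}. x $$ (k, i) * b $$ (i, n - 2))"
    by (rule sum.mono_neutral_right) (use n5 in \<open>auto simp: bz\<close>)
  thus "(x * b) $$ (k, n - 2) = x $$ (k, n - 2) * b $$ (n - 2, n - 2) + x $$ (k, n - 1) * b $$ (n - 1, n - 2)"
    using S_entry_mult[OF x borel_S[OF b] k, of "n - 2"] n5 by simp
qed

lemma row_borel:
  assumes x: "x \<in> S" and b: "b \<in> borel_neg n" and k: "k < n"
  shows "iv (x * b) $$ (0, k) = inverse (b $$ (0, 0)) * iv x $$ (0, k)"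
    and "iv (x * b) $$ (1, k) = iv b $$ (1, 0) * iv x $$ (0, k) + inverse (b $$ (1, 1)) * iv x $$ (1, k)"
proof -
  note z = iv_borel[OF b]
  have e: "iv (x * b) $$ (r, k) = (\<Sum>i<n. iv b $$ (r, i) * iv x $$ (i, k))" if "r < n" for r
    using S_entry_mult[OF iv_S[OF borel_S[OF b]] iv_S[OF x] that k] iv_mult[OF x borel_S[OF b]] by simp
  have "(\<Sum>i<n. iv b $$ (0, i) * iv x $$ (i, k)) = (\<Sum>i\<in>{0}. iv b $$ (0, i) * iv x $$ (i, k))"
    by (rule sum.mono_neutral_right) (use n5 in \<open>auto simp: z\<close>)
  thus "iv (x * b) $$ (0, k) = inverse (b $$ (0, 0)) * iv x $$ (0, k)" using e[of 0] n5 z(2)[of 0] by simp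
  have "(\<Sum>i<n. iv b $$ (1, i) * iv x $$ (i, k)) = (\<Sum>i\<in>{0, 1}. iv b $$ (1, i) * iv x $$ (i, k))"
    by (rule sum.mono_neutral_right) (use n5 in \<open>auto simp: z\<close>)
  thus "iv (x * b) $$ (1, k) = iv b $$ (1, 0) * iv x $$ (0, k) + inverse (b $$ (1, 1)) * iv x $$ (1, k)"
    using e[of 1] n5 z(2)[of 1] by simp
qed

text \<open>The minor of \<open>x\<close> scales by the last two diagonal entries of
  \<open>b\<close>. As the diagonal has product 1, this is the inverse of the product of the first
  \<open>n - 2\<close> entries, the factor belonging to \<open>\<omega> (n - 2)\<close>.\<close>

lemma PQ_V:
  assumes ijkl: "i < n" "j < n" "k < n" "l < n"
  shows "(\<lambda>x\<in>S. PQ i j k l x) \<in> V mw"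
  unfolding V_iff
proof (intro conjI ballI)
  have "(\<lambda>x\<in>S. (iv x $$ (0, i) * iv x $$ (1, j) + - 1 * (iv x $$ (0, j) * iv x $$ (1, i))) *
    (x $$ (k, n - 2) * x $$ (l, n - 1) + - 1 * (x $$ (l, n - 2) * x $$ (k, n - 1)))) \<in> regular_functions n"
    by (intro reg_mult reg_add reg_iv regular_functions.entry regular_functions.const) (use ijkl n5 in auto)
  thus "(\<lambda>x\<in>S. PQ i j k l x) \<in> regular_functions n"
    by (rule reg_cong) (simp add: PQ_def Pm_def Qm_def)
  fix x b :: "'k mat" assume x: "x \<in> S" and b: "b \<in> borel_neg n"
  have P: "Pm i j (x * b) = inverse (b $$ (0, 0)) * inverse (b $$ (1, 1)) * Pm i j x"
    unfolding Pm_def row_borel[OF x b ijkl(1)] row_borel[OF x b ijkl(2)] by (simp add: algebra_simps)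
  have Q: "Qm k l (x * b) = b $$ (n - 2, n - 2) * b $$ (n - 1, n - 1) * Qm k l x"
    unfolding Qm_def col_borel[OF x b ijkl(3)] col_borel[OF x b ijkl(4)] by (simp add: algebra_simps)
  obtain m where m: "n = Suc (Suc m)" using n5 by (intro that[of "n - 2"]) auto
  have "(\<Prod>i<n - 2. b $$ (i, i)) * (b $$ (n - 2, n - 2) * b $$ (n - 1, n - 1)) = 1"
    using borel_diag(1)[OF b] by (simp add: m mult.assoc)
  hence inv: "b $$ (n - 2, n - 2) * b $$ (n - 1, n - 1) = inverse (\<Prod>i<n - 2. b $$ (i, i))"
    by (rule inverse_unique[symmetric])
  have "weight_char n mw b = b $$ (0, 0) * b $$ (1, 1) * (\<Prod>i<n - 2. b $$ (i, i))"
    unfolding mw_def using n5 borel_diag(2)[OF b] by (subst weight_char_two) (auto simp: numeral_2_eq_2)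
  hence "inverse (weight_char n mw b) = inverse (b $$ (0, 0)) * inverse (b $$ (1, 1)) *
      (b $$ (n - 2, n - 2) * b $$ (n - 1, n - 1))"
    unfolding inv by simp
  thus "(\<lambda>x\<in>S. PQ i j k l x) (x * b) = inverse (weight_char n mw b) * (\<lambda>x\<in>S. PQ i j k l x) x"
    using x borel_S[OF b] by (simp add: S_mult PQ_def P Q mult_ac)
qed

lemma AZ_V:
  assumes ik: "i < n" "k < n"
  shows "(\<lambda>x\<in>S. AZ i k x) \<in> V aw"
  unfolding V_iff
proof (intro conjI ballI)
  have "(\<lambda>x\<in>S. iv x $$ (0, i) * x $$ (k, n - 1)) \<in> regular_functions n"
    by (intro reg_mult reg_add reg_iv regular_functions.entry regular_functions.const) (use ik n5 in auto)
  thus "(\<lambda>x\<in>S. AZ i k x) \<in> regular_functions n"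
    by (rule reg_cong) (simp add: AZ_def)
  fix x b :: "'k mat" assume x: "x \<in> S" and b: "b \<in> borel_neg n"
  have P: "AZ i k (x * b) = inverse (b $$ (0, 0)) * b $$ (n - 1, n - 1) * AZ i k x"
    unfolding AZ_def row_borel[OF x b ik(1)] col_borel[OF x b ik(2)] by (simp add: algebra_simps)
  obtain m where m: "n = Suc m" using n5 by (cases n) auto
  have "(\<Prod>i<n - 1. b $$ (i, i)) * b $$ (n - 1, n - 1) = 1"
    using borel_diag(1)[OF b] by (simp add: m)
  hence inv: "b $$ (n - 1, n - 1) = inverse (\<Prod>i<n - 1. b $$ (i, i))"
    by (rule inverse_unique[symmetric])
  have "weight_char n aw b = b $$ (0, 0) * (\<Prod>i<n - 1. b $$ (i, i))"
    unfolding aw_def using n5 borel_diag(2)[OF b] by (subst weight_char_two) auto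
  hence "inverse (weight_char n aw b) = inverse (b $$ (0, 0)) * b $$ (n - 1, n - 1)"
    unfolding inv by simp
  thus "(\<lambda>x\<in>S. AZ i k x) (x * b) = inverse (weight_char n aw b) * (\<lambda>x\<in>S. AZ i k x) x"
    using x borel_S[OF b] by (simp add: S_mult P mult_ac)
qed

section \<open>The weights of the two modules\<close>

lemma mw_simps: "mw r = (if r < 2 then 2 else if r < n - 2 then 1 else 0)"
  using n5 by (auto simp: mw_def fund_weight_def)

lemma aw_simps: "aw r = (if r < 1 then 2 else if r < n - 1 then 1 else 0)"
  using n5 by (auto simp: aw_def fund_weight_def)

lemma occurs_prefix:
  assumes "occurs \<mu> \<kappa>" "k \<le> n"
  shows "(\<Sum>i<k. \<kappa> i + \<mu> i - \<mu> 0) \<ge> 0" "(\<Sum>i<n. \<kappa> i + \<mu> i - \<mu> 0) = 0"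
  using assms wt_prefix unfolding occurs_def by blast+

text \<open>Permutations preserve occurrence, so the entries may be sorted increasingly. The
  inequalities of \<open>wt_prefix\<close> for the lengths 1, 3, \<open>n - 3\<close> and
  \<open>n - 1\<close> leave 1 in all middle places; the outer four entries have sum 4, which allows
  three patterns.\<close>

lemma occurs_mw:
  assumes o: "occurs mw \<kappa>"
  obtains \<pi> where "\<pi> permutes {0..<n}" "\<And>r. r < n \<Longrightarrow> \<kappa> (\<pi> r) = K2 0 1 (n - 2) (n - 1) r"
  | \<pi> where "\<pi> permutes {0..<n}" "\<And>r. r < n \<Longrightarrow> \<kappa> (\<pi> r) = K1 0 (n - 1) r"
  | "\<And>r. r < n \<Longrightarrow> \<kappa> r = 1"
proof -
  obtain \<pi> where \<pi>: "\<pi> permutes {0..<n}" and mono: "\<And>i j. i \<le> j \<Longrightarrow> j < n \<Longrightarrow> \<kappa> (\<pi> i) \<le> \<kappa> (\<pi> j)"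
    using sorting_permutation[of n \<kappa>] by blast
  define a where "a r = \<kappa> (\<pi> r)" for r
  have mono: "i \<le> j \<Longrightarrow> j < n \<Longrightarrow> a i \<le> a j" for i j using mono by (simp add: a_def)
  have oa: "occurs mw a" unfolding a_def by (rule occurs_perm[OF o \<pi>])
  note pre = occurs_prefix(1)[OF oa] and tot = occurs_prefix(2)[OF oa order_refl]
  define h where "h i = a i + mw i - mw 0" for i
  have hv: "h (n - 1) = a (n - 1) - 2" "h (n - 2) = a (n - 2) - 2" "h (n - 3) = a (n - 3) - 1"
    using n5 by (auto simp: h_def mw_simps)
  note pre = pre[folded h_def] and tot = tot[folded h_def]
  have a0: "a 0 \<ge> 0" using pre[of 1] n5 by (simp add: h_def)
  have "a 0 + a 1 + a 2 \<ge> 1" 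
  proof -
    have "{..<3 :: nat} = {0, 1, 2}" by auto
    thus ?thesis using pre[of 3] n5 by (auto simp: h_def mw_simps split: if_splits)
  qed
  hence a2: "a 2 \<ge> 1" using mono[of 0 2] mono[of 1 2] n5 by auto
  have last: "a (n - 1) \<le> 2" using pre[of "n - 1"] tot n5 sum_last(1)[of n h] hv by simp
  have "a (n - 3) + a (n - 2) + a (n - 1) \<le> 5" using pre[of "n - 3"] tot n5 sum_last(3)[of n h] hv by simp
  hence am: "a (n - 3) \<le> 1" using mono[of "n - 3" "n - 2"] mono[of "n - 3" "n - 1"] n5 by linarith
  have mid: "a i = 1" if "2 \<le> i" "i \<le> n - 3" for i
    using a2 am mono[of 2 i] mono[of i "n - 3"] that n5 by linarith
  have sum_eq: "(\<Sum>i<n. h i) = (\<Sum>i\<in>{0, 1, n - 2, n - 1}. h i)"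
  proof (rule sum.mono_neutral_right)
    show "\<forall>i\<in>{..<n} - {0, 1, n - 2, n - 1}. h i = 0"
    proof
      fix i assume "i \<in> {..<n} - {0, 1, n - 2, n - 1}"
      hence "2 \<le> i" "i \<le> n - 3" by auto
      thus "h i = 0" using mid[of i] n5 by (auto simp: mw_simps h_def)
    qed
  qed (use n5 in auto)
  have sum4: "a 0 + a 1 + a (n - 2) + a (n - 1) = 4" 
  proof -
    have "(1 :: nat) \<noteq> n - 2" "(1 :: nat) \<noteq> n - 1" "n - 2 \<noteq> n - 1" "0 \<noteq> n - 1" "0 \<noteq> n - 2" using n5 by auto
    hence "(\<Sum>i\<in>{0, 1, n - 2, n - 1}. h i) = h 0 + (h 1 + (h (n - 2) + h (n - 1)))" by simp
    thus ?thesis using sum_eq tot hv n5 by (simp add: h_def[of 0] h_def[of "Suc 0"] mw_simps)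
  qed
  have bd: "a 0 \<le> a 1" "a 1 \<le> 1" "1 \<le> a (n - 2)" "a (n - 2) \<le> a (n - 1)"
    using mono[of 0 1] mono[of 1 2] mid[of 2] mid[of "n - 3"] mono[of "n - 3" "n - 2"] mono[of "n - 2" "n - 1"] n5 by auto
  consider "a 0 = 0" "a 1 = 0" "a (n - 2) = 2" "a (n - 1) = 2" |
     "a 0 = 0" "a 1 = 1" "a (n - 2) = 1" "a (n - 1) = 2" | "a 0 = 1" "a 1 = 1" "a (n - 2) = 1" "a (n - 1) = 1"
    using sum4 bd a0 last by linarith
  thus ?thesis
  proof cases
    case 1
    have "a r = K2 0 1 (n - 2) (n - 1) r" if r: "r < n" for r
    proof -
      consider "r = 0" | "r = 1" | "r = n - 2" | "r = n - 1" | "2 \<le> r" "r \<le> n - 3" using r n5 by linarith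
      thus ?thesis using 1 mid[of r] n5 by cases (auto simp: K2_def)
    qed
    thus ?thesis using that(1)[OF \<pi>] by (simp add: a_def)
  next
    case 2
    have "a r = K1 0 (n - 1) r" if r: "r < n" for r
    proof -
      consider "r = 0" | "r = 1" | "r = n - 2" | "r = n - 1" | "2 \<le> r" "r \<le> n - 3" using r n5 by linarith
      thus ?thesis using 2 mid[of r] n5 by cases (auto simp: K1_def)
    qed
    thus ?thesis using that(2)[OF \<pi>] by (simp add: a_def)
  next
    case 3
    have a1: "a r = 1" if r: "r < n" for r
    proof -
      consider "r = 0" | "r = 1" | "r = n - 2" | "r = n - 1" | "2 \<le> r" "r \<le> n - 3" using r n5 by linarith
      thus ?thesis using 3 mid[of r] n5 by cases auto
    qed
    have "\<kappa> r = 1" if r: "r < n" for r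
      using a1[of "inv_into UNIV \<pi> r"] permutes_in_image[OF permutes_inv[OF \<pi>], of r] r
        permutes_inverses(1)[OF \<pi>] by (simp add: a_def)
    thus ?thesis by (rule that(3))
  qed
qed

lemma occurs_aw:
  assumes o: "occurs aw \<kappa>"
  obtains \<pi> where "\<pi> permutes {0..<n}" "\<And>r. r < n \<Longrightarrow> \<kappa> (\<pi> r) = K1 0 (n - 1) r"
  | "\<And>r. r < n \<Longrightarrow> \<kappa> r = 1"
proof -
  obtain \<pi> where \<pi>: "\<pi> permutes {0..<n}" and mono: "\<And>i j. i \<le> j \<Longrightarrow> j < n \<Longrightarrow> \<kappa> (\<pi> i) \<le> \<kappa> (\<pi> j)"
    using sorting_permutation[of n \<kappa>] by blast
  define a where "a r = \<kappa> (\<pi> r)" for r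
  have mono: "i \<le> j \<Longrightarrow> j < n \<Longrightarrow> a i \<le> a j" for i j using mono by (simp add: a_def)
  have oa: "occurs aw a" unfolding a_def by (rule occurs_perm[OF o \<pi>])
  note pre = occurs_prefix(1)[OF oa] and tot = occurs_prefix(2)[OF oa order_refl]
  define h where "h i = a i + aw i - aw 0" for i
  have hv: "h (n - 1) = a (n - 1) - 2" "h (n - 2) = a (n - 2) - 1"
    using n5 by (auto simp: h_def aw_simps)
  note pre = pre[folded h_def] and tot = tot[folded h_def]
  have a0: "a 0 \<ge> 0" using pre[of 1] n5 by (simp add: h_def)
  have "a 0 + a 1 \<ge> 1" 
  proof -
    have "{..<2 :: nat} = {0, 1}" by auto
    thus ?thesis using pre[of 2] n5 by (auto simp: h_def aw_simps split: if_splits)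
  qed
  hence a1: "a 1 \<ge> 1" using mono[of 0 1] n5 by auto
  have last: "a (n - 1) \<le> 2" using pre[of "n - 1"] tot n5 sum_last(1)[of n h] hv by simp
  have "a (n - 2) + a (n - 1) \<le> 3" using pre[of "n - 2"] tot n5 sum_last(2)[of n h] hv by simp
  hence am: "a (n - 2) \<le> 1" using mono[of "n - 2" "n - 1"] n5 by linarith
  have mid: "a i = 1" if "1 \<le> i" "i \<le> n - 2" for i
    using a1 am mono[of 1 i] mono[of i "n - 2"] that n5 by linarith
  have "(\<Sum>i<n. h i) = (\<Sum>i\<in>{0, n - 1}. h i)"
  proof (rule sum.mono_neutral_right)
    show "\<forall>i\<in>{..<n} - {0, n - 1}. h i = 0"
    proof
      fix i assume "i \<in> {..<n} - {0, n - 1}"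
      hence "1 \<le> i" "i \<le> n - 2" by auto
      thus "h i = 0" using mid[of i] n5 by (auto simp: aw_simps h_def)
    qed
  qed (use n5 in auto)
  hence sum2: "a 0 + a (n - 1) = 2" using tot hv n5 by (simp add: h_def[of 0] aw_simps)
  have bd: "a 0 \<le> 1" using mono[of 0 1] mid[of 1] n5 by auto
  consider "a 0 = 0" "a (n - 1) = 2" | "a 0 = 1" "a (n - 1) = 1"
    using sum2 bd a0 last by linarith
  thus ?thesis
  proof cases
    case 1
    have "a r = K1 0 (n - 1) r" if r: "r < n" for r
    proof -
      consider "r = 0" | "r = n - 1" | "1 \<le> r" "r \<le> n - 2" using r n5 by linarith
      thus ?thesis using 1 mid[of r] n5 by cases (auto simp: K1_def)
    qed
    thus ?thesis using that(1)[OF \<pi>] by (simp add: a_def)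
  next
    case 2
    have a1: "a r = 1" if r: "r < n" for r
    proof -
      consider "r = 0" | "r = n - 1" | "1 \<le> r" "r \<le> n - 2" using r n5 by linarith
      thus ?thesis using 2 mid[of r] n5 by cases auto
    qed
    have "\<kappa> r = 1" if r: "r < n" for r
      using a1[of "inv_into UNIV \<pi> r"] permutes_in_image[OF permutes_inv[OF \<pi>], of r] r
        permutes_inverses(1)[OF \<pi>] by (simp add: a_def)
    thus ?thesis by (rule that(2))
  qed
qed

lemma permutes_preimage:
  assumes "\<pi> permutes {0..<n}" "r < n"
  obtains q where "q < n" "r = \<pi> q"
  using permutes_in_image[OF permutes_inv[OF assms(1)], of r] permutes_inverses(1)[OF assms(1), of r] assms(2)
  by (intro that[of "inv_into UNIV \<pi> r"]) auto

text \<open>What the root element arguments use about weights: a shift that makes an entry negative,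
  exceeds 2 or creates a third zero does not occur.\<close>

lemma occurs_mw_bounds:
  assumes o: "occurs mw \<kappa>"
  shows "r < n \<Longrightarrow> 0 \<le> \<kappa> r \<and> \<kappa> r \<le> 2"
    and "distinct [p, q, r] \<Longrightarrow> {p, q, r} \<subseteq> {..<n} \<Longrightarrow> \<not> (\<kappa> p = 0 \<and> \<kappa> q = 0 \<and> \<kappa> r = 0)"
  using o
proof -
  have "(\<forall>r<n. 0 \<le> \<kappa> r \<and> \<kappa> r \<le> 2) \<and> (\<forall>p<n. \<forall>q<n. \<forall>r<n. p \<noteq> q \<and> p \<noteq> r \<and> q \<noteq> r \<longrightarrow> \<not> (\<kappa> p = 0 \<and> \<kappa> q = 0 \<and> \<kappa> r = 0))"
    using o
  proof (cases rule: occurs_mw)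
    case (1 \<pi>)
    show ?thesis
    proof (intro conjI allI impI)
      fix r assume "r < n"
      then obtain a where a: "a < n" "r = \<pi> a" by (rule permutes_preimage[OF 1(1)])
      show "0 \<le> \<kappa> r" "\<kappa> r \<le> 2" using 1(2)[OF a(1)] n5 a by (auto simp: K2_def split: if_splits)
    next
      fix p q r assume pqr: "p < n" "q < n" "r < n" "p \<noteq> q \<and> p \<noteq> r \<and> q \<noteq> r"
      obtain a b c where *: "a < n" "p = \<pi> a" "b < n" "q = \<pi> b" "c < n" "r = \<pi> c"
        using permutes_preimage[OF 1(1)] pqr by metis
      have z: "a' = 0 \<or> a' = 1" if "a' < n" "\<kappa> (\<pi> a') = 0" for a'
        using 1(2)[OF that(1)] that(2) n5 by (auto simp: K2_def split: if_splits)
      show "\<not> (\<kappa> p = 0 \<and> \<kappa> q = 0 \<and> \<kappa> r = 0)" using z[of a] z[of b] z[of c] * pqr by auto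
    qed
  next
    case (2 \<pi>)
    show ?thesis
    proof (intro conjI allI impI)
      fix r assume "r < n"
      then obtain a where a: "a < n" "r = \<pi> a" by (rule permutes_preimage[OF 2(1)])
      show "0 \<le> \<kappa> r" "\<kappa> r \<le> 2" using 2(2)[OF a(1)] n5 a by (auto simp: K1_def split: if_splits)
    next
      fix p q r assume pqr: "p < n" "q < n" "r < n" "p \<noteq> q \<and> p \<noteq> r \<and> q \<noteq> r"
      obtain a b c where *: "a < n" "p = \<pi> a" "b < n" "q = \<pi> b" "c < n" "r = \<pi> c"
        using permutes_preimage[OF 2(1)] pqr by metis
      have z: "a' = 0" if "a' < n" "\<kappa> (\<pi> a') = 0" for a'
        using 2(2)[OF that(1)] that(2) n5 by (auto simp: K1_def split: if_splits)
      show "\<not> (\<kappa> p = 0 \<and> \<kappa> q = 0 \<and> \<kappa> r = 0)" using z[of a] z[of b] z[of c] * pqr by auto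
    qed
  next
    case 3
    thus ?thesis by auto
  qed
  thus "r < n \<Longrightarrow> 0 \<le> \<kappa> r \<and> \<kappa> r \<le> 2"
    and "distinct [p, q, r] \<Longrightarrow> {p, q, r} \<subseteq> {..<n} \<Longrightarrow> \<not> (\<kappa> p = 0 \<and> \<kappa> q = 0 \<and> \<kappa> r = 0)"
    by auto
qed

lemma occurs_aw_bounds:
  assumes o: "occurs aw \<kappa>"
  shows "r < n \<Longrightarrow> 0 \<le> \<kappa> r \<and> \<kappa> r \<le> 2"
    and "p \<noteq> q \<Longrightarrow> p < n \<Longrightarrow> q < n \<Longrightarrow> \<not> (\<kappa> p = 0 \<and> \<kappa> q = 0)"
proof -
  have "(\<forall>r<n. 0 \<le> \<kappa> r \<and> \<kappa> r \<le> 2) \<and> (\<forall>p<n. \<forall>q<n. p \<noteq> q \<longrightarrow> \<not> (\<kappa> p = 0 \<and> \<kappa> q = 0))"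
    using o
  proof (cases rule: occurs_aw)
    case (1 \<pi>)
    show ?thesis
    proof (intro conjI allI impI)
      fix r assume "r < n"
      then obtain a where a: "a < n" "r = \<pi> a" by (rule permutes_preimage[OF 1(1)])
      show "0 \<le> \<kappa> r" "\<kappa> r \<le> 2" using 1(2)[OF a(1)] n5 a by (auto simp: K1_def split: if_splits)
    next
      fix p q assume pqr: "p < n" "q < n" "p \<noteq> q"
      obtain a b where *: "a < n" "p = \<pi> a" "b < n" "q = \<pi> b"
        using permutes_preimage[OF 1(1)] pqr by metis
      have z: "a' = 0" if "a' < n" "\<kappa> (\<pi> a') = 0" for a'
        using 1(2)[OF that(1)] that(2) n5 by (auto simp: K1_def split: if_splits)
      show "\<not> (\<kappa> p = 0 \<and> \<kappa> q = 0)" using z[of a] z[of b] * pqr by auto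
    qed
  next
    case 2
    thus ?thesis by auto
  qed
  thus "r < n \<Longrightarrow> 0 \<le> \<kappa> r \<and> \<kappa> r \<le> 2" "p \<noteq> q \<Longrightarrow> p < n \<Longrightarrow> q < n \<Longrightarrow> \<not> (\<kappa> p = 0 \<and> \<kappa> q = 0)"
    by auto
qed

section \<open>Extremal weight vectors\<close>

lemma transport:
  assumes f: "f \<in> V \<mu>" "wt f \<kappa>" and p: "\<pi> permutes {0..<n}" and q: "q < n"
    and k: "\<And>r. r < n \<Longrightarrow> \<kappa> (\<pi> r) = \<kappa>' r"
  obtains f' where "f' \<in> V \<mu>" "wt f' \<kappa>'" "\<And>x. x \<in> S \<Longrightarrow> f x = f' (mon \<pi> q * x)"
proof -
  let ?\<sigma> = "inv_into UNIV \<pi>"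
  have s: "?\<sigma> permutes {0..<n}" by (rule permutes_inv[OF p])
  have pq: "\<pi> q < n" using permutes_in_image[OF p, of q] q by auto
  define f' where "f' = (\<lambda>x\<in>S. f (mon ?\<sigma> (\<pi> q) * x))"
  have "wt f' (\<lambda>r. \<kappa> (inv_into UNIV ?\<sigma> r))" unfolding f'_def by (rule wt_mon[OF s pq f(2)])
  hence "wt f' \<kappa>'" unfolding permutes_inv_inv[OF p] by (subst wt_cong[of \<kappa>' "\<lambda>r. \<kappa> (\<pi> r)"]) (use k in auto)
  moreover have "f x = f' (mon \<pi> q * x)" if x: "x \<in> S" for x
  proof -
    have "mon ?\<sigma> (\<pi> q) * (mon (inv_into UNIV ?\<sigma>) (?\<sigma> (\<pi> q)) * x) = x"
      by (rule iv_mon_inverse[OF s pq x])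
    hence "mon ?\<sigma> (\<pi> q) * (mon \<pi> q * x) = x"
      unfolding permutes_inv_inv[OF p] using permutes_inverses(2)[OF p] by simp
    thus ?thesis using S_mult[OF mon_S[OF p q] x] by (simp add: f'_def)
  qed
  ultimately show ?thesis using that V_left[OF f(1) mon_S[OF s pq]] unfolding f'_def by blast
qed

text \<open>The sign of the permutation is put into row 2, which differs from 0, 1,
  \<open>n - 2\<close> and \<open>n - 1\<close> because \<open>n \<ge> 5\<close>; thus the product
  of minors is carried over without a sign.\<close>

lemma PQ_transport:
  assumes d: "distinct [i, j, k, l]" "{i, j, k, l} \<subseteq> {0..<n}"
  obtains \<pi> where "\<pi> permutes {0..<n}" "\<pi> 0 = i" "\<pi> 1 = j" "\<pi> (n - 2) = k" "\<pi> (n - 1) = l"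
    "\<And>x. x \<in> S \<Longrightarrow> PQ 0 1 (n - 2) (n - 1) (mon \<pi> 2 * x) = PQ i j k l x"
proof -
  have 0: "distinct [0, 1, n - 2, n - 1]" "{0, 1, n - 2, n - 1} \<subseteq> {0..<n}" using n5 by auto
  obtain \<pi> where \<pi>: "\<pi> permutes {0..<n}" "\<pi> 0 = i" "\<pi> 1 = j" "\<pi> (n - 2) = k" "\<pi> (n - 1) = l"
    by (rule permutation4[OF 0 d])
  show ?thesis
    by (rule that[OF \<pi>], subst PQ_mon[OF \<pi>(1)]) (use n5 \<pi> in auto)
qed

lemma PQ_one: "PQ 0 1 (n - 2) (n - 1) (1\<^sub>m n) = 1"
  using n5 by (simp add: PQ_def Pm_def Qm_def)

lemma PQ_nonzero:
  assumes d: "distinct [i, j, k, l]" "{i, j, k, l} \<subseteq> {0..<n}"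
  obtains x where "x \<in> S" "PQ i j k l x = 1"
proof -
  obtain \<pi> where \<pi>: "\<pi> permutes {0..<n}"
    and e: "\<And>x. x \<in> S \<Longrightarrow> PQ 0 1 (n - 2) (n - 1) (mon \<pi> 2 * x) = PQ i j k l x"
    using PQ_transport[OF d] by metis
  have m: "mon \<pi> 2 \<in> S" by (rule mon_S[OF \<pi>]) (use n5 in simp)
  show ?thesis using that[of "iv (mon \<pi> 2)"] e[of "iv (mon \<pi> 2)"] m PQ_one by simp
qed

lemma PQ_E:
  assumes "x \<in> S" "i < n" "j < n" "i \<noteq> j" "p < n" "q < n" "r < n" "s < n"
  shows "PQ p q r s (E i j t * x) = (Pm p q x - t * ((if p = j then Pm i q x else 0) + (if q = j then Pm p i x else 0))) *
    (Qm r s x + t * ((if r = i then Qm j s x else 0) + (if s = i then Qm r j x else 0)))"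
  using assms by (simp add: PQ_def Pm_E Qm_E)

text \<open>Any shift along an upper root element violates \<open>occurs_mw_bounds\<close>. Hence
  \<open>f\<close>, minus the multiple of \<open>PQ\<close> with the same value at the identity, is
  invariant and vanishes there.\<close>

lemma mw_highest_weight_vector:
  assumes f: "f \<in> V mw" "wt f (K2 0 1 (n - 2) (n - 1))" and x: "x \<in> S"
  shows "f x = f (1\<^sub>m n) * PQ 0 1 (n - 2) (n - 1) x"
proof -
  have no: "\<not> occurs mw (shift (K2 0 1 (n - 2) (n - 1)) i j m)" if ij: "i < j" "j < n" and m: "m \<ge> 1" for i j m
  proof
    assume o: "occurs mw (shift (K2 0 1 (n - 2) (n - 1)) i j m)"
    have bi: "K2 0 1 (n - 2) (n - 1) i - int m \<ge> 0" and bj: "K2 0 1 (n - 2) (n - 1) j + int m \<le> 2"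
      using occurs_mw_bounds(1)[OF o, of i] occurs_mw_bounds(1)[OF o, of j] ij by (auto simp: shift_def)
    have i: "i \<noteq> 0" "i \<noteq> 1" and j: "j \<noteq> n - 2" "j \<noteq> n - 1" using bi bj m n5 ij by (auto simp: K2_def split: if_splits)
    have i2: "i \<noteq> n - 2" "i \<noteq> n - 1" using ij j n5 by auto
    hence m1: "m = 1" using i bi m by (auto simp: K2_def)
    show False using occurs_mw_bounds(2)[OF o, of 0 1 i] i i2 m1 ij n5 by (auto simp: shift_def K2_def split: if_splits)
  qed
  define g where "g = (\<lambda>x\<in>S. f x - f (1\<^sub>m n) * PQ 0 1 (n - 2) (n - 1) x)"
  have pqv: "(\<lambda>x\<in>S. PQ 0 1 (n - 2) (n - 1) x) \<in> V mw" using n5 by (intro PQ_V) auto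
  have gV: "g \<in> V mw" unfolding g_def
    by (intro fsub_diff fsub_smult V_fsub pqv fsub_restrict f)
  have gw: "wt g (K2 0 1 (n - 2) (n - 1))"
    unfolding g_def wtk_def using n5 by (auto simp: dil_S PQ_dil wtD[OF f(2)] algebra_simps)
  have "g x = 0"
  proof (rule V_zero_if_invariant[OF gV _ _ x])
    show "g (1\<^sub>m n) = 0" using S_one by (simp add: g_def PQ_one[unfolded One_nat_def])
    show "g (E i j t * x) = g x" if "i < j" "j < n" "x \<in> S" for i j t x
      using E_fixed[OF gV gw _ _ _ _ that(3)] no that by auto
  qed
  thus ?thesis using x by (simp add: g_def)
qed

lemma K2_perm:
  assumes p: "\<pi> permutes {0..<n}"
  shows "K2 (\<pi> i) (\<pi> j) (\<pi> k) (\<pi> l) (\<pi> r) = K2 i j k l r"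
  by (simp add: K2_def inj_eq[OF permutes_inj[OF p]])

lemma mw_extremal_weight_vector:
  assumes f: "f \<in> V mw" "wt f (K2 i j k l)" and d: "distinct [i, j, k, l]" "{i, j, k, l} \<subseteq> {0..<n}"
  obtains c where "\<And>x. x \<in> S \<Longrightarrow> f x = c * PQ i j k l x"
proof -
  obtain \<pi> where \<pi>: "\<pi> permutes {0..<n}" "\<pi> 0 = i" "\<pi> 1 = j" "\<pi> (n - 2) = k" "\<pi> (n - 1) = l"
    and e: "\<And>x. x \<in> S \<Longrightarrow> PQ 0 1 (n - 2) (n - 1) (mon \<pi> 2 * x) = PQ i j k l x"
    by (rule PQ_transport[OF d]) blast
  have 2: "2 < n" using n5 by simp
  obtain f' where f': "f' \<in> V mw" "wt f' (K2 0 1 (n - 2) (n - 1))" "\<And>x. x \<in> S \<Longrightarrow> f x = f' (mon \<pi> 2 * x)"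
  proof (rule transport[OF f \<pi>(1) 2, of "K2 0 1 (n - 2) (n - 1)"])
    show "K2 i j k l (\<pi> r) = K2 0 1 (n - 2) (n - 1) r" for r
      using K2_perm[OF \<pi>(1), of 0 1 "n - 2" "n - 1" r] \<pi> by simp
  qed blast
  have "f x = f' (1\<^sub>m n) * PQ i j k l x" if "x \<in> S" for x
    using f'(3)[OF that] mw_highest_weight_vector[OF f'(1,2) S_mult[OF mon_S[OF \<pi>(1) 2] that]] e[OF that] by simp
  thus ?thesis by (rule that)
qed

end

section \<open>Weight vectors of root weights\<close>

lemma sum_pairs_with:
  fixes a :: "nat \<Rightarrow> 'a :: comm_monoid_add"
  assumes "i < n" "a i = 0"
  shows "(\<Sum>k<n. \<Sum>l<n. if k < l then (if k = i then a l else 0) + (if l = i then a k else 0) else 0) = (\<Sum>l<n. a l)"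
proof -
  have "(\<Sum>k<n. \<Sum>l<n. if k < l then (if k = i then a l else 0) + (if l = i then a k else 0) else 0)
    = (\<Sum>k<n. \<Sum>l<n. (if k = i then (if i < l then a l else 0) else 0)) + (\<Sum>k<n. \<Sum>l<n. if l = i then (if k < i then a k else 0) else 0)"
    unfolding sum.distrib[symmetric] by (intro sum.cong) auto
  also have "(\<Sum>k<n. \<Sum>l<n. (if k = i then (if i < l then a l else 0) else 0)) = (\<Sum>l<n. if i < l then a l else 0)"
    using assms(1) by (subst sum.swap) simp
  also have "(\<Sum>k<n. \<Sum>l<n. if l = i then (if k < i then a k else 0) else 0) = (\<Sum>k<n. if k < i then a k else 0)"
    using assms(1) by simp
  also have "(\<Sum>l<n. if i < l then a l else 0) + (\<Sum>k<n. if k < i then a k else 0) = (\<Sum>l<n. a l)"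
    unfolding sum.distrib[symmetric] using assms(2) by (intro sum.cong) (auto simp: not_less_iff_gr_or_eq)
  finally show ?thesis .
qed

context sl5
begin

text \<open>The functions of weight \<open>K1 i j\<close>. By \<open>T_const\<close> and
  \<open>T_zero\<close> the values of \<open>e\<close> away from \<open>i\<close> and
  \<open>j\<close> matter up to a common constant.\<close>

definition T :: "(nat \<Rightarrow> 'k) \<Rightarrow> nat \<Rightarrow> nat \<Rightarrow> 'k mat \<Rightarrow> 'k" where
  "T e i j x = (\<Sum>l<n. e l * PQ i l j l x)"

lemma T_add: "T (\<lambda>l. e l + e' l) i j x = T e i j x + T e' i j x"
  by (simp add: T_def sum.distrib algebra_simps)

lemma T_diff: "T (\<lambda>l. e l - e' l) i j x = T e i j x - T e' i j x"
  by (simp add: T_def sum_subtractf algebra_simps)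

lemma T_single: "q < n \<Longrightarrow> T (\<lambda>l. if l = q then c else 0) i j x = c * PQ i q j q x"
  by (simp add: T_def if_distrib[of "\<lambda>c. c * _"] cong: if_cong)

text \<open>Expanding the minors turns the sum over \<open>l\<close> into entries of
  \<open>iv x * x = 1\<close> in rows 0, 1 and columns \<open>n - 2\<close>, \<open>n - 1\<close>,
  all off the diagonal. The values \<open>e i\<close> and \<open>e j\<close> stay free because they
  meet \<open>Pm i i\<close> and \<open>Qm j j\<close>.\<close>

lemma T_const:
  assumes x: "x \<in> S" and ij: "i < n" "j < n" and e: "\<And>l. l < n \<Longrightarrow> l \<noteq> i \<Longrightarrow> l \<noteq> j \<Longrightarrow> e l = c"
  shows "T e i j x = 0"
proof -
  have z: "(\<Sum>k<n. iv x $$ (r, k) * x $$ (k, q)) = 0" if "r < 2" "n - 2 \<le> q" "q < n" for r q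
    using iv_left_sum[OF x, of r q] that n5 by simp
  have "T e i j x = (\<Sum>l<n. c * PQ i l j l x)"
    unfolding T_def
  proof (rule sum.cong)
    fix l assume "l \<in> {..<n}"
    thus "e l * PQ i l j l x = c * PQ i l j l x"
      using e[of l] by (cases "l = i \<or> l = j") (auto simp: PQ_def Pm_anti(2) Qm_anti(2))
  qed simp
  also have "(\<Sum>l<n. c * PQ i l j l x) = c * (\<Sum>l<n. PQ i l j l x)" by (simp add: sum_distrib_left)
  also have "(\<Sum>l<n. PQ i l j l x) =
    iv x $$ (0, i) * x $$ (j, n - 2) * (\<Sum>l<n. iv x $$ (1, l) * x $$ (l, n - 1))
    - iv x $$ (0, i) * x $$ (j, n - 1) * (\<Sum>l<n. iv x $$ (1, l) * x $$ (l, n - 2))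
    - iv x $$ (1, i) * x $$ (j, n - 2) * (\<Sum>l<n. iv x $$ (0, l) * x $$ (l, n - 1))
    + iv x $$ (1, i) * x $$ (j, n - 1) * (\<Sum>l<n. iv x $$ (0, l) * x $$ (l, n - 2))"
    unfolding sum_distrib_left sum_subtractf[symmetric] sum.distrib[symmetric] PQ_def Pm_def Qm_def
    by (intro sum.cong) (auto simp: algebra_simps)
  also have "\<dots> = 0" using z n5 by simp
  finally show ?thesis by simp
qed

lemma T_E_disjoint:
  assumes x: "x \<in> S" and d: "distinct [i, j, l, m]" "{i, j, l, m} \<subseteq> {..<n}"
  shows "T e i j (E l m t * x) = T e i j x + t * ((e l - e m) * PQ i l j m x)"
proof -
  have "T e i j (E l m t * x) = (\<Sum>q<n. e q * PQ i q j q x + ((if q = l then t * (e q * PQ i l j m x) else 0) - (if q = m then t * (e q * PQ i l j m x) else 0)))"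
    unfolding T_def
  proof (rule sum.cong)
    fix q assume "q \<in> {..<n}"
    thus "e q * PQ i q j q (E l m t * x) = e q * PQ i q j q x + ((if q = l then t * (e q * PQ i l j m x) else 0) - (if q = m then t * (e q * PQ i l j m x) else 0))"
      using d x by (subst PQ_E) (auto simp: PQ_def algebra_simps)
  qed simp
  also have "\<dots> = T e i j x + t * ((e l - e m) * PQ i l j m x)"
    using d by (simp add: T_def sum.distrib sum_subtractf algebra_simps)
  finally show ?thesis .
qed

lemma T_E_right:
  assumes x: "x \<in> S" and d: "distinct [i, j, l]" "{i, j, l} \<subseteq> {..<n}"
  shows "T e i j (E j l t * x) = T e i j x + t * T e i l x + t * ((e l - e j) * PQ i j l j x)"
proof -
  have "T e i j (E j l t * x) = (\<Sum>q<n. (e q * PQ i q j q x + t * (e q * PQ i q l q x)) + ((if q = l then t * (e q * PQ i j l j x) else 0) - (if q = j then t * (e q * PQ i j l j x) else 0)))"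
    unfolding T_def
  proof (rule sum.cong)
    fix q assume "q \<in> {..<n}"
    thus "e q * PQ i q j q (E j l t * x) = (e q * PQ i q j q x + t * (e q * PQ i q l q x)) + ((if q = l then t * (e q * PQ i j l j x) else 0) - (if q = j then t * (e q * PQ i j l j x) else 0))"
      using d x Qm_anti(1)[of j l x] by (subst PQ_E) (auto simp: PQ_def Qm_anti(2) algebra_simps)
  qed simp
  also have "\<dots> = T e i j x + t * T e i l x + t * ((e l - e j) * PQ i j l j x)"
    using d by (simp add: T_def sum.distrib sum_subtractf sum_distrib_left algebra_simps)
  finally show ?thesis .
qed

lemma T_E_left:
  assumes x: "x \<in> S" and d: "distinct [i, j, l]" "{i, j, l} \<subseteq> {..<n}"
  shows "T e j l (E i j t * x) = T e j l x - t * T e i l x - t * ((e i - e j) * PQ i j l j x)"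
proof -
  have "T e j l (E i j t * x) = (\<Sum>q<n. (e q * PQ j q l q x - t * (e q * PQ i q l q x)) - ((if q = i then t * (e q * PQ i j l j x) else 0) - (if q = j then t * (e q * PQ i j l j x) else 0)))"
    unfolding T_def
  proof (rule sum.cong)
    fix q assume "q \<in> {..<n}"
    thus "e q * PQ j q l q (E i j t * x) = (e q * PQ j q l q x - t * (e q * PQ i q l q x)) - ((if q = i then t * (e q * PQ i j l j x) else 0) - (if q = j then t * (e q * PQ i j l j x) else 0))"
      using d x Pm_anti(1)[of i j x] by (subst PQ_E) (auto simp: PQ_def Pm_anti(2) algebra_simps)
  qed simp
  also have "\<dots> = T e j l x - t * T e i l x - t * ((e i - e j) * PQ i j l j x)"
    using d by (simp add: T_def sum.distrib sum_subtractf sum_distrib_left algebra_simps)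
  finally show ?thesis .
qed

lemma T_E_fixed:
  assumes x: "x \<in> S" and d: "distinct [i, j, l]" "{i, j, l} \<subseteq> {..<n}"
  shows "T e i l (E j l t * x) = T e i l x" "T e i l (E i j t * x) = T e i l x"
proof -
  show "T e i l (E j l t * x) = T e i l x"
    unfolding T_def
  proof (rule sum.cong)
    fix q assume "q \<in> {..<n}"
    thus "e q * PQ i q l q (E j l t * x) = e q * PQ i q l q x"
      using d x by (subst PQ_E) (auto simp: PQ_def Qm_anti(2))
  qed simp
  show "T e i l (E i j t * x) = T e i l x"
    unfolding T_def
  proof (rule sum.cong)
    fix q assume "q \<in> {..<n}"
    thus "e q * PQ i q l q (E i j t * x) = e q * PQ i q l q x"
      using d x by (subst PQ_E) (auto simp: PQ_def Pm_anti(2))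
  qed simp
qed

lemma PQ_cancel:
  assumes d: "distinct [i, j, k, l]" "{i, j, k, l} \<subseteq> {..<n}" and e: "\<And>x. x \<in> S \<Longrightarrow> a * PQ i j k l x = b * PQ i j k l x"
  shows "a = b"
proof -
  have "{i, j, k, l} \<subseteq> {0..<n}" using d by auto
  from PQ_nonzero[OF d(1) this] obtain x where "x \<in> S" "PQ i j k l x = 1" .
  thus ?thesis using e[of x] by simp
qed

text \<open>Translating by a root element with indices away from \<open>i\<close> and
  \<open>j\<close> isolates the difference of two coefficients as the factor of an extremal
  function, and that function is not zero.\<close>

lemma T_zero:
  assumes d: "distinct [i, j, q, m]" "{i, j, q, m} \<subseteq> {..<n}" and z: "\<And>x. x \<in> S \<Longrightarrow> T e i j x = 0"
  shows "e q = e m"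
proof (rule PQ_cancel)
  show "distinct [i, q, j, m]" "{i, q, j, m} \<subseteq> {..<n}" using d by auto
  fix x assume x: "x \<in> S"
  have "E q m 1 * x \<in> S" using d x by (intro S_mult) auto
  hence "1 * ((e q - e m) * PQ i q j m x) = 0" using T_E_disjoint[OF x d, of e 1] z x by simp
  thus "e q * PQ i q j m x = e m * PQ i q j m x" by (simp add: algebra_simps)
qed

lemma T_V: "i < n \<Longrightarrow> j < n \<Longrightarrow> (\<lambda>x\<in>S. T e i j x) \<in> V mw"
  unfolding T_def by (intro fsub_sum fsub_smult V_fsub PQ_V) auto

lemma E_assoc: "x \<in> S \<Longrightarrow> (E i j s * E k l t) * x = E i j s * (E k l t * x)"
  by (rule assoc_mult_mat[of _ n n _ n _ n]) (auto simp: S_carrier)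

text \<open>For middle indices, \<open>E i j\<close> moves the weight to an extremal one and so
  changes \<open>f\<close> by a multiple \<open>c i j\<close> of \<open>PQ 0 i (n - 1) j\<close>.
  The commutator relation makes \<open>c\<close> a cocycle. Its potential \<open>e\<close> supplies
  the coefficients, and \<open>f - T e 0 (n - 1)\<close> is invariant.\<close>

lemma mw_root_weight_vector_base:
  assumes f: "f \<in> V mw" "wt f (K1 0 (n - 1))"
  obtains e where "\<And>x. x \<in> S \<Longrightarrow> f x = T e 0 (n - 1) x"
proof -
  let ?N = "n - 1"
  define Mid where "Mid = {1..<n - 1}"
  have ex: "\<exists>c. \<forall>t. \<forall>x\<in>S. f (E i j t * x) = f x + t * (c * PQ 0 i ?N j x)" if ij: "i \<in> Mid" "j \<in> Mid" "i \<noteq> j" for i j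
  proof -
    have ij': "i < n" "j < n" using ij by (auto simp: Mid_def)
    have no: "\<not> occurs mw (shift (K1 0 ?N) i j m)" if "m \<ge> 2" for m
      using occurs_mw_bounds(1)[of "shift (K1 0 ?N) i j m" i] ij ij' that n5 by (auto simp: shift_def K1_def Mid_def)
    obtain F where F: "F \<in> V mw" "wt F (shift (K1 0 ?N) i j 1)" "\<And>t x. x \<in> S \<Longrightarrow> f (E i j t * x) = f x + t * F x"
      using E_linear[OF f ij' ij(3) no] by blast
    have "shift (K1 0 ?N) i j 1 = K2 0 i ?N j" by (auto simp: shift_def K1_def K2_def fun_eq_iff)
    hence "wt F (K2 0 i ?N j)" using F(2) by simp
    moreover have "distinct [0, i, ?N, j]" "{0, i, ?N, j} \<subseteq> {0..<n}" using ij n5 by (auto simp: Mid_def)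
    ultimately obtain c where "\<And>x. x \<in> S \<Longrightarrow> F x = c * PQ 0 i ?N j x"
      using mw_extremal_weight_vector[OF F(1), of 0 i ?N j] by blast
    thus ?thesis using F(3) by auto
  qed
  define c where "c i j = (SOME c. \<forall>t. \<forall>x\<in>S. f (E i j t * x) = f x + t * (c * PQ 0 i ?N j x))" for i j
  have c: "f (E i j t * x) = f x + t * (c i j * PQ 0 i ?N j x)" if "i \<in> Mid" "j \<in> Mid" "i \<noteq> j" "x \<in> S" for i j t x
    using someI_ex[OF ex[OF that(1-3)]] that(4) unfolding c_def by blast
  \<comment> \<open>When \<open>f\<close> is evaluated at both sides of the commutator relation, all
    terms cancel except those in \<open>PQ 0 i (n - 1) l\<close>.\<close>
  have coc: "c i l = c i j + c j l" if ijl: "i \<in> Mid" "j \<in> Mid" "l \<in> Mid" "i \<noteq> j" "j \<noteq> l" "i \<noteq> l" for i j l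
  proof (rule PQ_cancel[of 0 i ?N l])
    have b: "i < n" "j < n" "l < n" "0 \<noteq> i" "0 \<noteq> j" "0 \<noteq> l" "?N \<noteq> i" "?N \<noteq> j" "?N \<noteq> l" "?N < n" "0 < n"
      using ijl n5 by (auto simp: Mid_def)
    show "distinct [0, i, ?N, l]" "{0, i, ?N, l} \<subseteq> {..<n}" using b ijl n5 by auto
    fix x assume x: "x \<in> S"
    note xE = S_mult[OF E_S x]
    have y: "E j l 1 * x \<in> S" "E i j 1 * x \<in> S" "E j l 1 * (E i j 1 * x) \<in> S"
      using x ijl by (auto intro!: S_mult)
    have "f (E i j 1 * (E j l 1 * x)) = f (E i l 1 * (E j l 1 * (E i j 1 * x)))"
    proof -
      have "E i j 1 * (E j l 1 * x) = (E i j 1 * E j l 1) * x" using E_assoc[OF x] by simp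
      also have "\<dots> = (E i l 1 * (E j l 1 * E i j 1)) * x" using E_commutator[of i j l 1 1] b ijl by simp
      also have "\<dots> = E i l 1 * ((E j l 1 * E i j 1) * x)"
        by (rule assoc_mult_mat[of _ n n _ n _ n]) (use x S_carrier in \<open>auto intro: mult_carrier_mat[of _ n n]\<close>)
      finally show ?thesis using E_assoc[OF x] by simp
    qed
    moreover have "f (E i j 1 * (E j l 1 * x)) = f x + c j l * PQ 0 j ?N l x + c i j * (PQ 0 i ?N j x + PQ 0 i ?N l x)"
    proof -
      have "PQ 0 i ?N j (E j l 1 * x) = PQ 0 i ?N j x + PQ 0 i ?N l x"
        using x b ijl by (subst PQ_E) (auto simp: PQ_def algebra_simps)
      thus ?thesis using c[OF ijl(1,2,4) y(1), of 1] c[OF ijl(2,3,5) x, of 1] by simp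
    qed
    moreover have "f (E i l 1 * (E j l 1 * (E i j 1 * x))) = f x + c i j * PQ 0 i ?N j x + c j l * (PQ 0 j ?N l x - PQ 0 i ?N l x) + c i l * PQ 0 i ?N l x"
    proof -
      have 1: "PQ 0 j ?N l (E i j 1 * x) = PQ 0 j ?N l x - PQ 0 i ?N l x"
        using x b ijl by (subst PQ_E) (auto simp: PQ_def algebra_simps)
      have 2: "PQ 0 i ?N l (E i j 1 * x) = PQ 0 i ?N l x"
        using x b ijl by (subst PQ_E) (auto simp: PQ_def algebra_simps)
      have 3: "PQ 0 i ?N l (E j l 1 * (E i j 1 * x)) = PQ 0 i ?N l (E i j 1 * x)"
        using y b ijl by (subst PQ_E) (auto simp: PQ_def algebra_simps)
      show ?thesis
        using c[OF ijl(1,3,6) y(3), of 1] c[OF ijl(2,3,5) y(2), of 1] c[OF ijl(1,2,4) x, of 1] 1 2 3 by simp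
    qed
    ultimately show "c i l * PQ 0 i ?N l x = (c i j + c j l) * PQ 0 i ?N l x"
      by (simp add: algebra_simps)
  qed
  obtain e where e: "\<And>i j. i \<in> Mid \<Longrightarrow> j \<in> Mid \<Longrightarrow> i \<noteq> j \<Longrightarrow> c i j = e i - e j"
  proof (rule cocycle_solution[of 1 Mid 2 3 c])
    show "1 \<in> Mid" "2 \<in> Mid" "3 \<in> Mid" using n5 by (auto simp: Mid_def)
    show "c i l = c i j + c j l" if "i \<in> Mid" "j \<in> Mid" "l \<in> Mid" "i \<noteq> j" "j \<noteq> l" "i \<noteq> l" for i j l
      by (rule coc[OF that])
  qed auto
  define g where "g = (\<lambda>x\<in>S. f x - T e 0 ?N x)"
  have n0: "0 < n" "?N < n" using n5 by auto
  have TV: "(\<lambda>x\<in>S. T e 0 ?N x) \<in> V mw" by (rule T_V[OF n0])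
  have gV: "g \<in> V mw" unfolding g_def
    by (intro fsub_diff V_fsub TV fsub_restrict f)
  have gw: "wt g (K1 0 ?N)"
    unfolding g_def wtk_def using n0 by (auto simp: dil_S PQ_dil T_def K2_diag wtD[OF f(2)] algebra_simps sum_distrib_left)
  have g0: "g x = 0" if x: "x \<in> S" for x
  proof (rule V_zero_if_invariant[OF gV _ _ x])
    show "g (1\<^sub>m n) = 0"
    proof (rule ccontr)
      assume "g (1\<^sub>m n) \<noteq> 0"
      from wt_one[OF gV gw this, of 1] show False using n5 by (auto simp: K1_def mw_simps split: if_splits)
    qed
    show "g (E i j t * x) = g x" if ij: "i < j" "j < n" and x: "x \<in> S" for i j t x
    proof (cases "i = 0 \<or> j = ?N")
      \<comment> \<open>The entry at 0 is already 0 and the entry at \<open>n - 1\<close> already 2,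
        so no shift along such a root occurs.\<close>
      case True
      show ?thesis
      proof (rule E_fixed[OF gV gw _ _ _ _ x])
        fix m :: nat assume m: "m \<ge> 1"
        show "\<not> occurs mw (shift (K1 0 ?N) i j m)"
          using occurs_mw_bounds(1)[of "shift (K1 0 ?N) i j m" i] occurs_mw_bounds(1)[of "shift (K1 0 ?N) i j m" j] True m ij n5
          by (auto simp: shift_def K1_def)
      qed (use ij in auto)
    next
      case False
      hence m: "i \<in> Mid" "j \<in> Mid" "i \<noteq> j" using ij by (auto simp: Mid_def)
      have "distinct [0, ?N, i, j]" "{0, ?N, i, j} \<subseteq> {..<n}" using m n5 by (auto simp: Mid_def)
      from T_E_disjoint[OF x this, of e t] c[OF m x, of t] e[OF m] x
      show ?thesis using S_mult[OF E_S x] m by (simp add: g_def)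
    qed
  qed
  show ?thesis by (rule that[of e]) (use g0 in \<open>auto simp: g_def\<close>)
qed

lemma mw_root_weight_vector:
  assumes f: "f \<in> V mw" "wt f (K1 i k)" and ik: "i < n" "k < n" "i \<noteq> k"
  obtains e where "\<And>x. x \<in> S \<Longrightarrow> f x = T e i k x"
proof -
  let ?N = "n - 1"
  obtain \<pi> where \<pi>: "\<pi> permutes {0..<n}" and pA: "\<And>a. a \<in> {0, ?N} \<Longrightarrow> \<pi> a = (if a = 0 then i else k)"
    using extend_to_permutation[of "\<lambda>a. if a = 0 then i else k" "{0, ?N}" n] ik n5 by (auto simp: inj_on_def)
  have p0: "\<pi> 0 = i" "\<pi> ?N = k" using pA n5 by auto
  have 1: "1 < n" using n5 by simp
  obtain f' where f': "f' \<in> V mw" "wt f' (K1 0 ?N)" "\<And>x. x \<in> S \<Longrightarrow> f x = f' (mon \<pi> 1 * x)"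
  proof (rule transport[OF f \<pi>(1) 1, of "K1 0 ?N"])
    show "K1 i k (\<pi> r) = K1 0 ?N r" for r
      using p0 inj_eq[OF permutes_inj[OF \<pi>], of r 0] inj_eq[OF permutes_inj[OF \<pi>], of r ?N] by (simp add: K1_def)
  qed blast
  obtain e where e: "\<And>x. x \<in> S \<Longrightarrow> f' x = T e 0 ?N x" using mw_root_weight_vector_base[OF f'(1,2)] by blast
  have "f x = T (\<lambda>l. e (inv_into UNIV \<pi> l)) i k x" if x: "x \<in> S" for x
  proof -
    have "f x = T e 0 ?N (mon \<pi> 1 * x)" using f'(3)[OF x] e[OF S_mult[OF mon_S[OF \<pi> 1] x]] by simp
    also have "\<dots> = (\<Sum>l<n. e l * PQ i (\<pi> l) k (\<pi> l) x)"
      unfolding T_def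
    proof (rule sum.cong)
      fix l assume l: "l \<in> {..<n}"
      \<comment> \<open>The sign sits in row 1; for \<open>l = 1\<close> it enters both minors and
        cancels.\<close>
      have "PQ 0 l ?N l (mon \<pi> 1 * x) = PQ i (\<pi> l) k (\<pi> l) x"
        using l n5 p0 signof_sq[of \<pi>] by (subst PQ_mon[OF \<pi> 1 x]) auto
      thus "e l * PQ 0 l ?N l (mon \<pi> 1 * x) = e l * PQ i (\<pi> l) k (\<pi> l) x" by simp
    qed simp
    also have "\<dots> = (\<Sum>l<n. e (inv_into UNIV \<pi> l) * PQ i l k l x)"
      using sum.permute[of \<pi> "{..<n}" "\<lambda>l. e (inv_into UNIV \<pi> l) * PQ i l k l x"] \<pi> permutes_inverses(2)[OF \<pi>]
      by (simp add: o_def atLeast0LessThan)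
    finally show ?thesis by (simp add: T_def)
  qed
  thus ?thesis by (rule that)
qed

section \<open>Weight vectors of weight zero\<close>

definition Dsum :: "(nat \<Rightarrow> nat \<Rightarrow> 'k) \<Rightarrow> 'k mat \<Rightarrow> 'k" where
  "Dsum d x = (\<Sum>k<n. \<Sum>l<n. if k < l then d k l * PQ k l k l x else 0)"

text \<open>The pairs through \<open>i\<close> and those through \<open>j\<close> contribute the
  same functions \<open>PQ i l j l\<close> with opposite signs. A term quadratic in \<open>t\<close>
  would need both minors of one pair to change, which antisymmetry excludes.\<close>

lemma Dsum_E:
  assumes x: "x \<in> S" and ij: "i < n" "j < n" "i \<noteq> j" and sym: "\<And>k l. d k l = d l k"
  shows "Dsum d (E i j t * x) = Dsum d x + t * T (\<lambda>l. d i l - d j l) i j x"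
proof -
  define a where "a b l = t * (d b l * PQ i l j l x)" for b l
  have "Dsum d (E i j t * x) = (\<Sum>k<n. \<Sum>l<n. (if k < l then d k l * PQ k l k l x else 0) +
      ((if k < l then (if k = i then a i l else 0) + (if l = i then a i k else 0) else 0)
     - (if k < l then (if k = j then a j l else 0) + (if l = j then a j k else 0) else 0)))"
    unfolding Dsum_def
  proof (intro sum.cong refl)
    fix k l assume kl: "k \<in> {..<n}" "l \<in> {..<n}"
    show "(if k < l then d k l * PQ k l k l (E i j t * x) else 0) = (if k < l then d k l * PQ k l k l x else 0) +
      ((if k < l then (if k = i then a i l else 0) + (if l = i then a i k else 0) else 0)
     - (if k < l then (if k = j then a j l else 0) + (if l = j then a j k else 0) else 0))"
    proof (cases "k < l")
      case True
      have pq: "PQ k l k l (E i j t * x) = PQ k l k l x + t * (((if k = i then PQ i l j l x else 0) + (if l = i then PQ i k j k x else 0))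
         - ((if k = j then PQ i l j l x else 0) + (if l = j then PQ i k j k x else 0)))"
        using kl x ij True Qm_anti(1)[of k j x] Pm_anti(1)[of k i x] Pm_anti(1)[of j i x] Qm_anti(1)[of j i x]
        by (subst PQ_E) (auto simp: PQ_def Pm_anti(2) Qm_anti(2) algebra_simps)
      show ?thesis unfolding pq using True sym[of i k] sym[of j k] ij by (auto simp: a_def algebra_simps)
    qed simp
  qed
  also have "\<dots> = Dsum d x + ((\<Sum>l<n. a i l) - (\<Sum>l<n. a j l))"
    unfolding Dsum_def sum.distrib sum_subtractf using ij
    by (subst sum_pairs_with, simp, simp add: a_def PQ_def Pm_anti(2), subst sum_pairs_with, simp, simp add: a_def PQ_def Qm_anti(2)) simp
  also have "(\<Sum>l<n. a i l) - (\<Sum>l<n. a j l) = t * T (\<lambda>l. d i l - d j l) i j x"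
    by (simp add: T_def a_def sum_distrib_left algebra_simps flip: sum_subtractf)
  finally show ?thesis .
qed

lemma Dsum_V: "(\<lambda>x\<in>S. Dsum d x) \<in> V mw"
  unfolding Dsum_def
proof (intro fsub_sum V_fsub)
  fix k l assume "k \<in> {..<n}" "l \<in> {..<n}"
  thus "(\<lambda>x\<in>S. if k < l then d k l * PQ k l k l x else 0) \<in> V mw"
    by (cases "k < l") (use fsub_zero[OF V_fsub] in \<open>auto intro!: fsub_smult V_fsub PQ_V\<close>)
qed

text \<open>Translation by \<open>E i j\<close> moves weight zero to a root weight and changes
  \<open>f\<close> by a function \<open>T (C i j) i j\<close>. Commuting root elements make the
  differences of the \<open>C i j\<close> symmetric and the commutator relation makes them cyclic,
  so they are the second differences of a symmetric array \<open>d\<close>.\<close>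

lemma mw_zero_weight_vector:
  assumes f: "f \<in> V mw" "wt f (\<lambda>_. 1)"
  obtains d where "\<And>x. x \<in> S \<Longrightarrow> f x = Dsum d x"
proof -
  have ex: "\<exists>e. \<forall>t. \<forall>x\<in>S. f (E i j t * x) = f x + t * T e i j x" if ij: "i < n" "j < n" "i \<noteq> j" for i j
  proof -
    have no: "\<not> occurs mw (shift (\<lambda>_. 1) i j m)" if "m \<ge> 2" for m
      using occurs_mw_bounds(1)[of "shift (\<lambda>_. 1) i j m" i] ij that by (auto simp: shift_def)
    obtain F where F: "F \<in> V mw" "wt F (shift (\<lambda>_. 1) i j 1)" "\<And>t x. x \<in> S \<Longrightarrow> f (E i j t * x) = f x + t * F x"
      using E_linear[OF f ij no] by blast
    have "shift (\<lambda>_. 1) i j 1 = K1 i j" by (auto simp: shift_def K1_def fun_eq_iff)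
    hence "wt F (K1 i j)" using F(2) by simp
    then obtain e where "\<And>x. x \<in> S \<Longrightarrow> F x = T e i j x"
      using mw_root_weight_vector[OF F(1) _ ij] by blast
    thus ?thesis using F(3) by auto
  qed
  define C where "C i j = (SOME e. \<forall>t. \<forall>x\<in>S. f (E i j t * x) = f x + t * T e i j x)" for i j
  have C: "f (E i j t * x) = f x + t * T (C i j) i j x" if "i < n" "j < n" "i \<noteq> j" "x \<in> S" for i j t x
    using someI_ex[OF ex[OF that(1-3)]] that(4) unfolding C_def by blast
  \<comment> \<open>By \<open>T_const\<close> an additive constant in \<open>C i j\<close> is
    invisible, so the relations are stated for differences.\<close>
  define X where "X i j l m = C i j l - C i j m" for i j l m
  have sym: "X i j l m = X l m i j" if d: "distinct [i, j, l, m]" "{i, j, l, m} \<subseteq> {..<n}" for i j l m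
  proof (rule PQ_cancel[of i l j m])
    show "distinct [i, l, j, m]" "{i, l, j, m} \<subseteq> {..<n}" using d by auto
    fix x assume x: "x \<in> S"
    have y: "E l m 1 * x \<in> S" "E i j 1 * x \<in> S" using x d by (auto intro!: S_mult)
    have "E i j 1 * (E l m 1 * x) = E l m 1 * (E i j 1 * x)"
      unfolding E_assoc[OF x, symmetric] using E_comm[of i j l m 1 1] d by simp
    hence "f (E i j 1 * (E l m 1 * x)) = f (E l m 1 * (E i j 1 * x))" by simp
    moreover have "f (E i j 1 * (E l m 1 * x)) = f x + T (C l m) l m x + T (C i j) i j x + X i j l m * PQ i l j m x"
      using C[of i j "E l m 1 * x" 1] C[of l m x 1] T_E_disjoint[OF x d, of "C i j" 1] y x d by (simp add: X_def)
    moreover have "f (E l m 1 * (E i j 1 * x)) = f x + T (C i j) i j x + T (C l m) l m x + X l m i j * PQ l i m j x"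
      using C[of l m "E i j 1 * x" 1] C[of i j x 1] T_E_disjoint[OF x, of l m i j "C l m" 1] y x d by (simp add: X_def)
    moreover have "PQ l i m j x = PQ i l j m x" using Pm_anti(1)[of l i x] Qm_anti(1)[of m j x] by (simp add: PQ_def)
    ultimately show "X i j l m * PQ i l j m x = X l m i j * PQ i l j m x" by simp
  qed
  have cyc: "X i l q j = X i j q l + X j l q i" if d: "distinct [i, j, l, q]" "{i, j, l, q} \<subseteq> {..<n}" for i j l q
  proof -
    \<comment> \<open>The commutator relation leaves the combination
      \<open>C i j + C j l - C i l\<close> under \<open>T\<close> and a multiple of
      \<open>PQ i j l j\<close>. The latter is absorbed as an extra coefficient at
      \<open>r = j\<close>, so that \<open>T_zero\<close> applies.\<close>
    let ?e = "\<lambda>r. (C i j r + C j l r - C i l r) + (if r = j then C i j l - C i j j + C j l i - C j l j else 0)"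
    have "?e q = ?e j"
    proof (rule T_zero[of i l q j])
      show "distinct [i, l, q, j]" "{i, l, q, j} \<subseteq> {..<n}" using d by auto
      fix x assume x: "x \<in> S"
      have y: "E j l 1 * x \<in> S" "E i j 1 * x \<in> S" "E j l 1 * (E i j 1 * x) \<in> S"
        using x d by (auto intro!: S_mult)
      have d3: "distinct [i, j, l]" "{i, j, l} \<subseteq> {..<n}" using d by auto
      have "f (E i j 1 * (E j l 1 * x)) = f (E i l 1 * (E j l 1 * (E i j 1 * x)))"
      proof -
        have "E i j 1 * (E j l 1 * x) = (E i j 1 * E j l 1) * x" using E_assoc[OF x] by simp
        also have "\<dots> = (E i l 1 * (E j l 1 * E i j 1)) * x" using E_commutator[of i j l 1 1] d by simp
        also have "\<dots> = E i l 1 * ((E j l 1 * E i j 1) * x)"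
          by (rule assoc_mult_mat[of _ n n _ n _ n]) (use x S_carrier in \<open>auto intro: mult_carrier_mat[of _ n n]\<close>)
        finally show ?thesis using E_assoc[OF x] by simp
      qed
      moreover have "f (E i j 1 * (E j l 1 * x)) = f x + T (C j l) j l x + (T (C i j) i j x + T (C i j) i l x + (C i j l - C i j j) * PQ i j l j x)"
        using C[of i j "E j l 1 * x" 1] C[of j l x 1] T_E_right[OF x d3, of "C i j" 1] y x d by simp
      moreover have "f (E i l 1 * (E j l 1 * (E i j 1 * x))) = f x + T (C i j) i j x
          + (T (C j l) j l x - T (C j l) i l x - (C j l i - C j l j) * PQ i j l j x) + T (C i l) i l x"
        using C[of i l "E j l 1 * (E i j 1 * x)" 1] C[of j l "E i j 1 * x" 1] C[of i j x 1]
          T_E_left[OF x d3, of "C j l" 1] T_E_fixed(1)[OF y(2) d3, of "C i l" 1] T_E_fixed(2)[OF x d3, of "C i l" 1] y x d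
        by simp
      ultimately have "T (C i j) i l x + T (C j l) i l x - T (C i l) i l x + (C i j l - C i j j + C j l i - C j l j) * PQ i j l j x = 0"
        by (simp add: algebra_simps)
      thus "T ?e i l x = 0" using d by (simp add: T_add T_diff T_single)
    qed
    thus ?thesis using d by (auto simp: X_def algebra_simps)
  qed
  obtain d where dsym: "\<And>i j. d i j = d j i"
    and dX: "\<And>i j l m. distinct [i, j, l, m] \<Longrightarrow> {i, j, l, m} \<subseteq> {..<n} \<Longrightarrow> X i j l m = d i l - d j l - d i m + d j m"
  proof -
    have "X i j l m = - X i j m l" "X i j l m + X i j m q = X i j l q" for i j l m q
      by (simp_all add: X_def)
    thus ?thesis using that cross_difference_solution[of n X, OF n5 sym _ _ cyc] by blast
  qed
  define g where "g = (\<lambda>x\<in>S. f x - Dsum d x)"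
  have gV: "g \<in> V mw" unfolding g_def
    by (intro fsub_diff V_fsub Dsum_V fsub_restrict f)
  have gw: "wt g (\<lambda>_. 1)"
    unfolding wtk_def
  proof (intro allI impI ballI)
    fix r and s :: 'k and x assume r: "r < n" and s: "s \<noteq> 0" and x: "x \<in> S"
    have "Dsum d (dil r s x) = s * Dsum d x"
      unfolding Dsum_def sum_distrib_left
    proof (intro sum.cong refl)
      fix k l assume kl: "k \<in> {..<n}" "l \<in> {..<n}"
      have "K2 k l k l r = 1" by (simp add: K2_def)
      thus "(if k < l then d k l * PQ k l k l (dil r s x) else 0) = s * (if k < l then d k l * PQ k l k l x else 0)"
        using kl PQ_dil[OF x r s, of k l k l] by simp
    qed
    thus "g (dil r s x) = s powi 1 * g x"
      using wtD[OF f(2) r s x] x dil_S[OF x r s] by (simp add: g_def algebra_simps)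
  qed
  have g0: "g x = 0" if x: "x \<in> S" for x
  proof (rule V_zero_if_invariant[OF gV _ _ x])
    show "g (1\<^sub>m n) = 0"
    proof (rule ccontr)
      assume "g (1\<^sub>m n) \<noteq> 0"
      from wt_one[OF gV gw this, of 0] show False using n5 by simp
    qed
    show "g (E i j t * x) = g x" if ij: "i < j" "j < n" and x: "x \<in> S" for i j t x
    proof -
      \<comment> \<open>A third index, at which the constant for \<open>T_const\<close> is read
        off.\<close>
      obtain l0 where l0: "l0 < n" "l0 \<noteq> i" "l0 \<noteq> j"
      proof -
        have "\<not> {0, 1, 2} \<subseteq> {i, j}" by auto
        thus ?thesis using that[of 0] that[of 1] that[of 2] n5 by fastforce
      qed
      have "T (\<lambda>l. C i j l - (d i l - d j l)) i j x = 0"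
      proof (rule T_const[OF x, of _ _ _ "C i j l0 - (d i l0 - d j l0)"])
        fix l assume l: "l < n" "l \<noteq> i" "l \<noteq> j"
        show "C i j l - (d i l - d j l) = C i j l0 - (d i l0 - d j l0)"
        proof (cases "l = l0")
          case False
          have "X i j l l0 = d i l - d j l - d i l0 + d j l0" using l l0 ij False by (intro dX) auto
          thus ?thesis by (simp add: X_def algebra_simps)
        qed simp
      qed (use ij in auto)
      hence "T (C i j) i j x = T (\<lambda>l. d i l - d j l) i j x" by (simp add: T_diff)
      thus ?thesis
        using C[of i j x t] Dsum_E[OF x, of i j d t] dsym ij x S_mult[OF E_S x, of i j t] by (simp add: g_def)
    qed
  qed
  show ?thesis by (rule that[of d]) (use g0 in \<open>auto simp: g_def\<close>)
qed

section \<open>All functions of the induced module for \<open>mw\<close>\<close>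

definition psi :: "(nat \<Rightarrow> nat \<Rightarrow> nat \<Rightarrow> nat \<Rightarrow> 'k) \<Rightarrow> 'k mat \<Rightarrow> 'k" where
  "psi c x = (\<Sum>i<n. \<Sum>j<n. \<Sum>k<n. \<Sum>l<n. c i j k l * PQ i j k l x)"

definition psi_functions :: "('k mat \<Rightarrow> 'k) set" where
  "psi_functions = {f. \<exists>c. f = (\<lambda>x\<in>S. psi c x)}"

lemma psiset_fsub: "func_sub psi_functions"
  unfolding func_sub_def
proof (intro conjI ballI allI)
  show "psi_functions \<subseteq> extensional S" by (auto simp: psi_functions_def)
  have "(\<lambda>x\<in>S. 0) = (\<lambda>x\<in>S. psi (\<lambda>_ _ _ _. 0) x)" by (auto simp: psi_def)
  thus "(\<lambda>x\<in>S. 0) \<in> psi_functions" unfolding psi_functions_def by blast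
  fix f assume "f \<in> psi_functions"
  then obtain c where c: "f = (\<lambda>x\<in>S. psi c x)" by (auto simp: psi_functions_def)
  show "(\<lambda>x\<in>S. a * f x) \<in> psi_functions" for a
  proof -
    have "(\<lambda>x\<in>S. a * f x) = (\<lambda>x\<in>S. psi (\<lambda>i j k l. a * c i j k l) x)"
      by (auto simp: c psi_def sum_distrib_left mult.assoc)
    thus ?thesis unfolding psi_functions_def by blast
  qed
  fix h assume "h \<in> psi_functions"
  then obtain c' where c': "h = (\<lambda>x\<in>S. psi c' x)" by (auto simp: psi_functions_def)
  have "(\<lambda>x\<in>S. f x + h x) = (\<lambda>x\<in>S. psi (\<lambda>i j k l. c i j k l + c' i j k l) x)"
    by (auto simp: c c' psi_def sum.distrib distrib_right)
  thus "(\<lambda>x\<in>S. f x + h x) \<in> psi_functions" unfolding psi_functions_def by blast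
qed

lemma PQ_psiset:
  assumes "i < n" "j < n" "k < n" "l < n"
  shows "(\<lambda>x\<in>S. PQ i j k l x) \<in> psi_functions"
proof -
  have "(\<lambda>x\<in>S. PQ i j k l x) = (\<lambda>x\<in>S. psi (\<lambda>i' j' k' l'. if l' = l then if k' = k then if j' = j then if i' = i then 1 else 0 else 0 else 0 else 0) x)"
    using assms by (auto simp: psi_def if_distrib[of "\<lambda>c. c * _"] cong: if_cong)
  thus ?thesis unfolding psi_functions_def by blast
qed

lemma restrict_mem: "f \<in> V \<mu> \<Longrightarrow> (\<And>x. x \<in> S \<Longrightarrow> f x = g x) \<Longrightarrow> (\<lambda>x\<in>S. g x) \<in> W \<Longrightarrow> f \<in> W"
  using extensional_restrict[OF V_ext, of f \<mu>] restrict_ext[of S f g] by simp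

theorem V_mw_subset: "V mw \<subseteq> psi_functions"
proof (rule weight_decomposition[OF psiset_fsub])
  fix f \<kappa> assume f: "f \<in> V mw" "wt f \<kappa>"
  show "f \<in> psi_functions"
  proof (cases "\<exists>x\<in>S. f x \<noteq> 0")
    case False
    hence "f = (\<lambda>x\<in>S. 0)" using V_ext[OF f(1)] by (intro extensionalityI[of _ S]) auto
    thus ?thesis using fsub_zero[OF psiset_fsub] by simp
  next
    case True
    hence "occurs mw \<kappa>" using f unfolding occurs_def by blast
    thus ?thesis
    proof (cases rule: occurs_mw)
      case (1 \<pi>)
      have pn: "\<pi> r < n" if "r < n" for r using permutes_in_image[OF 1(1), of r] that by auto
      let ?K = "K2 (\<pi> 0) (\<pi> 1) (\<pi> (n - 2)) (\<pi> (n - 1))"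
      have "wt f ?K"
      proof (subst wt_cong)
        fix r assume "r < n"
        then obtain q where q: "q < n" "r = \<pi> q" by (rule permutes_preimage[OF 1(1)])
        show "?K r = \<kappa> r" using 1(2)[OF q(1)] q K2_perm[OF 1(1)] by simp
      qed (rule f)
      moreover have "distinct [\<pi> 0, \<pi> 1, \<pi> (n - 2), \<pi> (n - 1)]" "{\<pi> 0, \<pi> 1, \<pi> (n - 2), \<pi> (n - 1)} \<subseteq> {0..<n}"
        using n5 pn by (auto simp: inj_eq[OF permutes_inj[OF 1(1)]])
      ultimately obtain c where c: "\<And>x. x \<in> S \<Longrightarrow> f x = c * PQ (\<pi> 0) (\<pi> 1) (\<pi> (n - 2)) (\<pi> (n - 1)) x"
        using mw_extremal_weight_vector[OF f(1)] by blast
      show ?thesis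
        by (rule restrict_mem[OF f(1) c]) (use n5 pn in \<open>auto intro!: fsub_smult psiset_fsub PQ_psiset\<close>)
    next
      case (2 \<pi>)
      have pn: "\<pi> r < n" if "r < n" for r using permutes_in_image[OF 2(1), of r] that by auto
      let ?K = "K1 (\<pi> 0) (\<pi> (n - 1))"
      have "wt f ?K"
      proof (subst wt_cong)
        fix r assume "r < n"
        then obtain q where q: "q < n" "r = \<pi> q" by (rule permutes_preimage[OF 2(1)])
        show "?K r = \<kappa> r" using 2(2)[OF q(1)] q by (simp add: K1_def inj_eq[OF permutes_inj[OF 2(1)]])
      qed (rule f)
      moreover have "\<pi> 0 \<noteq> \<pi> (n - 1)" "\<pi> 0 < n" "\<pi> (n - 1) < n"
        using n5 pn by (auto simp: inj_eq[OF permutes_inj[OF 2(1)]])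
      ultimately obtain e where e: "\<And>x. x \<in> S \<Longrightarrow> f x = T e (\<pi> 0) (\<pi> (n - 1)) x"
        using mw_root_weight_vector[OF f(1)] by blast
      show ?thesis
        by (rule restrict_mem[OF f(1) e], unfold T_def) (use n5 pn in \<open>auto intro!: fsub_sum fsub_smult psiset_fsub PQ_psiset\<close>)
    next
      case 3
      have "wt f (\<lambda>_. 1)" by (subst wt_cong[of _ \<kappa>]) (use 3 f in auto)
      then obtain d where d: "\<And>x. x \<in> S \<Longrightarrow> f x = Dsum d x" using mw_zero_weight_vector[OF f(1)] by blast
      have "(\<lambda>x\<in>S. Dsum d x) \<in> psi_functions"
        unfolding Dsum_def
      proof (intro fsub_sum psiset_fsub)
        fix k l assume "k \<in> {..<n}" "l \<in> {..<n}"
        thus "(\<lambda>x\<in>S. if k < l then d k l * PQ k l k l x else 0) \<in> psi_functions"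
          by (cases "k < l") (use fsub_zero[OF psiset_fsub] in \<open>auto intro!: fsub_smult psiset_fsub PQ_psiset\<close>)
      qed
      thus ?thesis by (rule restrict_mem[OF f(1), rotated]) (rule d)
    qed
  qed
qed

section \<open>The same determination for the adjoint weight\<close>

lemma AZ_one: "AZ 0 (n - 1) (1\<^sub>m n) = 1"
  using n5 by (simp add: AZ_def)

lemma AZ_transport:
  assumes ik: "i < n" "k < n" "i \<noteq> k"
  obtains \<pi> where "\<pi> permutes {0..<n}" "\<pi> 0 = i" "\<pi> (n - 1) = k"
    "\<And>x. x \<in> S \<Longrightarrow> AZ 0 (n - 1) (mon \<pi> 1 * x) = AZ i k x"
proof -
  obtain \<pi> where \<pi>: "\<pi> permutes {0..<n}" and pA: "\<And>a. a \<in> {0, n - 1} \<Longrightarrow> \<pi> a = (if a = 0 then i else k)"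
    using extend_to_permutation[of "\<lambda>a. if a = 0 then i else k" "{0, n - 1}" n] ik n5 by (auto simp: inj_on_def)
  have p0: "\<pi> 0 = i" "\<pi> (n - 1) = k" using pA n5 by auto
  show ?thesis
    by (rule that[OF \<pi> p0], subst AZ_mon[OF \<pi>]) (use n5 p0 in auto)
qed

lemma AZ_nonzero:
  assumes ik: "i < n" "k < n" "i \<noteq> k"
  obtains x where "x \<in> S" "AZ i k x = 1"
proof -
  obtain \<pi> where \<pi>: "\<pi> permutes {0..<n}"
    and e: "\<And>x. x \<in> S \<Longrightarrow> AZ 0 (n - 1) (mon \<pi> 1 * x) = AZ i k x"
    using AZ_transport[OF ik] by metis
  have m: "mon \<pi> 1 \<in> S" by (rule mon_S[OF \<pi>]) (use n5 in simp)
  show ?thesis using that[of "iv (mon \<pi> 1)"] e[of "iv (mon \<pi> 1)"] m AZ_one by simp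
qed

lemma AZ_cancel:
  assumes ik: "i < n" "k < n" "i \<noteq> k" and e: "\<And>x. x \<in> S \<Longrightarrow> a * AZ i k x = b * AZ i k x"
  shows "a = b"
proof -
  from AZ_nonzero[OF ik] obtain x where "x \<in> S" "AZ i k x = 1" .
  thus ?thesis using e[of x] by simp
qed

lemma aw_highest_weight_vector:
  assumes f: "f \<in> V aw" "wt f (K1 0 (n - 1))" and x: "x \<in> S"
  shows "f x = f (1\<^sub>m n) * AZ 0 (n - 1) x"
proof -
  have no: "\<not> occurs aw (shift (K1 0 (n - 1)) i j m)" if ij: "i < j" "j < n" and m: "m \<ge> 1" for i j m
  proof
    assume o: "occurs aw (shift (K1 0 (n - 1)) i j m)"
    have bi: "K1 0 (n - 1) i - int m \<ge> 0" and bj: "K1 0 (n - 1) j + int m \<le> 2"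
      using occurs_aw_bounds(1)[OF o, of i] occurs_aw_bounds(1)[OF o, of j] ij by (auto simp: shift_def)
    have i: "i \<noteq> 0" and j: "j \<noteq> n - 1" using bi bj m n5 ij by (auto simp: K1_def split: if_splits)
    have i2: "i \<noteq> n - 1" using ij j n5 by auto
    hence m1: "m = 1" using i bi m by (auto simp: K1_def)
    show False using occurs_aw_bounds(2)[OF o, of 0 i] i i2 m1 ij n5 by (auto simp: shift_def K1_def split: if_splits)
  qed
  define g where "g = (\<lambda>x\<in>S. f x - f (1\<^sub>m n) * AZ 0 (n - 1) x)"
  have pqv: "(\<lambda>x\<in>S. AZ 0 (n - 1) x) \<in> V aw" using n5 by (intro AZ_V) auto
  have gV: "g \<in> V aw" unfolding g_def
    by (intro fsub_diff fsub_smult V_fsub pqv fsub_restrict f)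
  have gw: "wt g (K1 0 (n - 1))"
    unfolding g_def wtk_def using n5 by (auto simp: dil_S AZ_dil wtD[OF f(2)] algebra_simps)
  have "g x = 0"
  proof (rule V_zero_if_invariant[OF gV _ _ x])
    show "g (1\<^sub>m n) = 0" using S_one by (simp add: g_def AZ_one[unfolded One_nat_def])
    show "g (E i j t * x) = g x" if "i < j" "j < n" "x \<in> S" for i j t x
      using E_fixed[OF gV gw _ _ _ _ that(3)] no that by auto
  qed
  thus ?thesis using x by (simp add: g_def)
qed

lemma aw_root_weight_vector:
  assumes f: "f \<in> V aw" "wt f (K1 i k)" and ik: "i < n" "k < n" "i \<noteq> k"
  obtains c where "\<And>x. x \<in> S \<Longrightarrow> f x = c * AZ i k x"
proof -
  obtain \<pi> where \<pi>: "\<pi> permutes {0..<n}" "\<pi> 0 = i" "\<pi> (n - 1) = k"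
    and e: "\<And>x. x \<in> S \<Longrightarrow> AZ 0 (n - 1) (mon \<pi> 1 * x) = AZ i k x"
    by (rule AZ_transport[OF ik]) blast
  have 1: "1 < n" using n5 by simp
  obtain f' where f': "f' \<in> V aw" "wt f' (K1 0 (n - 1))" "\<And>x. x \<in> S \<Longrightarrow> f x = f' (mon \<pi> 1 * x)"
  proof (rule transport[OF f \<pi>(1) 1, of "K1 0 (n - 1)"])
    show "K1 i k (\<pi> r) = K1 0 (n - 1) r" for r
      using \<pi>(2,3) inj_eq[OF permutes_inj[OF \<pi>(1)], of r 0] inj_eq[OF permutes_inj[OF \<pi>(1)], of r "n - 1"] by (simp add: K1_def)
  qed blast
  have "f x = f' (1\<^sub>m n) * AZ i k x" if "x \<in> S" for x
    using f'(3)[OF that] aw_highest_weight_vector[OF f'(1,2) S_mult[OF mon_S[OF \<pi>(1) 1] that]] e[OF that] by simp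
  thus ?thesis by (rule that)
qed

lemma aw_zero_weight_vector:
  assumes f: "f \<in> V aw" "wt f (\<lambda>_. 1)"
  obtains e where "\<And>x. x \<in> S \<Longrightarrow> f x = (\<Sum>k<n. e k * AZ k k x)"
proof -
  have ex: "\<exists>c. \<forall>t. \<forall>x\<in>S. f (E i j t * x) = f x + t * (c * AZ i j x)" if ij: "i < n" "j < n" "i \<noteq> j" for i j
  proof -
    have no: "\<not> occurs aw (shift (\<lambda>_. 1) i j m)" if "m \<ge> 2" for m
      using occurs_aw_bounds(1)[of "shift (\<lambda>_. 1) i j m" i] ij that by (auto simp: shift_def)
    obtain F where F: "F \<in> V aw" "wt F (shift (\<lambda>_. 1) i j 1)" "\<And>t x. x \<in> S \<Longrightarrow> f (E i j t * x) = f x + t * F x"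
      using E_linear[OF f ij no] by blast
    have "shift (\<lambda>_. 1) i j 1 = K1 i j" by (auto simp: shift_def K1_def fun_eq_iff)
    hence "wt F (K1 i j)" using F(2) by simp
    then obtain c where "\<And>x. x \<in> S \<Longrightarrow> F x = c * AZ i j x"
      using aw_root_weight_vector[OF F(1) _ ij] by blast
    thus ?thesis using F(3) by auto
  qed
  define c where "c i j = (SOME c. \<forall>t. \<forall>x\<in>S. f (E i j t * x) = f x + t * (c * AZ i j x))" for i j
  have c: "f (E i j t * x) = f x + t * (c i j * AZ i j x)" if "i < n" "j < n" "i \<noteq> j" "x \<in> S" for i j t x
    using someI_ex[OF ex[OF that(1-3)]] that(4) unfolding c_def by blast
  have coc: "c i l = c i j + c j l" if ijl: "i < n" "j < n" "l < n" "i \<noteq> j" "j \<noteq> l" "i \<noteq> l" for i j l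
  proof (rule AZ_cancel[OF ijl(1,3,6)])
    fix x assume x: "x \<in> S"
    have y: "E j l 1 * x \<in> S" "E i j 1 * x \<in> S" "E j l 1 * (E i j 1 * x) \<in> S"
      using x ijl by (auto intro!: S_mult)
    have "f (E i j 1 * (E j l 1 * x)) = f (E i l 1 * (E j l 1 * (E i j 1 * x)))"
    proof -
      have "E i j 1 * (E j l 1 * x) = (E i j 1 * E j l 1) * x" using E_assoc[OF x] by simp
      also have "\<dots> = (E i l 1 * (E j l 1 * E i j 1)) * x" using E_commutator[of i j l 1 1] ijl by simp
      also have "\<dots> = E i l 1 * ((E j l 1 * E i j 1) * x)"
        by (rule assoc_mult_mat[of _ n n _ n _ n]) (use x S_carrier in \<open>auto intro: mult_carrier_mat[of _ n n]\<close>)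
      finally show ?thesis using E_assoc[OF x] by simp
    qed
    moreover have "f (E i j 1 * (E j l 1 * x)) = f x + c j l * AZ j l x + c i j * (AZ i j x + AZ i l x)"
    proof -
      have "AZ i j (E j l 1 * x) = AZ i j x + AZ i l x"
        using x ijl by (subst AZ_E) (auto simp: AZ_def algebra_simps)
      thus ?thesis using c[OF ijl(1,2,4) y(1), of 1] c[OF ijl(2,3,5) x, of 1] by simp
    qed
    moreover have "f (E i l 1 * (E j l 1 * (E i j 1 * x))) = f x + c i j * AZ i j x + c j l * (AZ j l x - AZ i l x) + c i l * AZ i l x"
    proof -
      have 1: "AZ j l (E i j 1 * x) = AZ j l x - AZ i l x"
        using x ijl by (subst AZ_E) (auto simp: AZ_def algebra_simps)
      have 2: "AZ i l (E i j 1 * x) = AZ i l x"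
        using x ijl by (subst AZ_E) (auto simp: AZ_def algebra_simps)
      have 3: "AZ i l (E j l 1 * (E i j 1 * x)) = AZ i l (E i j 1 * x)"
        using y ijl by (subst AZ_E) (auto simp: AZ_def algebra_simps)
      show ?thesis
        using c[OF ijl(1,3,6) y(3), of 1] c[OF ijl(2,3,5) y(2), of 1] c[OF ijl(1,2,4) x, of 1] 1 2 3 by simp
    qed
    ultimately show "c i l * AZ i l x = (c i j + c j l) * AZ i l x"
      by (simp add: algebra_simps)
  qed
  obtain e where e: "\<And>i j. i \<in> {..<n} \<Longrightarrow> j \<in> {..<n} \<Longrightarrow> i \<noteq> j \<Longrightarrow> c i j = e i - e j"
  proof (rule cocycle_solution[of 0 "{..<n}" 1 2 c])
    show "0 \<in> {..<n}" "1 \<in> {..<n}" "2 \<in> {..<n}" using n5 by auto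
    show "c i l = c i j + c j l" if "i \<in> {..<n}" "j \<in> {..<n}" "l \<in> {..<n}" "i \<noteq> j" "j \<noteq> l" "i \<noteq> l" for i j l
      using coc[of i j l] that by simp
  qed auto
  define g where "g = (\<lambda>x\<in>S. f x - (\<Sum>k<n. e k * AZ k k x))"
  have TV: "(\<lambda>x\<in>S. \<Sum>k<n. e k * AZ k k x) \<in> V aw" by (intro fsub_sum fsub_smult V_fsub AZ_V) auto
  have gV: "g \<in> V aw" unfolding g_def
    by (intro fsub_diff V_fsub TV fsub_restrict f)
  have gw: "wt g (\<lambda>_. 1)"
    unfolding g_def wtk_def by (auto simp: dil_S AZ_dil K1_diag wtD[OF f(2)] algebra_simps sum_distrib_left)
  have g0: "g x = 0" if x: "x \<in> S" for x
  proof (rule V_zero_if_invariant[OF gV _ _ x])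
    show "g (1\<^sub>m n) = 0"
    proof (rule ccontr)
      assume "g (1\<^sub>m n) \<noteq> 0"
      from wt_one[OF gV gw this, of 0] show False using n5 by simp
    qed
    show "g (E i j t * x) = g x" if ij: "i < j" "j < n" and x: "x \<in> S" for i j t x
    proof -
      have ij': "i < n" "j < n" "i \<noteq> j" using ij by auto
      have "(\<Sum>k<n. e k * AZ k k (E i j t * x)) = (\<Sum>k<n. e k * AZ k k x +
          ((if k = i then t * (e k * AZ i j x) else 0) - (if k = j then t * (e k * AZ i j x) else 0)))"
      proof (rule sum.cong)
        fix k assume "k \<in> {..<n}"
        thus "e k * AZ k k (E i j t * x) = e k * AZ k k x +
          ((if k = i then t * (e k * AZ i j x) else 0) - (if k = j then t * (e k * AZ i j x) else 0))"
          using ij x by (subst AZ_E) (auto simp: AZ_def algebra_simps)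
      qed simp
      also have "\<dots> = (\<Sum>k<n. e k * AZ k k x) + t * ((e i - e j) * AZ i j x)"
        using ij' by (simp add: sum.distrib sum_subtractf algebra_simps)
      finally show ?thesis
        using c[OF ij' x, of t] e[of i j] ij' x S_mult[OF E_S x, of i j t] by (simp add: g_def)
    qed
  qed
  show ?thesis by (rule that[of e]) (use g0 in \<open>auto simp: g_def\<close>)
qed

definition sg :: "(nat \<Rightarrow> nat \<Rightarrow> 'k) \<Rightarrow> 'k mat \<Rightarrow> 'k" where
  "sg m x = (\<Sum>i<n. \<Sum>k<n. m i k * AZ i k x)"

definition sg_functions :: "('k mat \<Rightarrow> 'k) set" where
  "sg_functions = {f. \<exists>m. f = (\<lambda>x\<in>S. sg m x)}"

lemma sg_add: "sg (\<lambda>i k. m i k + m' i k) x = sg m x + sg m' x"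
  by (simp add: sg_def sum.distrib distrib_right)

lemma sg_smult: "sg (\<lambda>i k. a * m i k) x = a * sg m x"
  by (simp add: sg_def sum_distrib_left mult.assoc)

lemma sgset_fsub: "func_sub sg_functions"
  unfolding func_sub_def
proof (intro conjI ballI allI)
  show "sg_functions \<subseteq> extensional S" by (auto simp: sg_functions_def)
  have "(\<lambda>x\<in>S. 0) = (\<lambda>x\<in>S. sg (\<lambda>_ _. 0) x)" by (auto simp: sg_def)
  thus "(\<lambda>x\<in>S. 0) \<in> sg_functions" unfolding sg_functions_def by blast
  fix f assume "f \<in> sg_functions"
  then obtain c where c: "f = (\<lambda>x\<in>S. sg c x)" by (auto simp: sg_functions_def)
  show "(\<lambda>x\<in>S. a * f x) \<in> sg_functions" for a
  proof -
    have "(\<lambda>x\<in>S. a * f x) = (\<lambda>x\<in>S. sg (\<lambda>i j. a * c i j) x)"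
      by (auto simp: c sg_smult)
    thus ?thesis unfolding sg_functions_def by blast
  qed
  fix h assume "h \<in> sg_functions"
  then obtain c' where c': "h = (\<lambda>x\<in>S. sg c' x)" by (auto simp: sg_functions_def)
  have "(\<lambda>x\<in>S. f x + h x) = (\<lambda>x\<in>S. sg (\<lambda>i j. c i j + c' i j) x)"
    by (auto simp: c c' sg_add)
  thus "(\<lambda>x\<in>S. f x + h x) \<in> sg_functions" unfolding sg_functions_def by blast
qed

lemma AZ_sgset:
  assumes "i < n" "k < n"
  shows "(\<lambda>x\<in>S. AZ i k x) \<in> sg_functions"
proof -
  have "(\<lambda>x\<in>S. AZ i k x) = (\<lambda>x\<in>S. sg (\<lambda>i' k'. if k' = k then if i' = i then 1 else 0 else 0) x)"
    using assms by (auto simp: sg_def if_distrib[of "\<lambda>c. c * _"] cong: if_cong)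
  thus ?thesis unfolding sg_functions_def by blast
qed

lemma sg_V: "(\<lambda>x\<in>S. sg m x) \<in> V aw"
  unfolding sg_def by (intro fsub_sum fsub_smult V_fsub AZ_V) auto

theorem V_aw: "V aw = sg_functions"
proof
  show "sg_functions \<subseteq> V aw" using sg_V by (auto simp: sg_functions_def)
  show "V aw \<subseteq> sg_functions"
  proof (rule weight_decomposition[OF sgset_fsub])
    fix f \<kappa> assume f: "f \<in> V aw" "wt f \<kappa>"
    show "f \<in> sg_functions"
    proof (cases "\<exists>x\<in>S. f x \<noteq> 0")
      case False
      hence "f = (\<lambda>x\<in>S. 0)" using V_ext[OF f(1)] by (intro extensionalityI[of _ S]) auto
      thus ?thesis using fsub_zero[OF sgset_fsub] by simp
    next
      case True
      hence "occurs aw \<kappa>" using f unfolding occurs_def by blast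
      thus ?thesis
      proof (cases rule: occurs_aw)
        case (1 \<pi>)
        have pn: "\<pi> r < n" if "r < n" for r using permutes_in_image[OF 1(1), of r] that by auto
        let ?K = "K1 (\<pi> 0) (\<pi> (n - 1))"
        have "wt f ?K"
        proof (subst wt_cong)
          fix r assume "r < n"
          then obtain q where q: "q < n" "r = \<pi> q" by (rule permutes_preimage[OF 1(1)])
          show "?K r = \<kappa> r" using 1(2)[OF q(1)] q by (simp add: K1_def inj_eq[OF permutes_inj[OF 1(1)]])
        qed (rule f)
        moreover have "\<pi> 0 \<noteq> \<pi> (n - 1)" "\<pi> 0 < n" "\<pi> (n - 1) < n"
          using n5 pn by (auto simp: inj_eq[OF permutes_inj[OF 1(1)]])
        ultimately obtain c where c: "\<And>x. x \<in> S \<Longrightarrow> f x = c * AZ (\<pi> 0) (\<pi> (n - 1)) x"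
          using aw_root_weight_vector[OF f(1)] by blast
        show ?thesis
          by (rule restrict_mem[OF f(1) c]) (use n5 pn in \<open>auto intro!: fsub_smult sgset_fsub AZ_sgset\<close>)
      next
        case 2
        have "wt f (\<lambda>_. 1)" by (subst wt_cong[of _ \<kappa>]) (use 2 f in auto)
        then obtain e where e: "\<And>x. x \<in> S \<Longrightarrow> f x = (\<Sum>k<n. e k * AZ k k x)" using aw_zero_weight_vector[OF f(1)] by blast
        have "(\<lambda>x\<in>S. \<Sum>k<n. e k * AZ k k x) \<in> sg_functions"
          by (intro fsub_sum fsub_smult sgset_fsub AZ_sgset) auto
        thus ?thesis by (rule restrict_mem[OF f(1), rotated]) (rule e)
      qed
    qed
  qed
qed

lemma psi_V: "(\<lambda>x\<in>S. psi c x) \<in> V mw"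
  unfolding psi_def by (intro fsub_sum fsub_smult V_fsub PQ_V) auto

theorem V_mw: "V mw = psi_functions"
  using V_mw_subset psi_V by (auto simp: psi_functions_def)

end

section \<open>Contraction and trace of arrays\<close>

text \<open>If the second differences vanish modulo the subgroup \<open>Z\<close>, then off the
  diagonal \<open>d\<close> is a sum \<open>A i + A j + D\<close> modulo \<open>Z\<close>,
  normalised by \<open>A 0 = - D\<close>. Working modulo \<open>Z\<close> lets one statement
  describe both the kernel of \<open>psi\<close>, with \<open>Z = {0}\<close>, and the functions
  modulo a submodule.\<close>

lemma cross_differences_zero:
  fixes d :: "nat \<Rightarrow> nat \<Rightarrow> 'a :: ab_group_add"
  assumes n: "n \<ge> 5" and Z0: "0 \<in> Z" and Zd: "\<And>a b. a \<in> Z \<Longrightarrow> b \<in> Z \<Longrightarrow> a - b \<in> Z"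
    and sym: "\<And>i j. d i j = d j i"
    and cross: "\<And>i j l m. distinct [i, j, l, m] \<Longrightarrow> {i, j, l, m} \<subseteq> {..<n} \<Longrightarrow> d i l - d i m - d j l + d j m \<in> Z"
    and D: "D = d 1 2 - d 0 1 - d 0 2" and A: "\<And>i. A i = (if i = 0 then - D else d 0 i)"
    and ij: "i < n" "j < n" "i \<noteq> j"
  shows "d i j - A i - A j - D \<in> Z"
proof -
  have Zm: "- a \<in> Z" if "a \<in> Z" for a using Zd[OF Z0 that] by simp
  have Za: "a + b \<in> Z" if "a \<in> Z" "b \<in> Z" for a b using Zd[OF that(1) Zm[OF that(2)]] by simp
  define h where "h j k = d j k - A j - A k" for j k
  have hs: "h j k = h k j" for j k by (simp add: h_def sym[of j k] algebra_simps)
  have step: "h j k - h j l \<in> Z" if "distinct [0, j, k, l]" "{j, k, l} \<subseteq> {..<n}" for j k l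
  proof -
    have "d 0 k - d 0 l - d j k + d j l \<in> Z" using that n by (intro cross) auto
    hence "- (d 0 k - d 0 l - d j k + d j l) \<in> Z" by (rule Zm)
    thus ?thesis using that by (simp add: h_def A algebra_simps)
  qed
  have h12: "h 1 2 = D" by (simp add: h_def A D)
  have h1: "h 1 k - D \<in> Z" if "k \<ge> 2" "k < n" for k
  proof (cases "k = 2")
    case True thus ?thesis using h12 Z0 by simp
  next
    case False thus ?thesis using step[of 1 k 2] h12 that by auto
  qed
  have hh: "h j k - D \<in> Z" if "j \<ge> 1" "k \<ge> 1" "j \<noteq> k" "j < n" "k < n" for j k
  proof -
    have "j = 1 \<or> k = 1 \<or> j \<ge> 2 \<and> k \<ge> 2" using that by linarith
    then consider "j = 1" | "k = 1" | "j \<ge> 2" "k \<ge> 2" by blast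
    thus ?thesis
    proof cases
      case 1 thus ?thesis using h1[of k] that by auto
    next
      case 2 thus ?thesis using h1[of j] that hs[of j 1] by auto
    next
      case 3
      have "h j k - h j 1 \<in> Z" using step[of j k 1] 3 that by auto
      moreover have "h j 1 - D \<in> Z" using h1[of j] 3 that hs[of j 1] by auto
      ultimately have "(h j k - h j 1) + (h j 1 - D) \<in> Z" by (rule Za)
      thus ?thesis by simp
    qed
  qed
  show ?thesis
  proof (cases "i = 0 \<or> j = 0")
    case True
    thus ?thesis using ij sym[of i 0] Z0 by (auto simp: A)
  next
    case False
    thus ?thesis using hh[of i j] ij by (simp add: h_def)
  qed
qed

lemma sum_two_units:
  fixes F :: "nat \<Rightarrow> 'a :: comm_ring_1"
  assumes "i < n" "j < n"
  shows "(\<Sum>p<n. F p * ((if p = i then u else 0) + (if p = j then v else 0))) = F i * u + F j * v"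
  using assms by (simp add: distrib_left sum.distrib if_distrib[of "\<lambda>c. _ * c"] cong: if_cong)

lemma sum4_cart:
  "(\<Sum>i<n. \<Sum>j<n. \<Sum>k<n. \<Sum>l<n. f i j k l) =
   (\<Sum>(i, j, k, l)\<in>{..<n} \<times> {..<n} \<times> {..<n} \<times> {..<n :: nat}. f i j k l)"
  by (simp add: sum.cartesian_product)

text \<open>Each index lies in \<open>m - 1\<close> pairs; with \<open>m = n\<close> this is the
  source of the coefficients \<open>n - 1\<close> and \<open>n choose 2\<close>.\<close>

lemma pair_sum:
  fixes A :: "nat \<Rightarrow> 'a :: comm_ring_1"
  shows "(\<Sum>i<m. \<Sum>j<m. if i < j then A i + A j + D else 0) = (of_nat m - 1) * (\<Sum>j<m. A j) + of_nat (m choose 2) * D"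
proof (induction m)
  case 0 thus ?case by (simp add: numeral_2_eq_2)
next
  case (Suc m)
  have "(\<Sum>i<Suc m. \<Sum>j<Suc m. if i < j then A i + A j + D else 0)
    = (\<Sum>i<m. \<Sum>j<Suc m. if i < j then A i + A j + D else 0) + (\<Sum>j<Suc m. if m < j then A m + A j + D else 0)" by simp
  also have "(\<Sum>j<Suc m. if m < j then A m + A j + D else 0) = 0" by (intro sum.neutral) auto
  also have "(\<Sum>i<m. \<Sum>j<Suc m. if i < j then A i + A j + D else 0) = (\<Sum>i<m. \<Sum>j<m. if i < j then A i + A j + D else 0) + (\<Sum>i<m. A i + A m + D)"
    by (simp add: sum.distrib)
  also have "\<dots> = (of_nat m - 1) * (\<Sum>j<m. A j) + of_nat (m choose 2) * D + ((\<Sum>i<m. A i) + of_nat m * (A m + D))"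
    unfolding Suc by (simp add: sum.distrib algebra_simps)
  finally show ?case by (simp add: numeral_2_eq_2 algebra_simps)
qed

context sl5
begin

text \<open>Arrays \<open>c\<close> are arbitrary and \<open>psi c\<close> depends only on \<open>asym c\<close>; passing to antisymmetric arrays
  would need a division by \<open>4\<close>.\<close>

definition asym :: "(nat \<Rightarrow> nat \<Rightarrow> nat \<Rightarrow> nat \<Rightarrow> 'k) \<Rightarrow> nat \<Rightarrow> nat \<Rightarrow> nat \<Rightarrow> nat \<Rightarrow> 'k" where
  "asym c i j k l = c i j k l - c j i k l - c i j l k + c j i l k"

definition kap :: "(nat \<Rightarrow> nat \<Rightarrow> nat \<Rightarrow> nat \<Rightarrow> 'k) \<Rightarrow> nat \<Rightarrow> nat \<Rightarrow> 'k" where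
  "kap c p q = (\<Sum>j<n. asym c p j q j)"

text \<open>The sum of \<open>asym c i j i j\<close> over \<open>i < j\<close>, that is, half the
  trace of the contraction, written without a division.\<close>

definition pr :: "(nat \<Rightarrow> nat \<Rightarrow> nat \<Rightarrow> nat \<Rightarrow> 'k) \<Rightarrow> 'k" where
  "pr c = (\<Sum>i<n. \<Sum>j<n. c i j i j - c i j j i)"

lemma asym_anti: "asym c j i k l = - asym c i j k l" "asym c i j l k = - asym c i j k l"
  "asym c i i k l = 0" "asym c i j k k = 0"
  by (simp_all add: asym_def)

lemma kap_add: "kap (\<lambda>i j k l. c i j k l + c' i j k l) p q = kap c p q + kap c' p q"
  unfolding kap_def sum.distrib[symmetric] by (intro sum.cong) (auto simp: asym_def)

lemma kap_smult: "kap (\<lambda>i j k l. a * c i j k l) p q = a * kap c p q"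
  unfolding kap_def sum_distrib_left by (intro sum.cong) (auto simp: asym_def algebra_simps)

lemma pr_add: "pr (\<lambda>i j k l. c i j k l + c' i j k l) = pr c + pr c'"
  unfolding pr_def sum.distrib[symmetric] by (intro sum.cong) auto

lemma pr_smult: "pr (\<lambda>i j k l. a * c i j k l) = a * pr c"
  unfolding pr_def sum_distrib_left by (intro sum.cong) (auto simp: algebra_simps)

lemma psi_add: "psi (\<lambda>i j k l. c i j k l + c' i j k l) x = psi c x + psi c' x"
  by (simp add: psi_def sum.distrib distrib_right)

lemma psi_smult: "psi (\<lambda>i j k l. a * c i j k l) x = a * psi c x"
  by (simp add: psi_def sum_distrib_left mult.assoc)

text \<open>The link between the two invariants: with 2 invertible, \<open>pr\<close> is determined
  by \<open>kap\<close>; in characteristic 2, \<open>kap\<close> is traceless and \<open>pr\<close>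
  is independent of it. The case distinction for \<open>p = 2\<close> rests on this.\<close>

lemma trace_kap: "(\<Sum>p<n. kap c p p) = 2 * pr c"
proof -
  have "(\<Sum>p<n. kap c p p) = (\<Sum>p<n. \<Sum>j<n. c p j p j - c p j j p) + (\<Sum>p<n. \<Sum>j<n. c j p j p - c j p p j)"
    unfolding kap_def sum.distrib[symmetric] by (intro sum.cong) (auto simp: asym_def)
  also have "(\<Sum>p<n. \<Sum>j<n. c j p j p - c j p p j) = pr c" unfolding pr_def by (rule sum.swap)
  finally show ?thesis by (simp add: pr_def)
qed

lemma pr_asym: "pr c = (\<Sum>i<n. \<Sum>j<n. if i < j then asym c i j i j else 0)"
proof -
  let ?f = "\<lambda>i j. c i j i j - c i j j i"
  have "pr c = (\<Sum>i<n. \<Sum>j<n. (if i < j then ?f i j else 0) + (if j < i then ?f i j else 0))"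
    unfolding pr_def by (intro sum.cong) auto
  also have "\<dots> = (\<Sum>i<n. \<Sum>j<n. if i < j then ?f i j else 0) + (\<Sum>i<n. \<Sum>j<n. if j < i then ?f i j else 0)"
    by (simp add: sum.distrib)
  also have "(\<Sum>i<n. \<Sum>j<n. if j < i then ?f i j else 0) = (\<Sum>i<n. \<Sum>j<n. if i < j then ?f j i else 0)"
    by (rule sum.swap)
  also have "(\<Sum>i<n. \<Sum>j<n. if i < j then ?f i j else 0) + (\<Sum>i<n. \<Sum>j<n. if i < j then ?f j i else 0)
    = (\<Sum>i<n. \<Sum>j<n. if i < j then asym c i j i j else 0)"
    unfolding sum.distrib[symmetric] by (intro sum.cong refl) (simp add: asym_def)
  finally show ?thesis .
qed

text \<open>Reindexing moves the antisymmetry of the minors onto the coefficients, so that values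
  can be computed from plain products of entries.\<close>

lemma psi_asym: "psi c x = (\<Sum>i<n. \<Sum>j<n. \<Sum>k<n. \<Sum>l<n.
   asym c i j k l * (iv x $$ (0, i) * iv x $$ (1, j) * (x $$ (k, n - 2) * x $$ (l, n - 1))))"
proof -
  define g where "g i j k l = iv x $$ (0, i) * iv x $$ (1, j) * (x $$ (k, n - 2) * x $$ (l, n - 1))" for i j k l
  let ?S = "\<lambda>f. \<Sum>i<n. \<Sum>j<n. \<Sum>k<n. \<Sum>l<n. (f i j k l :: 'k)"
  have sw1: "?S (\<lambda>i j k l. f j i k l) = ?S f" for f by (rule sum.swap)
  have sw2: "?S (\<lambda>i j k l. f i j l k) = ?S f" for f
    by (intro sum.cong refl sum.swap)
  have "psi c x = ?S (\<lambda>i j k l. c i j k l * g i j k l) - ?S (\<lambda>i j k l. c i j k l * g j i k l)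
     - ?S (\<lambda>i j k l. c i j k l * g i j l k) + ?S (\<lambda>i j k l. c i j k l * g j i l k)"
    unfolding psi_def sum.distrib[symmetric] sum_subtractf[symmetric]
    by (intro sum.cong refl) (simp add: PQ_def Pm_def Qm_def g_def algebra_simps)
  also have "?S (\<lambda>i j k l. c i j k l * g j i k l) = ?S (\<lambda>i j k l. c j i k l * g i j k l)"
    using sw1[of "\<lambda>i j k l. c j i k l * g i j k l"] .
  also have "?S (\<lambda>i j k l. c i j k l * g i j l k) = ?S (\<lambda>i j k l. c i j l k * g i j k l)"
    using sw2[of "\<lambda>i j k l. c i j l k * g i j k l"] .
  also have "?S (\<lambda>i j k l. c i j k l * g j i l k) = ?S (\<lambda>i j k l. c j i l k * g i j k l)"
    using sw1[of "\<lambda>i j k l. c j i k l * g i j l k"] sw2[of "\<lambda>i j k l. c j i l k * g i j k l"] by simp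
  finally show ?thesis
    unfolding sum.distrib[symmetric] sum_subtractf[symmetric] g_def asym_def by (simp add: algebra_simps)
qed

text \<open>A matrix whose inverse has first rows \<open>e\<^sub>i, e\<^sub>j\<close> and whose last columns are \<open>e\<^sub>k, e\<^sub>l\<close>;
  the fifth index absorbs the sign of the permutation.\<close>

lemma frame:
  assumes d: "distinct [i, j, k, l]" "{i, j, k, l} \<subseteq> {..<n}"
  obtains w where "w \<in> S" "\<And>q. q < n \<Longrightarrow> iv w $$ (0, q) = (if q = i then 1 else 0)"
    "\<And>q. q < n \<Longrightarrow> iv w $$ (1, q) = (if q = j then 1 else 0)"
    "\<And>q. q < n \<Longrightarrow> w $$ (q, n - 2) = (if q = k then 1 else 0)"
    "\<And>q. q < n \<Longrightarrow> w $$ (q, n - 1) = (if q = l then 1 else 0)"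
proof -
  have d': "{i, j, k, l} \<subseteq> {0..<n}" using d by auto
  have 0: "distinct [0, 1, n - 2, n - 1]" "{0, 1, n - 2, n - 1} \<subseteq> {0..<n}" using n5 by auto
  obtain \<pi> where \<pi>: "\<pi> permutes {0..<n}" "\<pi> i = 0" "\<pi> j = 1" "\<pi> k = n - 2" "\<pi> l = n - 1"
    by (rule permutation4[OF d(1) d' 0])
  have "\<not> {..<n} \<subseteq> {i, j, k, l}"
  proof
    assume "{..<n} \<subseteq> {i, j, k, l}"
    hence "card {..<n} \<le> card {i, j, k, l}" by (intro card_mono) auto
    also have "\<dots> \<le> 4" using card_length[of "[i, j, k, l]"] by simp
    finally show False using n5 by simp
  qed
  then obtain q where q: "q < n" "q \<notin> {i, j, k, l}" by auto
  have inj: "\<pi> a = \<pi> b \<longleftrightarrow> a = b" for a b by (rule inj_eq[OF permutes_inj[OF \<pi>(1)]])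
  let ?w = "mon \<pi> q"
  have e: "?w $$ (r, c) = (if c = \<pi> r then (if r = q then signof \<pi> else 1) else 0)" if "r < n" "c < n" for r c
    using that by (simp add: mon_def)
  have ei: "iv ?w $$ (c, r) = ?w $$ (r, c)" if "r < n" "c < n" for r c
    using that unfolding iv_mon[OF \<pi>(1) q(1)] by (auto simp: mon_def)
  show ?thesis
  proof (rule that[OF mon_S[OF \<pi>(1) q(1)]])
    have u: "?w $$ (r, \<pi> a) = (if r = a then 1 else 0)" if "r < n" "a \<in> {i, j, k, l}" for r a
    proof -
      have "\<pi> a < n" using permutes_in_image[OF \<pi>(1), of a] that(2) d' by auto
      thus ?thesis using that q(2) inj[of a r] by (auto simp: e)
    qed
    have n: "\<pi> i < n" "\<pi> j < n" using n5 \<pi> by auto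
    show "iv ?w $$ (0, r) = (if r = i then 1 else 0)" if "r < n" for r
      using ei[OF that n(1)] u[OF that, of i] by (simp only: \<pi> insert_iff simp_thms)
    show "iv ?w $$ (1, r) = (if r = j then 1 else 0)" if "r < n" for r
      using ei[OF that n(2)] u[OF that, of j] by (simp only: \<pi> insert_iff simp_thms)
    show "?w $$ (r, n - 2) = (if r = k then 1 else 0)" if "r < n" for r
      using u[OF that, of k] by (simp only: \<pi> insert_iff simp_thms)
    show "?w $$ (r, n - 1) = (if r = l then 1 else 0)" if "r < n" for r
      using u[OF that, of l] by (simp only: \<pi> insert_iff simp_thms)
  qed
qed

text \<open>A frame isolates one coefficient with distinct indices. Translating the frame by one
  root element, and by a second one commuting with it, brings in coefficients with one and with two
  repeated indices, the earlier relations being available.\<close>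

lemma psi_zero:
  assumes z: "\<And>x. x \<in> S \<Longrightarrow> psi c x = 0" and d: "distinct [i, j, l, m]" "{i, j, l, m} \<subseteq> {..<n}"
  shows "asym c i j l m = 0" "asym c i l j l = asym c i m j m"
    "asym c i l i l - asym c i m i m - asym c j l j l + asym c j m j m = 0"
proof -
  \<comment> \<open>At the evaluation points each of the four vectors has at most two nonzero
    entries, so the fourfold sum collapses to sixteen terms.\<close>
  have ev: "(\<Sum>p<n. \<Sum>q<n. \<Sum>r<n. \<Sum>s<n. asym c p q r s *
      (((if p = i1 then u1 else 0) + (if p = i2 then u2 else 0)) * ((if q = j1 then v1 else 0) + (if q = j2 then v2 else 0))
      * (((if r = k1 then w1 else 0) + (if r = k2 then w2 else 0)) * ((if s = l1 then y1 else 0) + (if s = l2 then y2 else 0)))))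
     = u1 * (v1 * (w1 * (y1 * asym c i1 j1 k1 l1 + y2 * asym c i1 j1 k1 l2) + w2 * (y1 * asym c i1 j1 k2 l1 + y2 * asym c i1 j1 k2 l2))
           + v2 * (w1 * (y1 * asym c i1 j2 k1 l1 + y2 * asym c i1 j2 k1 l2) + w2 * (y1 * asym c i1 j2 k2 l1 + y2 * asym c i1 j2 k2 l2)))
     + u2 * (v1 * (w1 * (y1 * asym c i2 j1 k1 l1 + y2 * asym c i2 j1 k1 l2) + w2 * (y1 * asym c i2 j1 k2 l1 + y2 * asym c i2 j1 k2 l2))
           + v2 * (w1 * (y1 * asym c i2 j2 k1 l1 + y2 * asym c i2 j2 k1 l2) + w2 * (y1 * asym c i2 j2 k2 l1 + y2 * asym c i2 j2 k2 l2)))"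
    if b: "i1 < n" "i2 < n" "j1 < n" "j2 < n" "k1 < n" "k2 < n" "l1 < n" "l2 < n"
    for i1 i2 j1 j2 k1 k2 l1 l2 u1 u2 v1 v2 w1 w2 y1 y2
  proof -
    let ?d = "\<lambda>p i u j v. (if p = i then u else 0) + (if p = j then (v :: 'k) else 0)"
    have "(\<Sum>p<n. \<Sum>q<n. \<Sum>r<n. \<Sum>s<n. asym c p q r s *
      (?d p i1 u1 i2 u2 * ?d q j1 v1 j2 v2 * (?d r k1 w1 k2 w2 * ?d s l1 y1 l2 y2)))
     = (\<Sum>p<n. (\<Sum>q<n. (\<Sum>r<n. (\<Sum>s<n. asym c p q r s * ?d s l1 y1 l2 y2) * ?d r k1 w1 k2 w2) * ?d q j1 v1 j2 v2) * ?d p i1 u1 i2 u2)"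
      unfolding sum_distrib_right by (intro sum.cong refl) (simp only: ac_simps)
    also have "\<dots> = u1 * (v1 * (w1 * (y1 * asym c i1 j1 k1 l1 + y2 * asym c i1 j1 k1 l2) + w2 * (y1 * asym c i1 j1 k2 l1 + y2 * asym c i1 j1 k2 l2))
           + v2 * (w1 * (y1 * asym c i1 j2 k1 l1 + y2 * asym c i1 j2 k1 l2) + w2 * (y1 * asym c i1 j2 k2 l1 + y2 * asym c i1 j2 k2 l2)))
     + u2 * (v1 * (w1 * (y1 * asym c i2 j1 k1 l1 + y2 * asym c i2 j1 k1 l2) + w2 * (y1 * asym c i2 j1 k2 l1 + y2 * asym c i2 j1 k2 l2))
           + v2 * (w1 * (y1 * asym c i2 j2 k1 l1 + y2 * asym c i2 j2 k1 l2) + w2 * (y1 * asym c i2 j2 k2 l1 + y2 * asym c i2 j2 k2 l2)))"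
      unfolding sum_two_units[OF b(7,8)] sum_two_units[OF b(5,6)] sum_two_units[OF b(3,4)] sum_two_units[OF b(1,2)]
      by (simp only: mult.commute)
    finally show ?thesis .
  qed
  have K0: "asym c i j k l = 0" if d: "distinct [i, j, k, l]" "{i, j, k, l} \<subseteq> {..<n}" for i j k l
  proof -
    obtain w where w: "w \<in> S" "\<And>q. q < n \<Longrightarrow> iv w $$ (0, q) = (if q = i then 1 else 0)"
      "\<And>q. q < n \<Longrightarrow> iv w $$ (1, q) = (if q = j then 1 else 0)"
      "\<And>q. q < n \<Longrightarrow> w $$ (q, n - 2) = (if q = k then 1 else 0)"
      "\<And>q. q < n \<Longrightarrow> w $$ (q, n - 1) = (if q = l then 1 else 0)"
      using frame[OF d] by blast
    have "psi c w = (\<Sum>p<n. \<Sum>q<n. \<Sum>r<n. \<Sum>s<n. asym c p q r s *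
      (((if p = i then 1 else 0) + (if p = i then 0 else 0)) * ((if q = j then 1 else 0) + (if q = j then 0 else 0))
      * (((if r = k then 1 else 0) + (if r = k then 0 else 0)) * ((if s = l then 1 else 0) + (if s = l then 0 else 0)))))"
      unfolding psi_asym using w by (intro sum.cong refl) simp
    also have "\<dots> = asym c i j k l" using d by (subst ev) auto
    finally show ?thesis using z[OF w(1)] by simp
  qed
  show "asym c i j l m = 0" by (rule K0[OF d])
  have K1: "asym c i l j l = asym c i m j m" if d: "distinct [i, j, l, m]" "{i, j, l, m} \<subseteq> {..<n}" for i j l m
  proof -
    have d': "distinct [i, l, j, m]" "{i, l, j, m} \<subseteq> {..<n}" using d by auto
    obtain w where w: "w \<in> S" "\<And>q. q < n \<Longrightarrow> iv w $$ (0, q) = (if q = i then 1 else 0)"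
      "\<And>q. q < n \<Longrightarrow> iv w $$ (1, q) = (if q = l then 1 else 0)"
      "\<And>q. q < n \<Longrightarrow> w $$ (q, n - 2) = (if q = j then 1 else 0)"
      "\<And>q. q < n \<Longrightarrow> w $$ (q, n - 1) = (if q = m then 1 else 0)"
      using frame[OF d'] by blast
    let ?x = "E l m 1 * w"
    have x: "?x \<in> S" using w d by (intro S_mult) auto
    have "psi c ?x = (\<Sum>p<n. \<Sum>q<n. \<Sum>r<n. \<Sum>s<n. asym c p q r s *
      (((if p = i then 1 else 0) + (if p = i then 0 else 0)) * ((if q = l then 1 else 0) + (if q = m then - 1 else 0))
      * (((if r = j then 1 else 0) + (if r = j then 0 else 0)) * ((if s = m then 1 else 0) + (if s = l then 1 else 0)))))"
      unfolding psi_asym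
    proof (intro sum.cong refl arg_cong2[of _ _ _ _ "(*)"])
      fix p q r s assume b: "p \<in> {..<n}" "q \<in> {..<n}" "r \<in> {..<n}" "s \<in> {..<n}"
      show "iv ?x $$ (0, p) = (if p = i then 1 else 0) + (if p = i then 0 else 0)"
        using w d b n5 by (simp add: iv_E_mult)
      show "iv ?x $$ (1, q) = (if q = l then 1 else 0) + (if q = m then - 1 else 0)"
        using w d b n5 by (simp add: iv_E_mult)
      show "?x $$ (r, n - 2) = (if r = j then 1 else 0) + (if r = j then 0 else 0)"
        using w d b n5 by (simp add: E_mult_entry S_carrier del: index_mult_mat(1))
      show "?x $$ (s, n - 1) = (if s = m then 1 else 0) + (if s = l then 1 else 0)"
        using w d b n5 by (simp add: E_mult_entry S_carrier del: index_mult_mat(1))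
    qed
    also have "\<dots> = asym c i l j m + asym c i l j l - asym c i m j m - asym c i m j l" using d by (subst ev) auto
    finally show ?thesis using z[OF x] K0[of i l j m] K0[of i m j l] d by auto
  qed
  show "asym c i l j l = asym c i m j m" by (rule K1[OF d])
  have d': "distinct [i, l, j, m]" "{i, l, j, m} \<subseteq> {..<n}" using d by auto
  obtain w where w: "w \<in> S" "\<And>q. q < n \<Longrightarrow> iv w $$ (0, q) = (if q = i then 1 else 0)"
    "\<And>q. q < n \<Longrightarrow> iv w $$ (1, q) = (if q = l then 1 else 0)"
    "\<And>q. q < n \<Longrightarrow> w $$ (q, n - 2) = (if q = j then 1 else 0)"
    "\<And>q. q < n \<Longrightarrow> w $$ (q, n - 1) = (if q = m then 1 else 0)"
    using frame[OF d'] by blast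
  let ?y = "E l m 1 * w"
  let ?x = "E i j 1 * ?y"
  have y: "?y \<in> S" using w d by (intro S_mult) auto
  have x: "?x \<in> S" by (rule S_mult[OF E_S y]) (use d in auto)
  have "psi c ?x = (\<Sum>p<n. \<Sum>q<n. \<Sum>r<n. \<Sum>s<n. asym c p q r s *
    (((if p = i then 1 else 0) + (if p = j then - 1 else 0)) * ((if q = l then 1 else 0) + (if q = m then - 1 else 0))
    * (((if r = j then 1 else 0) + (if r = i then 1 else 0)) * ((if s = m then 1 else 0) + (if s = l then 1 else 0)))))"
    unfolding psi_asym
  proof (intro sum.cong refl arg_cong2[of _ _ _ _ "(*)"])
    fix p q r s assume b: "p \<in> {..<n}" "q \<in> {..<n}" "r \<in> {..<n}" "s \<in> {..<n}"
    show "iv ?x $$ (0, p) = (if p = i then 1 else 0) + (if p = j then - 1 else 0)"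
      using w d b n5 y by (simp add: iv_E_mult)
    show "iv ?x $$ (1, q) = (if q = l then 1 else 0) + (if q = m then - 1 else 0)"
      using w d b n5 y by (simp add: iv_E_mult)
    show "?x $$ (r, n - 2) = (if r = j then 1 else 0) + (if r = i then 1 else 0)"
      using w d b n5 y by (simp add: E_mult_entry S_carrier del: index_mult_mat(1))
    show "?x $$ (s, n - 1) = (if s = m then 1 else 0) + (if s = l then 1 else 0)"
      using w d b n5 y by (simp add: E_mult_entry S_carrier del: index_mult_mat(1))
  qed
  also have "\<dots> = (asym c i l j m + asym c i l j l + asym c i l i m + asym c i l i l
      - asym c i m j m - asym c i m j l - asym c i m i m - asym c i m i l)
      - (asym c j l j m + asym c j l j l + asym c j l i m + asym c j l i l
      - asym c j m j m - asym c j m j l - asym c j m i m - asym c j m i l)"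
    using d by (subst ev) (auto simp: algebra_simps)
  finally have "asym c i l j m + asym c i l j l + asym c i l i m + asym c i l i l
      - asym c i m j m - asym c i m j l - asym c i m i m - asym c i m i l
      = asym c j l j m + asym c j l j l + asym c j l i m + asym c j l i l
      - asym c j m j m - asym c j m j l - asym c j m i m - asym c j m i l"
    using z[OF x] by simp
  moreover have "asym c i l j m = 0" "asym c i m j l = 0" "asym c j l i m = 0" "asym c j m i l = 0"
    using d by (auto intro!: K0)
  moreover have "asym c i l j l = asym c i m j m" "asym c j l i l = asym c j m i m"
    using d by (auto intro!: K1)
  \<comment> \<open>Antisymmetry in both pairs moves the repeated index to the place required by
    \<open>K1\<close>.\<close>
  moreover have "asym c i l i m = asym c j l j m"
    using K1[of l m i j] d asym_anti(1)[of c l i m i] asym_anti(2)[of c i l i m] asym_anti(1)[of c l j m j] asym_anti(2)[of c j l j m]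
    by auto
  moreover have "asym c i m i l = asym c j m j l"
    using K1[of m l i j] d asym_anti(1)[of c m i l i] asym_anti(2)[of c i m i l] asym_anti(1)[of c m j l j] asym_anti(2)[of c j m j l]
    by auto
  ultimately show "asym c i l i l - asym c i m i m - asym c j l j l + asym c j m j m = 0"
    by (simp add: algebra_simps)
qed

lemma psi_kernel:
  assumes z: "\<forall>x\<in>S. psi c x = 0"
  shows "\<exists>r A D. (\<forall>i j l. distinct [i, j, l] \<longrightarrow> {i, j, l} \<subseteq> {..<n} \<longrightarrow> asym c i l j l = r i j) \<and>
    (\<forall>i j. i < n \<longrightarrow> j < n \<longrightarrow> i \<noteq> j \<longrightarrow> asym c i j i j = A i + A j + D) \<and> A 0 = - D"
proof -
  define d where "d i j = asym c i j i j" for i j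
  define D where "D = d 1 2 - d 0 1 - d 0 2"
  define A where "A i = (if i = 0 then - D else d 0 i)" for i
  have sym: "d i j = d j i" for i j
    unfolding d_def using asym_anti(1)[of c i j i j] asym_anti(2)[of c j i i j] by simp
  have dA: "d i j - A i - A j - D \<in> {0}" if "i < n" "j < n" "i \<noteq> j" for i j
  proof (rule cross_differences_zero[OF n5 _ _ sym _ D_def A_def that])
    show "d i l - d i m - d j l + d j m \<in> {0}" if "distinct [i, j, l, m]" "{i, j, l, m} \<subseteq> {..<n}" for i j l m
      using psi_zero(3)[OF z[rule_format] that] by (simp add: d_def)
  qed auto
  \<comment> \<open>By \<open>psi_zero\<close> the value is independent of the third index, so one
    is chosen.\<close>
  define r where "r i j = asym c i (SOME l. l < n \<and> l \<noteq> i \<and> l \<noteq> j) j (SOME l. l < n \<and> l \<noteq> i \<and> l \<noteq> j)" for i j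
  show ?thesis
  proof (intro exI[of _ r] exI[of _ A] exI[of _ D] conjI allI impI)
    fix i j l assume l: "distinct [i, j, l]" "{i, j, l} \<subseteq> {..<n}"
    let ?l = "SOME l. l < n \<and> l \<noteq> i \<and> l \<noteq> j"
    have "?l < n \<and> ?l \<noteq> i \<and> ?l \<noteq> j" by (rule someI[of _ l]) (use l in auto)
    thus "asym c i l j l = r i j" unfolding r_def
      using psi_zero(2)[OF z[rule_format], of i j l ?l] l by (cases "l = ?l") auto
  next
    fix i j assume "i < n" "j < n" "i \<noteq> j"
    from dA[OF this] show "asym c i j i j = A i + A j + D" by (simp add: d_def algebra_simps)
  qed (simp add: A_def)
qed

lemma sum_except:
  fixes f :: "nat \<Rightarrow> 'b :: ab_group_add"
  assumes "\<And>l. l < n \<Longrightarrow> l \<notin> I \<Longrightarrow> f l = g l" "\<And>l. l \<in> I \<Longrightarrow> f l = 0" "finite I" "I \<subseteq> {..<n}"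
  shows "(\<Sum>l<n. f l) = (\<Sum>l<n. g l) - (\<Sum>l\<in>I. g l)"
proof -
  have "(\<Sum>l<n. f l) = (\<Sum>l\<in>{..<n} - I. f l)"
    using assms by (intro sum.mono_neutral_right) auto
  also have "\<dots> = (\<Sum>l\<in>{..<n} - I. g l)" using assms by (intro sum.cong) auto
  also have "\<dots> = (\<Sum>l<n. g l) - (\<Sum>l\<in>I. g l)" using assms by (intro sum_diff) auto
  finally show ?thesis .
qed

text \<open>Cauchy-Binet for \<open>iv x * x = 1\<close>: the sum is the 2 by 2 minor of the
  identity in rows 0, 1 and columns \<open>n - 2\<close>, \<open>n - 1\<close>. It is computed as
  \<open>pr\<close> of a decomposable array.\<close>

lemma pair_zero:
  assumes x: "x \<in> S"
  shows "(\<Sum>i<n. \<Sum>j<n. if i < j then PQ i j i j x else 0) = 0"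
proof -
  have z: "(\<Sum>k<n. iv x $$ (r, k) * x $$ (k, q)) = 0" if "r < 2" "n - 2 \<le> q" "q < n" for r q
    using iv_left_sum[OF x, of r q] that n5 by simp
  have "(\<Sum>i<n. \<Sum>j<n. if i < j then PQ i j i j x else 0) = pr (\<lambda>i j k l. iv x $$ (0, i) * iv x $$ (1, j) * (x $$ (k, n - 2) * x $$ (l, n - 1)))"
    unfolding pr_asym by (intro sum.cong refl) (auto simp: asym_def PQ_def Pm_def Qm_def algebra_simps)
  also have "\<dots> = (\<Sum>i<n. iv x $$ (0, i) * x $$ (i, n - 2)) * (\<Sum>j<n. iv x $$ (1, j) * x $$ (j, n - 1))
     - (\<Sum>i<n. iv x $$ (0, i) * x $$ (i, n - 1)) * (\<Sum>j<n. iv x $$ (1, j) * x $$ (j, n - 2))"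
    unfolding pr_def sum_product sum_subtractf[symmetric] by (intro sum.cong refl) (simp add: algebra_simps)
  also have "\<dots> = 0" using z n5 by simp
  finally show ?thesis .
qed

text \<open>The contraction has \<open>n - 2\<close> surviving terms off the diagonal and
  \<open>n - 1\<close> on it, where each is \<open>A i + A l + D\<close>. An invariant made of
  \<open>kap\<close> and \<open>pr\<close> descends to functions when it vanishes on these
  right-hand sides.\<close>

lemma psi_zero_kap:
  assumes z: "\<forall>x\<in>S. psi c x = 0"
  obtains r A D where "\<And>i j. i < n \<Longrightarrow> j < n \<Longrightarrow> i \<noteq> j \<Longrightarrow> kap c i j = (of_nat n - 2) * r i j"
    "\<And>i. i < n \<Longrightarrow> kap c i i = (of_nat n - 2) * A i + (\<Sum>j<n. A j) + (of_nat n - 1) * D"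
    "pr c = (of_nat n - 1) * (\<Sum>j<n. A j) + of_nat (n choose 2) * D"
proof -
  obtain r A D where
    r: "\<And>i j l. distinct [i, j, l] \<Longrightarrow> {i, j, l} \<subseteq> {..<n} \<Longrightarrow> asym c i l j l = r i j" and
    A: "\<And>i j. i < n \<Longrightarrow> j < n \<Longrightarrow> i \<noteq> j \<Longrightarrow> asym c i j i j = A i + A j + D"
    using psi_kernel[OF z] by auto
  show ?thesis
  proof (rule that[of r A D])
    fix i j assume ij: "i < n" "j < n" "i \<noteq> j"
    have "kap c i j = (\<Sum>l<n. r i j) - (\<Sum>l\<in>{i, j}. r i j)"
      unfolding kap_def by (rule sum_except) (use ij r in \<open>auto simp: asym_anti(3,4)\<close>)
    thus "kap c i j = (of_nat n - 2) * r i j" using ij by (simp add: algebra_simps)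
  next
    fix i assume i: "i < n"
    have "kap c i i = (\<Sum>l<n. A i + A l + D) - (\<Sum>l\<in>{i}. A i + A l + D)"
      unfolding kap_def by (rule sum_except) (use i A in \<open>auto simp: asym_anti(3,4)\<close>)
    thus "kap c i i = (of_nat n - 2) * A i + (\<Sum>j<n. A j) + (of_nat n - 1) * D"
      by (simp add: sum.distrib algebra_simps)
  next
    have "pr c = (\<Sum>i<n. \<Sum>j<n. if i < j then A i + A j + D else 0)"
      unfolding pr_asym using A by (intro sum.cong) auto
    thus "pr c = (of_nat n - 1) * (\<Sum>j<n. A j) + of_nat (n choose 2) * D" using pair_sum[where A = A and m = n and D = D] by simp
  qed
qed

section \<open>The group action on arrays and matrices\<close>

definition ga :: "'k mat \<Rightarrow> (nat \<Rightarrow> nat \<Rightarrow> nat \<Rightarrow> nat \<Rightarrow> 'k) \<Rightarrow> nat \<Rightarrow> nat \<Rightarrow> nat \<Rightarrow> nat \<Rightarrow> 'k" where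
  "ga g c i' j' k' l' = (\<Sum>i<n. \<Sum>j<n. \<Sum>k<n. \<Sum>l<n.
     c i j k l * (g $$ (i', i) * g $$ (j', j) * (iv g $$ (k, k') * iv g $$ (l, l'))))"

text \<open>Conjugation of the matrix \<open>m\<close> by \<open>g\<close>.\<close>

definition sga :: "'k mat \<Rightarrow> (nat \<Rightarrow> nat \<Rightarrow> 'k) \<Rightarrow> nat \<Rightarrow> nat \<Rightarrow> 'k" where
  "sga g m p q = (\<Sum>i<n. \<Sum>k<n. m i k * (g $$ (p, i) * iv g $$ (k, q)))"

lemma iv_entry_act:
  assumes g: "g \<in> S" and x: "x \<in> S" and r: "r < n" "i < n"
  shows "iv (iv g * x) $$ (r, i) = (\<Sum>i'<n. iv x $$ (r, i') * g $$ (i', i))"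
proof -
  have "iv (iv g * x) = iv x * g" using iv_mult[OF iv_S[OF g] x] g by simp
  thus ?thesis using S_entry_mult[OF iv_S[OF x] g r] by simp
qed

lemma PQ_act:
  assumes g: "g \<in> S" and x: "x \<in> S" and b: "i < n" "j < n" "k < n" "l < n"
  shows "PQ i j k l (iv g * x) = (\<Sum>i'<n. \<Sum>j'<n. \<Sum>k'<n. \<Sum>l'<n.
     g $$ (i', i) * g $$ (j', j) * (iv g $$ (k, k') * iv g $$ (l, l')) * PQ i' j' k' l' x)"
proof -
  have P: "Pm i j (iv g * x) = (\<Sum>i'<n. \<Sum>j'<n. g $$ (i', i) * g $$ (j', j) * Pm i' j' x)"
  proof -
    have "Pm i j (iv g * x) = (\<Sum>i'<n. \<Sum>j'<n. iv x $$ (0, i') * g $$ (i', i) * (iv x $$ (1, j') * g $$ (j', j)))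
       - (\<Sum>j'<n. \<Sum>i'<n. iv x $$ (0, j') * g $$ (j', j) * (iv x $$ (1, i') * g $$ (i', i)))"
      using iv_entry_act[OF g x] b n5 by (simp add: Pm_def sum_product)
    also have "(\<Sum>j'<n. \<Sum>i'<n. iv x $$ (0, j') * g $$ (j', j) * (iv x $$ (1, i') * g $$ (i', i)))
      = (\<Sum>i'<n. \<Sum>j'<n. iv x $$ (0, j') * g $$ (j', j) * (iv x $$ (1, i') * g $$ (i', i)))" by (rule sum.swap)
    finally show ?thesis
      unfolding sum_subtractf[symmetric] by (simp add: Pm_def algebra_simps)
  qed
  have Q: "Qm k l (iv g * x) = (\<Sum>k'<n. \<Sum>l'<n. iv g $$ (k, k') * iv g $$ (l, l') * Qm k' l' x)"
  proof -
    have e: "(iv g * x) $$ (r, q) = (\<Sum>r'<n. iv g $$ (r, r') * x $$ (r', q))" if "r < n" "q < n" for r q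
      by (rule S_entry_mult[OF iv_S[OF g] x that])
    have "Qm k l (iv g * x) = (\<Sum>k'<n. \<Sum>l'<n. iv g $$ (k, k') * x $$ (k', n - 2) * (iv g $$ (l, l') * x $$ (l', n - 1)))
       - (\<Sum>l'<n. \<Sum>k'<n. iv g $$ (l, l') * x $$ (l', n - 2) * (iv g $$ (k, k') * x $$ (k', n - 1)))"
      using e b n5 by (simp add: Qm_def sum_product del: index_mult_mat(1))
    also have "(\<Sum>l'<n. \<Sum>k'<n. iv g $$ (l, l') * x $$ (l', n - 2) * (iv g $$ (k, k') * x $$ (k', n - 1)))
      = (\<Sum>k'<n. \<Sum>l'<n. iv g $$ (l, l') * x $$ (l', n - 2) * (iv g $$ (k, k') * x $$ (k', n - 1)))" by (rule sum.swap)
    finally show ?thesis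
      unfolding sum_subtractf[symmetric] by (simp add: Qm_def algebra_simps)
  qed
  show ?thesis
    unfolding PQ_def P Q sum_distrib_right unfolding sum_distrib_left
    by (intro sum.cong refl) (simp add: ac_simps)
qed

lemma psi_ga:
  assumes g: "g \<in> S" and x: "x \<in> S"
  shows "psi (ga g c) x = psi c (iv g * x)"
proof -
  let ?I = "{..<n} \<times> {..<n} \<times> {..<n} \<times> {..<n}"
  let ?G = "\<lambda>(i', j', k', l') (i, j, k, l). g $$ (i', i) * g $$ (j', j) * (iv g $$ (k, k') * iv g $$ (l, l'))"
  have "psi (ga g c) x = (\<Sum>t'\<in>?I. \<Sum>t\<in>?I. (case t of (i, j, k, l) \<Rightarrow> c i j k l) * (?G t' t * (case t' of (i, j, k, l) \<Rightarrow> PQ i j k l x)))"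
    unfolding psi_def ga_def sum4_cart by (auto simp: sum_distrib_right intro!: sum.cong simp: mult.assoc)
  also have "\<dots> = (\<Sum>t\<in>?I. \<Sum>t'\<in>?I. (case t of (i, j, k, l) \<Rightarrow> c i j k l) * (?G t' t * (case t' of (i, j, k, l) \<Rightarrow> PQ i j k l x)))"
    by (rule sum.swap)
  also have "\<dots> = (\<Sum>(i, j, k, l)\<in>?I. c i j k l * PQ i j k l (iv g * x))"
  proof (rule sum.cong)
    fix t assume t: "t \<in> ?I"
    obtain i j k l where tt: "t = (i, j, k, l)" by (cases t)
    have b: "i < n" "j < n" "k < n" "l < n" using t tt by auto
    show "(\<Sum>t'\<in>?I. (case t of (i, j, k, l) \<Rightarrow> c i j k l) * (?G t' t * (case t' of (i, j, k, l) \<Rightarrow> PQ i j k l x)))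
      = (case t of (i, j, k, l) \<Rightarrow> c i j k l * PQ i j k l (iv g * x))"
      unfolding tt PQ_act[OF g x b] sum4_cart prod.case sum_distrib_left
      by (rule sum.cong[OF refl]) (auto simp: ac_simps)
  qed simp
  finally show ?thesis unfolding psi_def sum4_cart .
qed

lemma ga_swap: "ga g c j' i' k' l' = ga g (\<lambda>i j k l. c j i k l) i' j' k' l'"
  "ga g c i' j' l' k' = ga g (\<lambda>i j k l. c i j l k) i' j' k' l'"
proof -
  show "ga g c j' i' k' l' = ga g (\<lambda>i j k l. c j i k l) i' j' k' l'"
    unfolding ga_def by (rule trans[OF sum.swap], intro sum.cong refl) (simp add: ac_simps)
  show "ga g c i' j' l' k' = ga g (\<lambda>i j k l. c i j l k) i' j' k' l'"
    unfolding ga_def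
    by (rule sum.cong[OF refl], rule sum.cong[OF refl], rule trans[OF sum.swap], intro sum.cong refl) (simp add: ac_simps)
qed

lemma asym_ga: "asym (ga g c) i j k l = ga g (asym c) i j k l"
proof -
  have "asym (ga g c) i j k l = ga g c i j k l - ga g (\<lambda>i j k l. c j i k l) i j k l
      - ga g (\<lambda>i j k l. c i j l k) i j k l + ga g (\<lambda>i j k l. c j i l k) i j k l"
    unfolding asym_def ga_swap(1)[of g c j i] ga_swap(2)[of g c i j l k] ga_swap(1)[of g c j i l k]
      ga_swap(2)[of g "\<lambda>i j k l. c j i k l" i j l k] by simp
  also have "\<dots> = ga g (asym c) i j k l"
    unfolding ga_def sum_subtractf[symmetric] sum.distrib[symmetric] by (simp add: asym_def algebra_simps)
  finally show ?thesis .
qed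

text \<open>On the contracted indices a factor \<open>iv g\<close> meets a factor \<open>g\<close>
  and they cancel; conjugation on the two remaining indices is left.\<close>

lemma ga_contract:
  assumes g: "g \<in> S" and pq: "p < n" "q < n"
  shows "(\<Sum>j'<n. ga g c p j' q j') = sga g (\<lambda>i k. \<Sum>j<n. c i j k j) p q"
proof -
  have "(\<Sum>j'<n. ga g c p j' q j') = (\<Sum>i<n. \<Sum>j<n. \<Sum>k<n. \<Sum>l<n. \<Sum>j'<n.
      c i j k l * (g $$ (p, i) * iv g $$ (k, q)) * (iv g $$ (l, j') * g $$ (j', j)))"
    unfolding ga_def
    by ((rule trans[OF sum.swap], rule sum.cong[OF refl])+, rule sum.cong[OF refl], simp add: ac_simps)
  also have "\<dots> = (\<Sum>i<n. \<Sum>j<n. \<Sum>k<n. \<Sum>l<n. if l = j then c i j k l * (g $$ (p, i) * iv g $$ (k, q)) else 0)"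
    unfolding sum_distrib_left[symmetric] using iv_left_sum[OF g] by (intro sum.cong refl) auto
  also have "\<dots> = (\<Sum>i<n. \<Sum>j<n. \<Sum>k<n. c i j k j * (g $$ (p, i) * iv g $$ (k, q)))"
    by (intro sum.cong refl) auto
  also have "\<dots> = (\<Sum>i<n. \<Sum>k<n. \<Sum>j<n. c i j k j * (g $$ (p, i) * iv g $$ (k, q)))"
    by (intro sum.cong refl sum.swap)
  finally show ?thesis unfolding sga_def sum_distrib_right .
qed

lemma kap_ga:
  assumes g: "g \<in> S" and pq: "p < n" "q < n"
  shows "kap (ga g c) p q = sga g (kap c) p q"
  unfolding kap_def[of "ga g c"] asym_ga ga_contract[OF g pq] kap_def[abs_def] ..

lemma sga_trace:
  assumes g: "g \<in> S"
  shows "(\<Sum>p<n. sga g m p p) = (\<Sum>p<n. m p p)"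
proof -
  have "(\<Sum>p<n. sga g m p p) = (\<Sum>i<n. \<Sum>k<n. \<Sum>p<n. m i k * (iv g $$ (k, p) * g $$ (p, i)))"
    unfolding sga_def
    by ((rule trans[OF sum.swap], rule sum.cong[OF refl])+, rule sum.cong[OF refl], simp add: ac_simps)
  also have "\<dots> = (\<Sum>i<n. \<Sum>k<n. if k = i then m i k else 0)"
    unfolding sum_distrib_left[symmetric] using iv_left_sum[OF g] by (intro sum.cong refl) auto
  finally show ?thesis by simp
qed

lemma pr_ga:
  assumes g: "g \<in> S"
  shows "pr (ga g c) = pr c"
proof -
  have tr: "(\<Sum>i<n. \<Sum>j<n. ga g c i j i j) = (\<Sum>i<n. \<Sum>j<n. c i j i j)" for c
  proof -
    have "(\<Sum>i<n. \<Sum>j<n. ga g c i j i j) = (\<Sum>i<n. sga g (\<lambda>i k. \<Sum>j<n. c i j k j) i i)"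
      by (intro sum.cong refl ga_contract[OF g]) auto
    thus ?thesis using sga_trace[OF g] by simp
  qed
  show ?thesis
  proof -
    have "(\<Sum>i<n. \<Sum>j<n. ga g c i j j i) = (\<Sum>i<n. \<Sum>j<n. ga g (\<lambda>i j k l. c i j l k) i j i j)"
      by (intro sum.cong refl ga_swap(2))
    thus ?thesis unfolding pr_def sum_subtractf using tr[of c] tr[of "\<lambda>i j k l. c i j l k"] by simp
  qed
qed

lemma AZ_act:
  assumes g: "g \<in> S" and x: "x \<in> S" and b: "i < n" "k < n"
  shows "AZ i k (iv g * x) = (\<Sum>p<n. \<Sum>q<n. g $$ (p, i) * iv g $$ (k, q) * AZ p q x)"
proof -
  have "AZ i k (iv g * x) = (\<Sum>p<n. iv x $$ (0, p) * g $$ (p, i)) * (\<Sum>q<n. iv g $$ (k, q) * x $$ (q, n - 1))"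
    using iv_entry_act[OF g x _ b(1), of 0] S_entry_mult[OF iv_S[OF g] x b(2), of "n - 1"] n5
    by (simp add: AZ_def del: index_mult_mat(1))
  thus ?thesis unfolding sum_product by (simp add: AZ_def ac_simps)
qed

lemma sg_sga:
  assumes g: "g \<in> S" and x: "x \<in> S"
  shows "sg (sga g m) x = sg m (iv g * x)"
proof -
  have "sg (sga g m) x = (\<Sum>p<n. \<Sum>q<n. \<Sum>i<n. \<Sum>k<n. m i k * (g $$ (p, i) * iv g $$ (k, q) * AZ p q x))"
    unfolding sg_def sga_def sum_distrib_right by (intro sum.cong refl) (simp add: ac_simps)
  also have "\<dots> = (\<Sum>p<n. \<Sum>i<n. \<Sum>k<n. \<Sum>q<n. m i k * (g $$ (p, i) * iv g $$ (k, q) * AZ p q x))"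
    by (rule sum.cong[OF refl], (rule trans[OF sum.swap], rule sum.cong[OF refl])+, rule sum.cong[OF refl], simp)
  also have "\<dots> = (\<Sum>i<n. \<Sum>k<n. \<Sum>p<n. \<Sum>q<n. m i k * (g $$ (p, i) * iv g $$ (k, q) * AZ p q x))"
    by (rule trans[OF sum.swap], rule sum.cong[OF refl], rule sum.swap)
  also have "\<dots> = sg m (iv g * x)"
    unfolding sg_def using AZ_act[OF g x] by (intro sum.cong refl) (auto simp: sum_distrib_left)
  finally show ?thesis .
qed

text \<open>The sum of the \<open>AZ i i\<close> is an off-diagonal entry of
  \<open>iv x * x = 1\<close>.\<close>

lemma sg_scalar:
  assumes x: "x \<in> S" and "\<And>i k. i < n \<Longrightarrow> k < n \<Longrightarrow> i \<noteq> k \<Longrightarrow> m i k = 0" "\<And>i. i < n \<Longrightarrow> m i i = t"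
  shows "sg m x = 0"
proof -
  have "sg m x = (\<Sum>i<n. \<Sum>k<n. if k = i then t * AZ i i x else 0)"
    unfolding sg_def by (intro sum.cong refl) (use assms in auto)
  also have "\<dots> = t * (\<Sum>i<n. iv x $$ (0, i) * x $$ (i, n - 1))" by (simp add: AZ_def sum_distrib_left)
  also have "\<dots> = 0" using iv_left_sum[OF x, of 0 "n - 1"] n5 by simp
  finally show ?thesis .
qed

lemma sg_zero:
  assumes z: "\<forall>x\<in>S. sg m x = 0" and ik: "i < n" "k < n" "i \<noteq> k"
  shows "m i k = 0" "m i i = m k k"
proof -
  have ev: "(\<Sum>p<n. \<Sum>q<n. m p q * (((if p = i1 then u1 else 0) + (if p = i2 then u2 else 0)) * ((if q = j1 then v1 else 0) + (if q = j2 then v2 else 0))))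
     = (m i1 j1 * v1 + m i1 j2 * v2) * u1 + (m i2 j1 * v1 + m i2 j2 * v2) * u2"
    if b: "i1 < n" "i2 < n" "j1 < n" "j2 < n" for i1 i2 j1 j2 u1 u2 v1 v2
  proof -
    let ?d = "\<lambda>p i u j v. (if p = i then u else 0) + (if p = j then (v :: 'k) else 0)"
    have "(\<Sum>p<n. \<Sum>q<n. m p q * (?d p i1 u1 i2 u2 * ?d q j1 v1 j2 v2)) = (\<Sum>p<n. (\<Sum>q<n. m p q * ?d q j1 v1 j2 v2) * ?d p i1 u1 i2 u2)"
      unfolding sum_distrib_right by (intro sum.cong refl) (simp only: ac_simps)
    thus ?thesis unfolding sum_two_units[OF b(3,4)] sum_two_units[OF b(1,2)] by simp
  qed
  have K0: "m i k = 0" if ik: "i < n" "k < n" "i \<noteq> k" for i k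
  proof -
    from AZ_transport[OF ik] obtain \<pi> where \<pi>: "\<pi> permutes {0..<n}" "\<pi> 0 = i" "\<pi> (n - 1) = k" by metis
    have 1: "1 < n" "0 < n" "n - 1 < n" using n5 by auto
    let ?\<sigma> = "inv_into UNIV \<pi>"
    have s: "?\<sigma> permutes {0..<n}" by (rule permutes_inv[OF \<pi>(1)])
    have inv: "?\<sigma> i = 0" "?\<sigma> k = n - 1" using permutes_inverses(2)[OF \<pi>(1)] \<pi> by auto
    have q: "\<pi> 1 < n" "\<pi> 1 \<noteq> i" "\<pi> 1 \<noteq> k"
      using permutes_in_image[OF \<pi>(1), of 1] 1 inj_eq[OF permutes_inj[OF \<pi>(1)], of 1 0] inj_eq[OF permutes_inj[OF \<pi>(1)], of 1 "n - 1"] \<pi> n5 by auto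
    let ?w = "mon ?\<sigma> (\<pi> 1)"
    have w: "?w \<in> S" by (rule mon_S[OF s q(1)])
    have e: "?w $$ (r, c) = (if c = ?\<sigma> r then (if r = \<pi> 1 then signof ?\<sigma> else 1) else 0)" if "r < n" "c < n" for r c
      using that by (simp add: mon_def)
    have inj: "?\<sigma> a = ?\<sigma> b \<longleftrightarrow> a = b" for a b by (rule inj_eq[OF permutes_inj[OF s]])
    have "iv ?w $$ (0, r) = (if r = i then 1 else 0)" if "r < n" for r
      using that 1 q inj[of i r] inv unfolding iv_mon[OF s q(1)] by (auto simp: mon_def)
    moreover have "?w $$ (r, n - 1) = (if r = k then 1 else 0)" if "r < n" for r
      using e[OF that 1(3)] q inj[of k r] inv by auto
    ultimately have "sg m ?w = (\<Sum>p<n. \<Sum>q<n. m p q * (((if p = i then 1 else 0) + (if p = i then 0 else 0)) * ((if q = k then 1 else 0) + (if q = k then 0 else 0))))"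
      unfolding sg_def AZ_def by (intro sum.cong refl) simp
    also have "\<dots> = m i k" using ik by (subst ev) auto
    finally show ?thesis using z w by simp
  qed
  show "m i k = 0" by (rule K0[OF ik])
  \<comment> \<open>\<open>j\<close> and \<open>l\<close> merely complete \<open>i\<close> and
    \<open>k\<close> to a frame.\<close>
  obtain j l where jl: "distinct [i, j, l, k]" "{i, j, l, k} \<subseteq> {..<n}"
  proof -
    have "card ({..<n} - {i, k}) \<ge> 2" using ik n5 by (subst card_Diff_subset) auto
    then obtain A where "A \<subseteq> {..<n} - {i, k}" "card A = 2" by (meson obtain_subset_with_card_n)
    then obtain j l where "j \<noteq> l" "{j, l} \<subseteq> {..<n} - {i, k}" by (auto simp: card_2_iff)
    thus ?thesis using that[of j l] ik by auto
  qed
  obtain w where w: "w \<in> S" "\<And>q. q < n \<Longrightarrow> iv w $$ (0, q) = (if q = i then 1 else 0)"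
    "\<And>q. q < n \<Longrightarrow> iv w $$ (1, q) = (if q = j then 1 else 0)"
    "\<And>q. q < n \<Longrightarrow> w $$ (q, n - 2) = (if q = l then 1 else 0)"
    "\<And>q. q < n \<Longrightarrow> w $$ (q, n - 1) = (if q = k then 1 else 0)"
    using frame[OF jl] by blast
  let ?x = "E i k 1 * w"
  have x: "?x \<in> S" using w ik by (intro S_mult) auto
  have "sg m ?x = (\<Sum>p<n. \<Sum>q<n. m p q * (((if p = i then 1 else 0) + (if p = k then - 1 else 0)) * ((if q = k then 1 else 0) + (if q = i then 1 else 0))))"
    unfolding sg_def AZ_def
  proof (intro sum.cong refl arg_cong2[of _ _ _ _ "(*)"])
    fix p q assume b: "p \<in> {..<n}" "q \<in> {..<n}"
    show "iv ?x $$ (0, p) = (if p = i then 1 else 0) + (if p = k then - 1 else 0)"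
      using w ik b n5 by (simp add: iv_E_mult)
    show "?x $$ (q, n - 1) = (if q = k then 1 else 0) + (if q = i then 1 else 0)"
      using w ik b n5 by (simp add: E_mult_entry S_carrier del: index_mult_mat(1))
  qed
  also have "\<dots> = m i k + m i i - (m k k + m k i)" using ik by (subst ev) auto
  finally show "m i i = m k k" using z x K0[OF ik] K0[of k i] ik by auto
qed

section \<open>Submodules\<close>


definition gsub :: "weight \<Rightarrow> ('k mat \<Rightarrow> 'k) set \<Rightarrow> bool" where
  "gsub \<mu> W \<longleftrightarrow> W \<subseteq> V \<mu> \<and> func_sub W \<and> (\<forall>g\<in>S. \<forall>f\<in>W. (\<lambda>x\<in>S. f (iv g * x)) \<in> W)"

lemma gsub_left:
  assumes W: "gsub \<mu> W" and g: "g \<in> S" and f: "(\<lambda>x\<in>S. f x) \<in> W"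
  shows "(\<lambda>x\<in>S. f (g * x)) \<in> W"
proof -
  have "(\<lambda>x\<in>S. (\<lambda>x\<in>S. f x) (iv (iv g) * x)) \<in> W" using W g f unfolding gsub_def by (meson iv_S)
  moreover have "(\<lambda>x\<in>S. (\<lambda>x\<in>S. f x) (iv (iv g) * x)) = (\<lambda>x\<in>S. f (g * x))"
    using g by (auto simp: S_mult)
  ultimately show ?thesis by simp
qed

text \<open>A translation moves a point where some function does not vanish to the identity.\<close>

lemma gsub_nonzero:
  assumes W: "gsub \<mu> W" and nz: "W \<noteq> {\<lambda>x\<in>S. 0}"
  obtains f where "f \<in> W" "f (1\<^sub>m n) \<noteq> 0"
proof -
  have "(\<lambda>x\<in>S. 0) \<in> W" using W by (simp add: gsub_def func_sub_def)
  then obtain f where f: "f \<in> W" "f \<noteq> (\<lambda>x\<in>S. 0)" using nz by blast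
  have fe: "f \<in> extensional S" using W f V_ext unfolding gsub_def by blast
  obtain x0 where x0: "x0 \<in> S" "f x0 \<noteq> 0"
  proof -
    have "\<not> (\<forall>x\<in>S. f x = 0)"
    proof
      assume "\<forall>x\<in>S. f x = 0"
      hence "f = (\<lambda>x\<in>S. 0)" using fe by (intro extensionalityI[of _ S]) auto
      thus False using f by simp
    qed
    thus ?thesis using that by blast
  qed
  have "(\<lambda>x\<in>S. f x) \<in> W" using f(1) extensional_restrict[OF fe] by simp
  hence "(\<lambda>x\<in>S. f (x0 * x)) \<in> W" by (rule gsub_left[OF W x0(1)])
  moreover have "(\<lambda>x\<in>S. f (x0 * x)) (1\<^sub>m n) \<noteq> 0" using x0 S_one S_carrier[OF x0(1)] by simp
  ultimately show ?thesis by (rule that)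
qed

text \<open>Both highest weight vectors are isolated as the leading coefficient under a one-parameter
  subgroup of the torus.\<close>

lemma highest_in_mw:
  assumes W: "gsub mw W" and nz: "W \<noteq> {\<lambda>x\<in>S. 0}"
  shows "(\<lambda>x\<in>S. PQ 0 1 (n - 2) (n - 1) x) \<in> W"
proof -
  note Wf = W[unfolded gsub_def, THEN conjunct2, THEN conjunct1]
  from gsub_nonzero[OF W nz] obtain f where f: "f \<in> W" "f (1\<^sub>m n) \<noteq> 0" .
  have "f \<in> psi_functions" using f W V_mw by (auto simp: gsub_def)
  then obtain c where c: "f = (\<lambda>x\<in>S. psi c x)" by (auto simp: psi_functions_def)
  \<comment> \<open>Exponents of \<open>s\<close> under the one-parameter subgroup, each raised by 1
    to be nonnegative; hence the factor \<open>s ^ 4\<close> below. The exponent 8 is reached by the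
    leading terms alone.\<close>
  define el where "el i = (if i < 2 then 2 else if i < n - 2 then 1 else (0 :: nat))" for i
  define eh where "eh i = (if i < 2 then 0 else if i < n - 2 then 1 else (2 :: nat))" for i
  define e where "e i j k l = el i + el j + eh k + eh l" for i j k l
  have e8: "e i j k l \<le> 8" for i j k l by (simp add: e_def el_def eh_def)
  define F where "F m x = (\<Sum>i<n. \<Sum>j<n. \<Sum>k<n. \<Sum>l<n. if e i j k l = m then c i j k l * PQ i j k l x else 0)" for m x
  have "(\<lambda>x\<in>S. F 8 x) \<in> W"
  proof (rule coeff_mem[OF Wf infinite_nonzero _ order_refl])
    fix s :: 'k assume "s \<in> UNIV - {0}"
    hence s: "s \<noteq> 0" by simp
    define d where "d i = (if i < 2 then inverse s else if i < n - 2 then 1 else s)" for i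
    define t where "t = sc d (\<lambda>_. 1) (1\<^sub>m n)"
    have "(\<Prod>i<n. d i) = 1"
    proof -
      have "(\<Prod>i<n. d i) = (\<Prod>i\<in>{0, 1, n - 2, n - 1}. d i)"
        by (rule prod.mono_neutral_right) (use n5 in \<open>auto simp: d_def\<close>)
      moreover have "(1 :: nat) \<noteq> n - 2" "(1 :: nat) \<noteq> n - 1" "n - 2 \<noteq> n - 1" "0 \<noteq> n - 1" "0 \<noteq> n - 2"
        "\<not> n - 2 < 2" "\<not> n - 1 < 2" "\<not> n - 1 < n - 2" using n5 by auto
      ultimately show ?thesis using s by (simp add: d_def field_simps)
    qed
    hence pd: "(\<Prod>i<n. d i) * (\<Prod>i<n. 1) = 1" by simp
    have tS: "t \<in> S" unfolding t_def by (rule sc_S[OF S_one pd])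
    have tx: "t * x = sc d (\<lambda>_. 1) x" if x: "x \<in> S" for x
    proof (rule S_eqI)
      fix i j assume ij: "i < n" "j < n"
      have "(t * x) $$ (i, j) = (\<Sum>k<n. if k = i then d i * x $$ (k, j) else 0)"
        unfolding S_entry_mult[OF tS x ij] using ij by (intro sum.cong) (auto simp: t_def)
      thus "(t * x) $$ (i, j) = sc d (\<lambda>_. 1) x $$ (i, j)" using ij by simp
    qed (use S_carrier[OF S_mult[OF tS x]] in auto)
    have PQt: "s ^ 4 * PQ i j k l (t * x) = s ^ e i j k l * PQ i j k l x" if x: "x \<in> S" and b: "i < n" "j < n" "k < n" "l < n" for i j k l x
    proof -
      have 1: "s * inverse (d i) = s ^ el i" "s * d i = s ^ eh i" for i
        using s by (auto simp: d_def el_def eh_def power2_eq_square)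
      have "PQ i j k l (t * x) = inverse (d i) * inverse (d j) * d k * d l * PQ i j k l x"
        unfolding tx[OF x] PQ_def Pm_def Qm_def iv_sc[OF x pd] using b n5 by (simp add: algebra_simps)
      hence "s ^ 4 * PQ i j k l (t * x) = (s * inverse (d i)) * (s * inverse (d j)) * (s * d k) * (s * d l) * PQ i j k l x"
        by (simp add: power4_eq_xxxx algebra_simps)
      thus ?thesis unfolding 1 e_def by (simp add: power_add)
    qed
    have "(\<lambda>x\<in>S. psi c x) \<in> W" using f c by simp
    hence "(\<lambda>x\<in>S. s ^ 4 * psi c (t * x)) \<in> W" by (intro fsub_smult[OF Wf] gsub_left[OF W tS])
    thus "(\<lambda>x\<in>S. \<Sum>m\<le>8. s ^ m * F m x) \<in> W"
    proof (rule fsub_cong)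
      fix x assume x: "x \<in> S"
      have "s ^ 4 * psi c (t * x) = (\<Sum>i<n. \<Sum>j<n. \<Sum>k<n. \<Sum>l<n. c i j k l * (s ^ 4 * PQ i j k l (t * x)))"
        unfolding psi_def sum_distrib_left by (simp add: ac_simps)
      also have "\<dots> = (\<Sum>i<n. \<Sum>j<n. \<Sum>k<n. \<Sum>l<n. \<Sum>m\<le>8. if e i j k l = m then s ^ m * (c i j k l * PQ i j k l x) else 0)"
        using e8 PQt[OF x] by (intro sum.cong refl) (auto simp: sum.delta)
      also have "\<dots> = (\<Sum>m\<le>8. s ^ m * F m x)"
        unfolding F_def sum_distrib_left
        by (rule sym, (rule trans[OF sum.swap], rule sum.cong[OF refl])+, rule sum.cong[OF refl]) simp
      finally show "s ^ 4 * psi c (t * x) = (\<Sum>m\<le>8. s ^ m * F m x)" .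
    qed
  qed
  moreover have "F 8 x = asym c 0 1 (n - 2) (n - 1) * PQ 0 1 (n - 2) (n - 1) x" for x
  proof -
    have e8': "e i j k l = 8 \<longleftrightarrow> i < 2 \<and> j < 2 \<and> n - 2 \<le> k \<and> n - 2 \<le> l" for i j k l
      using n5 by (auto simp: e_def el_def eh_def split: if_splits)
    have two: "(\<Sum>i<n. if i < 2 then g i else 0) = g 0 + g (1 :: nat)" for g :: "nat \<Rightarrow> 'k"
    proof -
      have "(\<Sum>i<n. if i < 2 then g i else 0) = (\<Sum>i\<in>{0, 1}. g i)"
        using n5 by (intro sum.mono_neutral_cong_right) auto
      thus ?thesis by simp
    qed
    have two': "(\<Sum>i<n. if n - 2 \<le> i then g i else 0) = g (n - 2) + g (n - 1)" for g :: "nat \<Rightarrow> 'k"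
    proof -
      have "(\<Sum>i<n. if n - 2 \<le> i then g i else 0) = (\<Sum>i\<in>{n - 2, n - 1}. g i)"
        using n5 by (intro sum.mono_neutral_cong_right) auto
      thus ?thesis using n5 by simp
    qed
    have "F 8 x = (\<Sum>i<n. if i < 2 then (\<Sum>j<n. if j < 2 then (\<Sum>k<n. if n - 2 \<le> k then (\<Sum>l<n. if n - 2 \<le> l then c i j k l * PQ i j k l x else 0) else 0) else 0) else 0)"
      unfolding F_def e8' by (intro sum.cong refl) (auto intro!: sum.neutral sum.cong)
    also have "\<dots> = asym c 0 1 (n - 2) (n - 1) * PQ 0 1 (n - 2) (n - 1) x"
      unfolding two two'
      using Pm_anti(1)[of 1 0 x] Qm_anti(1)[of "n - 1" "n - 2" x] by (simp add: PQ_def Pm_anti(2) Qm_anti(2) asym_def algebra_simps)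
    finally show ?thesis .
  qed
  moreover have "asym c 0 1 (n - 2) (n - 1) \<noteq> 0"
  proof -
    \<comment> \<open>At the identity only the leading coefficient contributes, so the choice of
      \<open>f\<close> makes it nonzero.\<close>
    have "psi c (1\<^sub>m n) = (\<Sum>i<n. \<Sum>j<n. \<Sum>k<n. \<Sum>l<n. if l = n - 1 then if k = n - 2 then if j = 1 then if i = 0 then asym c i j k l else 0 else 0 else 0 else 0)"
      unfolding psi_asym using n5 by (intro sum.cong refl) auto
    also have "\<dots> = asym c 0 1 (n - 2) (n - 1)" using n5 by simp
    finally show ?thesis using f(2) c S_one by simp
  qed
  ultimately have "(\<lambda>x\<in>S. asym c 0 1 (n - 2) (n - 1) * PQ 0 1 (n - 2) (n - 1) x) \<in> W" "asym c 0 1 (n - 2) (n - 1) \<noteq> 0" by auto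
  from fsub_smult[OF Wf this(1), of "inverse (asym c 0 1 (n - 2) (n - 1))"] this(2)
  show ?thesis by (simp add: mult.assoc[symmetric])
qed

lemma highest_in_aw:
  assumes W: "gsub aw W" and nz: "W \<noteq> {\<lambda>x\<in>S. 0}"
  shows "(\<lambda>x\<in>S. AZ 0 (n - 1) x) \<in> W"
proof -
  note Wf = W[unfolded gsub_def, THEN conjunct2, THEN conjunct1]
  from gsub_nonzero[OF W nz] obtain f where f: "f \<in> W" "f (1\<^sub>m n) \<noteq> 0" .
  have "f \<in> sg_functions" using f W V_aw by (auto simp: gsub_def)
  then obtain c where c: "f = (\<lambda>x\<in>S. sg c x)" by (auto simp: sg_functions_def)
  define el where "el i = (if i = 0 then 2 else if i < n - 1 then 1 else (0 :: nat))" for i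
  define eh where "eh i = (if i = 0 then 0 else if i < n - 1 then 1 else (2 :: nat))" for i
  define e where "e i k = el i + eh k" for i k
  have e4: "e i k \<le> 4" for i k by (simp add: e_def el_def eh_def)
  define F where "F m x = (\<Sum>i<n. \<Sum>k<n. if e i k = m then c i k * AZ i k x else 0)" for m x
  have "(\<lambda>x\<in>S. F 4 x) \<in> W"
  proof (rule coeff_mem[OF Wf infinite_nonzero _ order_refl])
    fix s :: 'k assume "s \<in> UNIV - {0}"
    hence s: "s \<noteq> 0" by simp
    define d where "d i = (if i = 0 then inverse s else if i < n - 1 then 1 else s)" for i
    define t where "t = sc d (\<lambda>_. 1) (1\<^sub>m n)"
    have "(\<Prod>i<n. d i) = 1"
    proof -
      have "(\<Prod>i<n. d i) = (\<Prod>i\<in>{0, n - 1}. d i)"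
        by (rule prod.mono_neutral_right) (use n5 in \<open>auto simp: d_def\<close>)
      thus ?thesis using s n5 by (simp add: d_def)
    qed
    hence pd: "(\<Prod>i<n. d i) * (\<Prod>i<n. 1) = 1" by simp
    have tS: "t \<in> S" unfolding t_def by (rule sc_S[OF S_one pd])
    have tx: "t * x = sc d (\<lambda>_. 1) x" if x: "x \<in> S" for x
    proof (rule S_eqI)
      fix i j assume ij: "i < n" "j < n"
      have "(t * x) $$ (i, j) = (\<Sum>k<n. if k = i then d i * x $$ (k, j) else 0)"
        unfolding S_entry_mult[OF tS x ij] using ij by (intro sum.cong) (auto simp: t_def)
      thus "(t * x) $$ (i, j) = sc d (\<lambda>_. 1) x $$ (i, j)" using ij by simp
    qed (use S_carrier[OF S_mult[OF tS x]] in auto)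
    have AZt: "s ^ 2 * AZ i k (t * x) = s ^ e i k * AZ i k x" if x: "x \<in> S" and b: "i < n" "k < n" for i k x
    proof -
      have 1: "s * inverse (d i) = s ^ el i" "s * d i = s ^ eh i" for i
        using s by (auto simp: d_def el_def eh_def power2_eq_square)
      have "AZ i k (t * x) = inverse (d i) * d k * AZ i k x"
        unfolding tx[OF x] AZ_def iv_sc[OF x pd] using b n5 by (simp add: algebra_simps)
      hence "s ^ 2 * AZ i k (t * x) = (s * inverse (d i)) * (s * d k) * AZ i k x"
        by (simp add: power2_eq_square algebra_simps)
      thus ?thesis unfolding 1 e_def by (simp add: power_add)
    qed
    have "(\<lambda>x\<in>S. sg c x) \<in> W" using f c by simp
    hence "(\<lambda>x\<in>S. s ^ 2 * sg c (t * x)) \<in> W" by (intro fsub_smult[OF Wf] gsub_left[OF W tS])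
    thus "(\<lambda>x\<in>S. \<Sum>m\<le>4. s ^ m * F m x) \<in> W"
    proof (rule fsub_cong)
      fix x assume x: "x \<in> S"
      have "s ^ 2 * sg c (t * x) = (\<Sum>i<n. \<Sum>k<n. c i k * (s ^ 2 * AZ i k (t * x)))"
        unfolding sg_def sum_distrib_left by (simp add: ac_simps)
      also have "\<dots> = (\<Sum>i<n. \<Sum>k<n. \<Sum>m\<le>4. if e i k = m then s ^ m * (c i k * AZ i k x) else 0)"
        using e4 AZt[OF x] by (intro sum.cong refl) (auto simp: sum.delta)
      also have "\<dots> = (\<Sum>m\<le>4. s ^ m * F m x)"
        unfolding F_def sum_distrib_left
        by (rule sym, (rule trans[OF sum.swap], rule sum.cong[OF refl])+, rule sum.cong[OF refl]) simp
      finally show "s ^ 2 * sg c (t * x) = (\<Sum>m\<le>4. s ^ m * F m x)" .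
    qed
  qed
  moreover have "F 4 x = c 0 (n - 1) * AZ 0 (n - 1) x" for x
  proof -
    have "F 4 x = (\<Sum>i<n. \<Sum>k<n. if k = n - 1 then if i = 0 then c i k * AZ i k x else 0 else 0)"
      unfolding F_def by (intro sum.cong refl) (use n5 in \<open>auto simp: e_def el_def eh_def\<close>)
    thus ?thesis using n5 by simp
  qed
  moreover have "c 0 (n - 1) \<noteq> 0"
  proof -
    have "sg c (1\<^sub>m n) = (\<Sum>i<n. \<Sum>k<n. if k = n - 1 then if i = 0 then c i k else 0 else 0)"
      unfolding sg_def AZ_def using n5 by (intro sum.cong refl) auto
    also have "\<dots> = c 0 (n - 1)" using n5 by simp
    finally show ?thesis using f(2) c S_one by simp
  qed
  ultimately have "(\<lambda>x\<in>S. c 0 (n - 1) * AZ 0 (n - 1) x) \<in> W" "c 0 (n - 1) \<noteq> 0" by auto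
  from fsub_smult[OF Wf this(1), of "inverse (c 0 (n - 1))"] this(2)
  show ?thesis by (simp add: mult.assoc[symmetric])
qed

text \<open>Permutations of the highest weight vector give every \<open>AZ i k\<close> with
  \<open>i \<noteq> k\<close>, and a root element applied to \<open>AZ i 0\<close> gives
  \<open>AZ i i - AZ 0 0\<close>. A traceless \<open>m\<close> is expanded in these
  functions.\<close>

lemma aw_minimal:
  assumes W: "gsub aw W" and nz: "W \<noteq> {\<lambda>x\<in>S. 0}" and m: "(\<Sum>i<n. m i i) = 0"
  shows "(\<lambda>x\<in>S. sg m x) \<in> W"
proof -
  note Wf = W[unfolded gsub_def, THEN conjunct2, THEN conjunct1]
  have off: "(\<lambda>x\<in>S. AZ i k x) \<in> W" if ik: "i < n" "k < n" "i \<noteq> k" for i k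
  proof -
    obtain \<pi> where \<pi>: "\<pi> permutes {0..<n}"
      and e: "\<And>x. x \<in> S \<Longrightarrow> AZ 0 (n - 1) (mon \<pi> 1 * x) = AZ i k x"
      using AZ_transport[OF ik] by metis
    have w: "mon \<pi> 1 \<in> S" by (rule mon_S[OF \<pi>]) (use n5 in simp)
    show ?thesis by (rule fsub_cong[OF gsub_left[OF W w highest_in_aw[OF W nz]]]) (rule e)
  qed
  have diag: "(\<lambda>x\<in>S. AZ i i x - AZ 0 0 x) \<in> W" if i: "i < n" for i
  proof (cases "i = 0")
    case True
    thus ?thesis using fsub_zero[OF Wf] by simp
  next
    case False
    have 0: "0 < n" using n5 by simp
    have "(\<lambda>x\<in>S. (AZ i 0 (E 0 i 1 * x) - AZ i 0 x) + AZ 0 i x) \<in> W"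
      using False i 0 by (intro fsub_add[OF Wf] fsub_diff[OF Wf] gsub_left[OF W] off) auto
    thus ?thesis
    proof (rule fsub_cong)
      fix x assume x: "x \<in> S"
      show "(AZ i 0 (E 0 i 1 * x) - AZ i 0 x) + AZ 0 i x = AZ i i x - AZ 0 0 x"
        using False i 0 x by (subst AZ_E) (auto simp: AZ_def algebra_simps)
    qed
  qed
  have "(\<lambda>x\<in>S. (\<Sum>i<n. \<Sum>k<n. if i = k then 0 else m i k * AZ i k x) + (\<Sum>i<n. m i i * (AZ i i x - AZ 0 0 x))) \<in> W"
  proof (intro fsub_add[OF Wf] fsub_sum[OF Wf])
    fix i k assume ik: "i \<in> {..<n}" "k \<in> {..<n}"
    show "(\<lambda>x\<in>S. if i = k then 0 else m i k * AZ i k x) \<in> W"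
      using ik fsub_zero[OF Wf] by (cases "i = k") (auto intro!: fsub_smult[OF Wf] off)
  next
    fix i assume "i \<in> {..<n}"
    thus "(\<lambda>x\<in>S. m i i * (AZ i i x - AZ 0 0 x)) \<in> W" by (intro fsub_smult[OF Wf] diag) auto
  qed
  thus ?thesis
  proof (rule fsub_cong)
    fix x assume x: "x \<in> S"
    have "(\<Sum>i<n. m i i * (AZ i i x - AZ 0 0 x)) = (\<Sum>i<n. m i i * AZ i i x) - (\<Sum>i<n. m i i) * AZ 0 0 x"
      by (simp add: right_diff_distrib sum_subtractf sum_distrib_right)
    also have "\<dots> = (\<Sum>i<n. \<Sum>k<n. if k = i then m i k * AZ i k x else 0)" using m by simp
    finally have e: "(\<Sum>i<n. m i i * (AZ i i x - AZ 0 0 x)) = (\<Sum>i<n. \<Sum>k<n. if k = i then m i k * AZ i k x else 0)" .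
    show "(\<Sum>i<n. \<Sum>k<n. if i = k then 0 else m i k * AZ i k x) + (\<Sum>i<n. m i i * (AZ i i x - AZ 0 0 x)) = sg m x"
      unfolding e sg_def sum.distrib[symmetric] by (intro sum.cong refl) auto
  qed
qed

section \<open>Relations modulo a nonzero submodule\<close>

context
  fixes W
  assumes W: "gsub mw W" and nz: "W \<noteq> {\<lambda>x\<in>S. 0}"
begin

lemma Wf: "func_sub W" using W by (simp add: gsub_def)

lemma PQ_in: 
  assumes d: "distinct [i, j, k, l]" "{i, j, k, l} \<subseteq> {..<n}"
  shows "(\<lambda>x\<in>S. PQ i j k l x) \<in> W"
proof -
  have d': "{i, j, k, l} \<subseteq> {0..<n}" using d by auto
  obtain \<pi> where \<pi>: "\<pi> permutes {0..<n}"
    and e: "\<And>x. x \<in> S \<Longrightarrow> PQ 0 1 (n - 2) (n - 1) (mon \<pi> 2 * x) = PQ i j k l x"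
    using PQ_transport[OF d(1) d'] by metis
  have w: "mon \<pi> 2 \<in> S" by (rule mon_S[OF \<pi>]) (use n5 in simp)
  show ?thesis by (rule fsub_cong[OF gsub_left[OF W w highest_in_mw[OF W nz]]]) (rule e)
qed

text \<open>The moves of \<open>psi_zero\<close> read dually: there root elements annihilate
  combinations of coefficients, here they produce elements of \<open>W\<close>.\<close>

lemma diff_in:
  assumes d: "distinct [i, j, l, m]" "{i, j, l, m} \<subseteq> {..<n}"
  shows "(\<lambda>x\<in>S. PQ i m j m x - PQ i l j l x) \<in> W"
proof -
  have "(\<lambda>x\<in>S. (PQ i m j l (E l m 1 * x) - PQ i m j l x) + PQ i l j m x) \<in> W"
    using d by (intro fsub_add[OF Wf] fsub_diff[OF Wf] gsub_left[OF W] PQ_in) auto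
  thus ?thesis
  proof (rule fsub_cong)
    fix x assume x: "x \<in> S"
    show "(PQ i m j l (E l m 1 * x) - PQ i m j l x) + PQ i l j m x = PQ i m j m x - PQ i l j l x"
      using d x by (subst PQ_E) (auto simp: PQ_def algebra_simps)
  qed
qed

lemma cross_in:
  assumes d: "distinct [i, j, l, m]" "{i, j, l, m} \<subseteq> {..<n}"
  shows "(\<lambda>x\<in>S. PQ i l i l x - PQ i m i m x - PQ j l j l x + PQ j m j m x) \<in> W"
proof -
  have 1: "(\<lambda>x\<in>S. PQ j m i m x - PQ j l i l x) \<in> W" using d by (intro diff_in) auto
  have "(\<lambda>x\<in>S. (PQ j m i m (E i j 1 * x) - PQ j l i l (E i j 1 * x)) - (PQ j m i m x - PQ j l i l x)
      + (PQ i m j m x - PQ i l j l x)) \<in> W"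
  proof (rule fsub_add[OF Wf])
    have "E i j 1 \<in> S" using d by simp
    from fsub_diff[OF Wf gsub_left[OF W this 1] 1]
    show "(\<lambda>x\<in>S. (PQ j m i m (E i j 1 * x) - PQ j l i l (E i j 1 * x)) - (PQ j m i m x - PQ j l i l x)) \<in> W" .
    show "(\<lambda>x\<in>S. PQ i m j m x - PQ i l j l x) \<in> W" by (rule diff_in[OF d])
  qed
  thus ?thesis
  proof (rule fsub_cong)
    fix x assume x: "x \<in> S"
    have e: "PQ j m i m (E i j 1 * x) = (Pm j m x - Pm i m x) * (Qm i m x + Qm j m x)"
      "PQ j l i l (E i j 1 * x) = (Pm j l x - Pm i l x) * (Qm i l x + Qm j l x)"
      using d x by (subst PQ_E, auto)+
    show "(PQ j m i m (E i j 1 * x) - PQ j l i l (E i j 1 * x)) - (PQ j m i m x - PQ j l i l x)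
      + (PQ i m j m x - PQ i l j l x) = PQ i l i l x - PQ i m i m x - PQ j l j l x + PQ j m j m x"
      unfolding e by (simp add: PQ_def algebra_simps)
  qed
qed

text \<open>The relations between \<open>B\<close> and \<open>D\<close> are the images of \<open>\<Sum>\<^sub>l PQ i l j l = 0\<close> and \<open>\<Sum>\<^bsub>i<j\<^esub> PQ i j i j = 0\<close>.\<close>

lemma mod_representatives:
  obtains B :: "nat \<Rightarrow> nat \<Rightarrow> 'k mat \<Rightarrow> 'k" and D :: "'k mat \<Rightarrow> 'k" where
    "\<forall>c. (\<lambda>x\<in>S. psi c x - ((\<Sum>p<n. \<Sum>q<n. kap c p q * B p q x) + pr c * D x)) \<in> W"
    "\<forall>i<n. \<forall>j<n. i \<noteq> j \<longrightarrow> (\<lambda>x\<in>S. (of_nat n - 2) * B i j x) \<in> W"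
    "\<forall>i<n. (\<lambda>x\<in>S. (of_nat n - 2) * B i i x + (\<Sum>l<n. B l l x) + (of_nat n - 1) * D x) \<in> W"
    "(\<lambda>x\<in>S. (of_nat n - 1) * (\<Sum>l<n. B l l x) + of_nat (n choose 2) * D x) \<in> W"
    "\<forall>x. B 0 0 x = - D x"
proof -
  \<comment> \<open>Congruence modulo \<open>W\<close> as an additive subgroup of functions, the
    form that \<open>cross_differences_zero\<close> expects.\<close>
  define Z where "Z = {h :: 'k mat \<Rightarrow> 'k. (\<lambda>x\<in>S. h x) \<in> W}"
  define d where "d i j = PQ i j i j" for i j
  define D where "D = d 1 2 - d 0 1 - d 0 2"
  define A where "A i = (if i = 0 then - D else d 0 i)" for i
  have dsym: "d i j = d j i" for i j
  proof
    fix x show "d i j x = d j i x" using Pm_anti(1)[of i j x] Qm_anti(1)[of i j x] by (simp add: d_def PQ_def)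
  qed
  have dA: "d i j - A i - A j - D \<in> Z" if "i < n" "j < n" "i \<noteq> j" for i j
  proof (rule cross_differences_zero[OF n5 _ _ dsym _ D_def A_def that])
    show "0 \<in> Z" using fsub_zero[OF Wf] by (simp add: Z_def zero_fun_def)
    show "a - b \<in> Z" if "a \<in> Z" "b \<in> Z" for a b using that fsub_diff[OF Wf, of a b] by (simp add: Z_def fun_diff_def)
    show "d i l - d i m - d j l + d j m \<in> Z" if "distinct [i, j, l, m]" "{i, j, l, m} \<subseteq> {..<n}" for i j l m
      using cross_in[OF that] by (simp add: Z_def d_def fun_diff_def plus_fun_def)
  qed
  define r where "r i j = (SOME l. l < n \<and> l \<noteq> i \<and> l \<noteq> j)" for i j
  \<comment> \<open>Modulo \<open>W\<close> the functions \<open>PQ i l j l\<close> do not depend on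
    \<open>l\<close> when \<open>i \<noteq> j\<close>, so one of them represents the class. On the
    diagonal the summand \<open>A i\<close> plays this role.\<close>
  define B where "B i j = (if i = j then A i else PQ i (r i j) j (r i j))" for i j
  have r: "(\<lambda>x\<in>S. PQ i l j l x - B i j x) \<in> W" if ijl: "distinct [i, j, l]" "{i, j, l} \<subseteq> {..<n}" for i j l
  proof -
    have "r i j < n \<and> r i j \<noteq> i \<and> r i j \<noteq> j" unfolding r_def by (rule someI[of _ l]) (use ijl in auto)
    thus ?thesis using ijl diff_in[of i j "r i j" l] fsub_zero[OF Wf] by (cases "r i j = l") (auto simp: B_def)
  qed
  \<comment> \<open>The expected value of \<open>PQ i j k l\<close> modulo \<open>W\<close>: the
    antisymmetrised contractions, with \<open>D\<close> entering when the two index pairs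
    coincide.\<close>
  define R where "R i j k l x = (if j = l then B i k x else 0) - (if j = k then B i l x else 0)
     - (if i = l then B j k x else 0) + (if i = k then B j l x else 0)
     + (if i = k \<and> j = l then D x else 0) - (if i = l \<and> j = k then D x else 0)" for i j k l x
  have PQR0: "(\<lambda>x\<in>S. PQ i j k l x - R i j k l x) \<in> W"
    if b: "i < n" "j < n" "k < n" "l < n" and c: "k \<noteq> j" "i \<noteq> l" "i \<noteq> j" "k \<noteq> l" for i j k l
  proof -
    consider "i = k" "j = l" | "i = k" "j \<noteq> l" | "i \<noteq> k" "j = l" | "i \<noteq> k" "j \<noteq> l" by blast
    thus ?thesis
    proof cases
      case 1
      have "(\<lambda>x\<in>S. (d i j - A i - A j - D) x) \<in> W" using dA[of i j] b c by (simp add: Z_def fun_diff_def)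
      thus ?thesis by (rule fsub_cong) (use 1 c in \<open>simp add: R_def d_def B_def\<close>)
    next
      case 2
      have "(\<lambda>x\<in>S. PQ j i l i x - B j l x) \<in> W" using b c 2 by (intro r) auto
      thus ?thesis by (rule fsub_cong)
        (use 2 c Pm_anti(1)[of i j] Qm_anti(1)[of i l] in \<open>simp add: R_def PQ_def\<close>)
    next
      case 3
      have "(\<lambda>x\<in>S. PQ i j k j x - B i k x) \<in> W" using b c 3 by (intro r) auto
      thus ?thesis by (rule fsub_cong) (use 3 c in \<open>simp add: R_def\<close>)
    next
      case 4
      have "(\<lambda>x\<in>S. PQ i j k l x) \<in> W" using b c 4 by (intro PQ_in) auto
      thus ?thesis by (rule fsub_cong) (use 4 c in \<open>simp add: R_def\<close>)
    qed
  qed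
  have PQR: "(\<lambda>x\<in>S. PQ i j k l x - R i j k l x) \<in> W" if b: "i < n" "j < n" "k < n" "l < n" for i j k l
  proof (cases "i = j \<or> k = l")
    case True
    have "PQ i j k l x - R i j k l x = 0" for x
      using True
    proof
      assume [simp]: "i = j"
      show ?thesis by (cases "j = l"; cases "j = k") (simp_all add: PQ_def Pm_anti(2) R_def)
    next
      assume [simp]: "k = l"
      show ?thesis by (cases "i = l"; cases "j = l") (simp_all add: PQ_def Qm_anti(2) R_def)
    qed
    thus ?thesis using fsub_zero[OF Wf] by simp
  next
    case F1: False
    show ?thesis
    proof (cases "k \<noteq> j \<and> i \<noteq> l")
      case True
      thus ?thesis using PQR0[of i j k l] b F1 by auto
    next
      case False
      \<comment> \<open>Exchanging \<open>k\<close> and \<open>l\<close> restores the index pattern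
        of \<open>PQR0\<close>; both terms change sign.\<close>
      have Rs: "R i j l k x = - R i j k l x" for x by (simp add: R_def)
      have Ps: "PQ i j l k x = - PQ i j k l x" for x using Qm_anti(1)[of l k x] by (simp add: PQ_def)
      show ?thesis
      proof (cases "l \<noteq> j \<and> i \<noteq> k")
        case True
        hence "(\<lambda>x\<in>S. PQ i j l k x - R i j l k x) \<in> W" using PQR0[of i j l k] b F1 by auto
        hence "(\<lambda>x\<in>S. - 1 * (PQ i j l k x - R i j l k x)) \<in> W" by (rule fsub_smult[OF Wf])
        thus ?thesis by (rule fsub_cong) (simp add: Rs Ps)
      next
        case False2: False
        have "False" using False False2 F1 by auto
        thus ?thesis ..
      qed
    qed
  qed
  have main: "(\<lambda>x\<in>S. psi c x - ((\<Sum>p<n. \<Sum>q<n. kap c p q * B p q x) + pr c * D x)) \<in> W" for c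
  proof -
    have "(\<lambda>x\<in>S. \<Sum>i<n. \<Sum>j<n. \<Sum>k<n. \<Sum>l<n. c i j k l * (PQ i j k l x - R i j k l x)) \<in> W"
      by (intro fsub_sum[OF Wf] fsub_smult[OF Wf] PQR) auto
    thus ?thesis
    proof (rule fsub_cong)
      fix x
      let ?S = "\<lambda>f. \<Sum>i<n. \<Sum>j<n. \<Sum>k<n. \<Sum>l<n. (f i j k l :: 'k)"
      have 1: "?S (\<lambda>i j k l. c i j k l * (if j = l then B i k x else 0)) = (\<Sum>p<n. \<Sum>q<n. \<Sum>j<n. c p j q j * B p q x)"
      proof -
        have "?S (\<lambda>i j k l. c i j k l * (if j = l then B i k x else 0)) = (\<Sum>i<n. \<Sum>j<n. \<Sum>k<n. c i j k j * B i k x)"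
          by (intro sum.cong refl) (simp add: if_distrib[of "\<lambda>c. _ * c"] cong: if_cong)
        also have "\<dots> = (\<Sum>p<n. \<Sum>q<n. \<Sum>j<n. c p j q j * B p q x)" by (intro sum.cong[OF refl] sum.swap)
        finally show ?thesis .
      qed
      have 2: "?S (\<lambda>i j k l. c i j k l * (if j = k then B i l x else 0)) = (\<Sum>p<n. \<Sum>q<n. \<Sum>j<n. c p j j q * B p q x)"
      proof -
        have "?S (\<lambda>i j k l. c i j k l * (if j = k then B i l x else 0)) = (\<Sum>i<n. \<Sum>j<n. \<Sum>l<n. \<Sum>k<n. c i j k l * (if j = k then B i l x else 0))"
          by (intro sum.cong[OF refl] sum.swap)
        also have "\<dots> = (\<Sum>i<n. \<Sum>j<n. \<Sum>l<n. c i j j l * B i l x)"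
          by (intro sum.cong refl) (simp add: if_distrib[of "\<lambda>c. _ * c"] cong: if_cong)
        also have "\<dots> = (\<Sum>p<n. \<Sum>q<n. \<Sum>j<n. c p j j q * B p q x)" by (intro sum.cong[OF refl] sum.swap)
        finally show ?thesis .
      qed
      have 3: "?S (\<lambda>i j k l. c i j k l * (if i = l then B j k x else 0)) = (\<Sum>p<n. \<Sum>q<n. \<Sum>j<n. c j p q j * B p q x)"
      proof -
        have "?S (\<lambda>i j k l. c i j k l * (if i = l then B j k x else 0)) = (\<Sum>i<n. \<Sum>j<n. \<Sum>k<n. c i j k i * B j k x)"
          by (intro sum.cong refl) (simp add: if_distrib[of "\<lambda>c. _ * c"] cong: if_cong)
        also have "\<dots> = (\<Sum>j<n. \<Sum>i<n. \<Sum>k<n. c i j k i * B j k x)" by (rule sum.swap)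
        also have "\<dots> = (\<Sum>p<n. \<Sum>q<n. \<Sum>j<n. c j p q j * B p q x)" by (intro sum.cong[OF refl] sum.swap)
        finally show ?thesis .
      qed
      have 4: "?S (\<lambda>i j k l. c i j k l * (if i = k then B j l x else 0)) = (\<Sum>p<n. \<Sum>q<n. \<Sum>j<n. c j p j q * B p q x)"
      proof -
        have "?S (\<lambda>i j k l. c i j k l * (if i = k then B j l x else 0)) = (\<Sum>i<n. \<Sum>j<n. \<Sum>l<n. \<Sum>k<n. c i j k l * (if i = k then B j l x else 0))"
          by (intro sum.cong[OF refl] sum.swap)
        also have "\<dots> = (\<Sum>i<n. \<Sum>j<n. \<Sum>l<n. c i j i l * B j l x)"
          by (intro sum.cong refl) (simp add: if_distrib[of "\<lambda>c. _ * c"] cong: if_cong)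
        also have "\<dots> = (\<Sum>j<n. \<Sum>i<n. \<Sum>l<n. c i j i l * B j l x)" by (rule sum.swap)
        also have "\<dots> = (\<Sum>p<n. \<Sum>q<n. \<Sum>j<n. c j p j q * B p q x)" by (intro sum.cong[OF refl] sum.swap)
        finally show ?thesis .
      qed
      have 5: "?S (\<lambda>i j k l. c i j k l * (if i = k \<and> j = l then D x else 0)) = (\<Sum>i<n. \<Sum>j<n. c i j i j) * D x"
      proof -
        have "?S (\<lambda>i j k l. c i j k l * (if i = k \<and> j = l then D x else 0)) = (\<Sum>i<n. \<Sum>j<n. \<Sum>k<n. \<Sum>l<n. if j = l then if i = k then c i j k l * D x else 0 else 0)"
          by (intro sum.cong refl) auto
        thus ?thesis by (simp add: sum_distrib_right)
      qed
      have 6: "?S (\<lambda>i j k l. c i j k l * (if i = l \<and> j = k then D x else 0)) = (\<Sum>i<n. \<Sum>j<n. c i j j i) * D x"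
      proof -
        have "?S (\<lambda>i j k l. c i j k l * (if i = l \<and> j = k then D x else 0)) = (\<Sum>i<n. \<Sum>j<n. \<Sum>k<n. \<Sum>l<n. if i = l then if j = k then c i j k l * D x else 0 else 0)"
          by (intro sum.cong refl) auto
        thus ?thesis by (simp add: sum_distrib_right)
      qed
      have "(\<Sum>i<n. \<Sum>j<n. \<Sum>k<n. \<Sum>l<n. c i j k l * (PQ i j k l x - R i j k l x)) = psi c x -
        (?S (\<lambda>i j k l. c i j k l * (if j = l then B i k x else 0)) - ?S (\<lambda>i j k l. c i j k l * (if j = k then B i l x else 0))
        - ?S (\<lambda>i j k l. c i j k l * (if i = l then B j k x else 0)) + ?S (\<lambda>i j k l. c i j k l * (if i = k then B j l x else 0))
        + ?S (\<lambda>i j k l. c i j k l * (if i = k \<and> j = l then D x else 0)) - ?S (\<lambda>i j k l. c i j k l * (if i = l \<and> j = k then D x else 0)))"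
        unfolding psi_def sum_subtractf[symmetric] sum.distrib[symmetric]
        by (intro sum.cong refl) (simp only: R_def algebra_simps)
      also have "\<dots> = psi c x - ((\<Sum>p<n. \<Sum>q<n. kap c p q * B p q x) + pr c * D x)"
      proof -
        have "(\<Sum>p<n. \<Sum>q<n. kap c p q * B p q x) = (\<Sum>p<n. \<Sum>q<n. \<Sum>j<n. c p j q j * B p q x)
          - (\<Sum>p<n. \<Sum>q<n. \<Sum>j<n. c j p q j * B p q x) - (\<Sum>p<n. \<Sum>q<n. \<Sum>j<n. c p j j q * B p q x)
          + (\<Sum>p<n. \<Sum>q<n. \<Sum>j<n. c j p j q * B p q x)"
          unfolding kap_def asym_def sum_distrib_right sum_subtractf[symmetric] sum.distrib[symmetric]
          by (intro sum.cong refl) (simp add: algebra_simps)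
        moreover have "pr c * D x = (\<Sum>i<n. \<Sum>j<n. c i j i j) * D x - (\<Sum>i<n. \<Sum>j<n. c i j j i) * D x"
          by (simp add: pr_def sum_subtractf left_diff_distrib)
        ultimately show ?thesis unfolding 1 2 3 4 5 6 by simp
      qed
      finally show "(\<Sum>i<n. \<Sum>j<n. \<Sum>k<n. \<Sum>l<n. c i j k l * (PQ i j k l x - R i j k l x)) = psi c x - ((\<Sum>p<n. \<Sum>q<n. kap c p q * B p q x) + pr c * D x)" .
    qed
  qed
  have rel1: "(\<lambda>x\<in>S. (of_nat n - 2) * B i j x) \<in> W" if ij: "i < n" "j < n" "i \<noteq> j" for i j
  proof -
    \<comment> \<open>The sum of the \<open>PQ i l j l\<close> is zero, while
      \<open>R i l j l\<close> equals \<open>B i j\<close> except at \<open>l = i\<close> and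
      \<open>l = j\<close>, where it vanishes. This leaves \<open>n - 2\<close> terms.\<close>
    have "(\<lambda>x\<in>S. - 1 * (\<Sum>l<n. PQ i l j l x - R i l j l x)) \<in> W"
      using ij by (intro fsub_smult[OF Wf] fsub_sum[OF Wf] PQR) auto
    thus ?thesis
    proof (rule fsub_cong)
      fix x assume x: "x \<in> S"
      have "(\<Sum>l<n. PQ i l j l x) = 0" using T_const[OF x ij(1,2), of "\<lambda>_. 1" 1] by (simp add: T_def)
      moreover have "(\<Sum>l<n. R i l j l x) = (\<Sum>l<n. B i j x - ((if l = j then B i j x else 0) + (if l = i then B i j x else 0)))"
        using ij by (intro sum.cong) (auto simp: R_def)
      ultimately show "- 1 * (\<Sum>l<n. PQ i l j l x - R i l j l x) = (of_nat n - 2) * B i j x"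
        using ij by (simp add: sum_subtractf sum.distrib algebra_simps)
    qed
  qed
  have rel2: "(\<lambda>x\<in>S. (of_nat n - 2) * B i i x + (\<Sum>l<n. B l l x) + (of_nat n - 1) * D x) \<in> W" if i: "i < n" for i
  proof -
    have "(\<lambda>x\<in>S. - 1 * (\<Sum>l<n. PQ i l i l x - R i l i l x)) \<in> W"
      using i by (intro fsub_smult[OF Wf] fsub_sum[OF Wf] PQR) auto
    thus ?thesis
    proof (rule fsub_cong)
      fix x assume x: "x \<in> S"
      have "(\<Sum>l<n. PQ i l i l x) = 0" using T_const[OF x i i, of "\<lambda>_. 1" 1] by (simp add: T_def)
      \<comment> \<open>At \<open>l = i\<close> the generic value is \<open>2 * B i i + D\<close>,
        but \<open>R\<close> is zero there, so it is subtracted again.\<close>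
      moreover have "(\<Sum>l<n. R i l i l x) = (\<Sum>l<n. (B i i x + B l l x + D x) - (if l = i then 2 * B i i x + D x else 0))"
        by (intro sum.cong) (auto simp: R_def)
      ultimately show "- 1 * (\<Sum>l<n. PQ i l i l x - R i l i l x) = (of_nat n - 2) * B i i x + (\<Sum>l<n. B l l x) + (of_nat n - 1) * D x"
        using i by (simp add: sum_subtractf sum.distrib algebra_simps)
    qed
  qed
  have rel3: "(\<lambda>x\<in>S. (of_nat n - 1) * (\<Sum>l<n. B l l x) + of_nat (n choose 2) * D x) \<in> W"
  proof -
    have "(\<lambda>x\<in>S. - 1 * (\<Sum>i<n. \<Sum>j<n. if i < j then PQ i j i j x - R i j i j x else 0)) \<in> W"
    proof (intro fsub_smult[OF Wf] fsub_sum[OF Wf])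
      fix i j assume "i \<in> {..<n}" "j \<in> {..<n}"
      thus "(\<lambda>x\<in>S. if i < j then PQ i j i j x - R i j i j x else 0) \<in> W"
        using PQR[of i j i j] fsub_zero[OF Wf] by (cases "i < j") auto
    qed
    thus ?thesis
    proof (rule fsub_cong)
      fix x assume x: "x \<in> S"
      have "(\<Sum>i<n. \<Sum>j<n. if i < j then PQ i j i j x - R i j i j x else 0)
        = (\<Sum>i<n. \<Sum>j<n. if i < j then PQ i j i j x else 0) - (\<Sum>i<n. \<Sum>j<n. if i < j then B i i x + B j j x + D x else 0)"
        unfolding sum_subtractf[symmetric] by (intro sum.cong refl) (auto simp: R_def)
      thus "- 1 * (\<Sum>i<n. \<Sum>j<n. if i < j then PQ i j i j x - R i j i j x else 0) = (of_nat n - 1) * (\<Sum>l<n. B l l x) + of_nat (n choose 2) * D x"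
        unfolding pair_zero[OF x] using pair_sum[where A = "\<lambda>i. B i i x" and m = n and D = "D x"] by simp
    qed
  qed
  show ?thesis
    by (rule that[of B D]) (use main rel1 rel2 rel3 in \<open>auto simp: B_def A_def\<close>)
qed

end

end

section \<open>Quotients and dimensions of modules\<close>

lemma vectorspace_class_ringI: "module class_ring V \<Longrightarrow> vectorspace (class_ring :: 'k :: field ring) V"
  by (simp add: vectorspace_def class_field)

text \<open>Independent subsets of the kernel stay independent in \<open>X\<close>, so their size is
  bounded by the dimension of \<open>X\<close>, and a maximal one is a finite basis. This finiteness
  of the kernel is what the modules \<open>L\<close> require.\<close>

lemma rank_nullity_surj:
  fixes X :: "('k :: field, 'v, 'c) module_scheme" and Y :: "('k, 'w, 'd) module_scheme"
  assumes X: "module class_ring X" and Y: "module class_ring Y" and fd: "vectorspace.fin_dim class_ring X"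
    and T: "T \<in> LinearCombinations.module_hom class_ring X Y" and surj: "T ` carrier X = carrier Y"
    and K: "K = {v \<in> carrier X. T v = \<zero>\<^bsub>Y\<^esub>}"
  shows "vectorspace.fin_dim class_ring Y" "vectorspace.fin_dim class_ring (X\<lparr>carrier := K\<rparr>)"
    "module class_ring (X\<lparr>carrier := K\<rparr>)"
    "vectorspace.dim class_ring Y + vectorspace.dim class_ring (X\<lparr>carrier := K\<rparr>) = vectorspace.dim class_ring X"
proof -
  interpret linear_map class_ring X Y T
    using X Y T by (intro linear_map.intro vectorspace_class_ringI mod_hom.intro mod_hom_axioms.intro)
  have k: "kerT = K" by (auto simp: ker_def K)
  show "vectorspace.fin_dim class_ring Y" by (rule rank_nullity_main(2)[OF fd surj])
  have im: "imT = carrier Y" using surj by (simp add: im_def)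
  show "W.dim + vectorspace.dim class_ring (X\<lparr>carrier := K\<rparr>) = V.dim"
    using rank_nullity_main(1)[OF fd] unfolding im k by simp
  have sub: "subspace class_ring K X" using kerT_is_subspace k by simp
  interpret ker: vectorspace class_ring "V.vs K" by (rule V.subspace_is_vs[OF sub])
  show "module class_ring (X\<lparr>carrier := K\<rparr>)" using V.subspace_is_vs[OF sub] by (rule vectorspace.axioms(1))
  have "finite A \<and> card A \<le> V.dim" if A: "A \<subseteq> K" "ker.lin_indpt A" for A
  proof -
    have "V.module.lin_indpt A" using A sub V.module.span_li_not_depend(2)[of A K] by auto
    moreover have "A \<subseteq> carrier X" using A K by auto
    ultimately show ?thesis using V.li_le_dim fd by blast
  qed
  hence "\<exists>A. finite A \<and> maximal A (\<lambda>A. A \<subseteq> carrier (V.vs K) \<and> ker.lin_indpt A)"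
    by (intro maximal_exists[where N = V.dim and B = "{}"]) (auto simp: ker.lin_dep_def)
  then obtain A where A: "finite A" "maximal A (\<lambda>A. A \<subseteq> carrier (V.vs K) \<and> ker.lin_indpt A)" by blast
  hence "ker.basis A" by (intro ker.max_li_is_basis)
  thus "ker.fin_dim" using A(1) by (auto simp: ker.fin_dim_def ker.basis_def)
qed

text \<open>The coordinate space of \<open>I\<close>, used as source and target of the linear maps
  whose ranks are counted.\<close>

definition FS :: "'i set \<Rightarrow> ('k :: field, 'i \<Rightarrow> 'k) module" where
  "FS I = \<lparr>carrier = {f. \<forall>i. i \<notin> I \<longrightarrow> f i = 0}, mult = undefined, one = undefined, zero = (\<lambda>_. 0),
     add = (\<lambda>f h i. f i + h i), smult = (\<lambda>c f i. c * f i)\<rparr>"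

lemma FS_simps [simp]: "f \<in> carrier (FS I) \<longleftrightarrow> (\<forall>i. i \<notin> I \<longrightarrow> f i = 0)" "zero (FS I) = (\<lambda>_. 0)"
  "add (FS I) = (\<lambda>f h i. f i + h i)" "smult (FS I) = (\<lambda>c f i. c * f i)"
  by (simp_all add: FS_def)

lemma FS_module: "module class_ring (FS I :: ('k :: field, 'i \<Rightarrow> 'k) module)"
proof (rule module_criteria)
  show "cring (class_ring :: 'k ring)" by (intro domain.axioms(1) field.axioms(1) class_field)
  show "\<forall>v\<in>carrier (FS I). \<exists>w\<in>carrier (FS I). v \<oplus>\<^bsub>FS I\<^esub> w = (\<zero>\<^bsub>FS I\<^esub> :: 'i \<Rightarrow> 'k)"
  proof
    fix v :: "'i \<Rightarrow> 'k" assume "v \<in> carrier (FS I)"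
    thus "\<exists>w\<in>carrier (FS I). v \<oplus>\<^bsub>FS I\<^esub> w = \<zero>\<^bsub>FS I\<^esub>" by (intro bexI[of _ "\<lambda>i. - v i"]) auto
  qed
qed (auto simp: algebra_simps)

lemma FS_dim:
  assumes "finite I"
  shows "vectorspace.fin_dim class_ring (FS I :: ('k :: field, 'i \<Rightarrow> 'k) module)"
    "vectorspace.dim class_ring (FS I :: ('k, 'i \<Rightarrow> 'k) module) = card I"
proof -
  obtain h where h: "bij_betw h I {0..<card I}" using ex_bij_betw_finite_nat[OF assms] by blast
  let ?F = "FS I :: ('k, 'i \<Rightarrow> 'k) module"
  let ?T = "\<lambda>v :: 'k vec. \<lambda>i. if i \<in> I then v $ h i else 0"
  let ?V = "module_vec TYPE('k) (card I)"
  interpret vec: vec_space "TYPE('k)" "card I" .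
  have hI: "h i < card I" if "i \<in> I" for i using h that by (auto simp: bij_betw_def)
  have hom: "?T \<in> LinearCombinations.module_hom class_ring ?V ?F"
    using hI by (auto simp: LinearCombinations.module_hom_def module_vec_simps)
  have surj: "?T ` carrier ?V = carrier ?F"
  proof (intro equalityI subsetI)
    fix f assume f: "f \<in> carrier ?F"
    let ?v = "vec (card I) (\<lambda>k. f (the_inv_into I h k))"
    have "?T ?v = f"
    proof
      fix i show "?T ?v i = f i"
        using f hI h by (auto simp: the_inv_into_f_f bij_betw_def)
    qed
    thus "f \<in> ?T ` carrier ?V" by (intro image_eqI[of _ _ ?v]) (auto simp: module_vec_simps)
  qed (auto simp: module_vec_simps)
  have inj: "inj_on ?T (carrier ?V)"
  proof (rule inj_onI)
    fix u v :: "'k vec" assume uv: "u \<in> carrier ?V" "v \<in> carrier ?V" "?T u = ?T v"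
    show "u = v"
    proof (rule eq_vecI)
      fix k assume "k < dim_vec v"
      hence "k \<in> h ` I" using h uv by (auto simp: bij_betw_def module_vec_simps)
      then obtain i where i: "i \<in> I" "k = h i" by auto
      have "?T u i = ?T v i" using uv(3) by (rule fun_cong)
      thus "u $ k = v $ k" using i by simp
    qed (use uv in \<open>auto simp: module_vec_simps\<close>)
  qed
  interpret linear_map class_ring ?V ?F ?T
    using hom by (intro linear_map.intro vectorspace_class_ringI mod_hom.intro mod_hom_axioms.intro FS_module vec_module)
  show "vectorspace.fin_dim class_ring ?F" by (rule surj_fin_dim[OF vec.fin_dim surj])
  show "vectorspace.dim class_ring ?F = card I" using dim_eq[OF vec.fin_dim inj surj] vec.dim_is_n by simp
qed

text \<open>The cosets of the kernel are the fibres of \<open>\<Phi>\<close>. Hence the induced map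
  takes the common value of \<open>\<Phi>\<close> on a coset, and every operation on cosets can be
  checked by the values of \<open>\<Phi>\<close> on its result.\<close>

lemma quotient_gmodule_iso:
  fixes H :: "('k :: field, 'v, 'g) gmodule" and Y :: "('k, 'w, 'g) gmodule"
  assumes H: "module class_ring H" and Y: "module class_ring Y"
    and hom: "\<Phi> \<in> LinearCombinations.module_hom class_ring H Y" and surj: "\<Phi> ` carrier H = carrier Y"
    and act: "\<And>g v. g \<in> carrier G \<Longrightarrow> v \<in> carrier H \<Longrightarrow> \<Phi> (act H g v) = act Y g (\<Phi> v)"
    and K: "K = {v \<in> carrier H. \<Phi> v = \<zero>\<^bsub>Y\<^esub>}"
  shows "gmodule_iso G (quotient_gmodule H K) Y"
proof -
  interpret mod_hom class_ring H Y \<Phi>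
    using H Y hom by (intro mod_hom.intro mod_hom_axioms.intro)
  have coset: "K +>\<^bsub>H\<^esub> v = {w \<in> carrier H. \<Phi> w = \<Phi> v}" if v: "v \<in> carrier H" for v
  proof (intro equalityI subsetI)
    fix w assume "w \<in> K +>\<^bsub>H\<^esub> v"
    then obtain k where "k \<in> K" "w = k \<oplus>\<^bsub>H\<^esub> v" by (auto simp: a_r_coset_def')
    thus "w \<in> {w \<in> carrier H. \<Phi> w = \<Phi> v}" using v by (auto simp: K)
  next
    fix w assume w: "w \<in> {w \<in> carrier H. \<Phi> w = \<Phi> v}"
    hence "w \<ominus>\<^bsub>H\<^esub> v \<in> K" using v by (simp add: K a_minus_def N.M.r_neg)
    moreover have "w = (w \<ominus>\<^bsub>H\<^esub> v) \<oplus>\<^bsub>H\<^esub> v"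
      using v w by (simp add: a_minus_def M.M.a_assoc M.M.l_neg)
    ultimately show "w \<in> K +>\<^bsub>H\<^esub> v" by (auto simp: a_r_coset_def')
  qed
  define f where "f X = the_elem (\<Phi> ` X)" for X
  have f: "f X = y" if "\<And>x. x \<in> X \<Longrightarrow> \<Phi> x = y" "X \<noteq> {}" for X y
  proof -
    have "\<Phi> ` X = {y}" using that by auto
    thus ?thesis by (simp add: f_def)
  qed
  let ?Q = "quotient_gmodule H K"
  have car: "\<exists>v. v \<in> carrier H \<and> X = {w \<in> carrier H. \<Phi> w = \<Phi> v}" if "X \<in> carrier ?Q" for X
    using that coset by (auto simp: quotient_gmodule_def A_RCOSETS_def')
  have carI: "{w \<in> carrier H. \<Phi> w = \<Phi> v} \<in> carrier ?Q" if "v \<in> carrier H" for v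
    using that coset[OF that] by (auto simp: quotient_gmodule_def A_RCOSETS_def')
  have fX: "f {w \<in> carrier H. \<Phi> w = \<Phi> v} = \<Phi> v" if "v \<in> carrier H" for v
    using that by (intro f) auto
  have K0: "\<zero>\<^bsub>H\<^esub> \<in> K" by (simp add: K)
  have "f \<in> LinearCombinations.module_hom class_ring ?Q Y"
    unfolding LinearCombinations.module_hom_def
  proof (intro CollectI conjI allI impI; (elim conjE)?)
    show "f \<in> carrier ?Q \<rightarrow> carrier Y"
    proof
      fix X assume "X \<in> carrier ?Q"
      from car[OF this] fX show "f X \<in> carrier Y" by auto
    qed
  next
    fix X X' assume X: "X \<in> carrier ?Q" "X' \<in> carrier ?Q"
    obtain v v' where v: "v \<in> carrier H" "X = {w \<in> carrier H. \<Phi> w = \<Phi> v}"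
      "v' \<in> carrier H" "X' = {w \<in> carrier H. \<Phi> w = \<Phi> v'}" using car[OF X(1)] car[OF X(2)] by blast
    have "f (X \<oplus>\<^bsub>?Q\<^esub> X') = \<Phi> v \<oplus>\<^bsub>Y\<^esub> \<Phi> v'"
    proof (rule f)
      show "\<Phi> x = \<Phi> v \<oplus>\<^bsub>Y\<^esub> \<Phi> v'" if x: "x \<in> X \<oplus>\<^bsub>?Q\<^esub> X'" for x
      proof -
        obtain w w' where "w \<in> X" "w' \<in> X'" "x = w \<oplus>\<^bsub>H\<^esub> w'"
          using x by (auto simp: quotient_gmodule_def AbelCoset.set_add_def')
        thus ?thesis using v by simp
      qed
      have "v \<in> X" "v' \<in> X'" using v by auto
      thus "X \<oplus>\<^bsub>?Q\<^esub> X' \<noteq> {}" by (auto simp: quotient_gmodule_def AbelCoset.set_add_def')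
    qed
    thus "f (X \<oplus>\<^bsub>?Q\<^esub> X') = f X \<oplus>\<^bsub>Y\<^esub> f X'" using v fX by simp
  next
    fix c X assume X: "X \<in> carrier ?Q"
    obtain v where v: "v \<in> carrier H" "X = {w \<in> carrier H. \<Phi> w = \<Phi> v}" using car[OF X] by blast
    have "f (c \<odot>\<^bsub>?Q\<^esub> X) = c \<odot>\<^bsub>Y\<^esub> \<Phi> v"
    proof (rule f)
      show "\<Phi> x = c \<odot>\<^bsub>Y\<^esub> \<Phi> v" if x: "x \<in> c \<odot>\<^bsub>?Q\<^esub> X" for x
      proof -
        obtain k w where "k \<in> K" "w \<in> X" "x = k \<oplus>\<^bsub>H\<^esub> (c \<odot>\<^bsub>H\<^esub> w)"
          using x by (auto simp: quotient_gmodule_def AbelCoset.set_add_def')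
        thus ?thesis using v by (simp add: K)
      qed
      have "v \<in> X" using v by auto
      thus "c \<odot>\<^bsub>?Q\<^esub> X \<noteq> {}" using K0 by (auto simp: quotient_gmodule_def AbelCoset.set_add_def')
    qed
    thus "f (c \<odot>\<^bsub>?Q\<^esub> X) = c \<odot>\<^bsub>Y\<^esub> f X" using v fX by simp
  qed
  moreover have "bij_betw f (carrier ?Q) (carrier Y)"
  proof (rule bij_betw_imageI)
    show "inj_on f (carrier ?Q)"
    proof (rule inj_onI)
      fix X X' assume X: "X \<in> carrier ?Q" "X' \<in> carrier ?Q" "f X = f X'"
      obtain v v' where v: "v \<in> carrier H" "X = {w \<in> carrier H. \<Phi> w = \<Phi> v}"
        "v' \<in> carrier H" "X' = {w \<in> carrier H. \<Phi> w = \<Phi> v'}" using car[OF X(1)] car[OF X(2)] by blast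
      thus "X = X'" using X(3) fX by simp
    qed
    show "f ` carrier ?Q = carrier Y"
    proof (intro equalityI subsetI)
      fix y assume "y \<in> f ` carrier ?Q"
      then obtain X where X: "X \<in> carrier ?Q" "y = f X" by auto
      from car[OF X(1)] fX X(2) show "y \<in> carrier Y" by auto
    next
      fix y assume "y \<in> carrier Y"
      then obtain v where v: "v \<in> carrier H" "y = \<Phi> v" using surj by auto
      show "y \<in> f ` carrier ?Q" by (rule image_eqI[OF _ carI[OF v(1)]]) (simp add: fX v)
    qed
  qed
  moreover have "f (act ?Q g X) = act Y g (f X)" if g: "g \<in> carrier G" and X: "X \<in> carrier ?Q" for g X
  proof -
    obtain v where v: "v \<in> carrier H" "X = {w \<in> carrier H. \<Phi> w = \<Phi> v}" using car[OF X] by blast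
    have "f (act ?Q g X) = act Y g (\<Phi> v)"
      by (rule f) (use v act[OF g] in \<open>auto simp: quotient_gmodule_def\<close>)
    thus ?thesis using v fX by simp
  qed
  ultimately show ?thesis unfolding gmodule_iso_def by blast
qed

context sln
begin

text \<open>The operations of \<open>H0\<close> do not involve the weight, so weight 0 serves as a
  template: an invariant space of functions becomes a module by replacing the carrier.\<close>

abbreviation FM :: "('k mat \<Rightarrow> 'k) set \<Rightarrow> ('k, 'k mat \<Rightarrow> 'k, 'k mat) gmodule" where
  "FM W \<equiv> (H0 TYPE('k) n (\<lambda>_. 0))\<lparr>carrier := W\<rparr>"

lemma H0_FM: "H0 TYPE('k) n \<mu> = FM (V \<mu>)" "(H0 TYPE('k) n \<mu>)\<lparr>carrier := W\<rparr> = FM W"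
  by (simp_all add: H0_def)

lemma FM_simps [simp]: "zero (FM W) = (\<lambda>x\<in>S. 0)" "add (FM W) = (\<lambda>f h. \<lambda>x\<in>S. f x + h x)"
  "smult (FM W) = (\<lambda>c f. \<lambda>x\<in>S. c * f x)" "act (FM W) = (\<lambda>g f. \<lambda>x\<in>S. f (iv g * x))"
  by (simp_all add: H0_def SL_def)

definition inv_sub :: "('k mat \<Rightarrow> 'k) set \<Rightarrow> bool" where
  "inv_sub W \<longleftrightarrow> func_sub W \<and> (\<forall>g\<in>S. \<forall>f\<in>W. (\<lambda>x\<in>S. f (iv g * x)) \<in> W)"

lemma fsub_ext: "func_sub W \<Longrightarrow> f \<in> W \<Longrightarrow> restrict f S = f"
  by (auto simp: func_sub_def intro!: extensional_restrict)

lemma FM_module: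
  assumes W: "func_sub W"
  shows "module class_ring (FM W)"
proof (rule module_criteria)
  show "cring (class_ring :: 'k ring)" by (intro domain.axioms(1) field.axioms(1) class_field)
  show "\<forall>v\<in>carrier (FM W). \<exists>w\<in>carrier (FM W). v \<oplus>\<^bsub>FM W\<^esub> w = \<zero>\<^bsub>FM W\<^esub>"
  proof
    fix v assume "v \<in> carrier (FM W)"
    hence v: "v \<in> W" by simp
    show "\<exists>w\<in>carrier (FM W). v \<oplus>\<^bsub>FM W\<^esub> w = \<zero>\<^bsub>FM W\<^esub>"
    proof (rule bexI[of _ "\<lambda>x\<in>S. - 1 * v x"])
      have "(\<lambda>x\<in>S. - 1 * v x) \<in> W" using v W unfolding func_sub_def by blast
      thus "(\<lambda>x\<in>S. - 1 * v x) \<in> carrier (FM W)" by simp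
    qed auto
  qed
  show "\<forall>v\<in>carrier (FM W). v \<oplus>\<^bsub>FM W\<^esub> \<zero>\<^bsub>FM W\<^esub> = v"
  proof
    fix v assume "v \<in> carrier (FM W)"
    moreover have "(\<lambda>x\<in>S. v x + (\<lambda>x\<in>S. 0) x) = restrict v S" by (rule restrict_ext) simp
    ultimately show "v \<oplus>\<^bsub>FM W\<^esub> \<zero>\<^bsub>FM W\<^esub> = v" using fsub_ext[OF W] by simp
  qed
qed (use W fsub_ext[OF W] in \<open>auto simp: func_sub_def algebra_simps intro!: restrict_ext\<close>)

lemma FM_gmodule:
  assumes W: "inv_sub W"
  shows "G_module (SL n) (FM W)"
proof (rule G_module.intro)
  have f: "func_sub W" using W by (simp add: inv_sub_def)
  have ext: "f \<in> extensional S" if "f \<in> W" for f using f that by (auto simp: func_sub_def)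
    show "group (SL n :: 'k mat monoid)" by (rule SLG.is_group)
  show "vectorspace class_ring (FM W)" by (rule vectorspace_class_ringI[OF FM_module[OF f]])
  show "G_module_axioms (SL n) (FM W)"
  proof
    fix g assume g: "g \<in> S"
    show "act (FM W) g \<in> LinearCombinations.module_hom class_ring (FM W) (FM W)"
      using W g by (auto simp: LinearCombinations.module_hom_def inv_sub_def S_mult intro!: restrict_ext)
  next
    fix v assume v: "v \<in> carrier (FM W)"
    have "iv (1\<^sub>m n) = 1\<^sub>m n" using iv_eqI[OF S_one, of "1\<^sub>m n"] by simp
    thus "act (FM W) \<one>\<^bsub>SL n\<^esub> v = v"
      using v ext S_carrier by (auto intro!: extensionalityI[of _ S])
  next
    fix g h v assume g: "g \<in> S" "h \<in> S" "v \<in> carrier (FM W)"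
    show "act (FM W) (g \<otimes>\<^bsub>SL n\<^esub> h) v = act (FM W) g (act (FM W) h v)"
      using g by (auto simp: iv_mult S_mult S_carrier assoc_mult_mat[of _ n n _ n _ n] intro!: restrict_ext)
  qed
qed

lemma gsubmodule_FM:
  assumes V: "inv_sub V'"
  shows "gsubmodule (SL n) W (FM V') \<longleftrightarrow> W \<subseteq> V' \<and> inv_sub W"
proof -
  have m: "module class_ring (FM V')" using V by (intro FM_module) (simp add: inv_sub_def)
  show ?thesis
  proof
    assume W: "gsubmodule (SL n) W (FM V')"
    hence s: "submodule class_ring W (FM V')" by (simp add: gsubmodule_def)
    have c: "W \<subseteq> V'" using submodule.subset[OF s] by simp
    moreover have "V' \<subseteq> extensional S" using V by (simp add: inv_sub_def func_sub_def)
    ultimately show "W \<subseteq> V' \<and> inv_sub W"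
      using W submodule.m_closed[OF s] submodule.zero_closed[OF s] submodule.smult_closed[OF s]
      by (auto simp: gsubmodule_def inv_sub_def func_sub_def)
  next
    assume "W \<subseteq> V' \<and> inv_sub W"
    thus "gsubmodule (SL n) W (FM V')"
      using m by (auto simp: gsubmodule_def inv_sub_def func_sub_def intro!: submodule.intro)
  qed
qed

lemma V_inv_sub: "inv_sub (V \<mu>)"
  unfolding inv_sub_def using V_fsub V_left by blast

lemma gsubmodule_H0: "gsubmodule (SL n) W (H0 TYPE('k) n \<mu>) \<longleftrightarrow> W \<subseteq> V \<mu> \<and> inv_sub W"
  by (subst H0_FM(1)) (rule gsubmodule_FM[OF V_inv_sub])

lemma simple_FM:
  assumes K: "inv_sub K" "K \<noteq> {\<lambda>x\<in>S. 0}" and min: "\<And>W. inv_sub W \<Longrightarrow> W \<subseteq> K \<Longrightarrow> W \<noteq> {\<lambda>x\<in>S. 0} \<Longrightarrow> K \<subseteq> W"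
  shows "simple_gmodule (SL n) (FM K)"
  unfolding simple_gmodule_def gsubmodule_FM[OF K(1)] using FM_gmodule[OF K(1)] K(2) min by auto

text \<open>A nonzero submodule contained in every nonzero one is simple, and any simple submodule
  contains it and so equals it. This justifies the definite description in \<open>L\<close>.\<close>

lemma L_eq:
  assumes K: "inv_sub K" "K \<noteq> {\<lambda>x\<in>S. 0}" "K \<subseteq> V \<mu>"
    and min: "\<And>W. inv_sub W \<Longrightarrow> W \<subseteq> V \<mu> \<Longrightarrow> W \<noteq> {\<lambda>x\<in>S. 0} \<Longrightarrow> K \<subseteq> W"
  shows "L TYPE('k) n \<mu> = FM K"
proof -
  have "(THE W. gsubmodule (SL n) W (H0 TYPE('k) n \<mu>) \<and> simple_gmodule (SL n) (FM W)) = K"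
  proof (rule the_equality)
    show "gsubmodule (SL n) K (H0 TYPE('k) n \<mu>) \<and> simple_gmodule (SL n) (FM K)"
      using K min simple_FM[OF K(1,2)] by (auto simp: gsubmodule_H0)
  next
    fix W assume W: "gsubmodule (SL n) W (H0 TYPE('k) n \<mu>) \<and> simple_gmodule (SL n) (FM W)"
    hence W1: "W \<subseteq> V \<mu>" "inv_sub W" by (auto simp: gsubmodule_H0)
    have W2: "W \<noteq> {\<lambda>x\<in>S. 0}" using W by (auto simp: simple_gmodule_def)
    have "K \<subseteq> W" by (rule min[OF W1(2,1) W2])
    moreover have "gsubmodule (SL n) K (FM W)" using calculation K gsubmodule_FM[OF W1(2)] by simp
    ultimately show "W = K" using W K(2) by (auto simp: simple_gmodule_def)
  qed
  thus ?thesis unfolding L_def Let_def H0_FM(2)[where \<mu> = \<mu>] by simp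
qed

end

context sl5
begin

lemma gsub_iff: "gsub \<mu> W \<longleftrightarrow> W \<subseteq> V \<mu> \<and> inv_sub W"
  by (auto simp: gsub_def inv_sub_def)

lemma psi_asym_cong:
  assumes "\<And>i j k l. i < n \<Longrightarrow> j < n \<Longrightarrow> k < n \<Longrightarrow> l < n \<Longrightarrow> asym c i j k l = asym c' i j k l"
  shows "psi c x = psi c' x"
  unfolding psi_asym using assms by (intro sum.cong refl) auto

lemma asym_sorted:
  assumes "\<And>i j k l. i < n \<Longrightarrow> j < n \<Longrightarrow> k < n \<Longrightarrow> l < n \<Longrightarrow> c' i j k l = (if i < j \<and> k < l then asym c i j k l else 0)"
    and "i < n" "j < n" "k < n" "l < n"
  shows "asym c' i j k l = asym c i j k l"
proof (cases i j rule: linorder_cases; cases k l rule: linorder_cases)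
qed (use assms asym_anti(1)[of c j i k l] asym_anti(2)[of c i j l k] asym_anti(1)[of c j i l k] in
    \<open>simp_all add: asym_def[of c'] asym_anti(3,4)\<close>)

text \<open>As \<open>G\<close> kills the kernel of \<open>psi\<close>, its value does not depend on
  the array chosen to represent a function.\<close>

lemma induced_hom:
  fixes Y :: "('k, 'w, 'z) module_scheme"
  assumes Y: "module class_ring Y" and car: "\<And>c. G c \<in> carrier Y"
    and lin: "\<And>c c' a. G (\<lambda>i j k l. c i j k l + a * c' i j k l) = G c \<oplus>\<^bsub>Y\<^esub> (a \<odot>\<^bsub>Y\<^esub> G c')"
    and wd: "\<And>c. \<forall>x\<in>S. psi c x = 0 \<Longrightarrow> G c = \<zero>\<^bsub>Y\<^esub>"
  obtains \<Phi> where "\<Phi> \<in> LinearCombinations.module_hom class_ring (FM (V mw)) Y" "\<forall>c. \<Phi> (\<lambda>x\<in>S. psi c x) = G c"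
    "{f \<in> V mw. \<Phi> f = \<zero>\<^bsub>Y\<^esub>} = {f. \<exists>c. f = (\<lambda>x\<in>S. psi c x) \<and> G c = \<zero>\<^bsub>Y\<^esub>}"
proof -
  interpret Y: Module.module class_ring Y by (rule Y)
  define \<Phi> where "\<Phi> f = G (SOME c. f = (\<lambda>x\<in>S. psi c x))" for f
  have eq: "G c = G c'" if e: "(\<lambda>x\<in>S. psi c x) = (\<lambda>x\<in>S. psi c' x)" for c c'
  proof -
    have e': "psi c x = psi c' x" if "x \<in> S" for x using fun_cong[OF e, of x] that by simp
    let ?d = "\<lambda>i j k l. c i j k l + (- 1) * c' i j k l"
    have "\<forall>x\<in>S. psi ?d x = 0" unfolding psi_add psi_smult by (simp add: e')
    hence "G ?d = \<zero>\<^bsub>Y\<^esub>" by (rule wd)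
    moreover have "G c = G ?d \<oplus>\<^bsub>Y\<^esub> (1 \<odot>\<^bsub>Y\<^esub> G c')" using lin[of ?d 1 c'] by simp
    ultimately show ?thesis using Y.smult_one car by simp
  qed
  have \<Phi>: "\<Phi> (\<lambda>x\<in>S. psi c x) = G c" for c
  proof -
    have "(\<lambda>x\<in>S. psi c x) = (\<lambda>x\<in>S. psi (SOME c'. (\<lambda>x\<in>S. psi c x) = (\<lambda>x\<in>S. psi c' x)) x)"
      by (rule someI[of _ c]) (rule refl)
    thus ?thesis unfolding \<Phi>_def by (rule eq[symmetric])
  qed
  have rep: "\<exists>c. f = (\<lambda>x\<in>S. psi c x)" if "f \<in> V mw" for f using that by (simp add: V_mw psi_functions_def)
  have G0: "G (\<lambda>i j k l. 0) = \<zero>\<^bsub>Y\<^esub>" by (rule wd) (simp add: psi_def)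
  show ?thesis
  proof (rule that)
    show "\<Phi> \<in> LinearCombinations.module_hom class_ring (FM (V mw)) Y"
      unfolding LinearCombinations.module_hom_def
    proof (intro CollectI conjI allI impI; (elim conjE)?)
      show "\<Phi> \<in> carrier (FM (V mw)) \<rightarrow> carrier Y" using car by (auto simp: \<Phi>_def)
    next
      fix f h assume fh: "f \<in> carrier (FM (V mw))" "h \<in> carrier (FM (V mw))"
      obtain c c' where c: "f = (\<lambda>x\<in>S. psi c x)" "h = (\<lambda>x\<in>S. psi c' x)" using rep[of f] rep[of h] fh by auto
      have "f \<oplus>\<^bsub>FM (V mw)\<^esub> h = (\<lambda>x\<in>S. psi (\<lambda>i j k l. c i j k l + 1 * c' i j k l) x)"
        unfolding psi_add psi_smult by (auto simp: c)
      thus "\<Phi> (f \<oplus>\<^bsub>FM (V mw)\<^esub> h) = \<Phi> f \<oplus>\<^bsub>Y\<^esub> \<Phi> h" using Y.smult_one car by (simp only: \<Phi> c lin) simp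
    next
      fix a f assume f: "f \<in> carrier (FM (V mw))"
      obtain c where c: "f = (\<lambda>x\<in>S. psi c x)" using rep[of f] f by auto
      have "a \<odot>\<^bsub>FM (V mw)\<^esub> f = (\<lambda>x\<in>S. psi (\<lambda>i j k l. 0 + a * c i j k l) x)"
        using psi_smult[of a c] by (auto simp: c)
      thus "\<Phi> (a \<odot>\<^bsub>FM (V mw)\<^esub> f) = a \<odot>\<^bsub>Y\<^esub> \<Phi> f" using car by (simp only: \<Phi> c lin G0) simp
    qed
    show "\<forall>c. \<Phi> (\<lambda>x\<in>S. psi c x) = G c" using \<Phi> by blast
    show "{f \<in> V mw. \<Phi> f = \<zero>\<^bsub>Y\<^esub>} = {f. \<exists>c. f = (\<lambda>x\<in>S. psi c x) \<and> G c = \<zero>\<^bsub>Y\<^esub>}"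
      using rep \<Phi> psi_V by auto metis
  qed
qed

definition unit_array :: "nat \<Rightarrow> nat \<Rightarrow> nat \<Rightarrow> nat \<Rightarrow> nat \<Rightarrow> nat \<Rightarrow> nat \<Rightarrow> nat \<Rightarrow> 'k" where
  "unit_array a b c d i j k l = (if i = a \<and> j = b \<and> k = c \<and> l = d then 1 else 0)"

lemma kap_unit_array:
  assumes "a < n" "b < n" "c < n" "d < n"
  shows "kap (unit_array a b c d) p q = (if p = a \<and> q = c \<and> b = d then 1 else 0) - (if p = b \<and> q = c \<and> a = d then 1 else 0)
    - (if p = a \<and> q = d \<and> b = c then 1 else 0) + (if p = b \<and> q = d \<and> a = c then 1 else 0)"
proof -
  have s: "(\<Sum>j<n. if Q \<and> j = s \<and> j = t then 1 else 0) = (if Q \<and> s = t then 1 else (0 :: 'k))" if "s < n" for Q s t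
  proof -
    have "(\<Sum>j<n. if Q \<and> j = s \<and> j = t then 1 else (0 :: 'k)) = (\<Sum>j<n. if j = s then if Q \<and> s = t then 1 else 0 else 0)"
      by (intro sum.cong) auto
    thus ?thesis using that by simp
  qed
  have "kap (unit_array a b c d) p q = (\<Sum>j<n. if (p = a \<and> q = c) \<and> j = b \<and> j = d then 1 else 0)
     - (\<Sum>j<n. if (p = b \<and> q = c) \<and> j = a \<and> j = d then 1 else 0) - (\<Sum>j<n. if (p = a \<and> q = d) \<and> j = b \<and> j = c then 1 else 0)
     + (\<Sum>j<n. if (p = b \<and> q = d) \<and> j = a \<and> j = c then 1 else 0)"
    unfolding kap_def asym_def sum_subtractf[symmetric] sum.distrib[symmetric]
    by (intro sum.cong refl arg_cong2[of _ _ _ _ "(+)"] arg_cong2[of _ _ _ _ "(-)"]) (auto simp: unit_array_def)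
  thus ?thesis unfolding s[OF assms(1)] s[OF assms(2)] by simp
qed

lemma pr_unit_array:
  assumes "a < n" "b < n"
  shows "pr (unit_array a b c d) = (if a = c \<and> b = d then 1 else 0) - (if a = d \<and> b = c then 1 else 0)"
proof -
  have "pr (unit_array a b c d) = (\<Sum>i<n. \<Sum>j<n. if j = b then if i = a then (if a = c \<and> b = d then 1 else 0) - (if a = d \<and> b = c then 1 else 0) else 0 else 0)"
    unfolding pr_def by (intro sum.cong refl) (auto simp: unit_array_def)
  thus ?thesis using assms by simp
qed

lemma psi_unit_array: "(\<lambda>x\<in>S. psi (unit_array 0 1 (n - 2) (n - 1)) x) \<noteq> (\<lambda>x\<in>S. 0)"
proof
  assume "(\<lambda>x\<in>S. psi (unit_array 0 1 (n - 2) (n - 1)) x) = (\<lambda>x\<in>S. 0)"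
  from fun_cong[OF this, of "1\<^sub>m n"] have "psi (unit_array 0 1 (n - 2) (n - 1)) (1\<^sub>m n) = 0" using S_one by simp
  moreover have "psi (unit_array 0 1 (n - 2) (n - 1)) (1\<^sub>m n) = (\<Sum>i<n. \<Sum>j<n. \<Sum>k<n. \<Sum>l<n.
     if l = n - 1 then if k = n - 2 then if j = 1 then if i = 0 then PQ i j k l (1\<^sub>m n) else 0 else 0 else 0 else 0)"
    unfolding psi_def by (intro sum.cong refl) (auto simp: unit_array_def)
  ultimately show False using n5 PQ_one[unfolded One_nat_def] by simp
qed

text \<open>\<open>trace_kap\<close> is the only constraint on the two invariants. Unit arrays give
  off-diagonal matrix units and differences of diagonal ones, all with \<open>pr\<close> zero, and a
  further array has \<open>pr\<close> equal to 1.\<close>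

lemma kap_pr_exists:
  assumes tr: "(\<Sum>i<n. m i i) = 2 * t"
  obtains c where "\<forall>p<n. \<forall>q<n. kap c p q = m p q" "pr c = t"
proof -
  define P where "P m t \<longleftrightarrow> (\<exists>c. (\<forall>p<n. \<forall>q<n. kap c p q = m p q) \<and> pr c = t)" for m t
  have add: "P (\<lambda>p q. m p q + m' p q) (t + t')" if mt: "P m t" "P m' t'" for m t m' t'
  proof -
    obtain c c' where "\<forall>p<n. \<forall>q<n. kap c p q = m p q" "pr c = t" "\<forall>p<n. \<forall>q<n. kap c' p q = m' p q" "pr c' = t'"
      using mt unfolding P_def by blast
    thus ?thesis unfolding P_def by (intro exI[of _ "\<lambda>i j k l. c i j k l + c' i j k l"]) (simp add: kap_add pr_add)
  qed
  have smult: "P (\<lambda>p q. a * m p q) (a * t)" if mt: "P m t" for a m t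
  proof -
    obtain c where "\<forall>p<n. \<forall>q<n. kap c p q = m p q" "pr c = t" using mt unfolding P_def by blast
    thus ?thesis unfolding P_def by (intro exI[of _ "\<lambda>i j k l. a * c i j k l"]) (simp add: kap_smult pr_smult)
  qed
  have zero: "P (\<lambda>p q. 0) 0"
    unfolding P_def by (intro exI[of _ "\<lambda>i j k l. 0"]) (simp add: kap_def pr_def asym_def)
  have sum: "P (\<lambda>p q. \<Sum>i<N. m i p q) 0" if "\<And>i. i < N \<Longrightarrow> P (m i) 0" for m and N :: nat
    using that
  proof (induction N)
    case (Suc N)
    thus ?case using add[of "\<lambda>p q. \<Sum>i<N. m i p q" 0 "m N" 0] by simp
  qed (simp add: zero)
  have cong: "P m' t" if "P m t" "\<And>p q. p < n \<Longrightarrow> q < n \<Longrightarrow> m p q = m' p q" for m m' t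
    using that unfolding P_def by simp
  have unit: "P (kap (unit_array a b c d)) (pr (unit_array a b c d))" for a b c d unfolding P_def by blast
  have third: "\<exists>r<n. r \<noteq> i \<and> r \<noteq> j" for i j
  proof -
    have "{0, 1, 2} - {i, j} \<noteq> ({} :: nat set)" by auto
    then obtain r where "r \<in> {0, 1, 2}" "r \<noteq> i" "r \<noteq> j" by blast
    thus ?thesis using n5 by (intro exI[of _ r]) auto
  qed
  have off: "P (\<lambda>p q. if p = i \<and> q = j then 1 else 0) 0" if ij: "i < n" "j < n" "i \<noteq> j" for i j
  proof -
    obtain r where r: "r < n" "r \<noteq> i" "r \<noteq> j" using third by blast
    have "P (kap (unit_array i r j r)) 0" using unit[of i r j r] r ij by (simp add: pr_unit_array)
    thus ?thesis by (rule cong) (use r ij in \<open>auto simp: kap_unit_array\<close>)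
  qed
  have diag: "P (\<lambda>p q. (if p = i \<and> q = i then 1 else 0) - (if p = 0 \<and> q = 0 then 1 else 0)) 0" if i: "i < n" "i \<noteq> 0" for i
  proof -
    obtain r where r: "r < n" "r \<noteq> i" "r \<noteq> 0" using third by blast
    have n0: "0 < n" using n5 by simp
    have "P (\<lambda>p q. kap (unit_array i r i r) p q + (- 1) * kap (unit_array 0 r 0 r) p q)
       (pr (unit_array i r i r) + (- 1) * pr (unit_array 0 r 0 r))" by (intro add smult unit)
    hence "P (\<lambda>p q. kap (unit_array i r i r) p q + (- 1) * kap (unit_array 0 r 0 r) p q) 0"
      using r i n0 by (simp add: pr_unit_array)
    thus ?thesis by (rule cong) (use r i n0 in \<open>auto simp: kap_unit_array\<close>)
  qed
  \<comment> \<open>The contraction of \<open>unit_array 0 1 0 1\<close>, with trace 2 and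
    \<open>pr\<close> 1; subtracting \<open>t * e\<close> leaves trace zero.\<close>
  define e where "e p q = (if p = 0 \<and> q = 0 then 1 else 0) + (if p = 1 \<and> q = 1 then 1 else (0 :: 'k))" for p q :: nat
  have e: "P e 1"
  proof -
    have "P (kap (unit_array 0 1 0 1)) 1" using unit[of 0 1 0 1] n5 by (simp add: pr_unit_array)
    thus ?thesis by (rule cong) (use n5 in \<open>auto simp: kap_unit_array e_def\<close>)
  qed
  define d where "d i = m i i - t * e i i" for i
  have "(\<Sum>i<n. e i i) = (\<Sum>i<n. if i = 0 then 1 else 0) + (\<Sum>i<n. if i = 1 then 1 else 0)"
    unfolding sum.distrib[symmetric] by (intro sum.cong) (auto simp: e_def)
  hence "(\<Sum>i<n. e i i) = 2" using n5 by simp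
  hence ds: "(\<Sum>i<n. d i) = 0" using tr by (simp add: d_def sum_subtractf sum_distrib_left[symmetric])
  have "P (\<lambda>p q. t * e p q + ((\<Sum>i<n. \<Sum>j<n. if i \<noteq> j then m i j * (if p = i \<and> q = j then 1 else 0) else 0)
      + (\<Sum>i<n. if i \<noteq> 0 then d i * ((if p = i \<and> q = i then 1 else 0) - (if p = 0 \<and> q = 0 then 1 else 0)) else 0))) (t * 1 + (0 + 0))"
  proof (intro add sum smult[OF e])
    show "P (\<lambda>p q. if i \<noteq> j then m i j * (if p = i \<and> q = j then 1 else 0) else 0) 0" if "i < n" "j < n" for i j
      using zero smult[OF off[OF that], of "m i j"] by (cases "i = j") simp_all
    show "P (\<lambda>p q. if i \<noteq> 0 then d i * ((if p = i \<and> q = i then 1 else 0) - (if p = 0 \<and> q = 0 then 1 else 0)) else 0) 0" if "i < n" for i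
      using zero smult[OF diag[OF that], of "d i"] by (cases "i = 0") simp_all
  qed
  hence "P m (t * 1 + (0 + 0))"
  proof (rule cong)
    fix p q assume pq: "p < n" "q < n"
    have 1: "(\<Sum>i<n. \<Sum>j<n. if i \<noteq> j then m i j * (if p = i \<and> q = j then 1 else 0) else 0) = (if p = q then 0 else m p q)"
    proof -
      have "(\<Sum>i<n. \<Sum>j<n. if i \<noteq> j then m i j * (if p = i \<and> q = j then 1 else 0) else 0)
        = (\<Sum>i<n. \<Sum>j<n. if j = q then if i = p then if p = q then 0 else m p q else 0 else 0)"
        by (intro sum.cong refl) auto
      thus ?thesis using pq by simp
    qed
    have 2: "(\<Sum>i<n. if i \<noteq> 0 then d i * ((if p = i \<and> q = i then 1 else 0) - (if p = 0 \<and> q = 0 then 1 else 0)) else 0)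
      = (if p = q then d p else 0)"
    proof -
      have "(\<Sum>i<n. if i \<noteq> 0 then d i * ((if p = i \<and> q = i then 1 else 0) - (if p = 0 \<and> q = 0 then 1 else 0)) else 0)
        = (\<Sum>i<n. (if i = p then if p = q then d p else 0 else 0) - d i * (if p = 0 \<and> q = 0 then 1 else 0))"
      proof (intro sum.cong refl)
        fix i
        show "(if i \<noteq> 0 then d i * ((if p = i \<and> q = i then 1 else 0) - (if p = 0 \<and> q = 0 then 1 else 0)) else 0)
          = (if i = p then if p = q then d p else 0 else 0) - d i * (if p = 0 \<and> q = 0 then 1 else 0)"
          by (cases "i = 0"; cases "p = i"; cases "q = i") auto
      qed
      also have "\<dots> = (if p = q then d p else 0)"
        using pq ds by (simp add: sum_subtractf sum_distrib_right[symmetric])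
      finally show ?thesis .
    qed
    show "t * e p q + ((\<Sum>i<n. \<Sum>j<n. if i \<noteq> j then m i j * (if p = i \<and> q = j then 1 else 0) else 0)
      + (\<Sum>i<n. if i \<noteq> 0 then d i * ((if p = i \<and> q = i then 1 else 0) - (if p = 0 \<and> q = 0 then 1 else 0)) else 0)) = m p q"
      unfolding 1 2 by (auto simp: d_def e_def)
  qed
  thus ?thesis using that unfolding P_def by auto
qed

text \<open>The frame shared by all non-simple cases. \<open>G\<close> is an equivariant invariant
  of arrays that descends to functions, and \<open>K\<close> is its kernel there. By
  \<open>nz\<close> the kernel is not zero, by \<open>min\<close> it lies in every nonzero
  submodule; thus it is the socle and the quotient is the range of \<open>G\<close>.\<close>

lemma quotient_of_minimal:
  fixes Y :: "('k, 'w, 'k mat) gmodule"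
  assumes Y: "module class_ring Y" and car: "\<And>c. G c \<in> carrier Y"
    and surj: "\<And>y. y \<in> carrier Y \<Longrightarrow> \<exists>c. G c = y"
    and lin: "\<And>c c' a. G (\<lambda>i j k l. c i j k l + a * c' i j k l) = G c \<oplus>\<^bsub>Y\<^esub> (a \<odot>\<^bsub>Y\<^esub> G c')"
    and wd: "\<And>c. \<forall>x\<in>S. psi c x = 0 \<Longrightarrow> G c = \<zero>\<^bsub>Y\<^esub>"
    and act: "\<And>g c. g \<in> S \<Longrightarrow> G (ga g c) = act Y g (G c)"
    and K: "K = {f. \<exists>c. f = (\<lambda>x\<in>S. psi c x) \<and> G c = \<zero>\<^bsub>Y\<^esub>}"
    and nz: "G (unit_array 0 1 (n - 2) (n - 1)) = \<zero>\<^bsub>Y\<^esub>"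
    and min: "\<And>W c. gsub mw W \<Longrightarrow> W \<noteq> {\<lambda>x\<in>S. 0} \<Longrightarrow> G c = \<zero>\<^bsub>Y\<^esub> \<Longrightarrow> (\<lambda>x\<in>S. psi c x) \<in> W"
  shows "L TYPE('k) n mw = FM K \<and> gmodule_iso (SL n) (quotient_gmodule (H0 TYPE('k) n mw) K) Y"
proof -
  obtain \<Phi> where \<Phi>: "\<Phi> \<in> LinearCombinations.module_hom class_ring (FM (V mw)) Y" "\<forall>c. \<Phi> (\<lambda>x\<in>S. psi c x) = G c"
    "{f \<in> V mw. \<Phi> f = \<zero>\<^bsub>Y\<^esub>} = {f. \<exists>c. f = (\<lambda>x\<in>S. psi c x) \<and> G c = \<zero>\<^bsub>Y\<^esub>}"
    by (rule induced_hom[OF Y car lin wd])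
  note K' = K[folded \<Phi>(3)]
  have M: "module class_ring (FM (V mw))" by (rule FM_module[OF V_fsub])
  interpret mod_hom class_ring "FM (V mw)" Y \<Phi>
    using M Y \<Phi>(1) by (intro mod_hom.intro mod_hom_axioms.intro)
  have ga: "(\<lambda>x\<in>S. psi (ga g c) x) = (\<lambda>x\<in>S. psi c (iv g * x))" if "g \<in> S" for g c
    using psi_ga[OF that] by auto
  have "func_sub K"
    unfolding func_sub_def
  proof (intro conjI ballI allI)
    show "K \<subseteq> extensional S" using V_ext unfolding K' by blast
    show "(\<lambda>x\<in>S. 0) \<in> K" using f0_is_0 V_fsub unfolding K' func_sub_def by simp
    fix f assume f: "f \<in> K"
    { fix h assume h: "h \<in> K"
      have "\<Phi> (f \<oplus>\<^bsub>FM (V mw)\<^esub> h) = \<Phi> f \<oplus>\<^bsub>Y\<^esub> \<Phi> h" using f h by (intro f_add) (auto simp: K')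
      moreover have "f \<oplus>\<^bsub>FM (V mw)\<^esub> h \<in> V mw" using f h V_fsub unfolding K' func_sub_def by simp
      ultimately show "(\<lambda>x\<in>S. f x + h x) \<in> K" using f h by (simp add: K') }
    { fix a
      have "\<Phi> (a \<odot>\<^bsub>FM (V mw)\<^esub> f) = a \<odot>\<^bsub>Y\<^esub> \<Phi> f" using f by (intro f_smult) (auto simp: K')
      moreover have "a \<odot>\<^bsub>FM (V mw)\<^esub> f \<in> V mw" using f V_fsub unfolding K' func_sub_def by simp
      ultimately show "(\<lambda>x\<in>S. a * f x) \<in> K" using f by (simp add: K') }
  qed
  moreover have "(\<lambda>x\<in>S. f (iv g * x)) \<in> K" if g: "g \<in> S" and f: "f \<in> K" for g f
  proof -
    obtain c where c: "f = (\<lambda>x\<in>S. psi c x)" "G c = \<zero>\<^bsub>Y\<^esub>" using f K by auto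
    have z: "G (\<lambda>i j k l. 0) = \<zero>\<^bsub>Y\<^esub>" by (rule wd) (simp add: psi_def)
    have "G (ga g c) = G (ga g (\<lambda>i j k l. 0))" using act[OF g] c z by simp
    also have "ga g (\<lambda>i j k l. 0) = (\<lambda>i j k l. 0)" by (simp add: ga_def fun_eq_iff)
    finally have "(\<lambda>x\<in>S. psi (ga g c) x) \<in> K" using z K by auto
    moreover have "(\<lambda>x\<in>S. f (iv g * x)) = (\<lambda>x\<in>S. psi c (iv g * x))" using g by (auto simp: c S_mult)
    ultimately show ?thesis using ga[OF g] by simp
  qed
  ultimately have Ki: "inv_sub K" by (simp add: inv_sub_def)
  have "(\<lambda>x\<in>S. psi (unit_array 0 1 (n - 2) (n - 1)) x) \<in> K" using nz K by auto
  hence "K \<noteq> {\<lambda>x\<in>S. 0}" using psi_unit_array by auto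
  moreover have "K \<subseteq> V mw" by (auto simp: K')
  moreover have "K \<subseteq> W" if "inv_sub W" "W \<subseteq> V mw" "W \<noteq> {\<lambda>x\<in>S. 0}" for W
    using min[of W] that unfolding K gsub_iff by auto
  ultimately have L: "L TYPE('k) n mw = FM K" using Ki L_eq by blast
  have "gmodule_iso (SL n) (quotient_gmodule (FM (V mw)) K) Y"
  proof (rule quotient_gmodule_iso[OF M Y \<Phi>(1)])
    show "\<Phi> ` carrier (FM (V mw)) = carrier Y"
    proof (intro equalityI subsetI)
      fix y assume "y \<in> carrier Y"
      then obtain c where "G c = y" using surj by blast
      thus "y \<in> \<Phi> ` carrier (FM (V mw))" using \<Phi>(2) psi_V by (intro image_eqI[of _ _ "\<lambda>x\<in>S. psi c x"]) auto
    qed (use f_im in blast)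
    show "\<Phi> (act (FM (V mw)) g f) = act Y g (\<Phi> f)" if g: "g \<in> S" and f: "f \<in> carrier (FM (V mw))" for g f
    proof -
      obtain c where c: "f = (\<lambda>x\<in>S. psi c x)" using f by (auto simp: V_mw psi_functions_def)
      have "act (FM (V mw)) g f = (\<lambda>x\<in>S. psi (ga g c) x)" using g by (auto simp: c ga S_mult)
      thus ?thesis using \<Phi>(2) act[OF g] c by simp
    qed
    show "K = {v \<in> carrier (FM (V mw)). \<Phi> v = \<zero>\<^bsub>Y\<^esub>}" by (simp add: K')
  qed
  hence "gmodule_iso (SL n) (quotient_gmodule (H0 TYPE('k) n mw) K) Y" by (subst H0_FM(1))
  with L show ?thesis ..
qed

text \<open>The kernel of \<open>psi\<close>: off the diagonal of \<open>w\<close> the first identity of \<open>PQ\<close>, on it the remaining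
  solutions \<open>A\<^sub>i + A\<^sub>j + D\<close> of the second, with \<open>A\<^sub>0 = - D\<close> making the parameters unique.\<close>

definition ker_array :: "(nat \<times> nat \<Rightarrow> 'k) \<Rightarrow> nat \<Rightarrow> nat \<Rightarrow> nat \<Rightarrow> nat \<Rightarrow> 'k" where
  "ker_array w i j k l = (if j = l then if i = k \<and> i = 0 then - w (0, 0) else w (i, k) else 0)
     + (if i < j \<and> i = k \<and> j = l then w (0, 0) else 0)"

lemma psi_ker_array:
  assumes x: "x \<in> S"
  shows "psi (ker_array w) x = 0"
proof -
  define r where "r i k = (if i = k \<and> i = 0 then - w (0, 0) else w (i, k))" for i k
  have "psi (ker_array w) x = (\<Sum>i<n. \<Sum>j<n. \<Sum>k<n. \<Sum>l<n. (if l = j then r i k * PQ i j k j x else 0)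
     + (if l = j then if k = i then if i < j then w (0, 0) * PQ i j i j x else 0 else 0 else 0))"
    unfolding psi_def by (intro sum.cong refl) (auto simp: ker_array_def r_def algebra_simps)
  also have "\<dots> = (\<Sum>i<n. \<Sum>j<n. \<Sum>k<n. r i k * PQ i j k j x) + w (0, 0) * (\<Sum>i<n. \<Sum>j<n. if i < j then PQ i j i j x else 0)"
    by (simp add: sum.distrib sum_distrib_left if_distrib[of "\<lambda>c. _ * c"] cong: if_cong)
  also have "(\<Sum>i<n. \<Sum>j<n. \<Sum>k<n. r i k * PQ i j k j x) = (\<Sum>i<n. \<Sum>k<n. r i k * (\<Sum>j<n. PQ i j k j x))"
    unfolding sum_distrib_left by (intro sum.cong[OF refl] sum.swap)
  also have "\<dots> = 0"
  proof (intro sum.neutral ballI)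
    fix i k assume "i \<in> {..<n}" "k \<in> {..<n}"
    hence "(\<Sum>j<n. PQ i j k j x) = 0" using T_const[OF x, of i k "\<lambda>_. 1" 1] by (simp add: T_def)
    thus "r i k * (\<Sum>j<n. PQ i j k j x) = 0" by simp
  qed
  also have "(\<Sum>i<n. \<Sum>j<n. if i < j then PQ i j i j x else 0) = 0" by (rule pair_zero[OF x])
  finally show ?thesis by simp
qed

section \<open>The dimension of the induced module\<close>

definition quads :: "(nat \<times> nat \<times> nat \<times> nat) set" where
  "quads = {(i, j, k, l). i < j \<and> j < n \<and> k < l \<and> l < n}"

lemma card_quads: "finite quads" "card quads = (n choose 2)\<^sup>2"
proof -
  define P where "P = {(i, j). i < j \<and> j < n}"
  have P: "P = (SIGMA i:{..<n}. {j \<in> {..<n}. i < j})" by (auto simp: P_def)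
  have "int (card P) = (\<Sum>i<n. \<Sum>j<n. if i < j then (0 :: int) + 0 + 1 else 0)"
    unfolding P by (subst card_SigmaI) (auto simp: sum.If_cases Int_def)
  also have "\<dots> = int (n choose 2)" using pair_sum[where A = "\<lambda>_. 0 :: int" and m = n and D = 1] by simp
  finally have card: "card P = n choose 2" by simp
  have fin: "finite P" unfolding P by auto
  have q: "quads = (\<lambda>((i, j), (k, l)). (i, j, k, l)) ` (P \<times> P)"
    by (auto simp: quads_def P_def image_iff)
  have "inj_on (\<lambda>((i, j), (k, l)). (i, j, k, l)) (P \<times> P)" by (auto simp: inj_on_def)
  from card_image[OF this] show "card quads = (n choose 2)\<^sup>2"
    by (simp add: q card card_cartesian_product power2_eq_square)
  show "finite quads" unfolding q using fin by simp
qed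

definition arr :: "(nat \<times> nat \<times> nat \<times> nat \<Rightarrow> 'k) \<Rightarrow> nat \<Rightarrow> nat \<Rightarrow> nat \<Rightarrow> nat \<Rightarrow> 'k" where
  "arr u i j k l = u (i, j, k, l)"

text \<open>An antisymmetrised array is determined by its values at \<open>i < j\<close>,
  \<open>k < l\<close>, and the array supported there has the same antisymmetrisation. This normal
  form takes the place of a division by 4.\<close>

definition sorted_part :: "(nat \<Rightarrow> nat \<Rightarrow> nat \<Rightarrow> nat \<Rightarrow> 'k) \<Rightarrow> nat \<times> nat \<times> nat \<times> nat \<Rightarrow> 'k" where
  "sorted_part c = (\<lambda>(i, j, k, l). if (i, j, k, l) \<in> quads then asym c i j k l else 0)"

lemma asym_arr_sorted: "i < n \<Longrightarrow> j < n \<Longrightarrow> k < n \<Longrightarrow> l < n \<Longrightarrow> asym (arr (sorted_part c)) i j k l = asym c i j k l"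
  by (rule asym_sorted) (auto simp: arr_def sorted_part_def quads_def)

lemma psi_arr_sorted: "psi (arr (sorted_part c)) x = psi c x"
  by (rule psi_asym_cong[OF asym_arr_sorted])

lemma sorted_arr: "u \<in> carrier (FS quads) \<Longrightarrow> sorted_part (arr u) = u"
  by (auto simp: sorted_part_def arr_def asym_def quads_def fun_eq_iff)

text \<open>Two rank counts: \<open>psi\<close> maps the coordinates in \<open>quads\<close> onto
  \<open>V mw\<close>, and \<open>ker_array\<close> identifies its kernel with the \<open>n\<close>
  by \<open>n\<close> matrices.\<close>

lemma dim_V_mw:
  shows "vectorspace.fin_dim class_ring (FM (V mw))"
    "vectorspace.dim class_ring (FM (V mw)) + n\<^sup>2 = (n choose 2)\<^sup>2"
proof -
  let ?X = "FS quads :: ('k, nat \<times> nat \<times> nat \<times> nat \<Rightarrow> 'k) module"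
  define T where "T u = (\<lambda>x\<in>S. psi (arr u) x)" for u
  define Ker where "Ker = {u \<in> carrier ?X. T u = \<zero>\<^bsub>FM (V mw)\<^esub>}"
  have M: "module class_ring (FM (V mw))" by (rule FM_module[OF V_fsub])
  have arr_add: "arr (\<lambda>i. u i + v i) = (\<lambda>i j k l. arr u i j k l + arr v i j k l)"
    and arr_smult: "arr (\<lambda>i. a * u i) = (\<lambda>i j k l. a * arr u i j k l)" for u v a
    by (simp_all add: arr_def fun_eq_iff)
  have hom: "T \<in> LinearCombinations.module_hom class_ring ?X (FM (V mw))"
    using psi_V by (auto simp: LinearCombinations.module_hom_def T_def arr_add arr_smult psi_add psi_smult intro!: restrict_ext)
  have surj: "T ` carrier ?X = carrier (FM (V mw))"
  proof (intro equalityI subsetI)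
    fix f assume "f \<in> carrier (FM (V mw))"
    then obtain c where "f = (\<lambda>x\<in>S. psi c x)" by (auto simp: V_mw psi_functions_def)
    hence f: "f = T (sorted_part c)" by (simp add: T_def psi_arr_sorted)
    have "sorted_part c \<in> carrier ?X" by (auto simp: sorted_part_def)
    thus "f \<in> T ` carrier ?X" unfolding f by (rule imageI)
  qed (use psi_V in \<open>auto simp: T_def\<close>)
  note rn = rank_nullity_surj[OF FS_module M FS_dim(1)[OF card_quads(1)] hom surj Ker_def]
  show "vectorspace.fin_dim class_ring (FM (V mw))" by (rule rn(1))
  let ?N = "{..<n} \<times> {..<n}"
  let ?Y = "FS ?N :: ('k, nat \<times> nat \<Rightarrow> 'k) module"
  define \<theta> where "\<theta> w = sorted_part (ker_array w)" for w
  have ker: "u \<in> Ker \<longleftrightarrow> u \<in> carrier ?X \<and> (\<forall>x\<in>S. psi (arr u) x = 0)" for u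
  proof -
    have "T u = (\<lambda>x\<in>S. 0) \<longleftrightarrow> (\<forall>x\<in>S. psi (arr u) x = 0)"
      by (auto simp: T_def fun_eq_iff restrict_def)
    thus ?thesis by (simp add: Ker_def)
  qed
  have \<theta>: "\<theta> w \<in> Ker" for w
    unfolding ker \<theta>_def psi_arr_sorted using psi_ker_array by (auto simp: sorted_part_def)
  have "asym (ker_array (\<lambda>i. w i + w' i)) i j k l = asym (ker_array w) i j k l + asym (ker_array w') i j k l"
    "asym (ker_array (\<lambda>i. a * w i)) i j k l = a * asym (ker_array w) i j k l" for a w w' i j k l
  proof -
    have k: "ker_array (\<lambda>i. w i + w' i) i j k l = ker_array w i j k l + ker_array w' i j k l"
      "ker_array (\<lambda>i. a * w i) i j k l = a * ker_array w i j k l" for i j k l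
      by (auto simp: ker_array_def algebra_simps)
    show "asym (ker_array (\<lambda>i. w i + w' i)) i j k l = asym (ker_array w) i j k l + asym (ker_array w') i j k l"
      "asym (ker_array (\<lambda>i. a * w i)) i j k l = a * asym (ker_array w) i j k l"
      unfolding asym_def k by (simp_all add: algebra_simps)
  qed
  hence hom2: "\<theta> \<in> LinearCombinations.module_hom class_ring ?Y (?X\<lparr>carrier := Ker\<rparr>)"
    using \<theta> by (auto simp: LinearCombinations.module_hom_def \<theta>_def sorted_part_def fun_eq_iff)
  have off: "asym (ker_array w) i j k j = w (i, k)" if "distinct [i, j, k]" for w i j k
    using that by (auto simp: asym_def ker_array_def)
  define A where "A w i = (if i = 0 then - w (0, 0) else w (i, i) :: 'k)" for w :: "nat \<times> nat \<Rightarrow> 'k" and i :: nat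
  have diag: "asym (ker_array w) i j i j = A w i + A w j + w (0, 0)" if "i \<noteq> j" for w i j
    using that by (cases i j rule: linorder_cases) (simp_all add: asym_def ker_array_def A_def)
  have disj: "asym (ker_array w) i j k l = 0" if "distinct [i, j, k, l]" for w i j k l
    using that by (auto simp: asym_def ker_array_def)
  have eq: "asym c i j k l = asym c' i j k l"
    if d: "\<And>i j k l. distinct [i, j, k, l] \<Longrightarrow> {i, j, k, l} \<subseteq> {..<n} \<Longrightarrow> asym c i j k l = asym c' i j k l"
    and o: "\<And>i j k. distinct [i, j, k] \<Longrightarrow> {i, j, k} \<subseteq> {..<n} \<Longrightarrow> asym c i j k j = asym c' i j k j"
    and g: "\<And>i j. i \<noteq> j \<Longrightarrow> {i, j} \<subseteq> {..<n} \<Longrightarrow> asym c i j i j = asym c' i j i j"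
    and b: "i < j" "j < n" "k < l" "l < n" for c c' i j k l
  proof -
    consider "i = k" "j = l" | "i = k" "j \<noteq> l" | "i \<noteq> k" "j = l" | "j = k" | "i = l" | "distinct [i, j, k, l]"
      using b by auto
    thus ?thesis
    proof cases
      case 1 thus ?thesis using g[of i j] b by simp
    next
      case 2
      have "asym c j i l i = asym c' j i l i" using 2 b by (intro o) auto
      thus ?thesis using 2 asym_anti(1)[of _ j i i l] asym_anti(2)[of _ j i i l] by simp
    next
      case 3
      have "asym c i j k j = asym c' i j k j" using 3 b by (intro o) auto
      thus ?thesis using 3 by simp
    next
      case 4
      have "asym c i j l j = asym c' i j l j" using 4 b by (intro o) auto
      thus ?thesis using 4 asym_anti(2)[of _ i j j l] by simp
    next
      case 5
      have "asym c j i k i = asym c' j i k i" using 5 b by (intro o) auto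
      thus ?thesis using 5 asym_anti(1)[of _ j i k i] by simp
    next
      case 6
      thus ?thesis using d[of i j k l] b by auto
    qed
  qed
  have surj2: "\<theta> ` carrier ?Y = carrier (?X\<lparr>carrier := Ker\<rparr>)"
  proof (intro equalityI subsetI)
    fix u assume "u \<in> carrier (?X\<lparr>carrier := Ker\<rparr>)"
    hence u: "u \<in> carrier ?X" "\<forall>x\<in>S. psi (arr u) x = 0" using ker by auto
    obtain r B D where r: "\<forall>i j l. distinct [i, j, l] \<longrightarrow> {i, j, l} \<subseteq> {..<n} \<longrightarrow> asym (arr u) i l j l = r i j"
      "\<forall>i j. i < n \<longrightarrow> j < n \<longrightarrow> i \<noteq> j \<longrightarrow> asym (arr u) i j i j = B i + B j + D" "B 0 = - D"
      using psi_kernel[OF u(2)] by blast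
    \<comment> \<open>The parameters of the kernel as a matrix: \<open>r\<close> off the diagonal,
      \<open>D\<close> at \<open>(0, 0)\<close>, and \<open>B p\<close> on the rest of the diagonal.
      \<open>B 0\<close> is encoded through \<open>D\<close>.\<close>
    define w where "w = (\<lambda>(p, q). if p < n \<and> q < n then if p \<noteq> q then r p q else if p = 0 then D else B p else 0)"
    have "u = \<theta> w"
    proof
      fix t :: "nat \<times> nat \<times> nat \<times> nat"
      obtain i j k l where t: "t = (i, j, k, l)" by (cases t)
      show "u t = \<theta> w t"
      proof (cases "t \<in> quads")
        case False
        thus ?thesis using u(1) by (simp add: \<theta>_def sorted_part_def t)
      next
        case True
        hence b: "i < j" "j < n" "k < l" "l < n" by (auto simp: t quads_def)
        have "u t = asym (arr u) i j k l" using fun_cong[OF sorted_arr[OF u(1)], of t] True by (simp add: sorted_part_def t)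
        also have "\<dots> = asym (ker_array w) i j k l"
        proof (rule eq[OF _ _ _ b])
          fix i j k l assume d: "distinct [i, j, k, l]" "{i, j, k, l} \<subseteq> {..<n}"
          show "asym (arr u) i j k l = asym (ker_array w) i j k l"
            using psi_zero(1)[OF _ d, of "arr u"] u(2) disj[OF d(1)] by simp
        next
          fix i j k assume d: "distinct [i, j, k]" "{i, j, k} \<subseteq> {..<n}"
          show "asym (arr u) i j k j = asym (ker_array w) i j k j"
            unfolding off[OF d(1)] using r(1)[rule_format, of i k j] d by (auto simp: w_def)
        next
          fix i j assume d: "i \<noteq> j" "{i, j} \<subseteq> {..<n}"
          show "asym (arr u) i j i j = asym (ker_array w) i j i j"
            unfolding diag[OF d(1)] using r(2)[rule_format, of i j] r(3) d n5 by (auto simp: w_def A_def)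
        qed
        finally show ?thesis using True by (simp add: \<theta>_def sorted_part_def t)
      qed
    qed
    moreover have "w \<in> carrier ?Y" by (auto simp: w_def)
    ultimately show "u \<in> \<theta> ` carrier ?Y" by blast
  qed (use \<theta> in auto)
  \<comment> \<open>Injectivity of the parametrisation, stated with the coordinate space of the
    empty set so that \<open>rank_nullity_surj\<close> applies once more.\<close>
  have "{w \<in> carrier ?Y. \<theta> w = \<zero>\<^bsub>?X\<lparr>carrier := Ker\<rparr>\<^esub>} = carrier (FS {} :: ('k, nat \<times> nat \<Rightarrow> 'k) module)"
  proof (intro equalityI subsetI)
    fix w assume "w \<in> {w \<in> carrier ?Y. \<theta> w = \<zero>\<^bsub>?X\<lparr>carrier := Ker\<rparr>\<^esub>}"
    hence w: "w \<in> carrier ?Y" "\<theta> w = (\<lambda>_. 0)" by auto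
    have z: "asym (ker_array w) i j k l = 0" if "i < n" "j < n" "k < n" "l < n" for i j k l
    proof -
      have "asym (ker_array w) i j k l = asym (arr (sorted_part (ker_array w))) i j k l"
        using asym_arr_sorted[OF that] by simp
      also have "arr (sorted_part (ker_array w)) = (\<lambda>i j k l. 0)" using w(2) by (simp add: \<theta>_def arr_def[abs_def])
      finally show ?thesis by (simp add: asym_def)
    qed
    have o: "w (i, k) = 0" if "i < n" "k < n" "i \<noteq> k" for i k
    proof -
      have "{0, 1, 2} - {i, k} \<noteq> ({} :: nat set)" by auto
      then obtain j where "j \<in> {0, 1, 2}" "j \<noteq> i" "j \<noteq> k" by blast
      moreover have "j < n" using calculation(1) n5 by auto
      ultimately show ?thesis using off[of i j k w] z[of i j k j] that by auto
    qed
    have d: "A w i + A w j + w (0, 0) = 0" if "i < n" "j < n" "i \<noteq> j" for i j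
      using diag[OF that(3), of w] z[of i j i j] that by simp
    have d0: "w (i, i) = 0" if "i < n" "i \<noteq> 0" for i
      using d[of 0 i] that n5 by (simp add: A_def)
    have "w (0, 0) = 0" using d[of 1 2] d0[of 1] d0[of 2] n5 by (simp add: A_def)
    hence "w (i, k) = 0" if "i < n" "k < n" for i k
      using o[OF that] d0[of i] that by (cases "i = k"; cases "i = 0") auto
    hence "w p = 0" for p using w(1) by (cases p) auto
    thus "w \<in> carrier (FS {})" by simp
  next
    fix w :: "nat \<times> nat \<Rightarrow> 'k" assume "w \<in> carrier (FS {})"
    hence w0: "w = (\<lambda>_. 0)" by auto
    have "\<theta> w = (\<lambda>_. 0)" by (auto simp: w0 \<theta>_def sorted_part_def asym_def ker_array_def fun_eq_iff)
    thus "w \<in> {w \<in> carrier ?Y. \<theta> w = \<zero>\<^bsub>?X\<lparr>carrier := Ker\<rparr>\<^esub>}" by (simp add: w0)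
  qed
  note e0 = this[symmetric]
  have fin: "finite ?N" by simp
  have "vectorspace.dim class_ring (?X\<lparr>carrier := Ker\<rparr>)
     + vectorspace.dim class_ring (?Y\<lparr>carrier := carrier (FS {} :: ('k, nat \<times> nat \<Rightarrow> 'k) module)\<rparr>) = vectorspace.dim class_ring ?Y"
    by (rule rank_nullity_surj(4)[OF FS_module rn(3) FS_dim(1)[OF fin] hom2 surj2 e0])
  moreover have "?Y\<lparr>carrier := carrier (FS {} :: ('k, nat \<times> nat \<Rightarrow> 'k) module)\<rparr> = FS {}" by (simp add: FS_def)
  moreover have "vectorspace.dim class_ring (FS {} :: ('k, nat \<times> nat \<Rightarrow> 'k) module) = 0" using FS_dim(2)[of "{}"] by simp
  moreover have "vectorspace.dim class_ring ?Y = n\<^sup>2" using FS_dim(2)[OF fin] by (simp add: power2_eq_square)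
  ultimately have "vectorspace.dim class_ring (?X\<lparr>carrier := Ker\<rparr>) = n\<^sup>2" by simp
  thus "vectorspace.dim class_ring (FM (V mw)) + n\<^sup>2 = (n choose 2)\<^sup>2"
    using rn(4) FS_dim(2)[OF card_quads(1)] card_quads(2) by simp
qed

text \<open>An invariant with \<open>card J\<close> independent coordinates lowers the dimension of
  \<open>V mw\<close> by \<open>card J\<close>; surjectivity of \<open>G\<close> expresses the
  independence.\<close>

lemma dim_kernel:
  fixes G :: "(nat \<Rightarrow> nat \<Rightarrow> nat \<Rightarrow> nat \<Rightarrow> 'k) \<Rightarrow> 'i \<Rightarrow> 'k"
  assumes J: "finite J" and car: "\<And>c i. i \<notin> J \<Longrightarrow> G c i = 0"
    and surj: "\<And>y. (\<And>i. i \<notin> J \<Longrightarrow> y i = 0) \<Longrightarrow> \<exists>c. G c = y"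
    and lin: "\<And>c c' a i. i \<in> J \<Longrightarrow> G (\<lambda>i j k l. c i j k l + a * c' i j k l) i = G c i + a * G c' i"
    and wd: "\<And>c i. \<forall>x\<in>S. psi c x = 0 \<Longrightarrow> i \<in> J \<Longrightarrow> G c i = 0"
    and K: "K = {f. \<exists>c. f = (\<lambda>x\<in>S. psi c x) \<and> (\<forall>i\<in>J. G c i = 0)}"
  shows "vectorspace.fin_dim class_ring (FM K) \<and> vectorspace.dim class_ring (FM K) + card J + n\<^sup>2 = (n choose 2)\<^sup>2"
proof -
  let ?Y = "FS J :: ('k, 'i \<Rightarrow> 'k) module"
  have G0: "G c = \<zero>\<^bsub>?Y\<^esub> \<longleftrightarrow> (\<forall>i\<in>J. G c i = 0)" for c using car[of _ c] by (auto simp: fun_eq_iff)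
  have l: "G (\<lambda>i j k l. c i j k l + a * c' i j k l) = G c \<oplus>\<^bsub>?Y\<^esub> (a \<odot>\<^bsub>?Y\<^esub> G c')" for c c' a
  proof
    fix i show "G (\<lambda>i j k l. c i j k l + a * c' i j k l) i = (G c \<oplus>\<^bsub>?Y\<^esub> (a \<odot>\<^bsub>?Y\<^esub> G c')) i"
      using lin[of i] car by (cases "i \<in> J") auto
  qed
  have w: "G c = \<zero>\<^bsub>?Y\<^esub>" if "\<forall>x\<in>S. psi c x = 0" for c unfolding G0 using wd[OF that] by blast
  have c: "G c \<in> carrier ?Y" for c using car by simp
  obtain \<Phi> where \<Phi>: "\<Phi> \<in> LinearCombinations.module_hom class_ring (FM (V mw)) ?Y" "\<forall>c. \<Phi> (\<lambda>x\<in>S. psi c x) = G c"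
    "{f \<in> V mw. \<Phi> f = \<zero>\<^bsub>?Y\<^esub>} = {f. \<exists>c. f = (\<lambda>x\<in>S. psi c x) \<and> G c = \<zero>\<^bsub>?Y\<^esub>}"
    by (rule induced_hom[OF FS_module c l w])
  have s: "\<Phi> ` carrier (FM (V mw)) = carrier ?Y"
  proof (intro equalityI subsetI)
    fix y assume "y \<in> carrier ?Y"
    then obtain c where "G c = y" using surj[of y] by auto
    thus "y \<in> \<Phi> ` carrier (FM (V mw))" using \<Phi>(2) psi_V by (intro image_eqI[of _ _ "\<lambda>x\<in>S. psi c x"]) auto
  next
    fix y assume "y \<in> \<Phi> ` carrier (FM (V mw))"
    thus "y \<in> carrier ?Y" using funcset_mem[OF module_hom_closed[OF \<Phi>(1)]] by blast
  qed
  have k: "K = {f \<in> carrier (FM (V mw)). \<Phi> f = \<zero>\<^bsub>?Y\<^esub>}"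
    using \<Phi>(3) unfolding K G0 by simp
  note rn = rank_nullity_surj[OF FM_module[OF V_fsub] FS_module dim_V_mw(1) \<Phi>(1) s k]
  show ?thesis
    using rn(2,4) dim_V_mw(2) FS_dim(2)[OF J, where ?'k = 'k] by simp
qed

section \<open>The socle of the induced module\<close>


lemma kap_lin: "kap (\<lambda>i j k l. c i j k l + a * c' i j k l) p q = kap c p q + a * kap c' p q"
  by (simp add: kap_add kap_smult)

lemma pr_lin: "pr (\<lambda>i j k l. c i j k l + a * c' i j k l) = pr c + a * pr c'"
  by (simp add: pr_add pr_smult)

lemma unit_array_zero: "kap (unit_array 0 1 (n - 2) (n - 1)) p q = 0" "pr (unit_array 0 1 (n - 2) (n - 1)) = 0"
  using n5 by (auto simp: kap_unit_array pr_unit_array)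

text \<open>As \<open>n - 2\<close> is invertible, the off-diagonal \<open>B\<close> vanish modulo
  \<open>W\<close> and every \<open>B i i\<close> agrees with \<open>B 0 0 = - D\<close>. Only
  \<open>D\<close> survives, and by \<open>trace_kap\<close> the function of \<open>c\<close>
  becomes \<open>- pr c * D\<close>.\<close>

lemma mod_generic:
  assumes W: "gsub mw W" "W \<noteq> {\<lambda>x\<in>S. 0}" and n2: "(of_nat n :: 'k) \<noteq> 2"
  obtains D where "\<forall>c. (\<lambda>x\<in>S. psi c x + pr c * D x) \<in> W" "(\<lambda>x\<in>S. (of_nat n - 1) * D x) \<in> W"
    "(\<lambda>x\<in>S. of_nat (n choose 2) * D x) \<in> W"
proof -
  note Wf = Wf[OF W]
  obtain B D where BD: "\<forall>c. (\<lambda>x\<in>S. psi c x - ((\<Sum>p<n. \<Sum>q<n. kap c p q * B p q x) + pr c * D x)) \<in> W"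
    "\<forall>i<n. \<forall>j<n. i \<noteq> j \<longrightarrow> (\<lambda>x\<in>S. (of_nat n - 2) * B i j x) \<in> W"
    "\<forall>i<n. (\<lambda>x\<in>S. (of_nat n - 2) * B i i x + (\<Sum>l<n. B l l x) + (of_nat n - 1) * D x) \<in> W"
    "(\<lambda>x\<in>S. (of_nat n - 1) * (\<Sum>l<n. B l l x) + of_nat (n choose 2) * D x) \<in> W"
    "\<forall>x. B 0 0 x = - D x"
    using mod_representatives[OF W] by blast
  have nz: "(of_nat n :: 'k) - 2 \<noteq> 0" using n2 by simp
  have n0: "0 < n" using n5 by simp
  have cancel: "(\<lambda>x\<in>S. h x) \<in> W" if "(\<lambda>x\<in>S. (of_nat n - 2) * h x) \<in> W" for h
    using fsub_smult[OF Wf that, of "inverse (of_nat n - 2)"] nz by (simp add: mult.assoc[symmetric])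
  have off: "(\<lambda>x\<in>S. B i j x) \<in> W" if "i < n" "j < n" "i \<noteq> j" for i j
    by (rule cancel) (use BD(2) that in blast)
  have diag: "(\<lambda>x\<in>S. B i i x + D x) \<in> W" if i: "i < n" for i
  proof (rule cancel)
    have "(\<lambda>x\<in>S. ((of_nat n - 2) * B i i x + (\<Sum>l<n. B l l x) + (of_nat n - 1) * D x)
       - ((of_nat n - 2) * B 0 0 x + (\<Sum>l<n. B l l x) + (of_nat n - 1) * D x)) \<in> W"
      using BD(3) i n0 by (intro fsub_diff[OF Wf]) auto
    thus "(\<lambda>x\<in>S. (of_nat n - 2) * (B i i x + D x)) \<in> W"
      by (rule fsub_cong) (simp add: BD(5) algebra_simps)
  qed
  have tr: "(\<lambda>x\<in>S. (\<Sum>l<n. B l l x) + D x) \<in> W"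
    by (rule fsub_cong[OF BD(3)[rule_format, OF n0]]) (simp add: BD(5) algebra_simps)
  \<comment> \<open>Modulo \<open>W\<close> the sum of the diagonal is \<open>- n * D\<close> by
    \<open>diag\<close> and \<open>- D\<close> by \<open>tr\<close>; the difference yields the
    coefficient \<open>n - 1\<close>.\<close>
  have "(\<lambda>x\<in>S. (\<Sum>l<n. B l l x + D x) - ((\<Sum>l<n. B l l x) + D x)) \<in> W"
    by (intro fsub_diff[OF Wf] fsub_sum[OF Wf] diag tr) auto
  hence n1: "(\<lambda>x\<in>S. (of_nat n - 1) * D x) \<in> W" by (rule fsub_cong) (simp add: sum.distrib algebra_simps)
  have "(\<lambda>x\<in>S. ((of_nat n - 1) * (\<Sum>l<n. B l l x) + of_nat (n choose 2) * D x)
     - (of_nat n - 1) * ((\<Sum>l<n. B l l x) + D x) + (of_nat n - 1) * D x) \<in> W"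
    by (intro fsub_add[OF Wf] fsub_diff[OF Wf] fsub_smult[OF Wf, of _ "of_nat n - 1"] BD(4) tr n1)
  hence C: "(\<lambda>x\<in>S. of_nat (n choose 2) * D x) \<in> W" by (rule fsub_cong) (simp add: algebra_simps)
  have "(\<lambda>x\<in>S. psi c x + pr c * D x) \<in> W" for c
  proof -
    have "(\<lambda>x\<in>S. (psi c x - ((\<Sum>p<n. \<Sum>q<n. kap c p q * B p q x) + pr c * D x))
       + (\<Sum>p<n. \<Sum>q<n. kap c p q * (B p q x + (if q = p then D x else 0)))) \<in> W"
    proof (rule fsub_add[OF Wf], goal_cases)
      case 1 show ?case using BD(1) by blast
    next
      have "(\<lambda>x\<in>S. B p q x + (if q = p then D x else 0)) \<in> W" if "p \<in> {..<n}" "q \<in> {..<n}" for p q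
        using off[of p q] diag[of p] that by (cases "q = p") auto
      moreover case 2
      ultimately show ?case by (intro fsub_sum[OF Wf] fsub_smult[OF Wf])
    qed
    thus ?thesis
    proof (rule fsub_cong)
      fix x assume "x \<in> S"
      have "(\<Sum>p<n. \<Sum>q<n. kap c p q * (B p q x + (if q = p then D x else 0)))
        = (\<Sum>p<n. \<Sum>q<n. kap c p q * B p q x) + (\<Sum>p<n. \<Sum>q<n. if q = p then kap c p p * D x else 0)"
        unfolding sum.distrib[symmetric] by (intro sum.cong refl) (auto simp: algebra_simps)
      also have "(\<Sum>p<n. \<Sum>q<n. if q = p then kap c p p * D x else 0) = 2 * pr c * D x"
        by (simp add: sum_distrib_right[symmetric] trace_kap)
      finally show "(psi c x - ((\<Sum>p<n. \<Sum>q<n. kap c p q * B p q x) + pr c * D x))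
       + (\<Sum>p<n. \<Sum>q<n. kap c p q * (B p q x + (if q = p then D x else 0))) = psi c x + pr c * D x"
        by (simp add: algebra_simps)
    qed
  qed
  thus ?thesis using that n1 C by blast
qed

text \<open>For \<open>n = 2\<close> in \<open>k\<close> the off-diagonal \<open>B\<close> are
  unconstrained, and the remaining relations say that the sum of the \<open>B l l\<close> is
  \<open>- D\<close> and that \<open>(n choose 2) - 1\<close> kills \<open>D\<close>. An array with
  scalar contraction \<open>\<tau>\<close> therefore contributes
  \<open>(pr c - \<tau>) * D\<close>.\<close>

lemma mod_special:
  assumes W: "gsub mw W" "W \<noteq> {\<lambda>x\<in>S. 0}" and n2: "(of_nat n :: 'k) = 2"
  obtains D where "(\<lambda>x\<in>S. (of_nat (n choose 2) - 1) * D x) \<in> W"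
    "\<forall>c \<tau>. (\<forall>p<n. \<forall>q<n. kap c p q = (if q = p then \<tau> else 0)) \<longrightarrow> (\<lambda>x\<in>S. psi c x - (pr c - \<tau>) * D x) \<in> W"
proof -
  note Wf = Wf[OF W]
  obtain B D where BD: "\<forall>c. (\<lambda>x\<in>S. psi c x - ((\<Sum>p<n. \<Sum>q<n. kap c p q * B p q x) + pr c * D x)) \<in> W"
    and "\<forall>i<n. \<forall>j<n. i \<noteq> j \<longrightarrow> (\<lambda>x\<in>S. (of_nat n - 2) * B i j x) \<in> W"
    and BD2: "\<forall>i<n. (\<lambda>x\<in>S. (of_nat n - 2) * B i i x + (\<Sum>l<n. B l l x) + (of_nat n - 1) * D x) \<in> W"
    and BD3: "(\<lambda>x\<in>S. (of_nat n - 1) * (\<Sum>l<n. B l l x) + of_nat (n choose 2) * D x) \<in> W"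
    and "\<forall>x. B 0 0 x = - D x"
    using mod_representatives[OF W] by blast
  have n0: "0 < n" using n5 by simp
  have tr: "(\<lambda>x\<in>S. (\<Sum>l<n. B l l x) + D x) \<in> W"
    by (rule fsub_cong[OF BD2[rule_format, OF n0]]) (simp add: n2)
  have "(\<lambda>x\<in>S. ((of_nat n - 1) * (\<Sum>l<n. B l l x) + of_nat (n choose 2) * D x) - ((\<Sum>l<n. B l l x) + D x)) \<in> W"
    by (intro fsub_diff[OF Wf] BD3 tr)
  hence 1: "(\<lambda>x\<in>S. (of_nat (n choose 2) - 1) * D x) \<in> W" by (rule fsub_cong) (simp add: n2 algebra_simps)
  have "(\<lambda>x\<in>S. psi c x - (pr c - \<tau>) * D x) \<in> W" if k: "\<forall>p<n. \<forall>q<n. kap c p q = (if q = p then \<tau> else 0)" for c \<tau>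
  proof -
    have "(\<lambda>x\<in>S. (psi c x - ((\<Sum>p<n. \<Sum>q<n. kap c p q * B p q x) + pr c * D x)) + \<tau> * ((\<Sum>l<n. B l l x) + D x)) \<in> W"
      using BD by (intro fsub_add[OF Wf] fsub_smult[OF Wf] tr) blast
    thus ?thesis
    proof (rule fsub_cong)
      fix x
      have "(\<Sum>p<n. \<Sum>q<n. kap c p q * B p q x) = (\<Sum>p<n. \<Sum>q<n. if q = p then \<tau> * B p p x else 0)"
        by (intro sum.cong refl) (auto simp: k)
      also have "\<dots> = \<tau> * (\<Sum>l<n. B l l x)" by (simp add: sum_distrib_left)
      finally show "(psi c x - ((\<Sum>p<n. \<Sum>q<n. kap c p q * B p q x) + pr c * D x)) + \<tau> * ((\<Sum>l<n. B l l x) + D x)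
        = psi c x - (pr c - \<tau>) * D x" by (simp add: algebra_simps)
    qed
  qed
  thus ?thesis using that 1 by blast
qed

lemma fsub_cancel:
  assumes "func_sub W" "(\<lambda>x\<in>S. a * h x) \<in> W" "a \<noteq> 0"
  shows "(\<lambda>x\<in>S. h x) \<in> W"
  using fsub_smult[OF assms(1,2), of "inverse a"] assms(3) by (simp add: mult.assoc[symmetric])

text \<open>One of the two coefficients that kill \<open>D\<close> modulo a submodule is invertible,
  so \<open>D\<close> lies in it, and with \<open>D\<close> every function.\<close>

theorem simple_case:
  assumes n2: "(of_nat n :: 'k) \<noteq> 2" and nz: "(of_nat n :: 'k) \<noteq> 1 \<or> (of_nat (n choose 2) :: 'k) \<noteq> 0"
  shows "L TYPE('k) n mw = FM (V mw)" "simple_gmodule (SL n) (H0 TYPE('k) n mw)"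
    "vectorspace.fin_dim class_ring (L TYPE('k) n mw)"
    "vectorspace.dim class_ring (L TYPE('k) n mw) + n\<^sup>2 = (n choose 2)\<^sup>2"
proof -
  have min: "V mw \<subseteq> W" if W: "gsub mw W" "W \<noteq> {\<lambda>x\<in>S. 0}" for W
  proof
    fix f assume "f \<in> V mw"
    then obtain c where c: "f = (\<lambda>x\<in>S. psi c x)" by (auto simp: V_mw psi_functions_def)
    have Wf: "func_sub W" using W by (simp add: gsub_def)
    obtain D where D: "\<forall>c. (\<lambda>x\<in>S. psi c x + pr c * D x) \<in> W" "(\<lambda>x\<in>S. (of_nat n - 1) * D x) \<in> W"
      "(\<lambda>x\<in>S. of_nat (n choose 2) * D x) \<in> W"
      using mod_generic[OF W n2] by blast
    have "(\<lambda>x\<in>S. D x) \<in> W" using nz fsub_cancel[OF Wf D(2)] fsub_cancel[OF Wf D(3)] by auto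
    hence "(\<lambda>x\<in>S. (psi c x + pr c * D x) - pr c * D x) \<in> W"
      using D(1) by (intro fsub_diff[OF Wf] fsub_smult[OF Wf]) auto
    thus "f \<in> W" by (simp add: c)
  qed
  have nz: "V mw \<noteq> {\<lambda>x\<in>S. 0}" using psi_unit_array psi_V[of "unit_array 0 1 (n - 2) (n - 1)"] by auto
  show L: "L TYPE('k) n mw = FM (V mw)" using V_inv_sub nz min by (intro L_eq) (auto simp: gsub_iff)
  have "simple_gmodule (SL n) (FM (V mw))" using V_inv_sub nz min by (intro simple_FM) (auto simp: gsub_iff)
  thus "simple_gmodule (SL n) (H0 TYPE('k) n mw)" by (subst H0_FM(1))
  show "vectorspace.fin_dim class_ring (L TYPE('k) n mw)"
    "vectorspace.dim class_ring (L TYPE('k) n mw) + n\<^sup>2 = (n choose 2)\<^sup>2"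
    unfolding L using dim_V_mw by simp_all
qed

text \<open>Both \<open>n - 1\<close> and \<open>n choose 2\<close> vanish in \<open>k\<close>, so
  \<open>pr\<close> is zero on the kernel of \<open>psi\<close> and survives as a one-dimensional
  invariant; \<open>mod_generic\<close> shows that nothing else does.\<close>

theorem trivial_case:
  assumes n1: "(of_nat n :: 'k) = 1" and C: "(of_nat (n choose 2) :: 'k) = 0"
  shows "gmodule_iso (SL n) (quotient_gmodule (H0 TYPE('k) n mw) (carrier (L TYPE('k) n mw))) (trivial_gmodule :: ('k, 'k, 'k mat) gmodule)"
    "vectorspace.fin_dim class_ring (L TYPE('k) n mw)"
    "vectorspace.dim class_ring (L TYPE('k) n mw) + 1 + n\<^sup>2 = (n choose 2)\<^sup>2"
proof -
  let ?Y = "trivial_gmodule :: ('k, 'k, 'k mat) gmodule"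
  define K where "K = {f. \<exists>c. f = (\<lambda>x\<in>S. psi c x) \<and> pr c = 0}"
  have Y: "module class_ring ?Y"
  proof (rule module_criteria)
    show "cring (class_ring :: 'k ring)" by (intro domain.axioms(1) field.axioms(1) class_field)
    show "\<forall>v\<in>carrier ?Y. \<exists>w\<in>carrier ?Y. v \<oplus>\<^bsub>?Y\<^esub> w = \<zero>\<^bsub>?Y\<^esub>"
      by (auto simp: trivial_gmodule_def intro: exI[of _ "- _"])
  qed (auto simp: trivial_gmodule_def algebra_simps)
  have wd: "pr c = 0" if z: "\<forall>x\<in>S. psi c x = 0" for c
    using psi_zero_kap[OF z] n1 C by (metis add.right_neutral diff_self mult_zero_left)
  have surj: "\<exists>c. pr c = t" for t
  proof -
    have "pr (\<lambda>i j k l. t * unit_array 0 1 0 1 i j k l) = t" using n5 by (simp add: pr_smult pr_unit_array)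
    thus ?thesis by blast
  qed
  have *: "L TYPE('k) n mw = FM K \<and> gmodule_iso (SL n) (quotient_gmodule (H0 TYPE('k) n mw) K) ?Y"
  proof (rule quotient_of_minimal[OF Y, where G = pr])
    show "K = {f. \<exists>c. f = (\<lambda>x\<in>S. psi c x) \<and> pr c = \<zero>\<^bsub>?Y\<^esub>}" by (simp add: K_def trivial_gmodule_def)
    fix W c assume W: "gsub mw W" "W \<noteq> {\<lambda>x\<in>S. 0}" and c: "pr c = \<zero>\<^bsub>?Y\<^esub>"
    have "(of_nat n :: 'k) \<noteq> 2" unfolding n1 by (metis add_cancel_right_right one_add_one zero_neq_one)
    then obtain D where "\<forall>c. (\<lambda>x\<in>S. psi c x + pr c * D x) \<in> W" using mod_generic[OF W] by blast
    hence "(\<lambda>x\<in>S. psi c x + pr c * D x) \<in> W" by blast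
    thus "(\<lambda>x\<in>S. psi c x) \<in> W" by (rule fsub_cong) (use c in \<open>simp add: trivial_gmodule_def\<close>)
  qed (use wd surj unit_array_zero(2) in \<open>simp_all add: trivial_gmodule_def pr_lin pr_ga\<close>)
  thus "gmodule_iso (SL n) (quotient_gmodule (H0 TYPE('k) n mw) (carrier (L TYPE('k) n mw))) ?Y" by simp
  have fin: "finite {()}" by simp
  have dim: "vectorspace.fin_dim class_ring (FM K) \<and> vectorspace.dim class_ring (FM K) + card {()} + n\<^sup>2 = (n choose 2)\<^sup>2"
  proof (rule dim_kernel[OF fin, where G = "\<lambda>c _. pr c"])
    fix y :: "unit \<Rightarrow> 'k"
    obtain c where "pr c = y ()" using surj by blast
    thus "\<exists>c. (\<lambda>_. pr c) = y" by (intro exI[of _ c]) auto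
  qed (auto simp: K_def pr_lin wd)
  show "vectorspace.fin_dim class_ring (L TYPE('k) n mw)"
    "vectorspace.dim class_ring (L TYPE('k) n mw) + 1 + n\<^sup>2 = (n choose 2)\<^sup>2"
    using * dim by simp_all
qed

section \<open>The adjoint module and its socle\<close>

lemma sg_cong: "(\<And>i k. i < n \<Longrightarrow> k < n \<Longrightarrow> m i k = m' i k) \<Longrightarrow> sg m x = sg m' x"
  by (simp add: sg_def)

lemma sg_zero_iff: "(\<forall>x\<in>S. sg m x = 0) \<longleftrightarrow> (\<forall>i<n. \<forall>k<n. m i k = (if k = i then m 0 0 else 0))"
proof
  assume z: "\<forall>x\<in>S. sg m x = 0"
  have diag: "m i i = m 0 0" if "i < n" for i using sg_zero(2)[OF z, of i 0] that by (cases "i = 0") auto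
  show "\<forall>i<n. \<forall>k<n. m i k = (if k = i then m 0 0 else 0)"
  proof (intro allI impI)
    fix i k assume "i < n" "k < n"
    thus "m i k = (if k = i then m 0 0 else 0)"
      using diag[of i] sg_zero(1)[OF z, of i k] by (cases "k = i") simp_all
  qed
next
  assume m: "\<forall>i<n. \<forall>k<n. m i k = (if k = i then m 0 0 else 0)"
  show "\<forall>x\<in>S. sg m x = 0"
  proof
    fix x assume x: "x \<in> S"
    show "sg m x = 0"
    proof (rule sg_scalar[OF x])
      fix i k assume "i < n" "k < n" "i \<noteq> k"
      thus "m i k = 0" using m[rule_format, of i k] by simp
    next
      fix i assume "i < n"
      thus "m i i = m 0 0" using m[rule_format, of i i] by simp
    qed
  qed
qed

lemma sg_kap_ga:
  assumes "g \<in> S" "x \<in> S"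
  shows "sg (kap (ga g c)) x = sg (kap c) (iv g * x)"
  unfolding sg_sga[OF assms, symmetric] by (rule sg_cong) (rule kap_ga[OF assms(1)])

text \<open>The image of the traceless matrices, which is the socle of \<open>H0\<close> for
  \<open>aw\<close>.\<close>

definition sg0 :: "('k mat \<Rightarrow> 'k) set" where
  "sg0 = {f. \<exists>m. f = (\<lambda>x\<in>S. sg m x) \<and> (\<Sum>i<n. m i i) = 0}"

lemma sg0_inv_sub: "inv_sub sg0"
  unfolding inv_sub_def func_sub_def
proof (intro conjI ballI allI)
  show "sg0 \<subseteq> extensional S" by (auto simp: sg0_def)
  show "(\<lambda>x\<in>S. 0) \<in> sg0" by (auto simp: sg0_def sg_def intro!: exI[of _ "\<lambda>i k. 0"])
  fix f assume "f \<in> sg0"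
  then obtain m where m: "f = (\<lambda>x\<in>S. sg m x)" "(\<Sum>i<n. m i i) = 0" by (auto simp: sg0_def)
  { fix h assume "h \<in> sg0"
    then obtain m' where m': "h = (\<lambda>x\<in>S. sg m' x)" "(\<Sum>i<n. m' i i) = 0" by (auto simp: sg0_def)
    have "(\<lambda>x\<in>S. f x + h x) = (\<lambda>x\<in>S. sg (\<lambda>i k. m i k + m' i k) x)" by (auto simp: m m' sg_add)
    moreover have "(\<Sum>i<n. m i i + m' i i) = 0" using m m' by (simp add: sum.distrib)
    ultimately show "(\<lambda>x\<in>S. f x + h x) \<in> sg0" unfolding sg0_def by blast }
  { fix a
    have "(\<lambda>x\<in>S. a * f x) = (\<lambda>x\<in>S. sg (\<lambda>i k. a * m i k) x)" by (auto simp: m sg_smult)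
    moreover have "(\<Sum>i<n. a * m i i) = 0" using m by (simp add: sum_distrib_left[symmetric])
    ultimately show "(\<lambda>x\<in>S. a * f x) \<in> sg0" unfolding sg0_def by blast }
next
  fix g f assume g: "g \<in> S" and "f \<in> sg0"
  then obtain m where m: "f = (\<lambda>x\<in>S. sg m x)" "(\<Sum>i<n. m i i) = 0" by (auto simp: sg0_def)
  have "(\<lambda>x\<in>S. f (iv g * x)) = (\<lambda>x\<in>S. sg (sga g m) x)" using g by (auto simp: m sg_sga S_mult)
  moreover have "(\<Sum>i<n. sga g m i i) = 0" using sga_trace[OF g] m by simp
  ultimately show "(\<lambda>x\<in>S. f (iv g * x)) \<in> sg0" unfolding sg0_def by blast
qed

lemma sg0_minimal:
  assumes "gsub aw W" "W \<noteq> {\<lambda>x\<in>S. 0}"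
  shows "sg0 \<subseteq> W"
  using aw_minimal[OF assms] by (auto simp: sg0_def)

lemma sg0_nonzero: "sg0 \<noteq> {\<lambda>x\<in>S. 0}"
proof -
  define m where "m i k = (if k = n - 1 then if i = 0 then 1 else 0 else (0 :: 'k))" for i k :: nat
  have "(\<lambda>x\<in>S. sg m x) \<in> sg0" using n5 by (auto simp: sg0_def m_def intro!: sum.neutral)
  moreover have "sg m (1\<^sub>m n) = (\<Sum>i<n. \<Sum>k<n. if k = n - 1 then if i = 0 then AZ i k (1\<^sub>m n) else 0 else 0)"
    unfolding sg_def by (intro sum.cong refl) (auto simp: m_def)
  hence "sg m (1\<^sub>m n) \<noteq> 0" using n5 AZ_one[unfolded One_nat_def] by simp
  hence "(\<lambda>x\<in>S. sg m x) (1\<^sub>m n) \<noteq> (\<lambda>x\<in>S. 0) (1\<^sub>m n)" using S_one by simp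
  ultimately show ?thesis by (metis singletonD)
qed

lemma L_aw: "L TYPE('k) n aw = FM sg0"
  using sg0_inv_sub sg0_nonzero sg0_minimal sg_V by (intro L_eq) (auto simp: gsub_iff sg0_def)

text \<open>With \<open>n\<close> invertible, every matrix becomes traceless after subtracting a
  scalar matrix, and scalar matrices lie in the kernel of \<open>sg\<close>.\<close>

lemma simple_aw:
  assumes "(of_nat n :: 'k) \<noteq> 0"
  shows "simple_gmodule (SL n) (H0 TYPE('k) n aw)"
proof -
  have "V aw \<subseteq> sg0"
  proof
    fix f assume "f \<in> V aw"
    then obtain m where m: "f = (\<lambda>x\<in>S. sg m x)" by (auto simp: V_aw sg_functions_def)
    define t where "t = (\<Sum>i<n. m i i) / of_nat n"
    define m' where "m' i k = m i k + (- 1) * (if k = i then t else 0)" for i k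
    have "sg m' x = sg m x" if x: "x \<in> S" for x
      unfolding m'_def sg_add sg_smult using sg_scalar[OF x, of "\<lambda>i k. if k = i then t else 0" t] by simp
    hence "f = (\<lambda>x\<in>S. sg m' x)" by (auto simp: m)
    moreover have "(\<Sum>i<n. m' i i) = 0" using assms by (simp add: m'_def sum_subtractf t_def)
    ultimately show "f \<in> sg0" unfolding sg0_def by blast
  qed
  hence e: "V aw = sg0" using sg_V by (auto simp: sg0_def)
  have "simple_gmodule (SL n) (FM (V aw))"
    using sg0_inv_sub sg0_nonzero sg0_minimal unfolding e gsub_iff by (intro simple_FM) (auto simp: e)
  thus ?thesis by (subst H0_FM(1))
qed

end

lemma dual_gmodule_module:
  assumes V: "module class_ring V"
  shows "module class_ring (dual_gmodule G (V :: ('k :: field, 'v, 'g) gmodule))"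
proof -
  interpret Module.module class_ring V by (rule V)
  have clos: "v \<oplus>\<^bsub>V\<^esub> w \<in> carrier V" "a \<odot>\<^bsub>V\<^esub> v \<in> carrier V" if "v \<in> carrier V" "w \<in> carrier V" for a v w
    using that by simp_all
  let ?D = "dual_gmodule G V"
  show ?thesis
  proof (rule module_criteria)
    show "cring (class_ring :: 'k ring)" by (intro domain.axioms(1) field.axioms(1) class_field)
    show "\<forall>\<phi>\<in>carrier ?D. \<exists>\<psi>\<in>carrier ?D. \<phi> \<oplus>\<^bsub>?D\<^esub> \<psi> = \<zero>\<^bsub>?D\<^esub>"
    proof
      fix \<phi> assume "\<phi> \<in> carrier ?D"
      thus "\<exists>\<psi>\<in>carrier ?D. \<phi> \<oplus>\<^bsub>?D\<^esub> \<psi> = \<zero>\<^bsub>?D\<^esub>"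
        by (intro bexI[of _ "\<lambda>v\<in>carrier V. - \<phi> v"])
          (auto simp: dual_gmodule_def trivial_gmodule_def LinearCombinations.module_hom_def clos)
    qed
    show "\<forall>\<phi>\<in>carrier ?D. \<phi> \<oplus>\<^bsub>?D\<^esub> \<zero>\<^bsub>?D\<^esub> = \<phi>" "\<forall>\<phi>\<in>carrier ?D. \<one>\<^bsub>class_ring\<^esub> \<odot>\<^bsub>?D\<^esub> \<phi> = \<phi>"
      by (auto simp: dual_gmodule_def intro!: extensionalityI[of _ "carrier V"])
  qed (auto simp: dual_gmodule_def trivial_gmodule_def LinearCombinations.module_hom_def clos algebra_simps intro!: restrict_ext)
qed

context sl5
begin

section \<open>The cases in which \<open>n = 2\<close> in \<open>k\<close>\<close>

lemma psi_zero_scalar: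
  assumes n2: "(of_nat n :: 'k) = 2" and z: "\<forall>x\<in>S. psi c x = 0"
  shows "\<exists>t D. (\<forall>p<n. \<forall>q<n. kap c p q = (if q = p then t + D else 0)) \<and> pr c = t + of_nat (n choose 2) * D"
proof (rule psi_zero_kap[OF z])
  fix r A D
  assume k: "\<And>i j. i < n \<Longrightarrow> j < n \<Longrightarrow> i \<noteq> j \<Longrightarrow> kap c i j = (of_nat n - 2) * r i j"
    "\<And>i. i < n \<Longrightarrow> kap c i i = (of_nat n - 2) * A i + (\<Sum>j<n. A j) + (of_nat n - 1) * D"
    "pr c = (of_nat n - 1) * (\<Sum>j<n. A j) + of_nat (n choose 2) * D"
  show ?thesis
    by (rule exI[of _ "\<Sum>j<n. A j"], rule exI[of _ D]) (use k in \<open>auto simp: n2\<close>)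
qed

definition scalar_kernel :: "('k mat \<Rightarrow> 'k) set" where
  "scalar_kernel = {f. \<exists>c. f = (\<lambda>x\<in>S. psi c x) \<and> (\<forall>p<n. \<forall>q<n. kap c p q = (if q = p then kap c 0 0 else 0))}"

text \<open>For \<open>n = 2\<close> in \<open>k\<close>, \<open>kap\<close> modulo scalars descends
  to functions, with range \<open>X\<close>. By \<open>mod_special\<close> an array with scalar
  contraction \<open>\<tau>\<close> lies in a submodule up to \<open>(pr c - \<tau>) * D\<close>. If
  2 is invertible, \<open>trace_kap\<close> gives \<open>pr c = \<tau>\<close>; otherwise
  \<open>h\<close> makes a factor killing \<open>D\<close> invertible.\<close>

lemma quotient_sg:
  assumes n2: "(of_nat n :: 'k) = 2" and h: "(2 :: 'k) \<noteq> 0 \<or> (of_nat (n choose 2) :: 'k) \<noteq> 1"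
    and X: "inv_sub X" "\<And>c. (\<lambda>x\<in>S. sg (kap c) x) \<in> X" "\<And>f. f \<in> X \<Longrightarrow> \<exists>c. (\<lambda>x\<in>S. sg (kap c) x) = f"
  shows "L TYPE('k) n mw = FM scalar_kernel \<and> gmodule_iso (SL n) (quotient_gmodule (H0 TYPE('k) n mw) scalar_kernel) (FM X)"
proof (rule quotient_of_minimal[where G = "\<lambda>c. \<lambda>x\<in>S. sg (kap c) x"])
  have z: "(\<lambda>x\<in>S. sg (kap c) x) = \<zero>\<^bsub>FM X\<^esub> \<longleftrightarrow> (\<forall>p<n. \<forall>q<n. kap c p q = (if q = p then kap c 0 0 else 0))" for c
  proof -
    have "(\<lambda>x\<in>S. sg (kap c) x) = (\<lambda>x\<in>S. 0) \<longleftrightarrow> (\<forall>x\<in>S. sg (kap c) x = 0)"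
      by (auto simp: fun_eq_iff restrict_def)
    thus ?thesis unfolding sg_zero_iff by simp
  qed
  show "module class_ring (FM X)" using X(1) by (intro FM_module) (simp add: inv_sub_def)
  show "(\<lambda>x\<in>S. sg (kap c) x) \<in> carrier (FM X)" for c using X(2) by simp
  show "\<exists>c. (\<lambda>x\<in>S. sg (kap c) x) = f" if "f \<in> carrier (FM X)" for f using X(3) that by simp
  show "(\<lambda>x\<in>S. sg (kap (\<lambda>i j k l. c i j k l + a * c' i j k l)) x)
      = (\<lambda>x\<in>S. sg (kap c) x) \<oplus>\<^bsub>FM X\<^esub> (a \<odot>\<^bsub>FM X\<^esub> (\<lambda>x\<in>S. sg (kap c') x))" for c c' a
  proof -
    have "kap (\<lambda>i j k l. c i j k l + a * c' i j k l) = (\<lambda>p q. kap c p q + a * kap c' p q)"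
      by (simp add: kap_lin fun_eq_iff)
    thus ?thesis by (auto simp: sg_add sg_smult)
  qed
  show "(\<lambda>x\<in>S. sg (kap c) x) = \<zero>\<^bsub>FM X\<^esub>" if z0: "\<forall>x\<in>S. psi c x = 0" for c
  proof -
    obtain t where t: "\<forall>p<n. \<forall>q<n. kap c p q = (if q = p then t else 0)"
      using psi_zero_scalar[OF n2 z0] by blast
    hence "kap c 0 0 = t" using n5 by simp
    thus ?thesis using t unfolding z by simp
  qed
  show "(\<lambda>x\<in>S. sg (kap (ga g c)) x) = act (FM X) g (\<lambda>x\<in>S. sg (kap c) x)" if "g \<in> S" for g c
    using that by (auto simp: sg_kap_ga S_mult)
  show "scalar_kernel = {f. \<exists>c. f = (\<lambda>x\<in>S. psi c x) \<and> (\<lambda>x\<in>S. sg (kap c) x) = \<zero>\<^bsub>FM X\<^esub>}"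
    unfolding z scalar_kernel_def ..
  show "(\<lambda>x\<in>S. sg (kap (unit_array 0 1 (n - 2) (n - 1))) x) = \<zero>\<^bsub>FM X\<^esub>"
    unfolding z using unit_array_zero(1) by simp
  fix W c assume W: "gsub mw W" "W \<noteq> {\<lambda>x\<in>S. 0}" and c: "(\<lambda>x\<in>S. sg (kap c) x) = \<zero>\<^bsub>FM X\<^esub>"
  have Wf: "func_sub W" using W by (simp add: gsub_def)
  define \<tau> where "\<tau> = kap c 0 0"
  have k: "\<forall>p<n. \<forall>q<n. kap c p q = (if q = p then \<tau> else 0)" using c unfolding z \<tau>_def .
  obtain D where D: "(\<lambda>x\<in>S. (of_nat (n choose 2) - 1) * D x) \<in> W"
    "\<forall>c \<tau>. (\<forall>p<n. \<forall>q<n. kap c p q = (if q = p then \<tau> else 0)) \<longrightarrow> (\<lambda>x\<in>S. psi c x - (pr c - \<tau>) * D x) \<in> W"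
    using mod_special[OF W n2] by blast
  have 1: "(\<lambda>x\<in>S. psi c x - (pr c - \<tau>) * D x) \<in> W" using D(2) k by blast
  have "(\<lambda>x\<in>S. (pr c - \<tau>) * D x) \<in> W"
  proof (cases "(2 :: 'k) = 0")
    case True
    hence "(of_nat (n choose 2) - 1 :: 'k) \<noteq> 0" using h by simp
    thus ?thesis by (intro fsub_smult[OF Wf] fsub_cancel[OF Wf D(1)])
  next
    case False
    have "2 * pr c = (\<Sum>p<n. \<tau>)" unfolding trace_kap[symmetric] using k by (intro sum.cong) auto
    hence "2 * (pr c - \<tau>) = 0" by (simp add: n2 algebra_simps)
    hence "pr c - \<tau> = 0" using False by simp
    thus ?thesis using fsub_zero[OF Wf] by simp
  qed
  from fsub_add[OF Wf 1 this] show "(\<lambda>x\<in>S. psi c x) \<in> W" by simp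
qed

lemma sg_kap_surj:
  assumes "(\<Sum>i<n. m i i) = 2 * t"
  shows "\<exists>c. (\<lambda>x\<in>S. sg (kap c) x) = (\<lambda>x\<in>S. sg m x)"
proof -
  obtain c where "\<forall>p<n. \<forall>q<n. kap c p q = m p q" "pr c = t" by (rule kap_pr_exists[where m = m and t = t, OF assms])
  thus ?thesis by (intro exI[of _ c] restrict_ext sg_cong) auto
qed

text \<open>Brings the condition that the contraction is scalar into the form demanded by
  \<open>dim_kernel\<close>: vanishing of the coordinates in \<open>J\<close>, from which
  \<open>rest\<close> recovers the other entries.\<close>

lemma scalar_coordinates:
  assumes J: "J \<subseteq> {..<n} \<times> {..<n}"
    and rest: "\<And>p q. p < n \<Longrightarrow> q < n \<Longrightarrow> (p, q) \<notin> J \<Longrightarrow> \<forall>(i, k)\<in>J. m i k = (if k = i then m 0 0 else 0)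
      \<Longrightarrow> m p q = (if q = p then m 0 0 else 0 :: 'k)"
  shows "(\<forall>p<n. \<forall>q<n. m p q = (if q = p then m 0 0 else 0)) \<longleftrightarrow>
    (\<forall>i\<in>J. (case i of (i, k) \<Rightarrow> if (i, k) \<in> J then m i k - (if k = i then m 0 0 else 0) else 0) = 0)" (is "?L \<longleftrightarrow> ?R")
proof
  define t where "t = m 0 0"
  assume ?L
  hence "m p q = (if q = p then t else 0)" if "(p, q) \<in> J" for p q using that J unfolding t_def by blast
  thus ?R unfolding t_def[symmetric] by auto
next
  define t where "t = m 0 0"
  assume ?R
  hence j: "m i k = (if k = i then t else 0)" if "(i, k) \<in> J" for i k
    using that unfolding t_def[symmetric] by (auto dest: bspec)
  hence j': "\<forall>(i, k)\<in>J. m i k = (if k = i then t else 0)" by auto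
  show ?L
  proof (intro allI impI)
    fix p q assume "p < n" "q < n"
    thus "m p q = (if q = p then m 0 0 else 0)"
      using j j' rest[of p q] unfolding t_def[symmetric] by (cases "(p, q) \<in> J") blast+
  qed
qed

text \<open>With 2 invertible every trace has the form \<open>2 * t\<close>, so \<open>kap\<close>
  reaches all matrices. Passing to matrices modulo scalars removes the single coordinate
  \<open>(0, 0)\<close>.\<close>

theorem adjoint_case:
  assumes n2: "(of_nat n :: 'k) = 2" and odd: "(2 :: 'k) \<noteq> 0"
  shows "gmodule_iso (SL n) (quotient_gmodule (H0 TYPE('k) n mw) (carrier (L TYPE('k) n mw))) (H0 TYPE('k) n aw)"
    "simple_gmodule (SL n) (H0 TYPE('k) n aw)"
    "vectorspace.fin_dim class_ring (L TYPE('k) n mw)"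
    "vectorspace.dim class_ring (L TYPE('k) n mw) + (n\<^sup>2 - 1) + n\<^sup>2 = (n choose 2)\<^sup>2"
proof -
  have t: "s = 2 * (s / 2)" for s :: 'k using odd by simp
  have *: "L TYPE('k) n mw = FM scalar_kernel \<and> gmodule_iso (SL n) (quotient_gmodule (H0 TYPE('k) n mw) scalar_kernel) (FM (V aw))"
  proof (rule quotient_sg[OF n2 _ V_inv_sub sg_V])
    fix f assume "f \<in> V aw"
    then obtain m where m: "f = (\<lambda>x\<in>S. sg m x)" by (auto simp: V_aw sg_functions_def)
    show "\<exists>c. (\<lambda>x\<in>S. sg (kap c) x) = f" unfolding m by (rule sg_kap_surj[OF t])
  qed (use odd in simp)
  thus "gmodule_iso (SL n) (quotient_gmodule (H0 TYPE('k) n mw) (carrier (L TYPE('k) n mw))) (H0 TYPE('k) n aw)"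
    by (subst H0_FM(1)[of aw]) simp
  show "simple_gmodule (SL n) (H0 TYPE('k) n aw)" by (rule simple_aw) (simp add: n2 odd)
  define J where "J = {..<n} \<times> {..<n} - {(0, 0)}"
  have "finite J" by (simp add: J_def)
  hence "vectorspace.fin_dim class_ring (FM scalar_kernel) \<and> vectorspace.dim class_ring (FM scalar_kernel) + card J + n\<^sup>2 = (n choose 2)\<^sup>2"
  proof (rule dim_kernel[where G = "\<lambda>c (i, k). if (i, k) \<in> J then kap c i k - (if k = i then kap c 0 0 else 0) else 0"], goal_cases)
    case (2 y)
    obtain c where c: "\<forall>p<n. \<forall>q<n. kap c p q = y (p, q)" by (rule kap_pr_exists[OF t])
    have "y (0, 0) = 0" using 2 by (simp add: J_def)
    thus ?case using c 2 n5 by (intro exI[of _ c]) (auto simp: J_def fun_eq_iff)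
  next
    case (4 c i)
    obtain t where t: "\<forall>p<n. \<forall>q<n. kap c p q = (if q = p then t else 0)"
      using psi_zero_scalar[OF n2 4(1)] by blast
    thus ?case using n5 4(2) by (cases i) (simp add: J_def)
  next
    case 5
    have "(p, q) = (0, 0)" if "p < n" "q < n" "(p, q) \<notin> J" for p q using that by (auto simp: J_def)
    hence "(\<forall>p<n. \<forall>q<n. kap c p q = (if q = p then kap c 0 0 else 0)) \<longleftrightarrow>
       (\<forall>i\<in>J. (case i of (i, k) \<Rightarrow> if (i, k) \<in> J then kap c i k - (if k = i then kap c 0 0 else 0) else 0) = 0)" for c
      by (intro scalar_coordinates) (auto simp: J_def)
    thus ?case unfolding scalar_kernel_def by simp
  qed (auto simp: kap_lin algebra_simps)
  moreover have "card J = n\<^sup>2 - 1"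
    unfolding J_def using n5 by (subst card_Diff_singleton) (auto simp: power2_eq_square)
  ultimately show "vectorspace.fin_dim class_ring (L TYPE('k) n mw)"
    "vectorspace.dim class_ring (L TYPE('k) n mw) + (n\<^sup>2 - 1) + n\<^sup>2 = (n choose 2)\<^sup>2"
    using * by simp_all
qed

text \<open>In characteristic 2 the contraction is traceless by \<open>trace_kap\<close>, and so are
  the scalar matrices because \<open>n = 0\<close> in \<open>k\<close>. The range is therefore
  \<open>sg0\<close>, and trace condition and scalars together cost two coordinates.\<close>

theorem even_case:
  assumes n0: "(of_nat n :: 'k) = 0" and two: "(2 :: 'k) = 0" and C: "(of_nat (n choose 2) :: 'k) = 0"
  shows "gmodule_iso (SL n) (quotient_gmodule (H0 TYPE('k) n mw) (carrier (L TYPE('k) n mw))) (L TYPE('k) n aw)"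
    "vectorspace.fin_dim class_ring (L TYPE('k) n mw)"
    "vectorspace.dim class_ring (L TYPE('k) n mw) + (n\<^sup>2 - 2) + n\<^sup>2 = (n choose 2)\<^sup>2"
proof -
  have n2: "(of_nat n :: 'k) = 2" using n0 two by simp
  have tr: "(\<Sum>p<n. kap c p p) = 0" for c unfolding trace_kap two by simp
  have *: "L TYPE('k) n mw = FM scalar_kernel \<and> gmodule_iso (SL n) (quotient_gmodule (H0 TYPE('k) n mw) scalar_kernel) (FM sg0)"
  proof (rule quotient_sg[OF n2 _ sg0_inv_sub])
    show "(\<lambda>x\<in>S. sg (kap c) x) \<in> sg0" for c using tr by (auto simp: sg0_def)
    fix f assume "f \<in> sg0"
    then obtain m where m: "f = (\<lambda>x\<in>S. sg m x)" "(\<Sum>i<n. m i i) = 2 * 0" by (auto simp: sg0_def)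
    show "\<exists>c. (\<lambda>x\<in>S. sg (kap c) x) = f" unfolding m(1) by (rule sg_kap_surj[where m = m and t = 0, OF m(2)])
  qed (simp add: C)
  thus "gmodule_iso (SL n) (quotient_gmodule (H0 TYPE('k) n mw) (carrier (L TYPE('k) n mw))) (L TYPE('k) n aw)"
    by (simp add: L_aw)
  define J where "J = {..<n} \<times> {..<n} - {(0, 0), (1, 1)}"
  have "finite J" by (simp add: J_def)
  hence "vectorspace.fin_dim class_ring (FM scalar_kernel) \<and> vectorspace.dim class_ring (FM scalar_kernel) + card J + n\<^sup>2 = (n choose 2)\<^sup>2"
  proof (rule dim_kernel[where G = "\<lambda>c (i, k). if (i, k) \<in> J then kap c i k - (if k = i then kap c 0 0 else 0) else 0"], goal_cases)
    case (2 y)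
    \<comment> \<open>The entry at \<open>(1, 1)\<close>, which is outside \<open>J\<close>, is used
      to make the trace zero.\<close>
    define m where "m i k = y (i, k) - (if k = 1 then if i = 1 then \<Sum>l<n. y (l, l) else 0 else 0)" for i k
    have "(\<Sum>i<n. m i i) = 2 * 0" using n5 by (simp add: m_def sum_subtractf)
    then obtain c where c: "\<forall>p<n. \<forall>q<n. kap c p q = m p q" by (rule kap_pr_exists)
    have "y (0, 0) = 0" using 2 by (simp add: J_def)
    hence "m 0 0 = 0" by (simp add: m_def)
    moreover have "m i k = y (i, k)" if "(i, k) \<in> J" for i k using that by (auto simp: m_def J_def)
    ultimately show ?case using c 2 n5 by (intro exI[of _ c]) (auto simp: J_def fun_eq_iff)
  next
    case (4 c i)
    obtain t where t: "\<forall>p<n. \<forall>q<n. kap c p q = (if q = p then t else 0)"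
      using psi_zero_scalar[OF n2 4(1)] by blast
    thus ?case using n5 4(2) by (cases i) (simp add: J_def)
  next
    case 5
    have "(\<forall>p<n. \<forall>q<n. kap c p q = (if q = p then kap c 0 0 else 0)) \<longleftrightarrow>
       (\<forall>i\<in>J. (case i of (i, k) \<Rightarrow> if (i, k) \<in> J then kap c i k - (if k = i then kap c 0 0 else 0) else 0) = 0)" for c
    proof (rule scalar_coordinates)
      fix p q assume pq: "p < n" "q < n" "(p, q) \<notin> J" and r: "\<forall>(i, k)\<in>J. kap c i k = (if k = i then kap c 0 0 else 0)"
      have "(\<Sum>p<n. kap c p p) = (\<Sum>p<n. kap c 0 0 + (if p = 1 then kap c 1 1 - kap c 0 0 else 0))"
      proof (intro sum.cong refl)
        fix p assume "p \<in> {..<n}"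
        hence "p = 0 \<or> p = 1 \<or> (p, p) \<in> J" by (auto simp: J_def)
        thus "kap c p p = kap c 0 0 + (if p = 1 then kap c 1 1 - kap c 0 0 else 0)"
          using bspec[OF r, of "(p, p)"] by (cases "p = 1") (auto simp: J_def)
      qed
      also have "\<dots> = kap c 1 1 - kap c 0 0" using n5 by (simp add: sum.distrib n0)
      finally have "kap c 1 1 = kap c 0 0" using tr[of c] by simp
      moreover have "p = 0 \<and> q = 0 \<or> p = 1 \<and> q = 1" using pq by (auto simp: J_def)
      ultimately show "kap c p q = (if q = p then kap c 0 0 else 0)" by (elim disjE conjE) simp_all
    qed (auto simp: J_def)
    thus ?case unfolding scalar_kernel_def by simp
  qed (auto simp: kap_lin algebra_simps)
  moreover have "card J = n\<^sup>2 - 2"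
    unfolding J_def using n5 by (subst card_Diff_subset) (auto simp: power2_eq_square)
  ultimately show "vectorspace.fin_dim class_ring (L TYPE('k) n mw)"
    "vectorspace.dim class_ring (L TYPE('k) n mw) + (n\<^sup>2 - 2) + n\<^sup>2 = (n choose 2)\<^sup>2"
    using * by simp_all
qed

text \<open>\<open>aw\<close> and \<open>- w0 n aw\<close> differ by the constant 2, and a constant
  weight is trivial on triangular matrices of determinant 1. The Weyl module is thus the dual of
  \<open>V aw\<close> itself.\<close>

lemma Weyl_aw: "Weyl TYPE('k) n aw = dual_gmodule (SL n) (FM (V aw))"
proof -
  have "weight_char n (- w0 n aw) b = weight_char n aw b" if b: "b \<in> borel_neg n" for b :: "'k mat"
  proof -
    have "weight_char n aw b = (\<Prod>i<n. b $$ (i, i) powi ((- w0 n aw) i) * (b $$ (i, i))\<^sup>2)"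
      unfolding weight_char_def
    proof (intro prod.cong refl)
      fix i assume i: "i \<in> {..<n}"
      hence nz: "b $$ (i, i) \<noteq> 0" using borel_diag(2)[OF b] by simp
      have "aw i = (- w0 n aw) i + 2" using i n5 by (auto simp: w0_def aw_def fund_weight_def)
      thus "b $$ (i, i) powi aw i = b $$ (i, i) powi ((- w0 n aw) i) * (b $$ (i, i))\<^sup>2"
        using power_int_add[of "b $$ (i, i)" "(- w0 n aw) i" 2] nz by simp
    qed
    also have "\<dots> = weight_char n (- w0 n aw) b * (\<Prod>i<n. b $$ (i, i))\<^sup>2"
      by (simp add: weight_char_def prod.distrib prod_power_distrib)
    finally show ?thesis using borel_diag(1)[OF b] by simp
  qed
  hence "H0 TYPE('k) n (- w0 n aw) = H0 TYPE('k) n aw" unfolding H0_def by (auto cong: conj_cong)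
  thus ?thesis unfolding Weyl_def by (subst H0_FM(1)[of aw, symmetric]) simp
qed

text \<open>The pairing \<open>sg m' \<mapsto> tr (m m')\<close>.  Since \<open>m'\<close> is determined only up to scalar matrices, it is
  independent of the choice when \<open>m\<close> has trace zero.\<close>

definition phi :: "(nat \<Rightarrow> nat \<Rightarrow> 'k) \<Rightarrow> ('k mat \<Rightarrow> 'k) \<Rightarrow> 'k" where
  "phi m = (\<lambda>f\<in>V aw. \<Sum>i<n. \<Sum>k<n. m i k * (SOME m'. f = (\<lambda>x\<in>S. sg m' x)) k i)"

lemma phi_lin: "phi (\<lambda>i k. m i k + a * m' i k) = (\<lambda>f\<in>V aw. phi m f + a * phi m' f)"
  by (auto simp: phi_def sum.distrib sum_distrib_left algebra_simps intro!: restrict_ext)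

lemma phi_sg:
  assumes tr: "(\<Sum>i<n. m i i) = 0"
  shows "phi m (\<lambda>x\<in>S. sg m' x) = (\<Sum>i<n. \<Sum>k<n. m i k * m' k i)"
proof -
  let ?f = "\<lambda>x\<in>S. sg m' x"
  define r where "r = (SOME r. ?f = (\<lambda>x\<in>S. sg r x))"
  have r: "?f = (\<lambda>x\<in>S. sg r x)" unfolding r_def by (rule someI[of _ m']) (rule refl)
  define d where "d i k = m' i k + (- 1) * r i k" for i k
  have "sg d x = 0" if "x \<in> S" for x
    unfolding d_def sg_add sg_smult using fun_cong[OF r, of x] that by simp
  hence "\<forall>x\<in>S. sg d x = 0" by blast
  hence d: "d i k = (if k = i then d 0 0 else 0)" if "i < n" "k < n" for i k using that unfolding sg_zero_iff by blast
  define t where "t = d 0 0"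
  have "(\<Sum>i<n. \<Sum>k<n. m i k * m' k i) = (\<Sum>i<n. \<Sum>k<n. m i k * r k i + (if k = i then t * m i i else 0))"
  proof (intro sum.cong refl)
    fix i k assume "i \<in> {..<n}" "k \<in> {..<n}"
    hence "d k i = (if i = k then t else 0)" unfolding t_def using d[of k i] by simp
    hence "m' k i = r k i + (if i = k then t else 0)" by (simp add: d_def algebra_simps)
    thus "m i k * m' k i = m i k * r k i + (if k = i then t * m i i else 0)" by (simp add: algebra_simps)
  qed
  also have "\<dots> = (\<Sum>i<n. \<Sum>k<n. m i k * r k i) + t * (\<Sum>i<n. m i i)"
    by (simp add: sum.distrib sum_distrib_left)
  finally show ?thesis using sg_V[of m'] tr by (simp add: phi_def r_def)
qed

lemma phi_dual:
  assumes tr: "(\<Sum>i<n. m i i) = 0"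
  shows "phi m \<in> carrier (dual_gmodule (SL n) (FM (V aw)))"
proof -
  have add: "phi m (\<lambda>x\<in>S. f x + h x) = phi m f + phi m h" if fh: "f \<in> V aw" "h \<in> V aw" for f h
  proof -
    obtain u v where u: "f = (\<lambda>x\<in>S. sg u x)" "h = (\<lambda>x\<in>S. sg v x)" using fh by (auto simp: V_aw sg_functions_def)
    have "(\<lambda>x\<in>S. f x + h x) = (\<lambda>x\<in>S. sg (\<lambda>i k. u i k + v i k) x)" by (auto simp: u sg_add)
    thus ?thesis unfolding u by (simp only: phi_sg[where m = m, OF tr]) (simp add: sum.distrib algebra_simps)
  qed
  have smult: "phi m (\<lambda>x\<in>S. a * f x) = a * phi m f" if f: "f \<in> V aw" for f a
  proof -
    obtain u where u: "f = (\<lambda>x\<in>S. sg u x)" using f by (auto simp: V_aw sg_functions_def)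
    have "(\<lambda>x\<in>S. a * f x) = (\<lambda>x\<in>S. sg (\<lambda>i k. a * u i k) x)" by (auto simp: u sg_smult)
    thus ?thesis unfolding u by (simp only: phi_sg[where m = m, OF tr]) (simp add: sum_distrib_left algebra_simps)
  qed
  have "phi m \<in> extensional (V aw)" by (simp add: phi_def)
  thus ?thesis using add smult
    by (simp add: dual_gmodule_def trivial_gmodule_def LinearCombinations.module_hom_def)
qed

lemma sum_two_deltas:
  assumes "a < n" "b < n"
  shows "(\<Sum>i<n. \<Sum>k<n. m i k * (if k = b \<and> i = a then 1 else 0)) = (m a b :: 'k)"
proof -
  have "(\<Sum>i<n. \<Sum>k<n. m i k * (if k = b \<and> i = a then 1 else 0)) = (\<Sum>i<n. \<Sum>k<n. if k = b then if i = a then m i k else 0 else 0)"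
    by (intro sum.cong refl) auto
  thus ?thesis using assms by simp
qed

lemma phi_zero_iff:
  assumes tr: "(\<Sum>i<n. m i i) = 0"
  shows "phi m = (\<lambda>f\<in>V aw. 0) \<longleftrightarrow> (\<forall>i<n. \<forall>k<n. m i k = 0)"
proof
  assume z: "phi m = (\<lambda>f\<in>V aw. 0)"
  show "\<forall>i<n. \<forall>k<n. m i k = 0"
  proof (intro allI impI)
    fix a b assume ab: "a < n" "b < n"
    have "m a b = phi m (\<lambda>x\<in>S. sg (\<lambda>k i. if k = b \<and> i = a then 1 else 0) x)"
      unfolding phi_sg[where m = m, OF tr] sum_two_deltas[OF ab] ..
    thus "m a b = 0" unfolding z using sg_V by simp
  qed
qed (simp add: phi_def)

lemma phi_cong: "(\<And>i k. i < n \<Longrightarrow> k < n \<Longrightarrow> m i k = m' i k) \<Longrightarrow> phi m = phi m'"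
  by (simp add: phi_def)

text \<open>The matrix of a functional is read off at the functions \<open>AZ k i\<close>. Its trace
  is the value of the functional at \<open>sg\<close> of the identity matrix, and that function is
  zero.\<close>

lemma dual_phi:
  assumes \<phi>: "\<phi> \<in> carrier (dual_gmodule (SL n) (FM (V aw)))"
  obtains m where "(\<Sum>i<n. m i i) = 0" "phi m = \<phi>"
proof -
  have add: "\<phi> (\<lambda>x\<in>S. f x + h x) = \<phi> f + \<phi> h" if "f \<in> V aw" "h \<in> V aw" for f h
    using \<phi> that by (simp add: dual_gmodule_def trivial_gmodule_def LinearCombinations.module_hom_def)
  have smult: "\<phi> (\<lambda>x\<in>S. a * f x) = a * \<phi> f" if "f \<in> V aw" for f a
    using \<phi> that by (simp add: dual_gmodule_def trivial_gmodule_def LinearCombinations.module_hom_def)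
  have ext: "\<phi> \<in> extensional (V aw)" using \<phi> by (simp add: dual_gmodule_def)
  note Vf = V_fsub[of aw]
  have zero: "\<phi> (\<lambda>x\<in>S. 0) = 0" using smult[OF fsub_zero[OF Vf], of 0] by simp
  have sum: "\<phi> (\<lambda>x\<in>S. \<Sum>i<N. h i x) = (\<Sum>i<N. \<phi> (\<lambda>x\<in>S. h i x))"
    if h: "\<And>i. i < N \<Longrightarrow> (\<lambda>x\<in>S. h i x) \<in> V aw" for h and N :: nat
    using h
  proof (induction N)
    case (Suc N)
    have "(\<lambda>x\<in>S. \<Sum>i<Suc N. h i x) = (\<lambda>x\<in>S. (\<lambda>x\<in>S. \<Sum>i<N. h i x) x + (\<lambda>x\<in>S. h N x) x)" by (rule restrict_ext) simp
    moreover have "(\<lambda>x\<in>S. \<Sum>i<N. h i x) \<in> V aw" by (rule fsub_sum[OF Vf], rule Suc.prems) simp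
    ultimately show ?case using Suc by (simp only: add) simp
  qed (simp add: zero)
  have AZ: "(\<lambda>x\<in>S. AZ i k x) \<in> V aw" if "i < n" "k < n" for i k using AZ_sgset[OF that] by (simp add: V_aw)
  define m where "m i k = \<phi> (\<lambda>x\<in>S. AZ k i x)" for i k
  have ev: "\<phi> (\<lambda>x\<in>S. sg m' x) = (\<Sum>k<n. \<Sum>i<n. m' k i * m i k)" for m'
  proof -
    have tm: "(\<lambda>x\<in>S. m' k i * AZ k i x) \<in> V aw" if "k < n" "i < n" for k i
      by (rule fsub_smult[OF Vf AZ[OF that]])
    have "\<phi> (\<lambda>x\<in>S. sg m' x) = (\<Sum>k<n. \<phi> (\<lambda>x\<in>S. \<Sum>i<n. m' k i * AZ k i x))"
      unfolding sg_def using tm by (intro sum fsub_sum[OF Vf]) auto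
    also have "\<dots> = (\<Sum>k<n. \<Sum>i<n. \<phi> (\<lambda>x\<in>S. m' k i * AZ k i x))"
      using tm by (intro sum.cong refl sum) auto
    also have "\<dots> = (\<Sum>k<n. \<Sum>i<n. m' k i * m i k)"
    proof (intro sum.cong refl)
      fix k i assume "k \<in> {..<n}" "i \<in> {..<n}"
      hence "\<phi> (\<lambda>x\<in>S. m' k i * (\<lambda>x\<in>S. AZ k i x) x) = m' k i * m i k"
        unfolding m_def by (intro smult AZ) auto
      moreover have "(\<lambda>x\<in>S. m' k i * (\<lambda>x\<in>S. AZ k i x) x) = (\<lambda>x\<in>S. m' k i * AZ k i x)" by (rule restrict_ext) simp
      ultimately show "\<phi> (\<lambda>x\<in>S. m' k i * AZ k i x) = m' k i * m i k" by simp
    qed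
    finally show ?thesis .
  qed
  have "(\<lambda>x\<in>S. sg (\<lambda>i k. if k = i then 1 else 0) x) = (\<lambda>x\<in>S. 0)"
    by (rule restrict_ext) (rule sg_scalar[where t = 1], auto)
  hence "0 = (\<Sum>k<n. \<Sum>i<n. (if i = k then 1 else 0) * m i k)" using ev[of "\<lambda>i k. if k = i then 1 else 0"] zero by simp
  also have "\<dots> = (\<Sum>k<n. m k k)" by (simp add: if_distrib[of "\<lambda>c. c * _"] cong: if_cong)
  finally have tr: "(\<Sum>i<n. m i i) = 0" by simp
  have "phi m = \<phi>"
  proof (rule extensionalityI[of _ "V aw"])
    fix f assume "f \<in> V aw"
    then obtain m' where f: "f = (\<lambda>x\<in>S. sg m' x)" by (auto simp: V_aw sg_functions_def)
    show "phi m f = \<phi> f" unfolding f phi_sg[where m = m, OF tr] ev by (rule trans[OF sum.swap]) (simp add: mult.commute)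
  qed (simp_all add: phi_def ext)
  thus ?thesis using that tr by blast
qed

text \<open>Cyclic invariance of the trace: conjugating one factor by \<open>g\<close> amounts to
  conjugating the other by the inverse.\<close>

lemma sga_adjoint:
  assumes g: "g \<in> S"
  shows "(\<Sum>i<n. \<Sum>k<n. sga g m i k * m' k i) = (\<Sum>i<n. \<Sum>k<n. m i k * sga (iv g) m' k i)"
proof -
  have gg: "iv (iv g) = g" using g by simp
  have "(\<Sum>p<n. \<Sum>q<n. sga g m p q * m' q p)
    = (\<Sum>p<n. \<Sum>q<n. \<Sum>i<n. \<Sum>k<n. m i k * (m' q p * (iv g $$ (k, q) * g $$ (p, i))))"
    unfolding sga_def sum_distrib_right by (intro sum.cong refl) (simp add: ac_simps)
  also have "\<dots> = (\<Sum>p<n. \<Sum>i<n. \<Sum>k<n. \<Sum>q<n. m i k * (m' q p * (iv g $$ (k, q) * g $$ (p, i))))"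
    by (rule sum.cong[OF refl], (rule trans[OF sum.swap], rule sum.cong[OF refl])+, rule sum.cong[OF refl], simp)
  also have "\<dots> = (\<Sum>i<n. \<Sum>k<n. \<Sum>q<n. \<Sum>p<n. m i k * (m' q p * (iv g $$ (k, q) * g $$ (p, i))))"
    by ((rule trans[OF sum.swap], rule sum.cong[OF refl])+, rule sum.cong[OF refl], simp)
  also have "\<dots> = (\<Sum>i<n. \<Sum>k<n. m i k * sga (iv g) m' k i)"
    unfolding sga_def gg sum_distrib_left by (rule refl)
  finally show ?thesis .
qed

lemma sga_id:
  assumes g: "g \<in> S" and pq: "p < n" "q < n"
  shows "sga g (\<lambda>i k. if k = i then t else 0) p q = (if q = p then t else 0)"
proof -
  have "sga g (\<lambda>i k. if k = i then t else 0) p q = (\<Sum>i<n. \<Sum>k<n. if k = i then t * (g $$ (p, i) * iv g $$ (i, q)) else 0)"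
    unfolding sga_def by (intro sum.cong refl) auto
  also have "\<dots> = t * (\<Sum>i<n. g $$ (p, i) * iv g $$ (i, q))" by (simp add: sum_distrib_left)
  finally show ?thesis using iv_right_sum[OF g pq] by auto
qed

lemma sga_add: "sga g (\<lambda>i k. m i k + m' i k) p q = sga g m p q + sga g m' p q"
  by (simp add: sga_def sum.distrib distrib_right)

text \<open>On the kernel of \<open>psi\<close> the contraction is the scalar \<open>t + D\<close>,
  and so is \<open>pr\<close> because \<open>n choose 2\<close> is 1 in \<open>k\<close>. In
  characteristic 2 their sum vanishes there, so it descends to functions. Unlike \<open>kap\<close>
  modulo scalars it retains the information in \<open>pr\<close>.\<close>

theorem weyl_case:
  assumes n0: "(of_nat n :: 'k) = 0" and two: "(2 :: 'k) = 0" and C: "(of_nat (n choose 2) :: 'k) = 1"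
  shows "gmodule_iso (SL n) (quotient_gmodule (H0 TYPE('k) n mw) (carrier (L TYPE('k) n mw))) (Weyl TYPE('k) n aw)"
    "vectorspace.fin_dim class_ring (L TYPE('k) n mw)"
    "vectorspace.dim class_ring (L TYPE('k) n mw) + (n\<^sup>2 - 1) + n\<^sup>2 = (n choose 2)\<^sup>2"
proof -
  let ?Y = "dual_gmodule (SL n) (FM (V aw))"
  have n2: "(of_nat n :: 'k) = 2" using n0 two by simp
  have dbl: "x + x = 0" for x :: 'k using two by (metis mult_2 mult_zero_left)
  \<comment> \<open>Traceless by \<open>trace_kap\<close>, because 2 and \<open>n\<close> both
    vanish in \<open>k\<close>.\<close>
  define M where "M c i k = kap c i k + (if k = i then pr c else 0)" for c and i k :: nat
  have tr: "(\<Sum>i<n. M c i i) = 0" for c by (simp add: M_def sum.distrib trace_kap two n0)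
  define K where "K = {f. \<exists>c. f = (\<lambda>x\<in>S. psi c x) \<and> (\<forall>p<n. \<forall>q<n. M c p q = 0)}"
  have z: "phi (M c) = \<zero>\<^bsub>?Y\<^esub> \<longleftrightarrow> (\<forall>p<n. \<forall>q<n. M c p q = 0)" for c
    using phi_zero_iff[where m = "M c", OF tr] by (simp add: dual_gmodule_def)
  have lin: "M (\<lambda>i j k l. c i j k l + a * c' i j k l) = (\<lambda>i k. M c i k + a * M c' i k)" for c c' a
    by (auto simp: M_def kap_lin pr_lin fun_eq_iff algebra_simps)
  have wd: "\<forall>p<n. \<forall>q<n. M c p q = 0" if z0: "\<forall>x\<in>S. psi c x = 0" for c
  proof -
    obtain t D where t: "\<forall>p<n. \<forall>q<n. kap c p q = (if q = p then t + D else 0)" "pr c = t + of_nat (n choose 2) * D"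
      using psi_zero_scalar[OF n2 z0] by blast
    thus ?thesis using dbl[of "t + D"] by (simp add: M_def C)
  qed
  have surj: "\<exists>c. \<forall>p<n. \<forall>q<n. M c p q = m p q" if m: "(\<Sum>i<n. m i i) = 0" for m
  proof -
    have "(\<Sum>i<n. m i i) = 2 * 0" using m by simp
    then obtain c where "\<forall>p<n. \<forall>q<n. kap c p q = m p q" "pr c = 0" by (rule kap_pr_exists[where m = m and t = 0])
    thus ?thesis by (intro exI[of _ c]) (simp add: M_def)
  qed
  have *: "L TYPE('k) n mw = FM K \<and> gmodule_iso (SL n) (quotient_gmodule (H0 TYPE('k) n mw) K) ?Y"
  proof (rule quotient_of_minimal[where G = "\<lambda>c. phi (M c)"])
    show "module class_ring ?Y" by (intro dual_gmodule_module FM_module V_fsub)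
    show "phi (M c) \<in> carrier ?Y" for c by (rule phi_dual) (rule tr)
    show "\<exists>c. phi (M c) = y" if y: "y \<in> carrier ?Y" for y
    proof -
      obtain m where m: "(\<Sum>i<n. m i i) = 0" "phi m = y" by (rule dual_phi[OF y])
      obtain c where "\<forall>p<n. \<forall>q<n. M c p q = m p q" using surj[where m = m, OF m(1)] by blast
      hence "phi (M c) = phi m" by (intro phi_cong) auto
      thus ?thesis using m by blast
    qed
    show "phi (M (\<lambda>i j k l. c i j k l + a * c' i j k l)) = phi (M c) \<oplus>\<^bsub>?Y\<^esub> (a \<odot>\<^bsub>?Y\<^esub> phi (M c'))" for c c' a
      unfolding lin phi_lin by (auto simp: dual_gmodule_def intro!: restrict_ext)
    show "phi (M c) = \<zero>\<^bsub>?Y\<^esub>" if "\<forall>x\<in>S. psi c x = 0" for c unfolding z by (rule wd[OF that])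
    show "K = {f. \<exists>c. f = (\<lambda>x\<in>S. psi c x) \<and> phi (M c) = \<zero>\<^bsub>?Y\<^esub>}" unfolding z K_def ..
    show "phi (M (unit_array 0 1 (n - 2) (n - 1))) = \<zero>\<^bsub>?Y\<^esub>" unfolding z by (simp only: M_def unit_array_zero) simp
    show "phi (M (ga g c)) = act ?Y g (phi (M c))" if g: "g \<in> S" for g c
    proof -
      have "phi (M (ga g c)) = phi (sga g (M c))"
      proof (rule phi_cong)
        fix i k assume ik: "i < n" "k < n"
        have "sga g (M c) i k = sga g (kap c) i k + (if k = i then pr c else 0)"
          unfolding M_def sga_add using sga_id[OF g ik] by simp
        thus "M (ga g c) i k = sga g (M c) i k" using kap_ga[OF g ik] pr_ga[OF g] by (simp add: M_def)
      qed
      also have "\<dots> = (\<lambda>f\<in>V aw. phi (M c) (\<lambda>x\<in>S. f (iv (iv g) * x)))"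
      proof (rule extensionalityI[of _ "V aw"])
        fix f assume f: "f \<in> V aw"
        then obtain m' where f': "f = (\<lambda>x\<in>S. sg m' x)" by (auto simp: V_aw sg_functions_def)
        have gi: "iv g \<in> S" using g by (rule iv_S)
        have "(\<lambda>x\<in>S. f (iv (iv g) * x)) = (\<lambda>x\<in>S. sg (sga (iv g) m') x)"
          by (rule restrict_ext) (use gi g in \<open>simp add: f' sg_sga[OF gi] S_mult\<close>)
        hence "(\<lambda>f\<in>V aw. phi (M c) (\<lambda>x\<in>S. f (iv (iv g) * x))) f = (\<Sum>i<n. \<Sum>k<n. M c i k * sga (iv g) m' k i)"
          using f phi_sg[where m = "M c", OF tr] by simp
        moreover have "phi (sga g (M c)) f = (\<Sum>i<n. \<Sum>k<n. sga g (M c) i k * m' k i)"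
          unfolding f' by (rule phi_sg) (simp add: sga_trace[OF g] tr)
        ultimately show "phi (sga g (M c)) f = (\<lambda>f\<in>V aw. phi (M c) (\<lambda>x\<in>S. f (iv (iv g) * x))) f"
          using sga_adjoint[OF g] by simp
      qed (simp_all add: phi_def)
      also have "\<dots> = act ?Y g (phi (M c))" by (simp add: dual_gmodule_def)
      finally show ?thesis .
    qed
    fix W c assume W: "gsub mw W" "W \<noteq> {\<lambda>x\<in>S. 0}" and "phi (M c) = \<zero>\<^bsub>?Y\<^esub>"
    hence M0: "\<forall>p<n. \<forall>q<n. M c p q = 0" unfolding z by simp
    have k: "\<forall>p<n. \<forall>q<n. kap c p q = (if q = p then pr c else 0)"
    proof (intro allI impI)
      fix p q assume "p < n" "q < n"
      hence m: "kap c p q + (if q = p then pr c else 0) = 0" using M0 by (simp add: M_def)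
      thus "kap c p q = (if q = p then pr c else 0)"
        using dbl[of "pr c"] by (cases "q = p") (simp_all add: eq_neg_iff_add_eq_0[symmetric])
    qed
    obtain D where "\<forall>c \<tau>. (\<forall>p<n. \<forall>q<n. kap c p q = (if q = p then \<tau> else 0)) \<longrightarrow> (\<lambda>x\<in>S. psi c x - (pr c - \<tau>) * D x) \<in> W"
      using mod_special[OF W n2] by blast
    \<comment> \<open>The contraction is the scalar \<open>pr c\<close>, for which the coefficient
      of \<open>D\<close> in \<open>mod_special\<close> is zero.\<close>
    hence "(\<lambda>x\<in>S. psi c x - (pr c - pr c) * D x) \<in> W" using k by blast
    thus "(\<lambda>x\<in>S. psi c x) \<in> W" by simp
  qed
  thus "gmodule_iso (SL n) (quotient_gmodule (H0 TYPE('k) n mw) (carrier (L TYPE('k) n mw))) (Weyl TYPE('k) n aw)"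
    by (simp add: Weyl_aw)
  define J where "J = {..<n} \<times> {..<n} - {(0, 0)}"
  have "finite J" by (simp add: J_def)
  hence "vectorspace.fin_dim class_ring (FM K) \<and> vectorspace.dim class_ring (FM K) + card J + n\<^sup>2 = (n choose 2)\<^sup>2"
  proof (rule dim_kernel[where G = "\<lambda>c (i, k). if (i, k) \<in> J then M c i k else 0"], goal_cases)
    case (2 y)
    \<comment> \<open>\<open>J\<close> omits \<open>(0, 0)\<close>, whose entry is determined by the
      vanishing of the trace.\<close>
    define m where "m i k = y (i, k) - (if k = 0 then if i = 0 then \<Sum>l<n. y (l, l) else 0 else 0)" for i k
    have "(\<Sum>i<n. m i i) = 0" using n5 by (simp add: m_def sum_subtractf)
    then obtain c where c: "\<forall>p<n. \<forall>q<n. M c p q = m p q" using surj by blast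
    moreover have "m i k = y (i, k)" if "(i, k) \<in> J" for i k using that by (auto simp: m_def J_def)
    ultimately show ?case using 2 by (intro exI[of _ c]) (auto simp: J_def fun_eq_iff)
  next
    case (4 c i)
    thus ?case using wd[OF 4(1)] by (cases i) (simp add: J_def)
  next
    case 5
    have "(\<forall>p<n. \<forall>q<n. M c p q = 0) \<longleftrightarrow> (\<forall>i\<in>J. (case i of (i, k) \<Rightarrow> if (i, k) \<in> J then M c i k else 0) = 0)" for c
    proof
      assume r: "\<forall>i\<in>J. (case i of (i, k) \<Rightarrow> if (i, k) \<in> J then M c i k else 0) = 0"
      have k: "M c i k = 0" if "i < n" "k < n" "(i, k) \<noteq> (0, 0)" for i k
        using bspec[OF r, of "(i, k)"] that by (auto simp: J_def)
      have "(\<Sum>p<n. M c p p) = (\<Sum>p<n. if p = 0 then M c 0 0 else 0)"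
        using k by (intro sum.cong) auto
      hence "M c 0 0 = 0" using tr[of c] n5 by simp
      thus "\<forall>p<n. \<forall>q<n. M c p q = 0" using k by (metis prod.inject)
    qed (auto simp: J_def split: if_splits)
    thus ?case unfolding K_def by simp
  qed (auto simp: lin)
  moreover have "card J = n\<^sup>2 - 1"
    unfolding J_def using n5 by (subst card_Diff_singleton) (auto simp: power2_eq_square)
  ultimately show "vectorspace.fin_dim class_ring (L TYPE('k) n mw)"
    "vectorspace.dim class_ring (L TYPE('k) n mw) + (n\<^sup>2 - 1) + n\<^sup>2 = (n choose 2)\<^sup>2"
    using * by simp_all
qed

end

section \<open>Translation of the cases into congruences of \<open>l\<close>\<close>

theorem theorem1p4:
  fixes l p n :: nat
    and G :: "'k :: alg_closed_field mat monoid"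
    and \<mu> \<alpha> :: weight
    and Q :: "('k, ('k mat \<Rightarrow> 'k) set, 'k mat) gmodule"
    and d :: real
  assumes char: "CHAR('k) = p" "p > 0"
    and rank: "l \<ge> 4"
    and n: "n = l + 1"
    and G: "G = SL n"
    and \<mu>: "\<mu> = \<omega> 2 + \<omega> (l - 1)"
    and \<alpha>: "\<alpha> = \<omega> 1 + \<omega> l"
    and Q: "Q = quotient_gmodule (H0 TYPE('k) n \<mu>) (carrier (L TYPE('k) n \<mu>))"
    and d: "d = real (vectorspace.dim class_ring (L TYPE('k) n \<mu>))"
  shows
    "(p > 2 \<and> [l = 0] (mod p) \<longrightarrow> gmodule_iso G Q trivial_gmodule)
     \<and> (p > 2 \<and> [l = 1] (mod p) \<longrightarrow>
         gmodule_iso G Q (H0 TYPE('k) n \<alpha>) \<and> simple_gmodule G (H0 TYPE('k) n \<alpha>))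
     \<and> (p > 2 \<and> \<not> [l = 0] (mod p) \<and> \<not> [l = 1] (mod p) \<longrightarrow>
         simple_gmodule G (H0 TYPE('k) n \<mu>))
     \<and> (p = 2 \<and> [l = 0] (mod 4) \<longrightarrow> gmodule_iso G Q trivial_gmodule)
     \<and> (p = 2 \<and> [l = 1] (mod 4) \<longrightarrow> gmodule_iso G Q (Weyl TYPE('k) n \<alpha>))
     \<and> (p = 2 \<and> [l = 2] (mod 4) \<longrightarrow> simple_gmodule G (H0 TYPE('k) n \<mu>))
     \<and> (p = 2 \<and> [l = 3] (mod 4) \<longrightarrow> gmodule_iso G Q (L TYPE('k) n \<alpha>))
     \<and> (vectorspace.fin_dim class_ring (L TYPE('k) n \<mu>))
     \<and> (p > 2 \<and> [l = 0] (mod p) \<or> p = 2 \<and> [l = 0] (mod 4) \<longrightarrow>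
         d = 1/4 * real l ^ 4 + 1/2 * real l ^ 3 - 3/4 * real l ^ 2 - 2 * real l - 2)
     \<and> (p > 2 \<and> [l = 1] (mod p) \<or> p = 2 \<and> [l = 1] (mod 4) \<longrightarrow>
         d = 1/4 * (real l + 2) * (real l ^ 3 - 7 * real l - 2))
     \<and> (p > 2 \<and> \<not> [l = 0] (mod p) \<and> \<not> [l = 1] (mod p) \<or> p = 2 \<and> [l = 2] (mod 4) \<longrightarrow>
         d = 1/4 * (real l - 2) * (real l + 2) * (real l + 1) ^ 2)
     \<and> (p = 2 \<and> [l = 3] (mod 4) \<longrightarrow>
         d = 1/4 * real l * (real l ^ 3 + 2 * real l ^ 2 - 7 * real l - 16))"
proof -
  interpret sl5 n "TYPE('k)" using rank n by unfold_locales auto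
  have "n - 2 = l - 1" "n - 1 = l" using n by auto
  hence mw: "mw = \<mu>" and aw: "aw = \<alpha>" by (simp_all only: mw_def aw_def \<mu> \<alpha>)
  have zero: "(of_nat m :: 'k) = 0 \<longleftrightarrow> p dvd m" for m
    unfolding char(1)[symmetric] by (rule of_nat_eq_0_iff_char_dvd)
  have one: "(of_nat n :: 'k) = 1 \<longleftrightarrow> [l = 0] (mod p)" using zero[of l] by (simp add: n cong_0_iff)
  have two: "(of_nat n :: 'k) = 2 \<longleftrightarrow> [l = 1] (mod p)"
  proof -
    have "(of_nat n :: 'k) = 2 \<longleftrightarrow> of_nat l = (of_nat 1 :: 'k)"
      unfolding n of_nat_add of_nat_1 one_add_one[symmetric] by (rule add_right_cancel)
    thus ?thesis unfolding of_nat_eq_iff_cong_CHAR char(1) .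
  qed
  have C: "2 * (n choose 2) = l * (l + 1)" by (simp add: choose_two n)
  have "1 \<noteq> p" using zero[of 1] by auto
  have triv: "gmodule_iso G Q trivial_gmodule \<and> vectorspace.fin_dim class_ring (L TYPE('k) n \<mu>) \<and>
     vectorspace.dim class_ring (L TYPE('k) n \<mu>) + 1 + n\<^sup>2 = (n choose 2)\<^sup>2"
    if "(of_nat n :: 'k) = 1" "(of_nat (n choose 2) :: 'k) = 0"
    using trivial_case[OF that] unfolding mw G Q by blast
  have adj: "gmodule_iso G Q (H0 TYPE('k) n \<alpha>) \<and> simple_gmodule G (H0 TYPE('k) n \<alpha>) \<and>
     vectorspace.fin_dim class_ring (L TYPE('k) n \<mu>) \<and>
     vectorspace.dim class_ring (L TYPE('k) n \<mu>) + (n\<^sup>2 - 1) + n\<^sup>2 = (n choose 2)\<^sup>2"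
    if "(of_nat n :: 'k) = 2" "(2 :: 'k) \<noteq> 0"
    using adjoint_case[OF that] unfolding mw aw G Q by blast
  have simp: "simple_gmodule G (H0 TYPE('k) n \<mu>) \<and> vectorspace.fin_dim class_ring (L TYPE('k) n \<mu>) \<and>
     vectorspace.dim class_ring (L TYPE('k) n \<mu>) + n\<^sup>2 = (n choose 2)\<^sup>2"
    if "(of_nat n :: 'k) \<noteq> 2" "(of_nat n :: 'k) \<noteq> 1 \<or> (of_nat (n choose 2) :: 'k) \<noteq> 0"
    using simple_case[OF that] unfolding mw G by blast
  have weyl: "gmodule_iso G Q (Weyl TYPE('k) n \<alpha>) \<and> vectorspace.fin_dim class_ring (L TYPE('k) n \<mu>) \<and>
     vectorspace.dim class_ring (L TYPE('k) n \<mu>) + (n\<^sup>2 - 1) + n\<^sup>2 = (n choose 2)\<^sup>2"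
    if "(of_nat n :: 'k) = 0" "(2 :: 'k) = 0" "(of_nat (n choose 2) :: 'k) = 1"
    using weyl_case[OF that] unfolding mw aw G Q by blast
  have even: "gmodule_iso G Q (L TYPE('k) n \<alpha>) \<and> vectorspace.fin_dim class_ring (L TYPE('k) n \<mu>) \<and>
     vectorspace.dim class_ring (L TYPE('k) n \<mu>) + (n\<^sup>2 - 2) + n\<^sup>2 = (n choose 2)\<^sup>2"
    if "(of_nat n :: 'k) = 0" "(2 :: 'k) = 0" "(of_nat (n choose 2) :: 'k) = 0"
    using even_case[OF that] unfolding mw aw G Q by blast
  \<comment> \<open>\<open>s\<close> is the dimension of the quotient: 0, 1,
    \<open>n\<^sup>2 - 1\<close> or \<open>n\<^sup>2 - 2\<close>.\<close>
  have dim: "d = (real l * (real l + 1) / 2)\<^sup>2 - (real l + 1)\<^sup>2 - real s"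
    if "vectorspace.dim class_ring (L TYPE('k) n \<mu>) + s + n\<^sup>2 = (n choose 2)\<^sup>2" for s
  proof -
    have "real (2 * (n choose 2)) = real (l * (l + 1))" by (simp only: C)
    hence c: "real (n choose 2) = real l * (real l + 1) / 2" by (simp add: algebra_simps)
    have "real (vectorspace.dim class_ring (L TYPE('k) n \<mu>) + s + n\<^sup>2) = real ((n choose 2)\<^sup>2)" by (simp only: that)
    moreover have "real n = real l + 1" using n by simp
    ultimately show ?thesis unfolding of_nat_add of_nat_power c d by simp
  qed
  have dims: "d = 1/4 * real l ^ 4 + 1/2 * real l ^ 3 - 3/4 * real l ^ 2 - 2 * real l - 2"
    if "vectorspace.dim class_ring (L TYPE('k) n \<mu>) + 1 + n\<^sup>2 = (n choose 2)\<^sup>2"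
    unfolding dim[OF that] by (simp add: field_simps power2_eq_square power3_eq_cube power4_eq_xxxx)
  have dimb: "d = 1/4 * (real l + 2) * (real l ^ 3 - 7 * real l - 2)"
    if h: "vectorspace.dim class_ring (L TYPE('k) n \<mu>) + (n\<^sup>2 - 1) + n\<^sup>2 = (n choose 2)\<^sup>2"
  proof -
    have "real (n\<^sup>2 - 1) = (real l + 1)\<^sup>2 - 1" unfolding n by (subst of_nat_diff) (simp_all add: add.commute)
    thus ?thesis unfolding dim[OF h] by (simp add: field_simps power2_eq_square power3_eq_cube)
  qed
  have dimc: "d = 1/4 * (real l - 2) * (real l + 2) * (real l + 1) ^ 2"
    if h: "vectorspace.dim class_ring (L TYPE('k) n \<mu>) + n\<^sup>2 = (n choose 2)\<^sup>2"
    using dim[of 0] h by (simp add: field_simps power2_eq_square)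
  have dimg: "d = 1/4 * real l * (real l ^ 3 + 2 * real l ^ 2 - 7 * real l - 16)"
    if h: "vectorspace.dim class_ring (L TYPE('k) n \<mu>) + (n\<^sup>2 - 2) + n\<^sup>2 = (n choose 2)\<^sup>2"
  proof -
    have "2 \<le> (l + 1)\<^sup>2" using rank by (simp add: power2_eq_square)
    hence "real (n\<^sup>2 - 2) = (real l + 1)\<^sup>2 - 2" unfolding n by (subst of_nat_diff) (simp_all add: add.commute)
    thus ?thesis unfolding dim[OF h] by (simp add: field_simps power2_eq_square power3_eq_cube)
  qed
  consider "p > 2" | "p = 2" using \<open>1 \<noteq> p\<close> char(2) by linarith
  thus ?thesis
  proof cases
    case 1
    have two0: "(2 :: 'k) \<noteq> 0" using zero[of 2] 1 by (auto dest: dvd_imp_le)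
    have not2: "p \<noteq> 2" using 1 by simp
    consider "[l = 0] (mod p)" | "[l = 1] (mod p)" | "\<not> [l = 0] (mod p)" "\<not> [l = 1] (mod p)" by blast
    thus ?thesis
    proof cases
      case a: 1
      have n1: "(of_nat n :: 'k) = 1" using a one by simp
      \<comment> \<open>For odd \<open>p\<close> the factor 2 can be cancelled, so
        \<open>n choose 2\<close> vanishes in \<open>k\<close> together with
        \<open>l\<close>.\<close>
      have "(of_nat (2 * (n choose 2)) :: 'k) = of_nat (l * (l + 1))" by (simp only: C)
      moreover have "(of_nat l :: 'k) = 0" using a zero by (simp add: cong_0_iff)
      ultimately have "(of_nat (n choose 2) :: 'k) = 0" using two0 by simp
      note t = triv[OF n1 this]
      have "(1 :: 'k) \<noteq> 2" by (metis add_cancel_right_right one_add_one zero_neq_one)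
      hence "\<not> [l = 1] (mod p)" using two n1 by simp
      thus ?thesis using t dims a not2 by simp
    next
      case b: 2
      have n2: "(of_nat n :: 'k) = 2" using b two by simp
      note t = adj[OF n2 two0]
      have "(1 :: 'k) \<noteq> 2" by (metis add_cancel_right_right one_add_one zero_neq_one)
      hence "\<not> [l = 0] (mod p)" using one n2 by simp
      thus ?thesis using t dimb b not2 by simp
    next
      case c: 3
      have "(of_nat n :: 'k) \<noteq> 2" "(of_nat n :: 'k) \<noteq> 1" using c one two by simp_all
      hence "simple_gmodule G (H0 TYPE('k) n \<mu>) \<and> vectorspace.fin_dim class_ring (L TYPE('k) n \<mu>) \<and>
         vectorspace.dim class_ring (L TYPE('k) n \<mu>) + n\<^sup>2 = (n choose 2)\<^sup>2" using simp by blast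
      thus ?thesis using dimc c not2 by simp
    qed
  next
    case p2: 2
    have two0: "(2 :: 'k) = 0" using zero[of 2] p2 by simp
    have z: "(of_nat m :: 'k) = 0 \<longleftrightarrow> even m" for m using zero p2 by simp
    have o: "(of_nat m :: 'k) = 1 \<longleftrightarrow> odd m" for m
    proof (cases "even m")
      case True
      hence "(of_nat m :: 'k) = 0" using z by simp
      thus ?thesis using True by simp
    next
      case False
      then obtain k where "m = 2 * k + 1" by (rule oddE)
      thus ?thesis by (simp add: two0)
    qed
    \<comment> \<open>\<open>n choose 2\<close> is odd exactly when \<open>l\<close> is congruent to
      1 or 2 modulo 4; with the parity of \<open>n\<close> this separates the four classes.\<close>
    define q where "q = l div 4"
    have "l mod 4 < 4" by simp
    then consider "l mod 4 = 0" | "l mod 4 = 1" | "l mod 4 = 2" | "l mod 4 = 3" by linarith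
    thus ?thesis
    proof cases
      case 1
      have l: "l = 4 * q" using 1 q_def by presburger
      have "n choose 2 = 2 * q * (4 * q + 1)" using C unfolding l by (simp add: algebra_simps)
      hence "(of_nat (n choose 2) :: 'k) = 0" unfolding z by simp
      moreover have "(of_nat n :: 'k) = 1" unfolding o n l by simp
      ultimately show ?thesis using triv dims 1 p2 by (simp add: cong_def)
    next
      case 2
      have l: "l = 4 * q + 1" using 2 q_def by presburger
      have "n choose 2 = (4 * q + 1) * (2 * q + 1)" using C unfolding l by (simp add: algebra_simps)
      hence "(of_nat (n choose 2) :: 'k) = 1" unfolding o by simp
      moreover have "(of_nat n :: 'k) = 0" unfolding z n l by simp
      ultimately show ?thesis using weyl two0 dimb 2 p2 by (simp add: cong_def)
    next
      case 3
      have l: "l = 4 * q + 2" using 3 q_def by presburger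
      have "n choose 2 = (2 * q + 1) * (4 * q + 3)" using C unfolding l by (simp add: algebra_simps)
      hence "(of_nat (n choose 2) :: 'k) \<noteq> 0" unfolding z by simp
      moreover have "(of_nat n :: 'k) \<noteq> 2" unfolding two0 z n l by simp
      ultimately show ?thesis using simp dimc 3 p2 by (simp add: cong_def)
    next
      case 4
      have l: "l = 4 * q + 3" using 4 q_def by presburger
      have "n choose 2 = (4 * q + 3) * (2 * q + 2)" using C unfolding l by (simp add: algebra_simps)
      hence "(of_nat (n choose 2) :: 'k) = 0" unfolding z by simp
      moreover have "(of_nat n :: 'k) = 0" unfolding z n l by simp
      ultimately show ?thesis using even two0 dimg 4 p2 by (simp add: cong_def)
    qed
  qed
qed

end
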